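(* Let $L$ be a $\Theta_n$-graded Lie algebra over $\mathbb F$ with grading subalgebra $\mathfrak g\cong sl_n$, where $n\ge 7$, or $n\in\{5,6\}$ and the conditions $( * )$ of the context hold. Then $$L=(\mathfrak g\otimes A)\oplus(V\otimes B)\oplus(V'\otimes B')\oplus(S\otimes C)\oplus(S'\otimes C')\oplus(\Lambda\otimes E)\oplus(\Lambda'\otimes E')\oplus D,$$ where $A,B,B',C,C',E,E'$ are vector spaces and $D$ is the sum of the trivial $\mathfrak g$-submodules, and there are bilinear maps among these spaces such that the bracket of $L$ is given as follows. For all $x,y\in sl_n$, $u,v\in V$, $u',v'\in V'$, $s\in S$, $s'\in S'$, $\lambda\in\Lambda$, $\lambda'\in\Lambda'$, $a,a_i\in A$, $b,b_i\in B$, $b',b'_i\in B'$, $c\in C$, $c'\in C'$, $e\in E$, $e'\in E'$, $d,d_i\in D$: $[x\otimes a_1,y\otimes a_2]=(x\circ y)\otimes\frac{[a_1,a_2]}2+[x,y]\otimes\frac{a_1\circ a_2}2+(x\mid y)\langle a_1,a_2\rangle$; $[u\otimes b,v'\otimes b']=(uv'^t-\frac{\mathrm{tr}(uv'^t)}nI)\otimes(b,b')_A+\frac2n\mathrm{tr}(uv'^t)\langle b,b'\rangle$; $[s\otimes c,s'\otimes c']=(ss'-(s\mid s')I)\otimes(c,c')_A+(s\mid s')\langle c,c'\rangle$; $[\lambda\otimes e,\lambda'\otimes e']=(\lambda\lambda'-(\lambda\mid\lambda')I)\otimes(e,e')_A+(\lambda\mid\lambda')\langle e,e'\rangle$; $[u\otimes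 b_1,v\otimes b_2]=(uv^t+vu^t)\otimes\frac{(b_1,b_2)_C}2+(uv^t-vu^t)\otimes\frac{(b_1,b_2)_E}2$; $[u'\otimes b'_1,v'\otimes b'_2]=(u'v'^t+v'u'^t)\otimes\frac{(b'_1,b'_2)_{C'}}2+(u'v'^t-v'u'^t)\otimes\frac{(b'_1,b'_2)_{E'}}2$; $[x\otimes a,s\otimes c]=(xs+sx^t)\otimes\frac{(a,c)_C}2+(xs-sx^t)\otimes\frac{(a,c)_E}2$; $[x\otimes a,\lambda\otimes e]=(x\lambda+\lambda x^t)\otimes\frac{(a,e)_E}2+(x\lambda-\lambda x^t)\otimes\frac{(a,e)_C}2$; $[s'\otimes c',x\otimes a]=(s'x+x^ts')\otimes\frac{(c',a)_{C'}}2+(s'x-x^ts')\otimes\frac{(c',a)_{E'}}2$; $[\lambda'\otimes e',x\otimes a]=(\lambda'x+x^t\lambda')\otimes\frac{(e',a)_{E'}}2+(\lambda'x-x^t\lambda')\otimes\frac{(e',a)_{C'}}2$; $[s\otimes c,\lambda'\otimes e']=s\lambda'\otimes(c,e')_A$; $[s'\otimes c',\lambda\otimes e]=s'\lambda\otimes(c',e)_A$; $[x\otimes a,u\otimes b]=xu\otimes(a,b)_B$; $[s'\otimes c',u\otimes b]=s'u\otimes(c',b)_{B'}$; $[\lambda'\otimes e',u\otimes b]=\lambda'u\otimes(e',b)_{B'}$; $[u'\otimes b',x\otimes a]=x^tu'\otimes(b',a)_{B'}$; $[u'\otimes b',s\otimes c]=su'\otimes(b',c)_B$; $[u'\otimes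 b',\lambda\otimes e]=-\lambda u'\otimes(b',e)_B$; $[d,m\otimes h]=m\otimes dh$ for $m\otimes h$ in any of the first seven summands, $[d_1,d_2]\in D$; the brackets in the opposite order are given by anticommutativity and all other brackets of summands are zero. (Here a subscript indicates the space in which a bilinear map takes values, $[\ ,\ ]$ and $\circ$ on $A$ are respectively skew-symmetric and symmetric with values in $A$, $\langle\ ,\ \rangle$ has values in $D$, and $dh$ lies in the same space as $h$.) Decompose $\mathfrak g\otimes A=(\mathfrak g^+\otimes A^-)\oplus(\mathfrak g^-\otimes A^+)$, where $\mathfrak g^{\pm}=\{x\in\mathfrak g\mid x^t=\pm x\}$ and $A^+,A^-$ are two copies of $A$; put $\mathfrak a:=A^+\oplus A^-\oplus C\oplus E\oplus C'\oplus E'$ and $\mathfrak b:=\mathfrak a\oplus B\oplus B'$. Then the product in $L$ induces algebra structures on $\mathfrak a$ and $\mathfrak b$ (by the explicit formulas of the context) such that: (i) $\mathfrak a$ is a unital associative subalgebra of $\mathfrak b$ with an involution whose symmetric and skew-symmetric elements are $A^+\oplus E\oplus E'$ and $A^-\oplus C\oplus C'$, respectively. (ii) $\mathfrak b$ is a unital algebra with an involution $\eta$ whose symmetric and skew-symmetric elements are $A^+\oplus E\oplus E'\oplus B\oplus B'$ and $A^-\oplus C\oplus C'$, respectively. (iii) $B\oplus B'$ is an associative $\mathfrak a$-bimodule with a hermitian form $\chi$ with values in $\mathfrak a$. More exactly, for all $\beta_1,\beta_2\in B\oplus B'$ and $\alpha\in\mathfrak a$ one has $\chi(\beta_1,\beta_2)=\beta_1\beta_2$,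 $\chi(\alpha\beta_1,\beta_2)=\alpha\chi(\beta_1,\beta_2)$, $\eta(\chi(\beta_1,\beta_2))=\chi(\beta_2,\beta_1)$ and $\chi(\beta_1,\alpha\beta_2)=\chi(\beta_1,\beta_2)\eta(\alpha)$. (iv) $\mathcal A:=A^-\oplus A^+$ is a unital associative subalgebra of $\mathfrak a$, and $C\oplus E$, $C'\oplus E'$, $B$ and $B'$ are $\mathcal A$-bimodules. (v) $D$ acts by derivations on $\mathfrak b$.
   Context: $\mathbb F$ is a field of characteristic $0$. Let $\varepsilon_1,\dots,\varepsilon_n$ be the weights of the natural $sl_n$-module and $\Theta_n=\{0,\pm\varepsilon_i\pm\varepsilon_j,\pm\varepsilon_i,\pm2\varepsilon_i\mid 1\le i\ne j\le n\}$. A Lie algebra $L$ over $\mathbb F$ (possibly infinite-dimensional) is $\Theta_n$-graded with grading subalgebra $\mathfrak g$ if $\mathfrak g\subseteq L$ is a subalgebra isomorphic to (and identified with) $sl_n$, with Cartan subalgebra $\mathfrak h$ of diagonal matrices, $L=\bigoplus_{\alpha\in\Theta_n}L_\alpha$ where $L_\alpha=\{x\in L\mid[h,x]=\alpha(h)x\ \forall h\in\mathfrak h\}$, and $L_0=\sum_{\alpha,-\alpha\in\Theta_n\setminus\{0\}}[L_\alpha,L_{-\alpha}]$. Modules: $V=V'=\mathbb F^n$ as spaces (column vectors), $S=S'$ is the space of symmetric and $\Lambda=\Lambda'$ the space of skew-symmetric $n\times n$ matrices, with actions of $x\in sl_n$: $x.v=xv$ on $V$, $x.v'=-x^tv'$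 on $V'$, $x.s=xs+sx^t$ on $S$ and $\Lambda$, $x.s'=-s'x-x^ts'$ on $S'$ and $\Lambda'$; $\mathfrak g$ is the adjoint module. For matrices: $[x,y]=xy-yx$, $x\circ y=xy+yx-\frac2n\mathrm{tr}(xy)I$, $(x\mid y)=\frac1n\mathrm{tr}(xy)$. The spaces are $A=\mathrm{Hom}_{\mathfrak g}(\mathfrak g,L)$, $B=\mathrm{Hom}_{\mathfrak g}(V,L)$, $B'=\mathrm{Hom}_{\mathfrak g}(V',L)$, $C=\mathrm{Hom}_{\mathfrak g}(S,L)$, $C'=\mathrm{Hom}_{\mathfrak g}(S',L)$, $E=\mathrm{Hom}_{\mathfrak g}(\Lambda,L)$, $E'=\mathrm{Hom}_{\mathfrak g}(\Lambda',L)$, with $m\otimes\varphi$ identified with $\varphi(m)$; $1\in A$ denotes the inclusion of $\mathfrak g$, so $\mathfrak g=\mathfrak g\otimes1$. Thus $M\otimes\mathrm{Hom}_{\mathfrak g}(M,L)$ is the $M$-isotypic component of $L$. Conditions $( * )$: for $n=6$, $[\Lambda\otimes E,\Lambda\otimes E]=[\Lambda'\otimes E',\Lambda'\otimes E']=0$; for $n=5$, $[\Lambda\otimes E,(\Lambda\otimes E)\oplus(V\otimes B)]=[\Lambda'\otimes E',(\Lambda'\otimes E')\oplus(V'\otimes B')]=0$. Induced product on $\mathfrak b$. For $a\in A$ let $a^{\pm}$ be its copy in $A^{\pm}$. With $\sigma,\tau\in\{+,-\}$: $a_1^\sigma a_2^\tau=\frac12[a_1,a_2]^{-\sigma\tau}+\frac12(a_1\circ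 a_2)^{\sigma\tau}$; $a^\pm c=\frac12((a,c)_C+(a,c)_E)$, $ca^+=\frac12((a,c)_C-(a,c)_E)$, $ca^-=\frac12((a,c)_E-(a,c)_C)$; $a^\pm e=\frac12((a,e)_E+(a,e)_C)$, $ea^+=\frac12((a,e)_E-(a,e)_C)$, $ea^-=\frac12((a,e)_C-(a,e)_E)$; $c'a^\pm=\frac12((c',a)_{C'}+(c',a)_{E'})$, $a^+c'=\frac12((c',a)_{C'}-(c',a)_{E'})$, $a^-c'=\frac12((c',a)_{E'}-(c',a)_{C'})$; $e'a^\pm=\frac12((e',a)_{E'}+(e',a)_{C'})$, $a^+e'=\frac12((e',a)_{E'}-(e',a)_{C'})$, $a^-e'=\frac12((e',a)_{C'}-(e',a)_{E'})$; for $(p,q)=(c,c')$ or $(e,e')$: $pq=\frac12((p,q)_A^++(p,q)_A^-)$, $qp=\frac12((p,q)_A^+-(p,q)_A^-)$; for $(p,q)=(c,e')$ or $(c',e)$: $pq=\frac12((p,q)_A^++(p,q)_A^-)$, $qp=\frac12((p,q)_A^--(p,q)_A^+)$; products of two elements of $C\oplus E$, or of two elements of $C'\oplus E'$, are $0$. Let $\gamma:\mathfrak a\to\mathfrak a$ be the identity on $A^+,E,E'$ and minus the identity on $A^-,C,C'$. Then $a^\pm b=(a,b)_B$, $c'b=(c',b)_{B'}$, $e'b=(e',b)_{B'}$, $cb=eb=0$, and $b\alpha:=\gamma(\alpha)b$ for $\alpha\in\mathfrak a$; $b'a^\pm=(b',a)_{B'}$, $b'c=(b',c)_B$, $b'e=(b',e)_B$,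 $b'c'=b'e'=0$, and $\alpha b':=b'\gamma(\alpha)$ for $\alpha\in\mathfrak a$; $b_1b_2=\frac12((b_1,b_2)_C+(b_1,b_2)_E)$, $b_1'b_2'=\frac12((b'_1,b'_2)_{C'}+(b'_1,b'_2)_{E'})$, $bb'=\frac12((b,b')_A^++(b,b')_A^-)$, $b'b=\frac12((b,b')_A^+-(b,b')_A^-)$. The left and right actions in the bimodule statements are left and right multiplication in $\mathfrak b$. The action of $d\in D$ on $\mathfrak b$ is the given one on $B,B',C,C',E,E'$ and $d(a^\pm)=(da)^\pm$ on $A^\pm$. The involution on $\mathfrak a$ is $\gamma$; $\eta$ is $\gamma$ on $\mathfrak a$ and the identity on $B\oplus B'$. The identity element is $1^+$. "Involution" means an antiautomorphism of order $2$.
   Formalization: [s'⊗c',λ⊗e] is taken as (s'λ)^t⊗(c',e)_A; the product formulas for c'e and ec' are interchanged; "bimodule" for B⊕B', B and B' means associative unital left and right actions without (xm)y=x(my). As printed, these three claims fail. *)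

theory Defs
  imports "HOL-Analysis.Analysis" "HOL-Library.Function_Algebras"
begin

section \<open>Linear algebra on subspaces\<close>

definition linear_on :: "('f::field \<Rightarrow> 'x::ab_group_add \<Rightarrow> 'x) \<Rightarrow> 'x set \<Rightarrow>
    ('f \<Rightarrow> 'y::ab_group_add \<Rightarrow> 'y) \<Rightarrow> 'y set \<Rightarrow> ('x \<Rightarrow> 'y) \<Rightarrow> bool" where
  "linear_on sX X sY Y f \<longleftrightarrow>
     (\<forall>x\<in>X. f x \<in> Y) \<and>
     (\<forall>x\<in>X. \<forall>x'\<in>X. f (x + x') = f x + f x') \<and>
     (\<forall>c. \<forall>x\<in>X. f (sX c x) = sY c (f x))"

definition bilinear_on :: "('f::field \<Rightarrow> 'x::ab_group_add \<Rightarrow> 'x) \<Rightarrow> 'x set \<Rightarrow>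
    ('f \<Rightarrow> 'y::ab_group_add \<Rightarrow> 'y) \<Rightarrow> 'y set \<Rightarrow>
    ('f \<Rightarrow> 'z::ab_group_add \<Rightarrow> 'z) \<Rightarrow> 'z set \<Rightarrow> ('x \<Rightarrow> 'y \<Rightarrow> 'z) \<Rightarrow> bool" where
  "bilinear_on sX X sY Y sZ Z f \<longleftrightarrow>
     (\<forall>x\<in>X. linear_on sY Y sZ Z (f x)) \<and>
     (\<forall>y\<in>Y. linear_on sX X sZ Z (\<lambda>x. f x y))"

definition direct_sum_of :: "('f::field \<Rightarrow> 'x::ab_group_add \<Rightarrow> 'x) \<Rightarrow> 'i set \<Rightarrow> ('i \<Rightarrow> 'x set) \<Rightarrow>
    'x set \<Rightarrow> bool" where
  "direct_sum_of sX I W U \<longleftrightarrow>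
     finite I \<and> (\<forall>i\<in>I. module.subspace sX (W i)) \<and>
     U = {sum f I | f. \<forall>i\<in>I. f i \<in> W i} \<and>
     (\<forall>f. (\<forall>i\<in>I. f i \<in> W i) \<and> sum f I = 0 \<longrightarrow> (\<forall>i\<in>I. f i = 0))"

section \<open>Algebras, involutions, modules, forms\<close>

definition algebra_on :: "('f::field \<Rightarrow> 'x::ab_group_add \<Rightarrow> 'x) \<Rightarrow> 'x set \<Rightarrow> ('x \<Rightarrow> 'x \<Rightarrow> 'x) \<Rightarrow> bool" where
  "algebra_on sX X mul \<longleftrightarrow> module.subspace sX X \<and> bilinear_on sX X sX X sX X mul"

definition associative_on :: "'x set \<Rightarrow> ('x \<Rightarrow> 'x \<Rightarrow> 'x) \<Rightarrow> bool" where
  "associative_on X mul \<longleftrightarrow>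
     (\<forall>x\<in>X. \<forall>y\<in>X. \<forall>z\<in>X. mul (mul x y) z = mul x (mul y z))"

definition identity_on :: "'x set \<Rightarrow> ('x \<Rightarrow> 'x \<Rightarrow> 'x) \<Rightarrow> 'x \<Rightarrow> bool" where
  "identity_on X mul e \<longleftrightarrow> e \<in> X \<and> (\<forall>x\<in>X. mul e x = x \<and> mul x e = x)"

definition antiautomorphism_on :: "('f::field \<Rightarrow> 'x::ab_group_add \<Rightarrow> 'x) \<Rightarrow> 'x set \<Rightarrow>
    ('x \<Rightarrow> 'x \<Rightarrow> 'x) \<Rightarrow> ('x \<Rightarrow> 'x) \<Rightarrow> bool" where
  "antiautomorphism_on sX X mul f \<longleftrightarrow>
     linear_on sX X sX X f \<and> bij_betw f X X \<and> (\<forall>x\<in>X. \<forall>y\<in>X. f (mul x y) = mul (f y) (f x))"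

definition involution_on :: "('f::field \<Rightarrow> 'x::ab_group_add \<Rightarrow> 'x) \<Rightarrow> 'x set \<Rightarrow>
    ('x \<Rightarrow> 'x \<Rightarrow> 'x) \<Rightarrow> ('x \<Rightarrow> 'x) \<Rightarrow> bool" where
  "involution_on sX X mul f \<longleftrightarrow>
     antiautomorphism_on sX X mul f \<and> (\<forall>x\<in>X. f (f x) = x) \<and> (\<exists>x\<in>X. f x \<noteq> x)"

text \<open>Unital associative left and right actions, without \<open>(x m) y = x (m y)\<close>. This is the
  notion for \<open>B\<close> and \<open>B'\<close>: there \<open>m y = \<gamma>(y) m\<close>, so that \<open>(x m) y = (\<gamma>(y) x) m\<close> but
  \<open>x (m y) = (x \<gamma>(y)) m\<close>, which differ in general.\<close>

definition left_right_module_on :: "('f::field \<Rightarrow> 'x::ab_group_add \<Rightarrow> 'x) \<Rightarrow> 'x set \<Rightarrow>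
    ('x \<Rightarrow> 'x \<Rightarrow> 'x) \<Rightarrow> 'x \<Rightarrow> ('f \<Rightarrow> 'm::ab_group_add \<Rightarrow> 'm) \<Rightarrow> 'm set \<Rightarrow>
    ('x \<Rightarrow> 'm \<Rightarrow> 'm) \<Rightarrow> ('m \<Rightarrow> 'x \<Rightarrow> 'm) \<Rightarrow> bool" where
  "left_right_module_on sX X mul e sM M l r \<longleftrightarrow>
     module.subspace sM M \<and>
     bilinear_on sX X sM M sM M l \<and> bilinear_on sM M sX X sM M r \<and>
     (\<forall>x\<in>X. \<forall>y\<in>X. \<forall>m\<in>M. l (mul x y) m = l x (l y m) \<and> r m (mul x y) = r (r m x) y) \<and>
     (\<forall>m\<in>M. l e m = m \<and> r m e = m)"

definition bimodule_on :: "('f::field \<Rightarrow> 'x::ab_group_add \<Rightarrow> 'x) \<Rightarrow> 'x set \<Rightarrow>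
    ('x \<Rightarrow> 'x \<Rightarrow> 'x) \<Rightarrow> 'x \<Rightarrow> ('f \<Rightarrow> 'm::ab_group_add \<Rightarrow> 'm) \<Rightarrow> 'm set \<Rightarrow>
    ('x \<Rightarrow> 'm \<Rightarrow> 'm) \<Rightarrow> ('m \<Rightarrow> 'x \<Rightarrow> 'm) \<Rightarrow> bool" where
  "bimodule_on sX X mul e sM M l r \<longleftrightarrow>
     left_right_module_on sX X mul e sM M l r \<and>
     (\<forall>x\<in>X. \<forall>y\<in>X. \<forall>m\<in>M. r (l x m) y = l x (r m y))"

definition hermitian_form_on :: "('f::field \<Rightarrow> 'x::ab_group_add \<Rightarrow> 'x) \<Rightarrow> 'x set \<Rightarrow>
    ('x \<Rightarrow> 'x \<Rightarrow> 'x) \<Rightarrow> ('x \<Rightarrow> 'x) \<Rightarrow> ('f \<Rightarrow> 'm::ab_group_add \<Rightarrow> 'm) \<Rightarrow> 'm set \<Rightarrow>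
    ('x \<Rightarrow> 'm \<Rightarrow> 'm) \<Rightarrow> ('m \<Rightarrow> 'm \<Rightarrow> 'x) \<Rightarrow> bool" where
  "hermitian_form_on sX X mul invol sM M l form \<longleftrightarrow>
     bilinear_on sM M sM M sX X form \<and>
     (\<forall>\<beta>1\<in>M. \<forall>\<beta>2\<in>M. \<forall>\<alpha>\<in>X.
        form (l \<alpha> \<beta>1) \<beta>2 = mul \<alpha> (form \<beta>1 \<beta>2) \<and>
        invol (form \<beta>1 \<beta>2) = form \<beta>2 \<beta>1 \<and>
        form \<beta>1 (l \<alpha> \<beta>2) = mul (form \<beta>1 \<beta>2) (invol \<alpha>))"

definition derivation_on :: "('f::field \<Rightarrow> 'x::ab_group_add \<Rightarrow> 'x) \<Rightarrow> 'x set \<Rightarrow>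
    ('x \<Rightarrow> 'x \<Rightarrow> 'x) \<Rightarrow> ('x \<Rightarrow> 'x) \<Rightarrow> bool" where
  "derivation_on sX X mul \<delta> \<longleftrightarrow>
     linear_on sX X sX X \<delta> \<and>
     (\<forall>x\<in>X. \<forall>y\<in>X. \<delta> (mul x y) = mul (\<delta> x) y + mul x (\<delta> y))"

section \<open>Matrices and \<open>sl\<^sub>n\<close>\<close>

text \<open>Here \<open>n = CARD('n)\<close>.\<close>

definition mscale :: "'f::field \<Rightarrow> 'f^'n^'n \<Rightarrow> 'f^'n^'n" where
  "mscale k x = (\<chi> i j. k * x $ i $ j)"

definition comm_mat :: "'f::field^'n^'n \<Rightarrow> 'f^'n^'n \<Rightarrow> 'f^'n^'n" where
  "comm_mat x y = x ** y - y ** x"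

definition jord_mat :: "'f::field^'n^'n \<Rightarrow> 'f^'n^'n \<Rightarrow> 'f^'n^'n" where
  "jord_mat x y = x ** y + y ** x - mat (2 / of_nat CARD('n) * trace (x ** y))"

definition form_mat :: "'f::field^'n^'n \<Rightarrow> 'f^'n^'n \<Rightarrow> 'f" where
  "form_mat x y = 1 / of_nat CARD('n) * trace (x ** y)"

definition outer :: "'f::field^'n \<Rightarrow> 'f^'n \<Rightarrow> 'f^'n^'n" where
  "outer u v = (\<chi> i j. u $ i * v $ j)"

definition sl :: "('f::field^'n^'n) set" where
  "sl = {x. trace x = 0}"

definition cartan :: "('f::field^'n^'n) set" where
  "cartan = {h \<in> sl. \<forall>i j. i \<noteq> j \<longrightarrow> h $ i $ j = 0}"

definition sym_mats :: "('f::field^'n^'n) set" where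
  "sym_mats = {x. transpose x = x}"

definition skew_mats :: "('f::field^'n^'n) set" where
  "skew_mats = {x. transpose x = - x}"

text \<open>Linear functionals on the Cartan subalgebra are represented by functions on all matrices
  that vanish off it.\<close>

definition \<epsilon> :: "'n \<Rightarrow> 'f::field^'n^'n \<Rightarrow> 'f" where
  "\<epsilon> i h = (if h \<in> cartan then h $ i $ i else 0)"

definition Theta :: "('f::field^'n^'n \<Rightarrow> 'f) set" where
  "Theta = {0} \<union>
     {\<alpha>. \<exists>i j. i \<noteq> j \<and> \<alpha> \<in> {\<epsilon> i + \<epsilon> j, \<epsilon> i - \<epsilon> j, - \<epsilon> i + \<epsilon> j, - \<epsilon> i - \<epsilon> j}} \<union>
     {\<alpha>. \<exists>i. \<alpha> \<in> {\<epsilon> i, - \<epsilon> i, \<epsilon> i + \<epsilon> i, - (\<epsilon> i + \<epsilon> i)}}"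

definition act_V :: "'f::field^'n^'n \<Rightarrow> 'f^'n \<Rightarrow> 'f^'n" where
  "act_V x v = x *v v"

definition act_V' :: "'f::field^'n^'n \<Rightarrow> 'f^'n \<Rightarrow> 'f^'n" where
  "act_V' x v = - (transpose x *v v)"

definition act_S :: "'f::field^'n^'n \<Rightarrow> 'f^'n^'n \<Rightarrow> 'f^'n^'n" where
  "act_S x s = x ** s + s ** transpose x"

definition act_S' :: "'f::field^'n^'n \<Rightarrow> 'f^'n^'n \<Rightarrow> 'f^'n^'n" where
  "act_S' x s = - (s ** x) - transpose x ** s"

section \<open>Graded Lie algebras\<close>

locale lie_algebra = vector_space scale
  for scale :: "'f::field \<Rightarrow> 'l::ab_group_add \<Rightarrow> 'l" +
  fixes bracket :: "'l \<Rightarrow> 'l \<Rightarrow> 'l"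
  assumes bracket_bilinear: "bilinear_on scale UNIV scale UNIV scale UNIV bracket"
    and bracket_self: "bracket x x = 0"
    and jacobi: "bracket x (bracket y z) + bracket y (bracket z x) + bracket z (bracket x y) = 0"

locale lie_algebra_over_sl = lie_algebra scale bracket
  for scale :: "'f::field_char_0 \<Rightarrow> 'l::ab_group_add \<Rightarrow> 'l" and bracket :: "'l \<Rightarrow> 'l \<Rightarrow> 'l" +
  fixes \<iota> :: "'f^'n^'n \<Rightarrow> 'l"
  assumes \<iota>_linear: "linear_on mscale sl scale UNIV \<iota>"
    and \<iota>_inj: "inj_on \<iota> sl"
    and \<iota>_bracket: "x \<in> sl \<Longrightarrow> y \<in> sl \<Longrightarrow> \<iota> (comm_mat x y) = bracket (\<iota> x) (\<iota> y)"
begin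

definition weight_space :: "('f^'n^'n \<Rightarrow> 'f) \<Rightarrow> 'l set" where
  "weight_space \<alpha> = {x. \<forall>h\<in>cartan. bracket (\<iota> h) x = scale (\<alpha> h) x}"

end

locale theta_graded = lie_algebra_over_sl scale bracket \<iota>
  for scale :: "'f::field_char_0 \<Rightarrow> 'l::ab_group_add \<Rightarrow> 'l" and bracket :: "'l \<Rightarrow> 'l \<Rightarrow> 'l"
    and \<iota> :: "'f^'n^'n \<Rightarrow> 'l" +
  assumes weight_decomposition: "direct_sum_of scale Theta weight_space UNIV"
    and zero_weight_space: "weight_space 0 = module.span scale
      {bracket x y | x y \<alpha>. \<alpha> \<in> Theta - {0} \<and> - \<alpha> \<in> Theta - {0} \<and>
         x \<in> weight_space \<alpha> \<and> y \<in> weight_space (- \<alpha>)}"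

section \<open>Multiplicity spaces and isotypic components\<close>

text \<open>The tensor \<open>m \<otimes> \<phi>\<close> is identified with its image in the Lie algebra.\<close>

definition tens :: "'m \<Rightarrow> ('m \<Rightarrow> 'l) \<Rightarrow> 'l"  (infixl "\<otimes>" 75) where
  "m \<otimes> \<phi> = \<phi> m"

definition fscale :: "('f \<Rightarrow> 'l \<Rightarrow> 'l) \<Rightarrow> 'f \<Rightarrow> ('m \<Rightarrow> 'l) \<Rightarrow> 'm \<Rightarrow> 'l" where
  "fscale sL k \<phi> = (\<lambda>m. sL k (\<phi> m))"

context lie_algebra_over_sl
begin

text \<open>Homomorphisms from a module with carrier \<open>M\<close> are represented by functions that vanish
  off \<open>M\<close>; with the pointwise operations they form a vector space.\<close>

definition hom_space :: "('f \<Rightarrow> 'm::ab_group_add \<Rightarrow> 'm) \<Rightarrow> ('f^'n^'n \<Rightarrow> 'm \<Rightarrow> 'm) \<Rightarrow> 'm set \<Rightarrow>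
    ('m \<Rightarrow> 'l) set" where
  "hom_space sM act M =
     {\<phi>. linear_on sM M scale UNIV \<phi> \<and>
          (\<forall>x\<in>sl. \<forall>m\<in>M. \<phi> (act x m) = bracket (\<iota> x) (\<phi> m)) \<and>
          (\<forall>m. m \<notin> M \<longrightarrow> \<phi> m = 0)}"

definition A :: "('f^'n^'n \<Rightarrow> 'l) set" where "A = hom_space mscale comm_mat sl"
definition B :: "('f^'n \<Rightarrow> 'l) set" where "B = hom_space (*s) act_V UNIV"
definition B' :: "('f^'n \<Rightarrow> 'l) set" where "B' = hom_space (*s) act_V' UNIV"
definition C :: "('f^'n^'n \<Rightarrow> 'l) set" where "C = hom_space mscale act_S sym_mats"
definition C' :: "('f^'n^'n \<Rightarrow> 'l) set" where "C' = hom_space mscale act_S' sym_mats"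
definition E :: "('f^'n^'n \<Rightarrow> 'l) set" where "E = hom_space mscale act_S skew_mats"
definition E' :: "('f^'n^'n \<Rightarrow> 'l) set" where "E' = hom_space mscale act_S' skew_mats"

definition D :: "'l set" where
  "D = module.span scale
     (\<Union>{U. module.subspace scale U \<and> (\<forall>x\<in>sl. \<forall>z\<in>U. bracket (\<iota> x) z = 0)})"

definition one_A :: "'f^'n^'n \<Rightarrow> 'l" where
  "one_A x = (if x \<in> sl then \<iota> x else 0)"

definition tensor_image :: "'m set \<Rightarrow> ('m \<Rightarrow> 'l) set \<Rightarrow> 'l set" where
  "tensor_image M H = module.span scale {m \<otimes> \<phi> | m \<phi>. m \<in> M \<and> \<phi> \<in> H}"

text \<open>Injectivity of the canonical map from the algebraic tensor product of \<open>M\<close> and \<open>H\<close>: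
  a tensor is zero iff its coefficients with respect to linearly independent
  elements of \<open>M\<close> are zero.\<close>

definition tensor_injective :: "('f \<Rightarrow> 'm::ab_group_add \<Rightarrow> 'm) \<Rightarrow> 'm set \<Rightarrow> ('m \<Rightarrow> 'l) set \<Rightarrow> bool" where
  "tensor_injective sM M H \<longleftrightarrow>
     (\<forall>T \<phi>. finite T \<and> T \<subseteq> M \<and> \<not> module.dependent sM T \<and> (\<forall>m\<in>T. \<phi> m \<in> H) \<and>
        (\<Sum>m\<in>T. m \<otimes> \<phi> m) = 0 \<longrightarrow> (\<forall>m\<in>T. \<phi> m = 0))"

definition isotypic_decomposition :: bool where
  "isotypic_decomposition \<longleftrightarrow>
     direct_sum_of scale {..<8}
       ((!) [tensor_image sl A, tensor_image UNIV B, tensor_image UNIV B',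
             tensor_image sym_mats C, tensor_image sym_mats C',
             tensor_image skew_mats E, tensor_image skew_mats E', D]) (UNIV :: 'l set) \<and>
     tensor_injective mscale sl A \<and>
     tensor_injective (*s) UNIV B \<and> tensor_injective (*s) UNIV B' \<and>
     tensor_injective mscale sym_mats C \<and> tensor_injective mscale sym_mats C' \<and>
     tensor_injective mscale skew_mats E \<and> tensor_injective mscale skew_mats E'"

definition sym_skew_decomposition :: bool where
  "sym_skew_decomposition \<longleftrightarrow>
     direct_sum_of scale {..<2}
       ((!) [tensor_image (sl \<inter> sym_mats) A, tensor_image (sl \<inter> skew_mats) A]) (tensor_image sl A)"

definition condition_6 :: bool where
  "condition_6 \<longleftrightarrow>
     (\<forall>y\<in>tensor_image skew_mats E. \<forall>z\<in>tensor_image skew_mats E. bracket y z = 0) \<and>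
     (\<forall>y\<in>tensor_image skew_mats E'. \<forall>z\<in>tensor_image skew_mats E'. bracket y z = 0)"

definition condition_5 :: bool where
  "condition_5 \<longleftrightarrow>
     (\<forall>y\<in>tensor_image skew_mats E. \<forall>z\<in>tensor_image skew_mats E. \<forall>w\<in>tensor_image UNIV B.
        bracket y (z + w) = 0) \<and>
     (\<forall>y\<in>tensor_image skew_mats E'. \<forall>z\<in>tensor_image skew_mats E'. \<forall>w\<in>tensor_image UNIV B'.
        bracket y (z + w) = 0)"

end

section \<open>The system of bilinear maps\<close>

text \<open>The type \<open>'h\<close> is that of the elements of \<open>A\<close>, \<open>C\<close>, \<open>C'\<close>, \<open>E\<close>, \<open>E'\<close>, and \<open>'k\<close> that of
  the elements of \<open>B\<close>, \<open>B'\<close>. A name such as \<open>ac_E\<close> stands for the map \<open>(a,c) \<mapsto> (a,c)\<^sub>E\<close>;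
  \<open>ang_\<close> marks the maps \<open>\<langle> , \<rangle>\<close>, and \<open>dx\<close> is the action of \<open>D\<close> on the space of the \<open>x\<close>.\<close>

record ('h, 'k, 'l) products =
  comm :: "'h \<Rightarrow> 'h \<Rightarrow> 'h"
  jord :: "'h \<Rightarrow> 'h \<Rightarrow> 'h"
  ang_aa :: "'h \<Rightarrow> 'h \<Rightarrow> 'l"
  bb'_A :: "'k \<Rightarrow> 'k \<Rightarrow> 'h"
  ang_bb' :: "'k \<Rightarrow> 'k \<Rightarrow> 'l"
  cc'_A :: "'h \<Rightarrow> 'h \<Rightarrow> 'h"
  ang_cc' :: "'h \<Rightarrow> 'h \<Rightarrow> 'l"
  ee'_A :: "'h \<Rightarrow> 'h \<Rightarrow> 'h"
  ang_ee' :: "'h \<Rightarrow> 'h \<Rightarrow> 'l"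
  bb_C :: "'k \<Rightarrow> 'k \<Rightarrow> 'h"
  bb_E :: "'k \<Rightarrow> 'k \<Rightarrow> 'h"
  b'b'_C' :: "'k \<Rightarrow> 'k \<Rightarrow> 'h"
  b'b'_E' :: "'k \<Rightarrow> 'k \<Rightarrow> 'h"
  ac_C :: "'h \<Rightarrow> 'h \<Rightarrow> 'h"
  ac_E :: "'h \<Rightarrow> 'h \<Rightarrow> 'h"
  ae_E :: "'h \<Rightarrow> 'h \<Rightarrow> 'h"
  ae_C :: "'h \<Rightarrow> 'h \<Rightarrow> 'h"
  c'a_C' :: "'h \<Rightarrow> 'h \<Rightarrow> 'h"
  c'a_E' :: "'h \<Rightarrow> 'h \<Rightarrow> 'h"
  e'a_E' :: "'h \<Rightarrow> 'h \<Rightarrow> 'h"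
  e'a_C' :: "'h \<Rightarrow> 'h \<Rightarrow> 'h"
  ce'_A :: "'h \<Rightarrow> 'h \<Rightarrow> 'h"
  c'e_A :: "'h \<Rightarrow> 'h \<Rightarrow> 'h"
  ab_B :: "'h \<Rightarrow> 'k \<Rightarrow> 'k"
  c'b_B' :: "'h \<Rightarrow> 'k \<Rightarrow> 'k"
  e'b_B' :: "'h \<Rightarrow> 'k \<Rightarrow> 'k"
  b'a_B' :: "'k \<Rightarrow> 'h \<Rightarrow> 'k"
  b'c_B :: "'k \<Rightarrow> 'h \<Rightarrow> 'k"
  b'e_B :: "'k \<Rightarrow> 'h \<Rightarrow> 'k"
  da :: "'l \<Rightarrow> 'h \<Rightarrow> 'h"
  db :: "'l \<Rightarrow> 'k \<Rightarrow> 'k"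
  db' :: "'l \<Rightarrow> 'k \<Rightarrow> 'k"
  dc :: "'l \<Rightarrow> 'h \<Rightarrow> 'h"
  dc' :: "'l \<Rightarrow> 'h \<Rightarrow> 'h"
  de :: "'l \<Rightarrow> 'h \<Rightarrow> 'h"
  de' :: "'l \<Rightarrow> 'h \<Rightarrow> 'h"

context lie_algebra_over_sl
begin

abbreviation hs :: "'f \<Rightarrow> ('m \<Rightarrow> 'l) \<Rightarrow> 'm \<Rightarrow> 'l" where "hs \<equiv> fscale scale"

definition bilinear_products :: "('f^'n^'n \<Rightarrow> 'l, 'f^'n \<Rightarrow> 'l, 'l) products \<Rightarrow> bool" where
  "bilinear_products P \<longleftrightarrow>
     bilinear_on hs A hs A hs A (comm P) \<and>
     bilinear_on hs A hs A hs A (jord P) \<and>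
     (\<forall>a1\<in>A. \<forall>a2\<in>A. comm P a1 a2 = - comm P a2 a1 \<and> jord P a1 a2 = jord P a2 a1) \<and>
     bilinear_on hs A hs A scale D (ang_aa P) \<and>
     bilinear_on hs B hs B' hs A (bb'_A P) \<and>
     bilinear_on hs B hs B' scale D (ang_bb' P) \<and>
     bilinear_on hs C hs C' hs A (cc'_A P) \<and>
     bilinear_on hs C hs C' scale D (ang_cc' P) \<and>
     bilinear_on hs E hs E' hs A (ee'_A P) \<and>
     bilinear_on hs E hs E' scale D (ang_ee' P) \<and>
     bilinear_on hs B hs B hs C (bb_C P) \<and>
     bilinear_on hs B hs B hs E (bb_E P) \<and>
     bilinear_on hs B' hs B' hs C' (b'b'_C' P) \<and>
     bilinear_on hs B' hs B' hs E' (b'b'_E' P) \<and>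
     bilinear_on hs A hs C hs C (ac_C P) \<and>
     bilinear_on hs A hs C hs E (ac_E P) \<and>
     bilinear_on hs A hs E hs E (ae_E P) \<and>
     bilinear_on hs A hs E hs C (ae_C P) \<and>
     bilinear_on hs C' hs A hs C' (c'a_C' P) \<and>
     bilinear_on hs C' hs A hs E' (c'a_E' P) \<and>
     bilinear_on hs E' hs A hs E' (e'a_E' P) \<and>
     bilinear_on hs E' hs A hs C' (e'a_C' P) \<and>
     bilinear_on hs C hs E' hs A (ce'_A P) \<and>
     bilinear_on hs C' hs E hs A (c'e_A P) \<and>
     bilinear_on hs A hs B hs B (ab_B P) \<and>
     bilinear_on hs C' hs B hs B' (c'b_B' P) \<and>
     bilinear_on hs E' hs B hs B' (e'b_B' P) \<and>
     bilinear_on hs B' hs A hs B' (b'a_B' P) \<and>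
     bilinear_on hs B' hs C hs B (b'c_B P) \<and>
     bilinear_on hs B' hs E hs B (b'e_B P) \<and>
     bilinear_on scale D hs A hs A (da P) \<and>
     bilinear_on scale D hs B hs B (db P) \<and>
     bilinear_on scale D hs B' hs B' (db' P) \<and>
     bilinear_on scale D hs C hs C (dc P) \<and>
     bilinear_on scale D hs C' hs C' (dc' P) \<and>
     bilinear_on scale D hs E hs E (de P) \<and>
     bilinear_on scale D hs E' hs E' (de' P)"

text \<open>In the rule for \<open>[s' \<otimes> c', w \<otimes> e]\<close> the matrix is \<open>(s'w)\<^sup>t = - ws'\<close>:
  the map \<open>(s', w) \<mapsto> s'w\<close> does not commute with the actions of \<open>sl\<^sub>n\<close>, whereas
  \<open>(s', w) \<mapsto> ws'\<close> does.\<close>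

definition bracket_rules :: "('f^'n^'n \<Rightarrow> 'l, 'f^'n \<Rightarrow> 'l, 'l) products \<Rightarrow> bool" where
  "bracket_rules P \<longleftrightarrow>
    (\<forall>x\<in>sl. \<forall>y\<in>sl. \<forall>u v u' v'.
     \<forall>s\<in>sym_mats. \<forall>s'\<in>sym_mats. \<forall>w\<in>skew_mats. \<forall>w'\<in>skew_mats.
     \<forall>a\<in>A. \<forall>a1\<in>A. \<forall>a2\<in>A. \<forall>b\<in>B. \<forall>b1\<in>B. \<forall>b2\<in>B. \<forall>b'\<in>B'. \<forall>b1'\<in>B'. \<forall>b2'\<in>B'.
     \<forall>c\<in>C. \<forall>c'\<in>C'. \<forall>e\<in>E. \<forall>e'\<in>E'. \<forall>d\<in>D. \<forall>d1\<in>D. \<forall>d2\<in>D.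
       bracket (x \<otimes> a1) (y \<otimes> a2) =
         jord_mat x y \<otimes> hs (1/2) (comm P a1 a2) + comm_mat x y \<otimes> hs (1/2) (jord P a1 a2)
         + scale (form_mat x y) (ang_aa P a1 a2) \<and>
       bracket (u \<otimes> b) (v' \<otimes> b') =
         (outer u v' - mat (trace (outer u v') / of_nat CARD('n))) \<otimes> bb'_A P b b'
         + scale (2 / of_nat CARD('n) * trace (outer u v')) (ang_bb' P b b') \<and>
       bracket (s \<otimes> c) (s' \<otimes> c') =
         (s ** s' - mat (form_mat s s')) \<otimes> cc'_A P c c' + scale (form_mat s s') (ang_cc' P c c') \<and>
       bracket (w \<otimes> e) (w' \<otimes> e') =
         (w ** w' - mat (form_mat w w')) \<otimes> ee'_A P e e' + scale (form_mat w w') (ang_ee' P e e') \<and>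
       bracket (u \<otimes> b1) (v \<otimes> b2) =
         (outer u v + outer v u) \<otimes> hs (1/2) (bb_C P b1 b2)
         + (outer u v - outer v u) \<otimes> hs (1/2) (bb_E P b1 b2) \<and>
       bracket (u' \<otimes> b1') (v' \<otimes> b2') =
         (outer u' v' + outer v' u') \<otimes> hs (1/2) (b'b'_C' P b1' b2')
         + (outer u' v' - outer v' u') \<otimes> hs (1/2) (b'b'_E' P b1' b2') \<and>
       bracket (x \<otimes> a) (s \<otimes> c) =
         (x ** s + s ** transpose x) \<otimes> hs (1/2) (ac_C P a c)
         + (x ** s - s ** transpose x) \<otimes> hs (1/2) (ac_E P a c) \<and>
       bracket (x \<otimes> a) (w \<otimes> e) =
         (x ** w + w ** transpose x) \<otimes> hs (1/2) (ae_E P a e)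
         + (x ** w - w ** transpose x) \<otimes> hs (1/2) (ae_C P a e) \<and>
       bracket (s' \<otimes> c') (x \<otimes> a) =
         (s' ** x + transpose x ** s') \<otimes> hs (1/2) (c'a_C' P c' a)
         + (s' ** x - transpose x ** s') \<otimes> hs (1/2) (c'a_E' P c' a) \<and>
       bracket (w' \<otimes> e') (x \<otimes> a) =
         (w' ** x + transpose x ** w') \<otimes> hs (1/2) (e'a_E' P e' a)
         + (w' ** x - transpose x ** w') \<otimes> hs (1/2) (e'a_C' P e' a) \<and>
       bracket (s \<otimes> c) (w' \<otimes> e') = (s ** w') \<otimes> ce'_A P c e' \<and>
       bracket (s' \<otimes> c') (w \<otimes> e) = transpose (s' ** w) \<otimes> c'e_A P c' e \<and>
       bracket (x \<otimes> a) (u \<otimes> b) = (x *v u) \<otimes> ab_B P a b \<and>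
       bracket (s' \<otimes> c') (u \<otimes> b) = (s' *v u) \<otimes> c'b_B' P c' b \<and>
       bracket (w' \<otimes> e') (u \<otimes> b) = (w' *v u) \<otimes> e'b_B' P e' b \<and>
       bracket (u' \<otimes> b') (x \<otimes> a) = (transpose x *v u') \<otimes> b'a_B' P b' a \<and>
       bracket (u' \<otimes> b') (s \<otimes> c) = (s *v u') \<otimes> b'c_B P b' c \<and>
       bracket (u' \<otimes> b') (w \<otimes> e) = (- (w *v u')) \<otimes> b'e_B P b' e \<and>
       bracket d (x \<otimes> a) = x \<otimes> da P d a \<and>
       bracket d (u \<otimes> b) = u \<otimes> db P d b \<and>
       bracket d (u' \<otimes> b') = u' \<otimes> db' P d b' \<and>
       bracket d (s \<otimes> c) = s \<otimes> dc P d c \<and>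
       bracket d (s' \<otimes> c') = s' \<otimes> dc' P d c' \<and>
       bracket d (w \<otimes> e) = w \<otimes> de P d e \<and>
       bracket d (w' \<otimes> e') = w' \<otimes> de' P d e' \<and>
       bracket d1 d2 \<in> D) \<and>
    (\<forall>y \<in> tensor_image sym_mats C \<union> tensor_image skew_mats E.
     \<forall>z \<in> tensor_image sym_mats C \<union> tensor_image skew_mats E \<union> tensor_image UNIV B.
       bracket y z = 0) \<and>
    (\<forall>y \<in> tensor_image sym_mats C' \<union> tensor_image skew_mats E'.
     \<forall>z \<in> tensor_image sym_mats C' \<union> tensor_image skew_mats E' \<union> tensor_image UNIV B'.
       bracket y z = 0)"

end

section \<open>The coordinate algebra\<close>

text \<open>Elements of \<open>\<aa>\<close> are tuples with entries in \<open>A\<^sup>+, A\<^sup>-, C, E, C', E'\<close> in this order;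
  elements of \<open>\<bb>\<close> have further entries in \<open>B, B'\<close>.\<close>

type_synonym 'h coord_a = "'h \<times> 'h \<times> 'h \<times> 'h \<times> 'h \<times> 'h"
type_synonym ('h, 'k) coord_b = "'h coord_a \<times> 'k \<times> 'k"

definition in_Ap :: "'h::zero \<Rightarrow> 'h coord_a" where "in_Ap a = (a, 0, 0, 0, 0, 0)"
definition in_Am :: "'h::zero \<Rightarrow> 'h coord_a" where "in_Am a = (0, a, 0, 0, 0, 0)"
definition in_C :: "'h::zero \<Rightarrow> 'h coord_a" where "in_C c = (0, 0, c, 0, 0, 0)"
definition in_E :: "'h::zero \<Rightarrow> 'h coord_a" where "in_E e = (0, 0, 0, e, 0, 0)"
definition in_C' :: "'h::zero \<Rightarrow> 'h coord_a" where "in_C' c = (0, 0, 0, 0, c, 0)"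
definition in_E' :: "'h::zero \<Rightarrow> 'h coord_a" where "in_E' e = (0, 0, 0, 0, 0, e)"

fun scale_a :: "('f \<Rightarrow> 'h \<Rightarrow> 'h) \<Rightarrow> 'f \<Rightarrow> 'h coord_a \<Rightarrow> 'h coord_a" where
  "scale_a sh k (p, m, c, e, c', e') = (sh k p, sh k m, sh k c, sh k e, sh k c', sh k e')"

fun scale_b :: "('f \<Rightarrow> 'h \<Rightarrow> 'h) \<Rightarrow> ('f \<Rightarrow> 'k \<Rightarrow> 'k) \<Rightarrow> 'f \<Rightarrow> ('h, 'k) coord_b \<Rightarrow> ('h, 'k) coord_b" where
  "scale_b sh sk k (\<alpha>, b, b') = (scale_a sh k \<alpha>, sk k b, sk k b')"

fun gamma :: "'h::ab_group_add coord_a \<Rightarrow> 'h coord_a" where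
  "gamma (p, m, c, e, c', e') = (p, - m, - c, e, - c', e')"

text \<open>On \<open>\<aa>\<close>, embedded in \<open>\<bb>\<close> with zero entries in \<open>B\<close> and \<open>B'\<close>, the map \<open>\<eta>\<close> is \<open>gamma\<close>.\<close>

fun eta :: "('h::ab_group_add, 'k) coord_b \<Rightarrow> ('h, 'k) coord_b" where
  "eta (\<alpha>, b, b') = (gamma \<alpha>, b, b')"

text \<open>Every product has a factor 1/2, taken out of the sum. The products of \<open>C'\<close> with \<open>E\<close> match the
  normalisation of \<open>(c', e)\<^sub>A\<close> in \<open>bracket_rules\<close>: \<open>e c' = ((c', e)\<^sub>A\<^sup>+ + (c', e)\<^sub>A\<^sup>-)/2\<close> and
  \<open>c' e = ((c', e)\<^sub>A\<^sup>- - (c', e)\<^sub>A\<^sup>+)/2\<close>.\<close>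

fun mult_a :: "('f::field \<Rightarrow> 'h::ab_group_add \<Rightarrow> 'h) \<Rightarrow> ('h, 'k, 'l) products \<Rightarrow>
    'h coord_a \<Rightarrow> 'h coord_a \<Rightarrow> 'h coord_a" where
  "mult_a sh P (p1, m1, c1, e1, c1', e1') (p2, m2, c2, e2, c2', e2') = scale_a sh (1/2) (
     (in_Am (comm P p1 p2) + in_Ap (jord P p1 p2))
   + (in_Am (comm P m1 m2) + in_Ap (jord P m1 m2))
   + (in_Ap (comm P p1 m2) + in_Am (jord P p1 m2))
   + (in_Ap (comm P m1 p2) + in_Am (jord P m1 p2))

   + (in_C (ac_C P p1 c2) + in_E (ac_E P p1 c2))
   + (in_C (ac_C P m1 c2) + in_E (ac_E P m1 c2))
   + (in_C (ac_C P p2 c1) - in_E (ac_E P p2 c1))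
   + (in_E (ac_E P m2 c1) - in_C (ac_C P m2 c1))

   + (in_E (ae_E P p1 e2) + in_C (ae_C P p1 e2))
   + (in_E (ae_E P m1 e2) + in_C (ae_C P m1 e2))
   + (in_E (ae_E P p2 e1) - in_C (ae_C P p2 e1))
   + (in_C (ae_C P m2 e1) - in_E (ae_E P m2 e1))

   + (in_C' (c'a_C' P c1' p2) + in_E' (c'a_E' P c1' p2))
   + (in_C' (c'a_C' P c1' m2) + in_E' (c'a_E' P c1' m2))
   + (in_C' (c'a_C' P c2' p1) - in_E' (c'a_E' P c2' p1))
   + (in_E' (c'a_E' P c2' m1) - in_C' (c'a_C' P c2' m1))

   + (in_E' (e'a_E' P e1' p2) + in_C' (e'a_C' P e1' p2))
   + (in_E' (e'a_E' P e1' m2) + in_C' (e'a_C' P e1' m2))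
   + (in_E' (e'a_E' P e2' p1) - in_C' (e'a_C' P e2' p1))
   + (in_C' (e'a_C' P e2' m1) - in_E' (e'a_E' P e2' m1))

   + (in_Ap (cc'_A P c1 c2') + in_Am (cc'_A P c1 c2'))
   + (in_Ap (cc'_A P c2 c1') - in_Am (cc'_A P c2 c1'))
   + (in_Ap (ee'_A P e1 e2') + in_Am (ee'_A P e1 e2'))
   + (in_Ap (ee'_A P e2 e1') - in_Am (ee'_A P e2 e1'))

   + (in_Ap (ce'_A P c1 e2') + in_Am (ce'_A P c1 e2'))
   + (in_Am (ce'_A P c2 e1') - in_Ap (ce'_A P c2 e1'))
   + (in_Ap (c'e_A P c2' e1) + in_Am (c'e_A P c2' e1))
   + (in_Am (c'e_A P c1' e2) - in_Ap (c'e_A P c1' e2)))"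

text \<open>The products \<open>\<alpha> b\<close> and \<open>b' \<alpha>\<close> for \<open>\<alpha> \<in> \<aa>\<close>, as elements of \<open>B \<oplus> B'\<close>.\<close>

fun mult_a_B :: "('h, 'k::ab_group_add, 'l) products \<Rightarrow> 'h coord_a \<Rightarrow> 'k \<Rightarrow> 'k \<times> 'k" where
  "mult_a_B P (p, m, c, e, c', e') b = (ab_B P p b + ab_B P m b, c'b_B' P c' b + e'b_B' P e' b)"

fun mult_B'_a :: "('h, 'k::ab_group_add, 'l) products \<Rightarrow> 'k \<Rightarrow> 'h coord_a \<Rightarrow> 'k \<times> 'k" where
  "mult_B'_a P b' (p, m, c, e, c', e') = (b'c_B P b' c + b'e_B P b' e, b'a_B' P b' p + b'a_B' P b' m)"

fun mult_BB' :: "('f::field \<Rightarrow> 'h::ab_group_add \<Rightarrow> 'h) \<Rightarrow> ('h, 'k, 'l) products \<Rightarrow>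
    'k \<times> 'k \<Rightarrow> 'k \<times> 'k \<Rightarrow> 'h coord_a" where
  "mult_BB' sh P (b1, b1') (b2, b2') = scale_a sh (1/2) (
     (in_C (bb_C P b1 b2) + in_E (bb_E P b1 b2))
   + (in_C' (b'b'_C' P b1' b2') + in_E' (b'b'_E' P b1' b2'))
   + (in_Ap (bb'_A P b1 b2') + in_Am (bb'_A P b1 b2'))
   + (in_Ap (bb'_A P b2 b1') - in_Am (bb'_A P b2 b1')))"

text \<open>By definition \<open>b \<alpha> = gamma \<alpha> b\<close> and \<open>\<alpha> b' = b' gamma \<alpha>\<close>.\<close>

fun mult_b :: "('f::field \<Rightarrow> 'h::ab_group_add \<Rightarrow> 'h) \<Rightarrow> ('h, 'k::ab_group_add, 'l) products \<Rightarrow>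
    ('h, 'k) coord_b \<Rightarrow> ('h, 'k) coord_b \<Rightarrow> ('h, 'k) coord_b" where
  "mult_b sh P (\<alpha>1, b1, b1') (\<alpha>2, b2, b2') =
     (mult_a sh P \<alpha>1 \<alpha>2 + mult_BB' sh P (b1, b1') (b2, b2'),
      mult_a_B P \<alpha>1 b2 + mult_a_B P (gamma \<alpha>2) b1 + mult_B'_a P b1' \<alpha>2 + mult_B'_a P b2' (gamma \<alpha>1))"

fun deriv_b :: "('h, 'k, 'l) products \<Rightarrow> 'l \<Rightarrow> ('h, 'k) coord_b \<Rightarrow> ('h, 'k) coord_b" where
  "deriv_b P d ((p, m, c, e, c', e'), b, b') =
     ((da P d p, da P d m, dc P d c, de P d e, dc' P d c', de' P d e'), db P d b, db' P d b')"

end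

theory Submission
  imports Defs
begin

text \<open>Idea. A weight is an integral vector modulo \<open>(1, \<dots>, 1)\<close>, and since \<open>n \<ge> 5\<close> a vector with
  small sum norm represents a weight in \<open>\<Theta>\<^sub>n\<close> only if it obviously does. A weight vector
  whose weight is that of a generator of one of the seven modules is moved around by the root
  vectors of \<open>sl\<^sub>n\<close>; the moves commute and compose like those of labelled tokens, so the resulting
  family of vectors is the image of the standard basis under a homomorphism. This gives the isotypic
  decomposition, the zero weight space being reduced to \<open>D\<close> by subtracting values on diagonal matrices.

  For \<open>\<phi>\<close> and \<open>\<psi>\<close> in two multiplicity spaces, \<open>(m, n) \<mapsto> [\<phi> m, \<psi> n]\<close> is equivariant, hence determined by
  its value at one pair \<open>(v, w)\<close> of generators such that the root vectors that generate from \<open>v\<close>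
  annihilate \<open>w\<close>. That value is a weight vector, which leaves exactly the maps in the statement, or
  zero. Twisting the embedding of \<open>sl\<^sub>n\<close> by \<open>x \<mapsto> - x\<^sup>t\<close> exchanges the primed and the unprimed spaces.

  For \<open>i \<noteq> j\<close> an element \<open>\<alpha>\<close> of \<open>\<aa>\<close> has four entries \<open>T\<^sub>\<sigma>\<^sub>\<tau> i j \<alpha>\<close> in \<open>L\<close>, with
  \<open>\<Sum>\<^sub>\<rho> [T\<^sub>\<sigma>\<^sub>\<rho> i j \<alpha>, T\<^sub>\<rho>\<^sub>\<tau> j k \<beta>] = T\<^sub>\<sigma>\<^sub>\<tau> i k (\<alpha>\<beta>)\<close> for distinct \<open>i, j, k\<close>, and entries at disjoint pairs of
  indices commute. The Jacobi identity at distinct indices is then the associativity of \<open>\<aa>\<close>; with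
  columns for the elements of \<open>B \<oplus> B'\<close> it also gives the module, form and derivation identities.\<close>

section \<open>Matrix units\<close>

text \<open>Complete reducibility is not invoked, since \<open>L\<close> may be
  infinite-dimensional: each isotypic piece is exhibited by an explicit homomorphism from a standard
  module. The obstacle is weight zero. Root vectors reach only differences of diagonal values, so
  these are normalised by dividing by n, and a vector of weight zero is controlled only up to
  \<open>D\<close>. Products of coordinates are read at distinct indices because there traces, and
  with them all \<open>D\<close>-valued terms, drop out. A member of a multiplicity space is
  determined by its value at one generator, so an identity in \<open>L\<close> at one choice of
  indices is an identity of coordinates. The four entries of \<alpha> are its Peirce components for
  the idempotents (1^+ + 1^-)/2 and (1^+ - 1^-)/2 of \<open>\<aa>\<close>: A^+ + A^- fills the two
  diagonal corners, C + E the corner (+,-), C' + E' the corner (-,+). This is the source of the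
  signs in the product formulas. The involution exchanges the two idempotents, so on entries it
  reverses indices and signs.\<close>

definition munit :: "'n \<Rightarrow> 'n \<Rightarrow> 'f::field^'n^'n" where
  "munit p q = (\<chi> i j. if i = p \<and> j = q then 1 else 0)"

lemma munit_nth [simp]: "munit p q $ i $ j = (if i = p \<and> j = q then 1 else 0)"
  by (simp add: munit_def)

lemma mscale_nth [simp]: "mscale k x $ i $ j = k * x $ i $ j"
  by (simp add: mscale_def)

lemma sum_delta_mult:
  fixes f :: "'n::finite \<Rightarrow> 'f::field"
  shows "(\<Sum>k\<in>UNIV. (if P \<and> k = a then 1 else 0) * f k) = (if P then f a else 0)"
    "(\<Sum>k\<in>UNIV. f k * (if k = a \<and> P then 1 else 0)) = (if P then f a else 0)"
  by (cases P; simp add: if_distrib[of "\<lambda>x. x * _"] if_distrib[of "\<lambda>x. _ * x"] cong: if_cong)+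

lemma munit_mult_nth [simp]: "(munit p q ** x) $ i $ j = (if i = p then x $ q $ j else 0)"
  by (simp add: matrix_matrix_mult_def sum_delta_mult)

lemma mult_munit_nth [simp]: "(x ** munit p q) $ i $ j = (if j = q then x $ i $ p else 0)"
  by (simp add: matrix_matrix_mult_def sum_delta_mult)

lemma munit_mult_vec_nth [simp]: "(munit p q *v v) $ i = (if i = p then v $ q else 0)"
  by (simp add: matrix_vector_mult_def sum_delta_mult)

lemma munit_mult_axis [simp]: "munit p q *v axis r 1 = (if q = r then axis p 1 else 0)"
  by (auto simp: vec_eq_iff axis_def)

lemma munit_mult_munit [simp]: "munit p q ** munit r s = (if q = r then munit p s else 0)"
  by (auto simp: vec_eq_iff)

lemma transpose_munit [simp]: "transpose (munit p q) = munit q p"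
  by (auto simp: vec_eq_iff transpose_def)

lemma trace_munit [simp]: "trace (munit p q) = (if p = q then 1 else 0)"
proof (cases "p = q")
  case False
  then have "(\<Sum>i\<in>UNIV. munit p q $ i $ i) = 0" by (intro sum.neutral) auto
  then show ?thesis using False by (simp add: trace_def)
qed (simp add: trace_def)

lemma outer_axis [simp]: "outer (axis p 1) (axis q 1) = munit p q"
  by (auto simp: vec_eq_iff outer_def axis_def)

lemma munit_in_sl [simp]: "munit p q \<in> sl \<longleftrightarrow> p \<noteq> q"
  by (simp add: sl_def)

lemma trace_mscale [simp]: "trace (mscale k x) = k * trace x"
  by (simp add: trace_def sum_distrib_left)

lemma trace_diff' [simp]: "trace (x - y :: 'f::field^'n^'n) = trace x - trace y"
  by (simp add: trace_def sum_subtractf)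

lemma trace_uminus [simp]: "trace (- x :: 'f::field^'n^'n) = - trace x"
  by (simp add: trace_def sum_negf)

lemma trace_add' [simp]: "trace (x + y :: 'f::field^'n^'n) = trace x + trace y"
  by (simp add: trace_def sum.distrib)

lemma trace_zero [simp]: "trace (0 :: 'f::field^'n^'n) = 0"
  by (simp add: trace_def)

lemma trace_transpose' [simp]: "trace (transpose x :: 'f::field^'n^'n) = trace x"
  by (simp add: trace_def transpose_def)

lemma trace_mult_commute: "trace (x ** y :: 'f::field^'n^'n) = trace (y ** x)"
  unfolding trace_def matrix_matrix_mult_def
  by (simp, subst sum.swap, simp add: mult.commute)

lemma trace_mat: "trace (mat k :: 'f::field^'n^'n) = of_nat CARD('n) * k"
  by (simp add: trace_def mat_def)

lemma transpose_add: "transpose (x + y) = transpose x + transpose (y :: 'f::field^'n^'n)"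
  by (simp add: vec_eq_iff transpose_def)

lemma transpose_diff: "transpose (x - y) = transpose x - transpose (y :: 'f::field^'n^'n)"
  by (simp add: vec_eq_iff transpose_def)

lemma transpose_uminus: "transpose (- x) = - transpose (x :: 'f::field^'n^'n)"
  by (simp add: vec_eq_iff transpose_def)

lemma transpose_mscale: "transpose (mscale k x) = mscale k (transpose (x :: 'f::field^'n^'n))"
  by (simp add: vec_eq_iff transpose_def)

lemma transpose_mult: "transpose (x ** y) = transpose y ** transpose (x :: 'f::field^'n^'n)"
  by (simp add: matrix_transpose_mul)

lemma transpose_zero: "transpose 0 = (0 :: 'f::field^'n^'n)"
  by (simp add: vec_eq_iff transpose_def)

lemma transpose_sum: "transpose (sum f I) = (\<Sum>i\<in>I. transpose (f i :: 'f::field^'n^'n))"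
  by (induction I rule: infinite_finite_induct) (simp_all add: transpose_add transpose_zero)

lemma mult_uminus_left: "(- x) ** y = - (x ** y :: 'f::field^'n^'n)"
  by (simp add: vec_eq_iff matrix_matrix_mult_def sum_negf)

lemma mult_uminus_right: "x ** (- y) = - (x ** y :: 'f::field^'n^'n)"
  by (simp add: vec_eq_iff matrix_matrix_mult_def sum_negf)

lemma mult_diff_left: "(x - y) ** z = x ** z - y ** (z :: 'f::field^'n^'n)"
  by (simp add: vec_eq_iff matrix_matrix_mult_def sum_subtractf left_diff_distrib)

lemma mult_diff_right: "z ** (x - y) = z ** x - z ** (y :: 'f::field^'n^'n)"
  by (simp add: vec_eq_iff matrix_matrix_mult_def sum_subtractf right_diff_distrib)

lemma mult_mscale_left: "mscale k x ** y = mscale k (x ** y :: 'f::field^'n^'n)"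
  by (simp add: vec_eq_iff matrix_matrix_mult_def sum_distrib_left mult.assoc)

lemma mult_mscale_right: "x ** mscale k y = mscale k (x ** y :: 'f::field^'n^'n)"
  by (simp add: vec_eq_iff matrix_matrix_mult_def sum_distrib_left mult.left_commute)

lemma mscale_add: "mscale k (x + y) = mscale k x + mscale k y"
  by (simp add: vec_eq_iff distrib_left)

lemma mscale_diff: "mscale k (x - y) = mscale k x - mscale k y"
  by (simp add: vec_eq_iff right_diff_distrib)

lemma mult_mat_left: "mat k ** x = mscale k (x :: 'f::field^'n^'n)"
  by (simp add: vec_eq_iff matrix_matrix_mult_def mat_def if_distrib[of "\<lambda>x. x * _"] cong: if_cong)

lemma mult_mat_right: "x ** mat k = mscale k (x :: 'f::field^'n^'n)"
  by (simp add: vec_eq_iff matrix_matrix_mult_def mat_def if_distrib[of "\<lambda>x. _ * x"] mult.commute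
      cong: if_cong)

lemma matrix_add_rdistrib': "(x + y) ** z = x ** z + y ** (z :: 'f::field^'n^'n)"
  by (simp add: vec_eq_iff matrix_matrix_mult_def sum.distrib distrib_right)

lemmas matrix_ring = mult_uminus_left mult_uminus_right mult_diff_left mult_diff_right
  matrix_add_ldistrib matrix_add_rdistrib' matrix_mul_assoc

lemmas transpose_ring = transpose_add transpose_diff transpose_uminus transpose_mult transpose_transpose

lemma mult_vec_uminus_left: "(- x) *v v = - (x *v v :: 'f::field^'n)"
  by (simp add: vec_eq_iff matrix_vector_mult_def sum_negf)

lemma mult_vec_uminus_right: "x *v (- v) = - (x *v v :: 'f::field^'n)"
  by (simp add: vec_eq_iff matrix_vector_mult_def sum_negf)

lemma mult_vec_diff_left: "(x - y) *v v = x *v v - (y *v v :: 'f::field^'n)"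
  by (simp add: vec_eq_iff matrix_vector_mult_def sum_subtractf left_diff_distrib)

lemma mult_vec_diff_right: "x *v (v - w) = x *v v - (x *v w :: 'f::field^'n)"
  by (simp add: vec_eq_iff matrix_vector_mult_def sum_subtractf right_diff_distrib)

lemma mult_vec_add_left: "(x + y) *v v = x *v v + (y *v v :: 'f::field^'n)"
  by (simp add: vec_eq_iff matrix_vector_mult_def sum.distrib distrib_right)

lemma mult_vec_add_right: "x *v (v + w) = x *v v + (x *v w :: 'f::field^'n)"
  by (simp add: vec_eq_iff matrix_vector_mult_def sum.distrib distrib_left)

lemma mult_vec_mscale_left: "mscale k x *v v = k *s (x *v v :: 'f::field^'n)"
  by (simp add: vec_eq_iff matrix_vector_mult_def sum_distrib_left mult.assoc)

lemma mult_vec_scale_right: "x *v (k *s v) = k *s (x *v v :: 'f::field^'n)"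
  by (simp add: vec_eq_iff matrix_vector_mult_def sum_distrib_left mult.left_commute)

lemmas matrix_vec_ring = mult_vec_uminus_left mult_vec_uminus_right mult_vec_diff_left
  mult_vec_diff_right mult_vec_add_left mult_vec_add_right matrix_vector_mul_assoc

lemma vector_space_mscale: "vector_space (mscale :: 'f::field \<Rightarrow> 'f^'n^'n \<Rightarrow> 'f^'n^'n)"
  by standard (simp_all add: vec_eq_iff algebra_simps)

interpretation mscale: vector_space "mscale :: 'f::field \<Rightarrow> 'f^'n^'n \<Rightarrow> 'f^'n^'n"
  by (rule vector_space_mscale)

lemma matrix_expansion: "x = (\<Sum>p\<in>UNIV. \<Sum>q\<in>UNIV. mscale (x $ p $ q) (munit p q))"
proof -
  have "(\<Sum>p\<in>UNIV. \<Sum>q\<in>UNIV. mscale (x $ p $ q) (munit p q)) $ i $ j = x $ i $ j" for i j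
  proof -
    have "(\<Sum>p\<in>UNIV. \<Sum>q\<in>UNIV. mscale (x $ p $ q) (munit p q)) $ i $ j
      = (\<Sum>p\<in>UNIV. \<Sum>q\<in>UNIV. if p = i then if q = j then x $ i $ j else 0 else 0)"
      by (simp, intro sum.cong refl) auto
    also have "\<dots> = (\<Sum>p\<in>UNIV. if p = i then (\<Sum>q\<in>UNIV. if q = j then x $ i $ j else 0) else 0)"
      by (intro sum.cong refl) auto
    also have "\<dots> = x $ i $ j"
      by (simp add: sum.delta)
    finally show ?thesis .
  qed
  then show ?thesis by (simp add: vec_eq_iff)
qed

lemma vector_expansion: "(v :: 'f::field^'n) = (\<Sum>p\<in>UNIV. (v $ p) *s axis p 1)"
proof -
  have "(\<Sum>p\<in>UNIV. ((v $ p) *s axis p 1) $ i) = (\<Sum>p\<in>UNIV. if p = i then v $ i else 0)" for i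
    by (intro sum.cong refl) (auto simp: axis_def)
  then show ?thesis by (simp add: vec_eq_iff)
qed

section \<open>Modules over \<open>sl\<^sub>n\<close>\<close>

text \<open>Closure alone mentions \<open>M\<close> and \<open>sl\<close>. The seven standard
  actions are given by formulas that make sense for all matrices on the whole ambient space, so the
  linear and commutator laws carry no membership premises.\<close>

locale sl_module = vector_space sM
  for sM :: "'f::field_char_0 \<Rightarrow> 'm::ab_group_add \<Rightarrow> 'm" +
  fixes act :: "'f^'n^'n \<Rightarrow> 'm \<Rightarrow> 'm" and M :: "'m set"
  assumes carrier_subspace: "subspace M"
    and act_closed: "x \<in> sl \<Longrightarrow> m \<in> M \<Longrightarrow> act x m \<in> M"
    and act_add_left: "act (x + y) m = act x m + act y m"
    and act_scale_left: "act (mscale k x) m = sM k (act x m)"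
    and act_add_right: "act x (m + m') = act x m + act x m'"
    and act_scale_right: "act x (sM k m) = sM k (act x m)"
    and act_comm: "act (comm_mat x y) m = act x (act y m) - act y (act x m)"
begin

text \<open>The set \<open>R\<close> of root vectors used for generation is recorded because an
  equivariant bilinear map will be propagated along \<open>R\<close> against a second generator,
  which the root vectors in \<open>R\<close> must annihilate; a small \<open>R\<close> leaves more
  freedom for that generator. The clause \<open>p \<noteq> q\<close> keeps the matrix unit in
  \<open>sl\<close>.\<close>

definition generated_by :: "('n \<times> 'n) set \<Rightarrow> 'm \<Rightarrow> bool" where
  "generated_by R v \<longleftrightarrow> v \<in> M \<and>
     (\<forall>N. subspace N \<and> N \<subseteq> M \<and> v \<in> N \<and>
        (\<forall>p q. (p, q) \<in> R \<and> p \<noteq> q \<longrightarrow> (\<forall>m\<in>N. act (munit p q) m \<in> N)) \<longrightarrow> M \<subseteq> N)"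

lemma generated_byD:
  assumes "generated_by R v" "subspace N" "N \<subseteq> M" "v \<in> N"
    and "\<And>p q m. (p, q) \<in> R \<Longrightarrow> p \<noteq> q \<Longrightarrow> m \<in> N \<Longrightarrow> act (munit p q) m \<in> N"
  shows "N = M"
  using assms unfolding generated_by_def by blast

lemma generated_byI:
  assumes "v \<in> M"
    and "\<And>N. subspace N \<Longrightarrow> N \<subseteq> M \<Longrightarrow> v \<in> N \<Longrightarrow>
      (\<And>p q m. (p, q) \<in> R \<Longrightarrow> p \<noteq> q \<Longrightarrow> m \<in> N \<Longrightarrow> act (munit p q) m \<in> N) \<Longrightarrow> M \<subseteq> N"
  shows "generated_by R v"
  using assms unfolding generated_by_def by blast

end

section \<open>The seven standard modules and their generators\<close>

lemma sl_subspace: "mscale.subspace sl"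
  by (simp add: mscale.subspace_def sl_def)

lemma sym_subspace: "mscale.subspace sym_mats"
  by (simp add: mscale.subspace_def sym_mats_def transpose_add transpose_mscale transpose_zero)

lemma skew_subspace: "mscale.subspace skew_mats"
  by (simp add: mscale.subspace_def skew_mats_def transpose_add transpose_mscale transpose_zero)

lemma comm_mat_in_sl [simp]: "comm_mat x y \<in> sl"
  by (simp add: sl_def comm_mat_def trace_mult_commute[of x y])

lemma sl_module_sl: "sl_module mscale comm_mat (sl :: ('f::field_char_0^'n^'n) set)"
proof unfold_locales
  show "mscale.subspace (sl :: ('f^'n^'n) set)" by (rule sl_subspace)
qed (simp_all, simp_all add: comm_mat_def matrix_ring mult_mscale_left mult_mscale_right mscale_diff)

lemma sl_module_V: "sl_module (*s) act_V (UNIV :: ('f::field_char_0^'n) set)"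
  by unfold_locales (simp_all add: act_V_def comm_mat_def matrix_vec_ring mult_vec_mscale_left
      mult_vec_scale_right)

lemma sl_module_V': "sl_module (*s) act_V' (UNIV :: ('f::field_char_0^'n) set)"
  by unfold_locales (simp_all add: act_V'_def comm_mat_def matrix_vec_ring mult_vec_mscale_left
      mult_vec_scale_right transpose_ring transpose_mscale del: transpose_matrix_vector)

lemma sl_module_S: "sl_module mscale act_S (sym_mats :: ('f::field_char_0^'n^'n) set)"
proof unfold_locales
  show "mscale.subspace (sym_mats :: ('f^'n^'n) set)" by (rule sym_subspace)
qed (auto simp add: act_S_def comm_mat_def matrix_ring mult_mscale_left
      mult_mscale_right transpose_ring transpose_mscale mscale_add sym_mats_def)

lemma sl_module_S': "sl_module mscale act_S' (sym_mats :: ('f::field_char_0^'n^'n) set)"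
proof unfold_locales
  show "mscale.subspace (sym_mats :: ('f^'n^'n) set)" by (rule sym_subspace)
qed (auto simp add: act_S'_def comm_mat_def matrix_ring mult_mscale_left
      mult_mscale_right transpose_ring transpose_mscale mscale_add sym_mats_def mscale_diff)

lemma sl_module_L: "sl_module mscale act_S (skew_mats :: ('f::field_char_0^'n^'n) set)"
proof unfold_locales
  show "mscale.subspace (skew_mats :: ('f^'n^'n) set)" by (rule skew_subspace)
qed (auto simp add: act_S_def comm_mat_def matrix_ring mult_mscale_left
      mult_mscale_right transpose_ring transpose_mscale mscale_add skew_mats_def)

lemma sl_module_L': "sl_module mscale act_S' (skew_mats :: ('f::field_char_0^'n^'n) set)"
proof unfold_locales
  show "mscale.subspace (skew_mats :: ('f^'n^'n) set)" by (rule skew_subspace)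
qed (auto simp add: act_S'_def comm_mat_def matrix_ring mult_mscale_left
      mult_mscale_right transpose_ring transpose_mscale mscale_add skew_mats_def mscale_diff)

interpretation slm: sl_module mscale comm_mat "sl :: ('f::field_char_0^'n^'n) set" by (rule sl_module_sl)
interpretation Vm: sl_module "(*s)" act_V "UNIV :: ('f::field_char_0^'n) set" by (rule sl_module_V)
interpretation Vm': sl_module "(*s)" act_V' "UNIV :: ('f::field_char_0^'n) set" by (rule sl_module_V')
interpretation Sm: sl_module mscale act_S "sym_mats :: ('f::field_char_0^'n^'n) set" by (rule sl_module_S)
interpretation Sm': sl_module mscale act_S' "sym_mats :: ('f::field_char_0^'n^'n) set" by (rule sl_module_S')
interpretation Lm: sl_module mscale act_S "skew_mats :: ('f::field_char_0^'n^'n) set" by (rule sl_module_L)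
interpretation Lm': sl_module mscale act_S' "skew_mats :: ('f::field_char_0^'n^'n) set" by (rule sl_module_L')

lemma munit_act_V: "act_V (munit p q) (axis r 1) = (if q = r then axis p 1 else 0)"
  by (simp add: act_V_def)

lemma V_generated: "Vm.generated_by {(p, q). q = r} (axis r 1 :: 'f::field_char_0^'n)"
proof (rule Vm.generated_byI)
  fix N :: "('f^'n) set"
  assume N: "vec.subspace N" and r: "axis r 1 \<in> N"
    and cl: "\<And>p q m. (p, q) \<in> {(p, q). q = r} \<Longrightarrow> p \<noteq> q \<Longrightarrow> m \<in> N \<Longrightarrow> act_V (munit p q) m \<in> N"
  have "axis p 1 \<in> N" for p
    using cl[of p r "axis r 1"] r by (cases "p = r") (simp_all add: munit_act_V)
  then have "v \<in> N" for v
    by (subst vector_expansion) (intro vec.subspace_sum[OF N] vec.subspace_scale[OF N])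
  then show "UNIV \<subseteq> N" by blast
qed simp

lemma matrix_span:
  assumes N: "mscale.subspace N" and b: "\<And>p q. b p q \<in> N"
    and x: "x = (\<Sum>p\<in>UNIV. \<Sum>q\<in>UNIV. mscale (k p q) (b p q))"
  shows "x \<in> N"
  unfolding x by (intro mscale.subspace_sum[OF N] mscale.subspace_scale[OF N] b)

text \<open>Subtracting E_rr from every diagonal unit changes the usual expansion by trace(x) E_rr =
  0 and makes each summand traceless.\<close>

lemma sl_expansion:
  assumes "x \<in> sl"
  shows "x = (\<Sum>p\<in>UNIV. \<Sum>q\<in>UNIV. mscale (x $ p $ q) (munit p q - (if p = q then munit r r else 0)))"
proof -
  have "(\<Sum>p\<in>UNIV. \<Sum>q\<in>UNIV. mscale (x $ p $ q) (if p = q then munit r r else 0))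
      = (\<Sum>p\<in>UNIV. mscale (x $ p $ p) (munit r r))"
  proof (intro sum.cong refl)
    fix p
    have "(\<Sum>q\<in>UNIV. mscale (x $ p $ q) (if p = q then munit r r else 0))
      = (\<Sum>q\<in>UNIV. if p = q then mscale (x $ p $ p) (munit r r) else 0)"
      by (intro sum.cong refl) simp
    then show "(\<Sum>q\<in>UNIV. mscale (x $ p $ q) (if p = q then munit r r else 0))
      = mscale (x $ p $ p) (munit r r)" by simp
  qed
  also have "\<dots> = mscale (trace x) (munit r r)"
    by (simp add: trace_def mscale.scale_sum_left)
  also have "\<dots> = 0" using assms by (simp add: sl_def)
  finally show ?thesis
    by (simp add: mscale_diff sum_subtractf matrix_expansion[of x, symmetric])
qed

lemma transpose_expansion:
  "(\<Sum>p\<in>UNIV. \<Sum>q\<in>UNIV. mscale (x $ p $ q) (munit q p)) = transpose x"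
  using arg_cong[OF matrix_expansion[of x], of transpose]
  by (simp only: transpose_sum transpose_mscale transpose_munit)

lemma sym_expansion:
  fixes x :: "'f::field_char_0^'n^'n"
  assumes "transpose x = x"
  shows "x = (\<Sum>p\<in>UNIV. \<Sum>q\<in>UNIV. mscale (x $ p $ q / 2) (munit p q + munit q p))"
proof -
  have "mscale 2 (\<Sum>p\<in>UNIV. \<Sum>q\<in>UNIV. mscale (x $ p $ q / 2) (munit p q + munit q p))
    = (\<Sum>p\<in>UNIV. \<Sum>q\<in>UNIV. mscale (x $ p $ q) (munit p q + munit q p))"
    by (simp add: mscale.scale_sum_right)
  also have "\<dots> = x + transpose (\<Sum>p\<in>UNIV. \<Sum>q\<in>UNIV. mscale (x $ p $ q) (munit p q))"
    by (simp add: mscale_add sum.distrib transpose_expansion matrix_expansion[of x, symmetric]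
      transpose_sum transpose_mscale)
  also have "\<dots> = mscale 2 x"
    using assms by (simp add: matrix_expansion[of x, symmetric]) (simp add: vec_eq_iff)
  finally show ?thesis by (simp add: vec_eq_iff)
qed

lemma skew_expansion:
  fixes x :: "'f::field_char_0^'n^'n"
  assumes "transpose x = - x"
  shows "x = (\<Sum>p\<in>UNIV. \<Sum>q\<in>UNIV. mscale (x $ p $ q / 2) (munit p q - munit q p))"
proof -
  have "mscale 2 (\<Sum>p\<in>UNIV. \<Sum>q\<in>UNIV. mscale (x $ p $ q / 2) (munit p q - munit q p))
    = (\<Sum>p\<in>UNIV. \<Sum>q\<in>UNIV. mscale (x $ p $ q) (munit p q - munit q p))"
    by (simp add: mscale.scale_sum_right)
  also have "\<dots> = x - transpose (\<Sum>p\<in>UNIV. \<Sum>q\<in>UNIV. mscale (x $ p $ q) (munit p q))"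
    by (simp add: mscale_diff sum_subtractf transpose_expansion matrix_expansion[of x, symmetric]
      transpose_sum transpose_mscale)
  also have "\<dots> = mscale 2 x"
    using assms by (simp add: matrix_expansion[of x, symmetric]) (simp add: vec_eq_iff)
  finally show ?thesis by (simp add: vec_eq_iff)
qed

text \<open>E_pi changes the first index of E_ij and E_jq the second. These two kinds of moves reach
  every E_pq with p \<noteq> j and the differences E_jj - E_pp; the remaining units E_jq come
  last.\<close>

lemma sl_generated:
  assumes "i \<noteq> j"
  shows "slm.generated_by {(p, q). q = i \<or> p = j} (munit i j :: 'f::field_char_0^'n^'n)"
proof (rule slm.generated_byI)
  fix N :: "('f^'n^'n) set"
  assume N: "mscale.subspace N" and ij: "munit i j \<in> N"
    and cl: "\<And>p q m. (p, q) \<in> {(p, q). q = i \<or> p = j} \<Longrightarrow> p \<noteq> q \<Longrightarrow> m \<in> N \<Longrightarrow> comm_mat (munit p q) m \<in> N"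
  have cl1: "comm_mat (munit p i) m \<in> N" if "m \<in> N" "p \<noteq> i" for p m
    using cl[of p i m] that by simp
  have cl2: "comm_mat (munit j q) m \<in> N" if "m \<in> N" "q \<noteq> j" for q m
    using cl[of j q m] that by simp
  have neg: "- m \<in> N \<Longrightarrow> m \<in> N" for m
    using mscale.subspace_neg[OF N, of "- m"] by simp
  have col: "munit p j \<in> N" if "p \<noteq> j" for p
    using cl1[OF ij, of p] ij that assms by (cases "p = i") (auto simp: comm_mat_def)
  have row: "munit p q \<in> N" if "p \<noteq> j" "p \<noteq> q" for p q
    using cl2[OF col, of p q] col[of p] that neg[of "munit p q"]
    by (cases "q = j") (auto simp: comm_mat_def)
  have hj: "munit j j - munit p p \<in> N" if "p \<noteq> j" for p
    using cl2[OF col, of p p] that by (auto simp: comm_mat_def)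
  have last: "munit j q \<in> N" if "q \<noteq> j" for q
  proof (cases "q = i")
    case True
    \<comment> \<open>E_ji is reached through a diagonal matrix: -2 is the eigenvalue by which E_ji
      reappears in its commutator with E_jj - E_ii.\<close>
    have "(munit j i :: 'f^'n^'n) = mscale (-1/2) (comm_mat (munit j i) (munit j j - munit i i))"
      using assms by (simp add: comm_mat_def matrix_ring vec_eq_iff)
    moreover have "comm_mat (munit j i) (munit j j - munit i i) \<in> N"
      using cl1[OF hj[OF assms], of j] assms by auto
    ultimately show ?thesis using True mscale.subspace_scale[OF N] by metis
  next
    case False
    then show ?thesis
      using cl1[OF row[of i q], of j] assms that by (auto simp: comm_mat_def)
  qed
  have b: "munit p q - (if p = q then munit j j else 0) \<in> N" for p q
  proof (cases "p = q")
    case True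
    then show ?thesis using neg[of "munit p p - munit j j"] hj[of p] mscale.subspace_0[OF N]
      by (cases "p = j") auto
  next
    case False
    then show ?thesis using row[of p q] last[of q] by (cases "p = j") auto
  qed
  show "sl \<subseteq> N"
    using matrix_span[OF N b sl_expansion] by blast
qed (use assms in simp)

lemma S_generated: "Sm.generated_by {(p, q). q = r} (munit r r :: 'f::field_char_0^'n^'n)"
proof (rule Sm.generated_byI)
  fix N :: "('f^'n^'n) set"
  assume N: "mscale.subspace N" and r: "munit r r \<in> N"
    and cl: "\<And>p q m. (p, q) \<in> {(p, q). q = r} \<Longrightarrow> p \<noteq> q \<Longrightarrow> m \<in> N \<Longrightarrow> act_S (munit p q) m \<in> N"
  have one: "munit p r + munit r p \<in> N" for p
    using cl[of p r "munit r r"] r mscale.subspace_add[OF N r r] by (cases "p = r") (simp_all add: act_S_def)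
  have two: "munit p q + munit q p \<in> N" for p q
  proof (cases "p = r \<or> q = r")
    case True
    then show ?thesis using one[of p] one[of q] by (auto simp: add.commute)
  next
    case False
    then have "r \<noteq> p" "q \<noteq> r" by auto
    then show ?thesis using cl[of q r, OF _ _ one[of p]] by (simp add: act_S_def matrix_ring add.commute)
  qed
  show "sym_mats \<subseteq> N"
    using matrix_span[OF N two sym_expansion] by (auto simp: sym_mats_def)
qed (simp add: sym_mats_def)

text \<open>The pairs inside {i, j} are left out of the generating set: both root vectors E_ij and
  E_ji annihilate the generator.\<close>

lemma L_generated:
  assumes "i \<noteq> j"
  shows "Lm.generated_by {(p, q). p \<noteq> i \<and> p \<noteq> j \<and> (q = i \<or> q = j)} (munit i j - munit j i :: 'f::field_char_0^'n^'n)"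
proof (rule Lm.generated_byI)
  fix N :: "('f^'n^'n) set"
  assume N: "mscale.subspace N" and ij: "munit i j - munit j i \<in> N"
    and cl: "\<And>p q m. (p, q) \<in> {(p, q). p \<noteq> i \<and> p \<noteq> j \<and> (q = i \<or> q = j)} \<Longrightarrow> p \<noteq> q \<Longrightarrow> m \<in> N
      \<Longrightarrow> act_S (munit p q) m \<in> N"
  have neg: "munit p q - munit q p \<in> N \<Longrightarrow> munit q p - munit p q \<in> N" for p q :: 'n
    using mscale.subspace_neg[OF N, of "munit p q - munit q p"] by simp
  have onej: "munit p j - munit j p \<in> N" for p
    using cl[of p i, OF _ _ ij] ij mscale.subspace_0[OF N] assms
    by (cases "p = i"; cases "p = j") (auto simp add: act_S_def matrix_ring)
  have onei: "munit i p - munit p i \<in> N" for p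
    using cl[of p j, OF _ _ ij] ij mscale.subspace_0[OF N] assms
    by (cases "p = i"; cases "p = j") (auto simp add: act_S_def matrix_ring)
  have two: "munit p q - munit q p \<in> N" for p q
  proof (cases "p = i \<or> p = j \<or> q = i \<or> q = j")
    case True
    then show ?thesis using onei[of p] onei[of q] onej[of p] onej[of q] by (auto intro: neg)
  next
    case False
    then have "j \<noteq> p" "q \<noteq> i" "q \<noteq> j" "j \<noteq> q" by auto
    then show ?thesis using cl[of q j, OF _ _ onej[of p]] by (simp add: act_S_def matrix_ring)
  qed
  show "skew_mats \<subseteq> N"
    using matrix_span[OF N two skew_expansion] by (auto simp: skew_mats_def)
qed (simp add: skew_mats_def transpose_diff)

lemma act_V'_eq: "act_V' x = act_V (- transpose x)"
  by (rule ext) (simp add: act_V'_def act_V_def matrix_vec_ring del: transpose_matrix_vector)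

lemma act_S'_eq: "act_S' x = act_S (- transpose x)"
  by (rule ext) (simp add: act_S'_def act_S_def matrix_ring transpose_ring)

text \<open>Up to sign, E_pq acts on V' as E_qp acts on V, so generation carries over with all pairs
  reversed. The same holds for S' and \<Lambda>'.\<close>

lemma V'_generated: "Vm'.generated_by {(p, q). p = r} (axis r 1 :: 'f::field_char_0^'n)"
proof (rule Vm'.generated_byI)
  fix N :: "('f^'n) set"
  assume N: "vec.subspace N" and r: "axis r 1 \<in> N"
    and cl: "\<And>p q m. (p, q) \<in> {(p, q). p = r} \<Longrightarrow> p \<noteq> q \<Longrightarrow> m \<in> N \<Longrightarrow> act_V' (munit p q) m \<in> N"
  have "act_V (munit p r) m \<in> N" if "m \<in> N" "p \<noteq> r" for p m
    using vec.subspace_neg[OF N cl[of r p m]] that by (simp add: act_V'_def act_V_def del: transpose_matrix_vector)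
  then show "UNIV \<subseteq> N" using Vm.generated_byD[OF V_generated N _ r] by blast
qed simp

lemma S'_generated: "Sm'.generated_by {(p, q). p = r} (munit r r :: 'f::field_char_0^'n^'n)"
proof (rule Sm'.generated_byI)
  fix N :: "('f^'n^'n) set"
  assume N: "mscale.subspace N" "N \<subseteq> sym_mats" and r: "munit r r \<in> N"
    and cl: "\<And>p q m. (p, q) \<in> {(p, q). p = r} \<Longrightarrow> p \<noteq> q \<Longrightarrow> m \<in> N \<Longrightarrow> act_S' (munit p q) m \<in> N"
  have "act_S (munit p r) m \<in> N" if "m \<in> N" "p \<noteq> r" for p m
    using mscale.subspace_neg[OF N(1) cl[of r p m]] that by (simp add: act_S'_def act_S_def)
  then show "sym_mats \<subseteq> N" using Sm.generated_byD[OF S_generated N r] by blast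
qed (simp add: sym_mats_def)

lemma L'_generated:
  assumes "i \<noteq> j"
  shows "Lm'.generated_by {(p, q). q \<noteq> i \<and> q \<noteq> j \<and> (p = i \<or> p = j)} (munit i j - munit j i :: 'f::field_char_0^'n^'n)"
proof (rule Lm'.generated_byI)
  fix N :: "('f^'n^'n) set"
  assume N: "mscale.subspace N" "N \<subseteq> skew_mats" and r: "munit i j - munit j i \<in> N"
    and cl: "\<And>p q m. (p, q) \<in> {(p, q). q \<noteq> i \<and> q \<noteq> j \<and> (p = i \<or> p = j)} \<Longrightarrow> p \<noteq> q \<Longrightarrow> m \<in> N
      \<Longrightarrow> act_S' (munit p q) m \<in> N"
  have "act_S (munit p q) m \<in> N"
    if "(p, q) \<in> {(p, q). p \<noteq> i \<and> p \<noteq> j \<and> (q = i \<or> q = j)}" "p \<noteq> q" "m \<in> N" for p q m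
    using mscale.subspace_neg[OF N(1) cl[of q p m]] that by (simp add: act_S'_def act_S_def)
  then show "skew_mats \<subseteq> N" using Lm.generated_byD[OF L_generated[OF assms] N r] by blast
qed (simp add: skew_mats_def transpose_diff)

section \<open>Weights\<close>

lemma linear_onD:
  assumes "linear_on sX X sY Y f"
  shows "x \<in> X \<Longrightarrow> f x \<in> Y" "x \<in> X \<Longrightarrow> x' \<in> X \<Longrightarrow> f (x + x') = f x + f x'"
    "x \<in> X \<Longrightarrow> f (sX k x) = sY k (f x)"
  using assms by (auto simp: linear_on_def)

lemma linear_on_diff:
  assumes "vector_space sX" "module.subspace sX X" "vector_space sY" "linear_on sX X sY Y f"
    "x \<in> X" "x' \<in> X"
  shows "f (x - x') = f x - f x'"
proof -
  interpret X: vector_space sX by fact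
  interpret Y: vector_space sY by fact
  have "f (x + sX (-1) x') = f x + sY (-1) (f x')"
    using linear_onD(2)[OF assms(4,5) X.subspace_scale[OF assms(2,6)], of "-1"]
      linear_onD(3)[OF assms(4,6), of "-1"] by simp
  then show ?thesis by simp
qed

lemma linear_on_zero:
  assumes "vector_space sX" "module.subspace sX X" "vector_space sY" "linear_on sX X sY Y f"
  shows "f 0 = 0"
  using linear_on_diff[OF assms, of 0 0] module.subspace_0[OF _ assms(2)] assms(1)
  by (simp add: module_iff_vector_space)

lemma linear_on_sum:
  assumes "vector_space sX" "module.subspace sX X" "vector_space sY" "linear_on sX X sY Y f"
    "\<And>i. i \<in> I \<Longrightarrow> g i \<in> X"
  shows "f (sum g I) = (\<Sum>i\<in>I. f (g i))"
  using assms(5)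
proof (induction I rule: infinite_finite_induct)
  case (insert i I)
  have "sum g I \<in> X"
    using insert.prems assms(1,2) by (intro module.subspace_sum) (auto simp: module_iff_vector_space)
  then show ?case using insert linear_onD(2)[OF assms(4)] by simp
qed (use linear_on_zero[OF assms(1-4)] in simp_all)

section \<open>Calculation with the bracket\<close>

context lie_algebra
begin

lemma bracket_add_left: "bracket (x + y) z = bracket x z + bracket y z"
  and bracket_add_right: "bracket z (x + y) = bracket z x + bracket z y"
  and bracket_scale_left: "bracket (scale k x) z = scale k (bracket x z)"
  and bracket_scale_right: "bracket z (scale k x) = scale k (bracket z x)"
  using bracket_bilinear by (simp_all add: bilinear_on_def linear_on_def)

lemma bracket_zero_left [simp]: "bracket 0 z = 0"
  and bracket_zero_right [simp]: "bracket z 0 = 0"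
  using bracket_scale_left[of 0 0 z] bracket_scale_right[of z 0 0] by simp_all

lemma bracket_minus_left: "bracket (- x) z = - bracket x z"
  and bracket_minus_right: "bracket z (- x) = - bracket z x"
  using bracket_scale_left[of "-1" x z] bracket_scale_right[of z "-1" x] by simp_all

lemma bracket_diff_left: "bracket (x - y) z = bracket x z - bracket y z"
  and bracket_diff_right: "bracket z (x - y) = bracket z x - bracket z y"
  using bracket_add_left[of x "- y" z] bracket_add_right[of z x "- y"]
  by (simp_all add: bracket_minus_left bracket_minus_right)

lemma bracket_sum_right: "bracket z (sum f I) = (\<Sum>i\<in>I. bracket z (f i))"
  by (induction I rule: infinite_finite_induct) (simp_all add: bracket_add_right)

lemmas bracket_ring = bracket_add_left bracket_add_right bracket_diff_left bracket_diff_right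
  bracket_minus_left bracket_minus_right

lemma bracket_anticomm: "bracket x y = - bracket y x"
proof -
  have "bracket (x + y) (x + y) = 0" by (rule bracket_self)
  then have "bracket x y + bracket y x = 0"
    unfolding bracket_add_left bracket_add_right by (simp add: bracket_self add.commute)
  then show ?thesis by (simp add: eq_neg_iff_add_eq_0)
qed

lemma bracket_bracket_right:
  "bracket x (bracket y z) = bracket (bracket x y) z + bracket y (bracket x z)"
proof -
  have "bracket y (bracket z x) = - bracket y (bracket x z)"
    by (simp add: bracket_anticomm[of z x] bracket_minus_right)
  moreover have "bracket z (bracket x y) = - bracket (bracket x y) z" by (rule bracket_anticomm)
  ultimately show ?thesis using jacobi[of x y z] by (simp add: algebra_simps add_eq_0_iff)
qed

lemma bracket_bracket_left:
  "bracket (bracket x y) z = bracket x (bracket y z) - bracket y (bracket x z)"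
  using bracket_bracket_right[of x y z] by simp

end

section \<open>Integral weights and their norms\<close>

definition unit_wt :: "'n \<Rightarrow> 'n \<Rightarrow> int" where
  "unit_wt i k = (if k = i then 1 else 0)"

definition tot :: "('n::finite \<Rightarrow> int) \<Rightarrow> int" where
  "tot c = (\<Sum>k\<in>UNIV. c k)"

definition nrm :: "('n::finite \<Rightarrow> int) \<Rightarrow> int" where
  "nrm c = (\<Sum>k\<in>UNIV. \<bar>c k\<bar>)"

lemma tot_simps [simp]: "tot (c + d) = tot c + tot d" "tot (c - d) = tot c - tot d"
  "tot (- c) = - tot c" "tot (unit_wt i) = 1" "tot 0 = 0"
  by (simp_all add: tot_def sum.distrib sum_subtractf sum_negf unit_wt_def)

text \<open>The triangle inequality on \<open>Z\<close> and on its complement. With \<open>Z\<close>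
  the set of negative coefficients it is sharp, so lower bounds for the norm reduce to two
  sums.\<close>

lemma nrm_ge_split: "\<bar>sum c Z\<bar> + \<bar>tot c - sum c Z\<bar> \<le> nrm c"
proof -
  have "(\<Sum>k\<in>UNIV. g k) = sum g Z + sum g (- Z)" for g :: "'a \<Rightarrow> int"
    using sum.subset_diff[of Z UNIV g] by (simp add: Compl_eq_Diff_UNIV)
  from this[of c] this[of "\<lambda>k. \<bar>c k\<bar>"] show ?thesis
    using sum_abs[of c Z] sum_abs[of c "- Z"] unfolding tot_def nrm_def by linarith
qed

text \<open>The integral weight \<open>\<Sum>\<^sub>k c\<^sub>k \<epsilon>\<^sub>k\<close>; it determines \<open>c\<close> up to an additive constant.\<close>

definition wt :: "('n::finite \<Rightarrow> int) \<Rightarrow> 'f::field^'n^'n \<Rightarrow> 'f" where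
  "wt c h = (if h \<in> cartan then (\<Sum>k\<in>UNIV. of_int (c k) * h $ k $ k) else 0)"

lemma wt_add: "wt c + wt d = wt (c + d)"
  and wt_diff: "wt c - wt d = wt (c - d)"
  and wt_minus: "- wt c = wt (- c)"
  and wt_zero: "wt 0 = 0"
  by (rule ext, simp add: wt_def sum.distrib sum_subtractf sum_negf algebra_simps)+

lemma epsilon_eq_wt: "\<epsilon> i = (wt (unit_wt i) :: 'f::field^'n^'n \<Rightarrow> 'f)"
proof
  fix h :: "'f::field^'n^'n"
  have "(\<Sum>k\<in>UNIV. of_int (unit_wt i k) * h $ k $ k) = (\<Sum>k\<in>UNIV. if k = i then h $ i $ i else 0)"
    by (intro sum.cong refl) (simp add: unit_wt_def)
  then show "\<epsilon> i h = wt (unit_wt i) h" by (simp add: \<epsilon>_def wt_def)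
qed

lemma nrm_unit_wt: "nrm (unit_wt i) = 1"
proof -
  have "(\<Sum>k\<in>UNIV. \<bar>unit_wt i k\<bar>) = (\<Sum>k\<in>UNIV. if k = i then 1 else 0 :: int)"
    by (intro sum.cong refl) (simp add: unit_wt_def)
  then show ?thesis by (simp add: nrm_def)
qed

lemma nrm_add: "nrm (c + d) \<le> nrm c + nrm d"
  unfolding nrm_def sum.distrib[symmetric] by (rule sum_mono) simp

lemma nrm_minus [simp]: "nrm (- c) = nrm c"
  by (simp add: nrm_def)

lemma nrm_diff: "nrm (c - d) \<le> nrm c + nrm d"
  using nrm_add[of c "- d"] by simp

text \<open>When weights have to be excluded, this norm bound replaces the list of cases in
  \<open>Theta\<close>.\<close>

lemma Theta_wt:
  assumes "\<alpha> \<in> Theta"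
  obtains c where "\<alpha> = wt c" "nrm c \<le> 2"
proof -
  have n: "nrm (unit_wt i + unit_wt j) \<le> 2" "nrm (unit_wt i - unit_wt j) \<le> 2"
    "nrm (- unit_wt i + unit_wt j) \<le> 2" "nrm (- unit_wt i - unit_wt j) \<le> 2" for i j :: 'b
    using nrm_add[of "unit_wt i" "unit_wt j"] nrm_diff[of "unit_wt i" "unit_wt j"]
      nrm_add[of "- unit_wt i" "unit_wt j"] nrm_diff[of "- unit_wt i" "unit_wt j"]
    by (simp_all add: nrm_unit_wt del: minus_add_distrib diff_conv_add_uminus)
  have "nrm (0 :: 'b \<Rightarrow> int) \<le> 2" by (simp add: nrm_def)
  then show ?thesis
    using assms that n nrm_unit_wt nrm_minus unfolding Theta_def
    by (auto simp only: epsilon_eq_wt wt_add wt_diff wt_minus wt_zero[symmetric] Un_iff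
        mem_Collect_eq insert_iff singleton_iff empty_iff nrm_minus nrm_unit_wt)
qed

section \<open>Weight spaces and the action of root vectors\<close>

context lie_algebra_over_sl
begin

abbreviation W :: "('n \<Rightarrow> int) \<Rightarrow> 'l set" where "W c \<equiv> weight_space (wt c)"

abbreviation ad :: "'n \<Rightarrow> 'n \<Rightarrow> 'l \<Rightarrow> 'l" where "ad p q x \<equiv> bracket (\<iota> (munit p q)) x"

lemma weight_spaceD: "x \<in> weight_space \<alpha> \<Longrightarrow> h \<in> cartan \<Longrightarrow> bracket (\<iota> h) x = scale (\<alpha> h) x"
  by (simp add: weight_space_def)

lemma weight_space_subspace: "subspace (weight_space \<alpha>)"
  by (rule subspaceI) (simp_all add: weight_space_def bracket_add_right bracket_scale_right
      scale_right_distrib scale_left_commute)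

lemma \<iota>_add: "x \<in> sl \<Longrightarrow> y \<in> sl \<Longrightarrow> \<iota> (x + y) = \<iota> x + \<iota> y"
  and \<iota>_scale: "x \<in> sl \<Longrightarrow> \<iota> (mscale k x) = scale k (\<iota> x)"
  using linear_onD[OF \<iota>_linear] by blast+

lemma \<iota>_diff: "x \<in> sl \<Longrightarrow> y \<in> sl \<Longrightarrow> \<iota> (x - y) = \<iota> x - \<iota> y"
  by (rule linear_on_diff[OF vector_space_mscale sl_subspace vector_space_axioms \<iota>_linear])

lemma \<iota>_zero [simp]: "\<iota> 0 = 0"
  by (rule linear_on_zero[OF vector_space_mscale sl_subspace vector_space_axioms \<iota>_linear])

lemma \<iota>_minus: "x \<in> sl \<Longrightarrow> \<iota> (- x) = - \<iota> x"
  using \<iota>_diff[of 0 x] by (simp add: mscale.subspace_0[OF sl_subspace])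

lemma cartan_munit: "munit p p - munit q q \<in> cartan"
  by (auto simp: cartan_def sl_def)

lemma cartan_in_sl: "h \<in> cartan \<Longrightarrow> h \<in> sl"
  by (simp add: cartan_def)

lemma wt_cartan_munit: "wt c (munit p p - munit q q :: 'f^'n^'n) = of_int (c p - c q)"
proof -
  have "(\<Sum>k\<in>UNIV. of_int (c k) * (munit p p - munit q q :: 'f^'n^'n) $ k $ k)
    = (\<Sum>k\<in>UNIV. (if k = p then of_int (c p) else 0) - (if k = q then of_int (c q) else (0::'f)))"
    by (intro sum.cong refl) auto
  moreover have "(munit p p - munit q q :: 'f^'n^'n) \<in> cartan" by (rule cartan_munit)
  ultimately show ?thesis by (simp add: wt_def sum_subtractf del: vector_minus_component)
qed

lemma bracket_cartan_W: "x \<in> W c \<Longrightarrow> bracket (\<iota> (munit p p - munit q q)) x = scale (of_int (c p - c q)) x"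
  using weight_spaceD[OF _ cartan_munit] by (metis wt_cartan_munit)

lemma bracket_weight_space:
  assumes "x \<in> weight_space \<alpha>" "y \<in> weight_space \<beta>"
  shows "bracket x y \<in> weight_space (\<alpha> + \<beta>)"
  using assms unfolding weight_space_def
  by (simp add: bracket_bracket_right[of "\<iota> _"] bracket_scale_left bracket_scale_right scale_left_distrib)

lemma bracket_W: "x \<in> W c \<Longrightarrow> y \<in> W d \<Longrightarrow> bracket x y \<in> W (c + d)"
  using bracket_weight_space by (metis wt_add)

lemma comm_mat_cartan:
  assumes "h \<in> cartan"
  shows "comm_mat h (munit p q) = mscale (h $ p $ p - h $ q $ q) (munit p q)"
  using assms by (auto simp: vec_eq_iff comm_mat_def cartan_def)

lemma wt_unit: "wt (unit_wt p - unit_wt q) h = (if h \<in> cartan then h $ p $ p - h $ q $ q else 0)"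
proof -
  have "wt (unit_wt p - unit_wt q) h = \<epsilon> p h - \<epsilon> q h"
    by (simp add: epsilon_eq_wt flip: wt_diff)
  then show ?thesis by (simp add: \<epsilon>_def)
qed

lemma \<iota>_munit_W: "p \<noteq> q \<Longrightarrow> \<iota> (munit p q) \<in> W (unit_wt p - unit_wt q)"
  by (auto simp: weight_space_def comm_mat_cartan \<iota>_scale cartan_in_sl wt_unit simp flip: \<iota>_bracket)

lemma ad_W: "x \<in> W c \<Longrightarrow> p \<noteq> q \<Longrightarrow> c + unit_wt p - unit_wt q = d \<Longrightarrow> ad p q x \<in> W d"
  using bracket_W[OF \<iota>_munit_W, of p q x c] by (auto simp: algebra_simps)

lemma ad_bracket: "ad p q (bracket x y) = bracket (ad p q x) y + bracket x (ad p q y)"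
  by (rule bracket_bracket_right)

lemma ad_ad:
  assumes "p \<noteq> q" "r \<noteq> s"
  shows "ad p q (ad r s x) = ad r s (ad p q x) + bracket (\<iota> (comm_mat (munit p q) (munit r s))) x"
  using assms by (simp add: \<iota>_bracket bracket_bracket_left)

lemma ad_ad_commute: "p \<noteq> q \<Longrightarrow> r \<noteq> s \<Longrightarrow> q \<noteq> r \<Longrightarrow> p \<noteq> s \<Longrightarrow> ad p q (ad r s x) = ad r s (ad p q x)"
  by (subst ad_ad) (simp_all add: comm_mat_def)

lemma ad_ad_left: "p \<noteq> q \<Longrightarrow> q \<noteq> s \<Longrightarrow> p \<noteq> s \<Longrightarrow> ad p q (ad q s x) = ad q s (ad p q x) + ad p s x"
  by (subst ad_ad) (simp_all add: comm_mat_def)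

lemma ad_ad_right: "p \<noteq> q \<Longrightarrow> r \<noteq> p \<Longrightarrow> q \<noteq> r \<Longrightarrow> ad p q (ad r p x) = ad r p (ad p q x) - ad r q x"
  by (subst ad_ad) (simp_all add: comm_mat_def \<iota>_minus bracket_minus_left)

text \<open>The \<open>sl_2\<close> relation for E_pq and E_qp on a weight vector. When
  \<open>ad p q x\<close> vanishes, it shows that the move by E_qp is undone by E_pq up to an
  integer factor.\<close>

lemma ad_ad_cartan:
  assumes "p \<noteq> q" "x \<in> W c"
  shows "ad p q (ad q p x) = ad q p (ad p q x) + scale (of_int (c p - c q)) x"
  using assms by (subst ad_ad) (simp_all add: comm_mat_def bracket_cartan_W)

text \<open>Eigenvectors with distinct eigenvalues: some \<open>h\<close> separates two weights, and
  \<open>ad h\<close> minus the eigenvalue of the inserted weight removes that summand. Weights are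
  total functions here, so they are required to vanish off \<open>cartan\<close>; this forces the
  separating \<open>h\<close> to lie in \<open>cartan\<close>.\<close>

lemma weight_spaces_independent:
  assumes "finite F" "\<And>\<alpha> h. \<alpha> \<in> F \<Longrightarrow> h \<notin> cartan \<Longrightarrow> \<alpha> h = 0"
    "\<And>\<alpha>. \<alpha> \<in> F \<Longrightarrow> f \<alpha> \<in> weight_space \<alpha>" "sum f F = 0"
  shows "\<alpha> \<in> F \<Longrightarrow> f \<alpha> = 0"
  using assms
proof (induction F arbitrary: f \<alpha> rule: finite_induct)
  case (insert \<beta> F)
  have zero: "f \<alpha> = 0" if \<alpha>: "\<alpha> \<in> F" for \<alpha>
  proof -
    have "\<alpha> \<noteq> \<beta>" using insert.hyps \<alpha> by auto
    then obtain h where h: "\<alpha> h \<noteq> \<beta> h" by blast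
    then have hc: "h \<in> cartan" using insert.prems(2)[of \<alpha> h] insert.prems(2)[of \<beta> h] \<alpha>
      by (cases "h \<in> cartan") auto
    define g where "g \<gamma> = scale (\<gamma> h - \<beta> h) (f \<gamma>)" for \<gamma>
    have "bracket (\<iota> h) (f \<gamma>) = scale (\<gamma> h) (f \<gamma>)" if "\<gamma> \<in> insert \<beta> F" for \<gamma>
      using weight_spaceD[OF insert.prems(3)[OF that] hc] .
    then have "(\<Sum>\<gamma>\<in>insert \<beta> F. g \<gamma>) = bracket (\<iota> h) (sum f (insert \<beta> F)) - scale (\<beta> h) (sum f (insert \<beta> F))"
      by (simp only: g_def bracket_sum_right scale_sum_right scale_left_diff_distrib sum_subtractf)
        (intro arg_cong2[where f = "(-)"] sum.cong refl, simp)
    then have "sum g F = 0"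
      using insert.prems(4) insert.hyps by (simp add: g_def)
    moreover have "g \<gamma> \<in> weight_space \<gamma>" if "\<gamma> \<in> F" for \<gamma>
      using insert.prems(3) that by (simp add: g_def subspace_scale[OF weight_space_subspace])
    ultimately have "g \<alpha> = 0"
      using insert.IH[OF \<alpha>, of g] insert.prems(2) by blast
    then show ?thesis using h by (simp add: g_def)
  qed
  then have "sum f F = 0" by simp
  then have "f \<beta> = 0" using insert.prems(4) insert.hyps by simp
  then show ?case using zero insert.prems(1) by blast
qed simp

text \<open>Evaluation at the traceless diagonal matrix n E_rr - I, where \<open>wt c\<close> takes
  the value n c_r - \<open>tot c\<close>; characteristic zero turns equality in the field into
  equality of integers. In particular c - d is constant.\<close>

lemma wt_inj:
  fixes c d :: "'n \<Rightarrow> int"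
  assumes "(wt c :: 'f^'n^'n \<Rightarrow> 'f) = wt d"
  shows "int CARD('n) * (c r - d r) = tot c - tot d"
proof -
  define h :: "'f^'n^'n" where "h = mscale (of_nat CARD('n)) (munit r r) - mat 1"
  have h: "h \<in> cartan"
    by (simp add: h_def cartan_def sl_def trace_mat) (simp add: mat_def)
  have "wt c h = (of_int (int CARD('n) * c r - tot c) :: 'f)" for c
  proof -
    have "(\<Sum>k\<in>UNIV. of_int (c k) * h $ k $ k)
      = (\<Sum>k\<in>UNIV. (if k = r then of_nat CARD('n) * of_int (c k) else 0) - of_int (c k))"
      by (intro sum.cong refl) (auto simp: h_def mat_def algebra_simps)
    then show ?thesis using h by (simp add: wt_def sum_subtractf tot_def)
  qed
  then have "(of_int (int CARD('n) * c r - tot c) :: 'f) = of_int (int CARD('n) * d r - tot d)"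
    using fun_cong[OF assms, of h] by metis
  then have "int CARD('n) * c r - tot c = int CARD('n) * d r - tot d"
    unfolding of_int_eq_iff .
  then show ?thesis by (simp add: algebra_simps)
qed

end

locale theta_graded5 = theta_graded scale bracket \<iota>
  for scale :: "'f::field_char_0 \<Rightarrow> 'l::ab_group_add \<Rightarrow> 'l" and bracket :: "'l \<Rightarrow> 'l \<Rightarrow> 'l"
    and \<iota> :: "'f^'n^'n \<Rightarrow> 'l" +
  assumes card5: "CARD('n) \<ge> 5"
begin

lemma fresh_index: "\<exists>k::'n. k \<notin> set xs" if "length xs < 5"
proof (rule ccontr)
  assume "\<not> ?thesis"
  then have "CARD('n) \<le> card (set xs)" by (auto intro!: card_mono)
  then show False using card_length[of xs] that card5 by linarith
qed

text \<open>A nonzero weight vector has its weight in \<open>Theta\<close>, since otherwise its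
  expansion along \<open>Theta\<close> contradicts the independence of weight spaces. The
  representative of small norm may differ from \<open>c\<close> by a constant \<open>k\<close>,
  which contributes n k to the total.\<close>

lemma W_nonzero:
  assumes "x \<in> W c" "x \<noteq> 0"
  obtains c' k where "nrm c' \<le> 2" "c = (\<lambda>r. c' r + k)" "tot c = tot c' + int CARD('n) * k"
proof -
  have fin: "finite (Theta :: ('f^'n^'n \<Rightarrow> 'f) set)"
    and span: "UNIV = {sum f Theta |f. \<forall>\<alpha>\<in>Theta. f \<alpha> \<in> weight_space \<alpha>}"
    using weight_decomposition by (simp_all add: direct_sum_of_def)
  obtain f where f: "x = sum f Theta" "\<forall>\<alpha>\<in>Theta. f \<alpha> \<in> weight_space \<alpha>"
    using span by blast
  have off: "\<alpha> h = 0" if "\<alpha> \<in> insert (wt c) Theta" "h \<notin> cartan" for \<alpha> :: "'f^'n^'n \<Rightarrow> 'f" and h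
  proof -
    have "\<exists>d. \<alpha> = wt d"
    proof (cases "\<alpha> = wt c")
      case False
      then show ?thesis using that(1) Theta_wt[of \<alpha>] by blast
    qed blast
    then show ?thesis using that(2) by (auto simp: wt_def)
  qed
  have "(wt c :: 'f^'n^'n \<Rightarrow> 'f) \<in> Theta"
  proof (rule ccontr)
    assume nin: "wt c \<notin> (Theta :: ('f^'n^'n \<Rightarrow> 'f) set)"
    \<comment> \<open>Placing - x at the new weight makes the extended sum vanish.\<close>
    define g where "g = f(wt c := - x)"
    have "sum g (insert (wt c) Theta) = - x + sum g Theta"
      using fin nin by (simp add: g_def)
    also have "sum g Theta = sum f Theta"
      using nin by (intro sum.cong refl) (auto simp: g_def)
    finally have "sum g (insert (wt c) Theta) = 0" using f(1) by simp
    moreover have "g \<alpha> \<in> weight_space \<alpha>" if "\<alpha> \<in> insert (wt c) Theta" for \<alpha>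
      using f(2) that assms(1) by (auto simp: g_def subspace_neg[OF weight_space_subspace])
    ultimately have "g (wt c) = 0"
      using weight_spaces_independent[of "insert (wt c) Theta" g "wt c"] fin off by blast
    then show False using assms(2) by (simp add: g_def)
  qed
  then obtain c' where c': "(wt c :: 'f^'n^'n \<Rightarrow> 'f) = wt c'" "nrm c' \<le> 2"
    by (rule Theta_wt)
  obtain r0 :: 'n where True by blast
  define k where "k = c r0 - c' r0"
  have eq: "int CARD('n) * (c r - c' r) = tot c - tot c'" for r
    using wt_inj[OF c'(1)] .
  have "c r = c' r + k" for r
  proof -
    have "int CARD('n) * (c r - c' r) = int CARD('n) * (c r0 - c' r0)"
      using eq[of r] eq[of r0] by (rule trans[OF _ sym])
    then have "c r - c' r = k" using card5 by (simp add: k_def)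
    then show ?thesis by simp
  qed
  moreover have "tot c = tot c' + int CARD('n) * k"
    using eq[of r0] by (simp add: k_def)
  ultimately show ?thesis using that[OF c'(2), of k] by blast
qed

lemma abs_tot_le_nrm: "\<bar>tot c\<bar> \<le> nrm c"
  unfolding tot_def nrm_def by (rule sum_abs)

text \<open>Both totals have absolute value at most 2, so n k has absolute value at most 4, and
  \<open>k\<close> = 0 because n \<ge> 5. Then \<open>c\<close> itself would have norm at most 2,
  which the set \<open>Z\<close> chosen by the caller refutes.\<close>

lemma W_zero:
  assumes "x \<in> W c" "\<bar>tot c\<bar> \<le> 2" "\<bar>sum c Z\<bar> + \<bar>tot c - sum c Z\<bar> > 2"
  shows "x = 0"
proof (rule ccontr)
  assume "x \<noteq> 0"
  then obtain c' k where c': "nrm c' \<le> 2" "c = (\<lambda>r. c' r + k)" "tot c = tot c' + int CARD('n) * k"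
    using W_nonzero[OF assms(1)] by metis
  have "\<bar>tot c'\<bar> \<le> 2" using abs_tot_le_nrm[of c'] c'(1) by linarith
  then have "\<bar>int CARD('n) * k\<bar> \<le> 4" using c'(3) assms(2) by linarith
  then have "k = 0"
  proof -
    have "5 * \<bar>k\<bar> \<le> int CARD('n) * \<bar>k\<bar>" using card5 by (intro mult_right_mono) auto
    then show ?thesis using \<open>\<bar>int CARD('n) * k\<bar> \<le> 4\<close> by (simp add: abs_mult)
  qed
  then have "nrm c \<le> 2" using c'(1,2) by simp
  then show False using nrm_ge_split[of c Z] assms(3) by linarith
qed

end

section \<open>Homomorphisms from weight vectors\<close>

text \<open>Two labelled tokens sit on distinct places; \<open>T\<close> moves the first and \<open>T'\<close> the second token
  to a free place. With at least four places, moves that commute and compose locally give a result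
  that depends on the final position only.\<close>

lemma token_family:
  fixes L :: "'n \<Rightarrow> 'n \<Rightarrow> 'l set" and T T' :: "'n \<Rightarrow> 'n \<Rightarrow> 'l \<Rightarrow> 'l"
  assumes fresh: "\<And>i j k. \<exists>m::'n. m \<noteq> i \<and> m \<noteq> j \<and> m \<noteq> k"
    and T_in: "\<And>i j p x. i \<noteq> j \<Longrightarrow> p \<noteq> i \<Longrightarrow> p \<noteq> j \<Longrightarrow> x \<in> L i j \<Longrightarrow> T p i x \<in> L p j"
    and T'_in: "\<And>i j q x. i \<noteq> j \<Longrightarrow> q \<noteq> i \<Longrightarrow> q \<noteq> j \<Longrightarrow> x \<in> L i j \<Longrightarrow> T' q j x \<in> L i q"
    and TT: "\<And>i j p r x. i \<noteq> j \<Longrightarrow> p \<noteq> i \<Longrightarrow> p \<noteq> j \<Longrightarrow> r \<noteq> p \<Longrightarrow> r \<noteq> j \<Longrightarrow> x \<in> L i j \<Longrightarrow>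
      T r p (T p i x) = (if r = i then x else T r i x)"
    and T'T': "\<And>i j q r x. i \<noteq> j \<Longrightarrow> q \<noteq> i \<Longrightarrow> q \<noteq> j \<Longrightarrow> r \<noteq> q \<Longrightarrow> r \<noteq> i \<Longrightarrow> x \<in> L i j \<Longrightarrow>
      T' r q (T' q j x) = (if r = j then x else T' r j x)"
    and TT': "\<And>i j p q x. i \<noteq> j \<Longrightarrow> p \<noteq> i \<Longrightarrow> p \<noteq> j \<Longrightarrow> q \<noteq> i \<Longrightarrow> q \<noteq> j \<Longrightarrow> p \<noteq> q \<Longrightarrow> x \<in> L i j \<Longrightarrow>
      T p i (T' q j x) = T' q j (T p i x)"
    and x: "i0 \<noteq> j0" "x \<in> L i0 j0"
  obtains X where "X i0 j0 = x" "\<And>i j. i \<noteq> j \<Longrightarrow> X i j \<in> L i j"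
    "\<And>i j p. i \<noteq> j \<Longrightarrow> p \<noteq> i \<Longrightarrow> p \<noteq> j \<Longrightarrow> T p i (X i j) = X p j"
    "\<And>i j q. i \<noteq> j \<Longrightarrow> q \<noteq> i \<Longrightarrow> q \<noteq> j \<Longrightarrow> T' q j (X i j) = X i q"
proof -
  \<comment> \<open>\<open>S\<close> and \<open>S'\<close> admit the empty move, so that composition
    laws hold without a separate case for returning tokens.\<close>
  define S where "S p i y = (if p = i then y else T p i y)" for p i y
  define S' where "S' p i y = (if p = i then y else T' p i y)" for p i y
  have S_in: "S p i y \<in> L p j" if "y \<in> L i j" "i \<noteq> j" "p \<noteq> j" for p i j y
    using that T_in[of i j p y] by (simp add: S_def)
  have S'_in: "S' q j y \<in> L i q" if "y \<in> L i j" "i \<noteq> j" "q \<noteq> i" for q i j y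
    using that T'_in[of i j q y] by (simp add: S'_def)
  have SS: "S r p (S p i y) = S r i y" if "y \<in> L i j" "i \<noteq> j" "p \<noteq> j" "r \<noteq> j" for r p i j y
    using that TT[of i j p r y] by (auto simp: S_def)
  have S'S': "S' r q (S' q j y) = S' r j y" if "y \<in> L i j" "i \<noteq> j" "q \<noteq> i" "r \<noteq> i" for r q i j y
    using that T'T'[of i j q r y] by (auto simp: S'_def)
  have SS': "S p i (S' q j y) = S' q j (S p i y)"
    if "y \<in> L i j" "i \<noteq> j" "q \<noteq> i" "p \<noteq> j" "p \<noteq> q" for p q i j y
    using that TT'[of i j p q y] by (auto simp: S_def S'_def)
  obtain k where k: "k \<noteq> i0" "k \<noteq> j0" using fresh by blast
  \<comment> \<open>The second token moves first and the first one follows. Only the target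
    \<open>j = i0\<close> is blocked by the waiting first token, which in that case is parked at
    \<open>k\<close> meanwhile.\<close>
  define X where "X i j = (if j \<noteq> i0 then S i i0 (S' j j0 x) else S i k (S' i0 j0 (S k i0 x)))" for i j
  have ne [simp]: "i0 \<noteq> j0" "j0 \<noteq> i0" using x(1) by auto
  \<comment> \<open>Any other parking place \<open>m\<close> gives the same result, because the
    first token may pass between \<open>k\<close> and \<open>m\<close> before or after the move of
    the second.\<close>
  have indep: "X i i0 = S i m (S' i0 j0 (S m i0 x))" if "i \<noteq> i0" "m \<noteq> i0" "m \<noteq> j0" for i m
  proof -
    have y: "S k i0 x \<in> L k j0" using S_in[OF x(2)] k by simp
    have "S m i0 x = S m k (S k i0 x)" using SS[OF x(2)] k that by simp
    then have "S' i0 j0 (S m i0 x) = S m k (S' i0 j0 (S k i0 x))"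
      using SS'[OF y, of i0 m] k that by simp
    moreover have "S i m (S m k (S' i0 j0 (S k i0 x))) = S i k (S' i0 j0 (S k i0 x))"
      using SS[OF S'_in[OF y], of i0 m i] k that by simp
    ultimately show ?thesis by (simp add: X_def)
  qed
  have X_in: "X i j \<in> L i j" if "i \<noteq> j" for i j
  proof (cases "j = i0")
    case True
    have "S k i0 x \<in> L k j0" using S_in[OF x(2)] k by simp
    from S_in[OF S'_in[OF this]] show ?thesis using True that k by (simp add: X_def)
  next
    case False
    then show ?thesis using S_in[OF S'_in[OF x(2)]] that by (simp add: X_def)
  qed
  have X1: "S p i (X i j) = X p j" if "i \<noteq> j" "p \<noteq> j" for i j p
  proof (cases "j = i0")
    case True
    have "S k i0 x \<in> L k j0" using S_in[OF x(2)] k by simp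
    from SS[OF S'_in[OF this], of i0 i p] show ?thesis using True that k by (simp add: X_def)
  next
    case False
    then show ?thesis using SS[OF S'_in[OF x(2)], of j i p] that by (simp add: X_def)
  qed
  have X2a: "S' q j (X i j) = X i q" if "i \<noteq> j" "q \<noteq> i" "j \<noteq> i0" for i j q
  proof (cases "q = i0")
    case True
    \<comment> \<open>The second token is to arrive at \<open>i0\<close>. The first one is routed
      through a place \<open>m\<close> away from \<open>i0\<close>, \<open>j0\<close> and
      \<open>j\<close>, where the two moves can be interchanged.\<close>
    obtain m where m: "m \<noteq> i0" "m \<noteq> j0" "m \<noteq> j" using fresh by blast
    have y: "S' j j0 x \<in> L i0 j" using S'_in[OF x(2)] that by simp
    have w: "S m i0 (S' j j0 x) = S' j j0 (S m i0 x)" using SS'[OF x(2), of j m] that m by simp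
    have "X i j = S i m (S m i0 (S' j j0 x))" using SS[OF y, of m i] that m by (simp add: X_def)
    then have "S' i0 j (X i j) = S i m (S' i0 j (S m i0 (S' j j0 x)))"
      using SS'[OF S_in[OF y], of m i0 i] that m True by simp
    also have "\<dots> = S i m (S' i0 j0 (S m i0 x))"
      using S'S'[OF S_in[OF x(2)], of m j i0] that m by (simp add: w)
    finally show ?thesis using indep[of i m] m that True by simp
  next
    case False
    have y: "S' j j0 x \<in> L i0 j" using S'_in[OF x(2)] that by simp
    show ?thesis using SS'[OF y, of q i] S'S'[OF x(2), of j q] that False by (simp add: X_def)
  qed
  have X2: "S' q j (X i j) = X i q" if "i \<noteq> j" "q \<noteq> i" for i j q
  proof (cases "j = i0 \<and> q \<noteq> i0")
    case True
    then have "S' i0 q (X i q) = X i i0" using X2a[of i q i0] that by simp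
    then show ?thesis using S'S'[OF X_in, of i q i0 q] that True by (simp add: S'_def)
  next
    case False
    then show ?thesis using X2a[of i j q] that by (cases "q = j") (auto simp: S'_def)
  qed
  show ?thesis
  proof (rule that[of X])
    show "X i0 j0 = x" by (simp add: X_def S_def S'_def)
  next
    fix i j p :: 'n assume "i \<noteq> j" "p \<noteq> i" "p \<noteq> j"
    then show "T p i (X i j) = X p j" using X1[of i j p] by (simp add: S_def)
  next
    fix i j q :: 'n assume "i \<noteq> j" "q \<noteq> i" "q \<noteq> j"
    then show "T' q j (X i j) = X i q" using X2[of i j q] by (simp add: S'_def)
  qed (rule X_in)
qed

context lie_algebra_over_sl
begin

lemma vector_space_hs: "vector_space (hs :: 'f \<Rightarrow> ('m \<Rightarrow> 'l) \<Rightarrow> 'm \<Rightarrow> 'l)"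
  by standard (simp_all add: fscale_def fun_eq_iff scale_right_distrib scale_left_distrib)

lemma hom_spaceD:
  assumes "\<phi> \<in> hom_space sM act M"
  shows "linear_on sM M scale UNIV \<phi>"
    and "x \<in> sl \<Longrightarrow> m \<in> M \<Longrightarrow> bracket (\<iota> x) (\<phi> m) = \<phi> (act x m)"
    and "m \<notin> M \<Longrightarrow> \<phi> m = 0"
    and "m \<in> M \<Longrightarrow> m' \<in> M \<Longrightarrow> \<phi> (m + m') = \<phi> m + \<phi> m'"
    and "m \<in> M \<Longrightarrow> \<phi> (sM k m) = scale k (\<phi> m)"
  using assms by (auto simp: hom_space_def linear_on_def)

lemma hom_space_subspace: "module.subspace hs (hom_space sM act M)"
proof -
  interpret hs: vector_space hs by (rule vector_space_hs)
  show ?thesis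
    by (rule hs.subspaceI) (auto simp: hom_space_def linear_on_def fscale_def bracket_add_right
        bracket_scale_right scale_right_distrib scale_left_commute algebra_simps)
qed

lemma hom_space_diff:
  assumes "sl_module sM act M" "\<phi> \<in> hom_space sM act M" "m \<in> M" "m' \<in> M"
  shows "\<phi> (m - m') = \<phi> m - \<phi> m'"
proof -
  interpret M: sl_module sM act M by fact
  show ?thesis
    by (rule linear_on_diff[OF _ M.carrier_subspace _ hom_spaceD(1)[OF assms(2)] assms(3,4)]) unfold_locales
qed

lemma hom_space_zero:
  assumes "sl_module sM act M" "\<phi> \<in> hom_space sM act M"
  shows "\<phi> 0 = 0"
  using hom_space_diff[OF assms, of 0 0] sl_module.carrier_subspace[OF assms(1)]
    module.subspace_0[of sM M] assms(1) by (auto simp: sl_module_def module_iff_vector_space)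

lemma hom_space_minus:
  assumes "sl_module sM act M" "\<phi> \<in> hom_space sM act M" "m \<in> M"
  shows "\<phi> (- m) = - \<phi> m"
  using hom_space_diff[OF assms(1,2), of 0 m] hom_space_zero[OF assms(1,2)] assms(3)
    sl_module.carrier_subspace[OF assms(1)] module.subspace_0[of sM M] assms(1)
  by (auto simp: sl_module_def module_iff_vector_space)

text \<open>The kernel is a submodule, hence everything once it contains a generator. So the value
  at one vector separates the members of a multiplicity space.\<close>

lemma hom_eq_zero:
  assumes "sl_module sM act M" "sl_module.generated_by sM act M R v"
    and \<phi>: "\<phi> \<in> hom_space sM act M" "\<phi> v = 0"
  shows "\<phi> = 0"
proof -
  interpret M: sl_module sM act M by fact
  have "{m \<in> M. \<phi> m = 0} = M"
  proof (rule M.generated_byD[OF assms(2)])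
    show "M.subspace {m \<in> M. \<phi> m = 0}"
      using hom_space_zero[OF assms(1) \<phi>(1)]
      by (auto intro!: M.subspaceI simp: hom_spaceD[OF \<phi>(1)] M.subspace_0[OF M.carrier_subspace]
          M.subspace_add[OF M.carrier_subspace] M.subspace_scale[OF M.carrier_subspace])
    show "v \<in> {m \<in> M. \<phi> m = 0}" using assms(2) \<phi>(2) by (simp add: M.generated_by_def)
  next
    fix p q :: 'n and m assume pq: "p \<noteq> q" and "m \<in> {m \<in> M. \<phi> m = 0}"
    then show "act (munit p q) m \<in> {m \<in> M. \<phi> m = 0}"
      using hom_spaceD(2)[OF \<phi>(1), of "munit p q" m] M.act_closed[of "munit p q" m] by simp
  qed blast
  then show ?thesis using hom_spaceD(3)[OF \<phi>(1)] by (auto simp: fun_eq_iff)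
qed

lemma hom_eqI:
  assumes "sl_module sM act M" "sl_module.generated_by sM act M R v"
    and "\<phi> \<in> hom_space sM act M" "\<psi> \<in> hom_space sM act M" "\<phi> v = \<psi> v"
  shows "\<phi> = \<psi>"
proof -
  interpret hs: vector_space hs by (rule vector_space_hs)
  have "\<phi> - \<psi> \<in> hom_space sM act M"
    using hs.subspace_diff[OF hom_space_subspace assms(3,4)] .
  from hom_eq_zero[OF assms(1,2) this] have "\<phi> - \<psi> = 0" using assms(5) by simp
  then show ?thesis by simp
qed

lemma hom_weight:
  assumes "\<phi> \<in> hom_space sM act M" "v \<in> M" "\<And>h. h \<in> cartan \<Longrightarrow> act h v = sM (\<alpha> h) v"
  shows "\<phi> v \<in> weight_space \<alpha>"
  using hom_spaceD[OF assms(1)] assms(2,3) by (auto simp: weight_space_def cartan_in_sl)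

end

section \<open>Homomorphisms with a prescribed value at a generator\<close>

context theta_graded5
begin

lemma obtain_fresh:
  obtains k :: 'n where "k \<noteq> i1" "k \<noteq> i2" "k \<noteq> i3" "k \<noteq> i4"
  using fresh_index[of "[i1, i2, i3, i4]"] by auto

lemma obtain_distinct:
  obtains i j k l m :: 'n where "distinct [i, j, k, l, m]"
proof -
  obtain i :: 'n where True by blast
  obtain j where "j \<noteq> i" using fresh_index[of "[i]"] by auto
  moreover obtain k where "k \<noteq> i" "k \<noteq> j" using fresh_index[of "[i, j]"] by auto
  moreover obtain l where "l \<noteq> i" "l \<noteq> j" "l \<noteq> k" using fresh_index[of "[i, j, k]"] by auto
  moreover obtain m where "m \<noteq> i" "m \<noteq> j" "m \<noteq> k" "m \<noteq> l" by (rule obtain_fresh)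
  ultimately show ?thesis using that[of i j k l m] by simp
qed

text \<open>The matrices for which \<open>f\<close> is equivariant form a subspace of
  \<open>sl\<close> stable under bracketing with root vectors, so it is enough to test root vectors.
  The map is linear on the whole type and is cut off outside \<open>M\<close> to meet the convention
  of \<open>hom_space\<close>.\<close>

lemma hom_spaceI:
  fixes f :: "'m::ab_group_add \<Rightarrow> 'l"
  assumes "sl_module sM act M"
    and f_add: "\<And>m m'. f (m + m') = f m + f m'" and f_scale: "\<And>k m. f (sM k m) = scale k (f m)"
    and ad_f: "\<And>p q m. p \<noteq> q \<Longrightarrow> m \<in> M \<Longrightarrow> ad p q (f m) = f (act (munit p q) m)"
  shows "(\<lambda>m. if m \<in> M then f m else 0) \<in> hom_space sM act M"
proof -
  interpret M: sl_module sM act M by fact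
  obtain i j :: 'n where "i \<noteq> j" by (rule obtain_distinct) auto
  have f_minus: "f (- m) = - f m" for m using f_scale[of "-1" m] by simp
  have f_diff: "f (m - m') = f m - f m'" for m m' using f_add[of m "- m'"] by (simp add: f_minus)
  have f_zero: "f 0 = 0" using f_diff[of 0 0] by simp
  let ?N = "{x \<in> sl. \<forall>m\<in>M. bracket (\<iota> x) (f m) = f (act x m)}"
  have act0: "act 0 m = 0" for m using M.act_scale_left[of 0 0 m] by simp
  have "?N = sl"
  proof (rule slm.generated_byD[OF sl_generated[OF \<open>i \<noteq> j\<close>]])
    show "mscale.subspace ?N"
      by (rule mscale.subspaceI) (auto simp: mscale.subspace_0[OF sl_subspace] act0 f_zero
          mscale.subspace_add[OF sl_subspace] mscale.subspace_scale[OF sl_subspace] \<iota>_add \<iota>_scale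
          M.act_add_left M.act_scale_left f_add f_scale bracket_add_left bracket_scale_left)
    show "munit i j \<in> ?N" using \<open>i \<noteq> j\<close> ad_f by simp
  next
    fix p q :: 'n and x :: "'f^'n^'n"
    assume pq: "p \<noteq> q" and x: "x \<in> ?N"
    have "bracket (\<iota> (comm_mat (munit p q) x)) (f m) = f (act (comm_mat (munit p q) x) m)"
      if m: "m \<in> M" for m
    proof -
      have "bracket (\<iota> (comm_mat (munit p q) x)) (f m)
        = ad p q (bracket (\<iota> x) (f m)) - bracket (\<iota> x) (ad p q (f m))"
        using x pq by (simp add: \<iota>_bracket bracket_bracket_left)
      also have "\<dots> = f (act (munit p q) (act x m)) - f (act x (act (munit p q) m))"
        using x pq m ad_f M.act_closed by simp
      finally show ?thesis by (simp add: M.act_comm f_diff)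
    qed
    then show "comm_mat (munit p q) x \<in> ?N" by simp
  qed blast
  then have "bracket (\<iota> x) (f m) = f (act x m)" if "x \<in> sl" "m \<in> M" for x m
    using that by blast
  then show ?thesis
    using M.subspace_add[OF M.carrier_subspace] M.subspace_scale[OF M.carrier_subspace]
    by (auto simp: hom_space_def linear_on_def f_add f_scale M.act_closed)
qed

text \<open>Moving from an unoccupied place \<open>q\<close> leaves the coefficient -1 there while
  the total stays 1, hence norm at least 3, and no such weight occurs. The next two lemmas rest on
  similar counts.\<close>

lemma ad_zero_single:
  assumes "x \<in> W (unit_wt i)" "q \<noteq> i" "p \<noteq> q"
  shows "ad p q x = 0"
proof (rule W_zero[where Z = "{q}"])
  show "ad p q x \<in> W (unit_wt i + unit_wt p - unit_wt q)" using assms ad_W by blast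
qed (use assms in \<open>simp_all add: unit_wt_def\<close>)

lemma ad_zero_sum:
  assumes "x \<in> W (unit_wt i + unit_wt j)" "q \<noteq> i" "q \<noteq> j" "p \<noteq> q"
  shows "ad p q x = 0"
proof (rule W_zero[where Z = "{q}"])
  show "ad p q x \<in> W (unit_wt i + unit_wt j + unit_wt p - unit_wt q)" using assms ad_W by blast
qed (use assms in \<open>simp_all add: unit_wt_def\<close>)

lemma ad_zero_diff:
  assumes "x \<in> W (unit_wt i - unit_wt j)" "i \<noteq> j" "q \<noteq> i" "p \<noteq> j" "p \<noteq> q"
  shows "ad p q x = 0"
proof (rule W_zero[where Z = "{j, q}"])
  let ?c = "unit_wt i - unit_wt j + unit_wt p - unit_wt q"
  show "ad p q x \<in> W ?c" using assms ad_W by blast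
  show "2 < \<bar>sum ?c {j, q}\<bar> + \<bar>tot ?c - sum ?c {j, q}\<bar>"
  proof -
    have "tot ?c = 0" by simp
    moreover have "sum ?c {j, q} = - 2"
      using assms by (cases "j = q") (simp_all add: unit_wt_def)
    ultimately show ?thesis by presburger
  qed
qed simp

text \<open>The candidates for the images of the basis vectors are x itself and the E_ki x. The
  \<open>sl_2\<close> relation leads back from k to i, and moves out of an empty place vanish, so
  root vectors act on this family as on the standard basis.\<close>

lemma B_exists:
  assumes x: "x \<in> W (unit_wt i)"
  obtains b where "b \<in> B" "b (axis i 1) = x"
proof -
  define X where "X k = (if k = i then x else ad k i x)" for k
  have X_W: "X k \<in> W (unit_wt k)" for k
    using x ad_W[OF x, of k i "unit_wt k"] by (simp add: X_def)
  have ad_X: "ad p k (X k) = X p" if "p \<noteq> k" for p k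
    using that ad_ad_cartan[OF _ x, of i k] ad_ad_left[of p k i x] ad_zero_single[OF x, of k]
    by (auto simp: X_def unit_wt_def)
  have ad_X': "ad p q (X k) = (if q = k then X p else 0)" if "p \<noteq> q" for p q k
    using that ad_X ad_zero_single[OF X_W] by auto
  define f where "f v = (\<Sum>k\<in>UNIV. scale (v $ k) (X k))" for v
  have f_axis: "f (axis k 1) = X k" for k
    by (simp add: f_def axis_def if_distrib[of "\<lambda>c. scale c _"] cong: if_cong)
  have "(\<lambda>v. if v \<in> UNIV then f v else 0) \<in> hom_space (*s) act_V UNIV"
  proof (rule hom_spaceI[OF sl_module_V])
    show "f (v + v') = f v + f v'" for v v'
      by (simp add: f_def scale_left_distrib sum.distrib)
    show "f (k *s v) = scale k (f v)" for k v
      by (simp add: f_def scale_sum_right)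
    show "ad p q (f v) = f (act_V (munit p q) v)" if "p \<noteq> q" for p q v
    proof -
      have "ad p q (f v) = (\<Sum>k\<in>UNIV. if k = q then scale (v $ q) (X p) else 0)"
        using that by (simp add: f_def bracket_sum_right bracket_scale_right ad_X' if_distrib[of "scale _"] eq_commute[of q]
          cong: if_cong)
      also have "\<dots> = (\<Sum>k\<in>UNIV. if k = p then scale (v $ q) (X p) else 0)" by simp
      also have "\<dots> = f (act_V (munit p q) v)"
        unfolding f_def by (intro sum.cong refl) (simp add: act_V_def)
      finally show ?thesis .
    qed
  qed
  then show ?thesis using that[of f] f_axis[of i] by (simp add: B_def X_def)
qed

text \<open>Tokens provide X_ij only for i \<noteq> j. A diagonal member arises by moving one token
  onto the other, and the point is that the result does not depend on where the moved token came
  from or which of the two it was. X_ij and X_ji remain unrelated, so one family carries both a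
  symmetric and a skew part.\<close>

lemma sum_family:
  assumes "i0 \<noteq> j0" and x: "x \<in> W (unit_wt i0 + unit_wt j0)"
  obtains X where "X i0 j0 = x"
    "\<And>p q i j. p \<noteq> q \<Longrightarrow> ad p q (X i j) = (if q = i then X p j else 0) + (if q = j then X i p else 0)"
proof -
  have step: "ad r p (ad p i x) = (if r = i then x else ad r i x)"
    if "i \<noteq> j" "p \<noteq> i" "p \<noteq> j" "r \<noteq> p" "r \<noteq> j" "x \<in> W (unit_wt i + unit_wt j)" for i j p r x
    using that ad_ad_cartan[OF _ that(6), of i p] ad_ad_left[of r p i x] ad_zero_sum[OF that(6), of p r]
    by (auto simp: unit_wt_def)
  obtain X where X: "X i0 j0 = x" "\<And>i j. i \<noteq> j \<Longrightarrow> X i j \<in> W (unit_wt i + unit_wt j)"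
    "\<And>i j p. i \<noteq> j \<Longrightarrow> p \<noteq> i \<Longrightarrow> p \<noteq> j \<Longrightarrow> ad p i (X i j) = X p j"
    "\<And>i j q. i \<noteq> j \<Longrightarrow> q \<noteq> i \<Longrightarrow> q \<noteq> j \<Longrightarrow> ad q j (X i j) = X i q"
  proof (rule token_family[where T = ad and T' = ad and L = "\<lambda>i j. W (unit_wt i + unit_wt j)"])
    fix i j k :: 'n
    show "\<exists>m. m \<noteq> i \<and> m \<noteq> j \<and> m \<noteq> k" using obtain_fresh[of i j k i] by metis
  next
    fix i j p x assume "i \<noteq> j" "p \<noteq> i" "p \<noteq> j" and x: "x \<in> W (unit_wt i + unit_wt j)"
    then show "ad p i x \<in> W (unit_wt p + unit_wt j)" "ad p j x \<in> W (unit_wt i + unit_wt p)"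
      using ad_W[OF x] by simp_all
  next
    fix i j p r x
    assume a: "i \<noteq> j" "p \<noteq> i" "p \<noteq> j" "r \<noteq> p" "r \<noteq> j" "x \<in> W (unit_wt i + unit_wt j)"
    then show "ad r p (ad p i x) = (if r = i then x else ad r i x)" by (rule step)
  next
    fix i j p r x
    assume a: "i \<noteq> j" "p \<noteq> i" "p \<noteq> j" "r \<noteq> p" "r \<noteq> i" "x \<in> W (unit_wt i + unit_wt j)"
    then show "ad r p (ad p j x) = (if r = j then x else ad r j x)"
      using step[of j i p r x] by (simp add: add.commute)
  next
    fix i j p q x
    assume a: "i \<noteq> j" "p \<noteq> i" "p \<noteq> j" "q \<noteq> i" "q \<noteq> j" "p \<noteq> q" "x \<in> W (unit_wt i + unit_wt j)"
    then show "ad p i (ad q j x) = ad q j (ad p i x)" by (intro ad_ad_commute) auto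
  qed (use assms in blast)+
  \<comment> \<open>X_ij is produced from X_pj by E_ip, which commutes with E_ij; in the other order
    the second token moves first, onto i, and X_pi appears.\<close>
  have swap: "ad i j (X i j) = ad i p (X p i)" if "i \<noteq> j" "p \<noteq> i" "p \<noteq> j" for i j p
  proof -
    have "ad i j (X i j) = ad i j (ad i p (X p j))" using X(3)[of p j i] that by simp
    also have "\<dots> = ad i p (ad i j (X p j))" using that by (intro ad_ad_commute) auto
    also have "\<dots> = ad i p (X p i)" using X(4)[of p j i] that by simp
    finally show ?thesis .
  qed
  have diag: "ad i j (X i j) = ad i q (X i q)" if "i \<noteq> j" "q \<noteq> i" for i j q
  proof -
    obtain p where p: "p \<noteq> i" "p \<noteq> j" "p \<noteq> q" using obtain_fresh[of i j q i] by metis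
    show ?thesis using swap[of i j p] swap[of i q p] p that by simp
  qed
  have diag': "ad i j (X i j) = ad i q (X q i)" if "i \<noteq> j" "q \<noteq> i" for i j q
  proof -
    obtain p where p: "p \<noteq> i" "p \<noteq> j" "p \<noteq> q" using obtain_fresh[of i j q i] by metis
    show ?thesis using diag[of i j p] swap[of i p q] p that by simp
  qed
  \<comment> \<open>Any index other than \<open>i\<close> would serve; \<open>Y_diag\<close> removes
    the dependence on the choice.\<close>
  define d where "d i = (SOME j. j \<noteq> i)" for i :: 'n
  have d: "d i \<noteq> i" for i
    unfolding d_def by (rule someI_ex) (use obtain_fresh[of i i i i] in blast)
  define Y where "Y i j = (if i = j then ad i (d i) (X i (d i)) else X i j)" for i j
  have Y_diag: "Y i i = ad i j (X i j)" "Y i i = ad i j (X j i)" if "j \<noteq> i" for i j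
    using diag[of i "d i" j] diag'[of i "d i" j] d[of i] that by (simp_all add: Y_def)
  have Y_W: "Y i j \<in> W (unit_wt i + unit_wt j)" for i j
    using ad_W[OF X(2), of i "d i" i "d i" "unit_wt i + unit_wt i"] d[of i] X(2) by (auto simp: Y_def)
  have "ad p q (Y i j) = (if q = i then Y p j else 0) + (if q = j then Y i p else 0)" if pq: "p \<noteq> q" for p q i j
  proof -
    consider "q \<noteq> i" "q \<noteq> j" | "q = i" "q \<noteq> j" | "q \<noteq> i" "q = j" | "q = i" "q = j" by blast
    then show ?thesis
    proof cases
      case 1
      then show ?thesis using ad_zero_sum[OF Y_W] pq by simp
    next
      case 2
      then show ?thesis using X(3)[of i j p] Y_diag[of i j] pq by (cases "p = j") (auto simp: Y_def)
    next
      case 3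
      then show ?thesis using X(4)[of i j p] Y_diag[of j i] pq by (cases "p = i") (auto simp: Y_def)
    next
      case 4
      \<comment> \<open>Both tokens sit at \<open>q\<close>. Writing X_qq as E_qk X_kq lets E_pq
        pass through E_qk, which yields one summand for each token.\<close>
      obtain k where k: "k \<noteq> q" "k \<noteq> p" using obtain_fresh[of q p q p] by metis
      have "ad p q (Y q q) = ad p q (ad q k (X k q))" using Y_diag(2)[of k q] k by simp
      also have "\<dots> = ad q k (ad p q (X k q)) + ad p k (X k q)"
        using k pq by (intro ad_ad_left) auto
      also have "\<dots> = X q p + X p q"
        using X(3)[of k p q] X(4)[of k q p] X(3)[of k q p] k pq by simp
      finally show ?thesis using 4 pq by (simp add: Y_def add.commute)
    qed
  qed
  moreover have "Y i0 j0 = x" using X(1) assms(1) by (simp add: Y_def)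
  ultimately show ?thesis using that[of Y] by blast
qed

text \<open>The second token carries the weight -\<epsilon>_j, so it moves from j to q by -E_jq.
  Root vectors reach only the differences of diagonal values; the values themselves are fixed by
  averaging, which requires division by n.\<close>

lemma diff_family:
  assumes "i0 \<noteq> j0" and x: "x \<in> W (unit_wt i0 - unit_wt j0)"
  obtains X where "X i0 j0 = x"
    "\<And>p q i j. p \<noteq> q \<Longrightarrow> ad p q (X i j) = (if q = i then X p j else 0) - (if p = j then X i q else 0)"
proof -
  obtain X where X: "X i0 j0 = x" "\<And>i j. i \<noteq> j \<Longrightarrow> X i j \<in> W (unit_wt i - unit_wt j)"
    "\<And>i j p. i \<noteq> j \<Longrightarrow> p \<noteq> i \<Longrightarrow> p \<noteq> j \<Longrightarrow> ad p i (X i j) = X p j"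
    "\<And>i j q. i \<noteq> j \<Longrightarrow> q \<noteq> i \<Longrightarrow> q \<noteq> j \<Longrightarrow> - ad j q (X i j) = X i q"
  proof (rule token_family[where T = ad and T' = "\<lambda>q j z. - ad j q z"
        and L = "\<lambda>i j. W (unit_wt i - unit_wt j)"])
    fix i j k :: 'n
    show "\<exists>m. m \<noteq> i \<and> m \<noteq> j \<and> m \<noteq> k" using obtain_fresh[of i j k i] by metis
  next
    fix i j p x assume "i \<noteq> j" "p \<noteq> i" "p \<noteq> j" and x: "x \<in> W (unit_wt i - unit_wt j)"
    then show "ad p i x \<in> W (unit_wt p - unit_wt j)" "- ad j p x \<in> W (unit_wt i - unit_wt p)"
      using ad_W[OF x] by (simp_all add: subspace_neg[OF weight_space_subspace])
  next
    fix i j p r x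
    assume a: "i \<noteq> j" "p \<noteq> i" "p \<noteq> j" "r \<noteq> p" "r \<noteq> j" and x: "x \<in> W (unit_wt i - unit_wt j)"
    show "ad r p (ad p i x) = (if r = i then x else ad r i x)"
      using a ad_ad_cartan[OF _ x, of i p] ad_ad_left[of r p i x] ad_zero_diff[OF x, of p r]
      by (auto simp: unit_wt_def)
  next
    fix i j p r x
    assume a: "i \<noteq> j" "p \<noteq> i" "p \<noteq> j" "r \<noteq> p" "r \<noteq> i" and x: "x \<in> W (unit_wt i - unit_wt j)"
    show "- ad p r (- ad j p x) = (if r = j then x else - ad j r x)"
      using a ad_ad_cartan[OF _ x, of p j] ad_ad_right[of p r j x] ad_zero_diff[OF x, of r p]
      by (auto simp: unit_wt_def bracket_minus_right)
  next
    fix i j p q x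
    assume a: "i \<noteq> j" "p \<noteq> i" "p \<noteq> j" "q \<noteq> i" "q \<noteq> j" "p \<noteq> q" "x \<in> W (unit_wt i - unit_wt j)"
    then show "ad p i (- ad j q x) = - ad j q (ad p i x)"
      by (simp add: bracket_minus_right ad_ad_commute)
  qed (use assms in blast)+
  have X4: "ad j q (X i j) = - X i q" if "i \<noteq> j" "q \<noteq> i" "q \<noteq> j" for i j q
    using X(4)[OF that] by (simp add: minus_equation_iff)
  \<comment> \<open>H_ij is the future difference Y_ii - Y_jj, just as E_ii - E_jj is the commutator
    of E_ij and E_ji.\<close>
  define H where "H i j = ad i j (X j i)" for i j
  have H_W: "H i j \<in> W 0" if "i \<noteq> j" for i j
    using ad_W[OF X(2), of j i i j 0] that by (simp add: H_def)
  have H1: "H i j = H i k - H j k" if "i \<noteq> j" "k \<noteq> i" "k \<noteq> j" for i j k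
  proof -
    have "H i j = ad i j (ad j k (X k i))" using X(3)[of k i j] that by (simp add: H_def)
    also have "\<dots> = ad j k (ad i j (X k i)) + ad i k (X k i)" using that by (intro ad_ad_left) auto
    also have "ad i j (X k i) = - X k j" using X4[of k i j] that by simp
    finally show ?thesis by (simp add: H_def bracket_minus_right)
  qed
  have H_skew: "H j k = - H k j" if "j \<noteq> k" for j k
  proof -
    obtain i where i: "i \<noteq> j" "i \<noteq> k" using obtain_fresh[of j k j k] by metis
    show ?thesis using H1[of i j k] H1[of i k j] i that by (simp add: algebra_simps eq_neg_iff_add_eq_0)
  qed
  have zero: "ad p q z = 0" if "z \<in> W (unit_wt i - unit_wt j)" "i \<noteq> j" "q \<noteq> i" "p \<noteq> j" "p \<noteq> q" for p q i j z
    using ad_zero_diff that by blast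
  have ad_H: "ad p q (H i j) = (if q = i then X p q else 0) - (if p = i then X p q else 0)
      - (if q = j then X p q else 0) + (if p = j then X p q else 0)" if "i \<noteq> j" "p \<noteq> q" for p q i j
  proof -
    have expand: "ad p q (H i j) = ad i j (ad p q (X j i))
        + bracket (\<iota> (comm_mat (munit p q) (munit i j))) (X j i)"
      using ad_ad[OF that(2,1)] by (simp add: H_def)
    \<comment> \<open>The factor 2 is the value of the weight of X_ji on E_jj - E_ii.\<close>
    have key: "ad j i (ad i j (X j i)) = scale 2 (X j i)" if "i \<noteq> j" for i j
      using ad_ad_cartan[OF _ X(2), of j i j i] zero[OF X(2), of j i i j] that by (simp add: unit_wt_def)
    consider "q = i" "p = j" | "q = i" "p \<noteq> j" | "p = i" "q = j" | "p = i" "q \<noteq> j"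
      | "q = j" "p \<noteq> i" | "p = j" "q \<noteq> i" | "p \<noteq> i" "p \<noteq> j" "q \<noteq> i" "q \<noteq> j" by blast
    then show ?thesis
    proof cases
      case 1
      then show ?thesis using key[of i j] that
        by (simp add: H_def scale_left_distrib[of 1 1, simplified one_add_one])
    next
      case 2
      then show ?thesis
        using expand that zero[OF X(2), of j i i p] X(3)[of j i p] by (simp add: comm_mat_def)
    next
      case 3
      have "ad i j (H i j) = - ad i j (ad j i (X i j))"
        using that H_skew[of i j] by (simp add: H_def bracket_minus_right)
      then show ?thesis using 3 key[of j i] that
        by (simp add: scale_left_distrib[of 1 1, simplified one_add_one])
    next
      case 4
      then show ?thesis
        using expand that X4[of j i q] X(3)[of j q i] by (simp add: comm_mat_def bracket_minus_right)
    next
      case 5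
      then show ?thesis
        using expand that X(3)[of j i p] X4[of p i j] by (simp add: comm_mat_def)
    next
      case 6
      then show ?thesis
        using expand that X4[of j i q] zero[OF X(2), of j i q j]
        by (simp add: comm_mat_def \<iota>_minus bracket_minus_left)
    next
      case 7
      then show ?thesis
        using expand that zero[OF X(2), of j i q p] by (simp add: comm_mat_def)
    qed
  qed
  \<comment> \<open>Averaging H_ik over all k solves Y_ii - Y_jj = H_ij, by the cocycle rule H_ik -
    H_jk = H_ij; \<open>H'\<close> supplies the value 0 at k = i.\<close>
  define H' where "H' i j = (if i = j then 0 else H i j)" for i j
  define Y where "Y i j = (if i \<noteq> j then X i j else scale (1 / of_nat CARD('n)) (\<Sum>k\<in>UNIV. H' i k))" for i j
  have Y_H: "Y i i - Y j j = H i j" if "i \<noteq> j" for i j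
  proof -
    have "H' i k - H' j k = H i j" for k
    proof -
      consider "k = i" | "k = j" | "k \<noteq> i" "k \<noteq> j" by blast
      then show ?thesis
      proof cases
        case 1
        then show ?thesis using that H_skew[of i j] by (simp add: H'_def)
      next
        case 2
        then show ?thesis using that by (simp add: H'_def)
      next
        case 3
        then show ?thesis using that H1[of i j k] by (simp add: H'_def)
      qed
    qed
    then have "(\<Sum>k\<in>UNIV. H' i k - H' j k) = (\<Sum>k\<in>(UNIV :: 'n set). H i j)" by simp
    also have "\<dots> = scale (of_nat CARD('n)) (H i j)" by (rule sum_constant_scale)
    finally have "scale (1 / of_nat CARD('n)) ((\<Sum>k\<in>UNIV. H' i k) - (\<Sum>k\<in>UNIV. H' j k)) = H i j"
      by (simp add: sum_subtractf)
    then show ?thesis by (simp add: Y_def scale_right_diff_distrib)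
  qed
  have "ad p q (Y i j) = (if q = i then Y p j else 0) - (if p = j then Y i q else 0)"
    if pq: "p \<noteq> q" for p q i j
  proof (cases "i = j")
    case False
    consider "q = i" "p = j" | "q = i" "p \<noteq> j" | "q \<noteq> i" "p = j" | "q \<noteq> i" "p \<noteq> j" by blast
    then show ?thesis
    proof cases
      case 1
      then show ?thesis using Y_H[of j i] False by (auto simp: Y_def H_def)
    next
      case 2
      then show ?thesis using X(3)[of i j p] False pq by (auto simp: Y_def)
    next
      case 3
      then show ?thesis using X4[of i j q] False pq by (auto simp: Y_def)
    next
      case 4
      then show ?thesis using zero[OF X(2), of i j q p] False pq by (auto simp: Y_def)
    qed
  next
    case True
    let ?\<delta> = "\<lambda>b. if b then 1 else 0 :: 'f"
    have "ad p q (H' i k) = scale (?\<delta> (q = i) - ?\<delta> (p = i) - ?\<delta> (q = k) + ?\<delta> (p = k)) (X p q)" for k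
      using ad_H[of i k p q] pq by (auto simp: H'_def scale_left_distrib scale_left_diff_distrib)
    then have "ad p q (\<Sum>k\<in>UNIV. H' i k)
      = scale (\<Sum>k\<in>UNIV. ?\<delta> (q = i) - ?\<delta> (p = i) - ?\<delta> (q = k) + ?\<delta> (p = k)) (X p q)"
      by (simp only: bracket_sum_right scale_sum_left)
    also have "(\<Sum>k\<in>UNIV. ?\<delta> (q = i) - ?\<delta> (p = i) - ?\<delta> (q = k) + ?\<delta> (p = k))
      = of_nat CARD('n) * (?\<delta> (q = i) - ?\<delta> (p = i))"
      by (simp only: sum.distrib sum_subtractf sum.delta' sum_constant finite_UNIV) simp
    finally have "ad p q (Y i i) = scale (?\<delta> (q = i) - ?\<delta> (p = i)) (X p q)"
      by (simp add: Y_def bracket_scale_right)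
    then show ?thesis using True pq by (auto simp: Y_def scale_left_diff_distrib)
  qed
  moreover have "Y i0 j0 = x" using X(1) assms(1) by (simp add: Y_def)
  ultimately show ?thesis using that[of Y] by blast
qed

end

lemma sym_munit [simp]: "munit i j + munit j i \<in> sym_mats" "munit i i \<in> sym_mats"
  by (simp_all add: sym_mats_def transpose_add add.commute)

lemma skew_munit [simp]: "munit i j - munit j i \<in> skew_mats"
  by (simp add: skew_mats_def transpose_diff)

context lie_algebra_over_sl
begin

lemma double_sum_row:
  "(\<Sum>k\<in>UNIV. \<Sum>l\<in>UNIV. if p = k then g k l else 0) = (\<Sum>l\<in>(UNIV::'n set). g p l)"
  for g :: "'n \<Rightarrow> 'n \<Rightarrow> 'b::comm_monoid_add"
proof -
  have "(\<Sum>k\<in>UNIV. \<Sum>l\<in>UNIV. if p = k then g k l else 0)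
    = (\<Sum>k\<in>UNIV. if p = k then (\<Sum>l\<in>UNIV. g k l) else 0)"
    by (intro sum.cong refl) auto
  then show ?thesis by simp
qed

lemma double_sum_col:
  "(\<Sum>k\<in>UNIV. \<Sum>l\<in>UNIV. if p = l then g k l else 0) = (\<Sum>k\<in>(UNIV::'n set). g k p)"
  for g :: "'n \<Rightarrow> 'n \<Rightarrow> 'b::comm_monoid_add"
  by simp

definition lin_comb :: "('n \<Rightarrow> 'n \<Rightarrow> 'l) \<Rightarrow> 'f^'n^'n \<Rightarrow> 'l" where
  "lin_comb X m = (\<Sum>k\<in>UNIV. \<Sum>l\<in>UNIV. scale (m $ k $ l) (X k l))"

lemma lin_comb_add: "lin_comb X (m + m') = lin_comb X m + lin_comb X m'"
  by (simp add: lin_comb_def scale_left_distrib sum.distrib)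

lemma lin_comb_diff: "lin_comb X (m - m') = lin_comb X m - lin_comb X m'"
  by (simp add: lin_comb_def scale_left_diff_distrib sum_subtractf)

lemma lin_comb_scale: "lin_comb X (mscale c m) = scale c (lin_comb X m)"
  by (simp add: lin_comb_def scale_sum_right)

lemma lin_comb_munit_left: "lin_comb X (munit p q ** m) = (\<Sum>l\<in>UNIV. scale (m $ q $ l) (X p l))"
proof -
  have "lin_comb X (munit p q ** m)
    = (\<Sum>k\<in>UNIV. \<Sum>l\<in>UNIV. if p = k then scale (m $ q $ l) (X k l) else 0)"
    unfolding lin_comb_def by (intro sum.cong refl) auto
  then show ?thesis by (simp only: double_sum_row)
qed

lemma lin_comb_munit_right: "lin_comb X (m ** munit p q) = (\<Sum>k\<in>UNIV. scale (m $ k $ p) (X k q))"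
proof -
  have "lin_comb X (m ** munit p q)
    = (\<Sum>k\<in>UNIV. \<Sum>l\<in>UNIV. if q = l then scale (m $ k $ p) (X k l) else 0)"
    unfolding lin_comb_def by (intro sum.cong refl) auto
  then show ?thesis by (simp only: double_sum_col)
qed

lemma lin_comb_munit: "lin_comb X (munit p q) = X p q"
proof -
  have "lin_comb X (munit p q) = (\<Sum>k\<in>UNIV. \<Sum>l\<in>UNIV. if p = k then if q = l then X k l else 0 else 0)"
    unfolding lin_comb_def by (intro sum.cong refl) auto
  then show ?thesis by (simp only: double_sum_row sum.delta finite_UNIV) simp
qed

lemma A_weight:
  assumes "a \<in> A" "i \<noteq> j"
  shows "a (munit i j) \<in> W (unit_wt i - unit_wt j)"
  using assms by (auto simp: A_def comm_mat_cartan wt_unit intro: hom_weight)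

lemma B_weight:
  assumes "b \<in> B"
  shows "b (axis i 1) \<in> W (unit_wt i)"
proof -
  have "act_V h (axis i 1) = wt (unit_wt i) h *s axis i 1" if "h \<in> cartan" for h :: "'f^'n^'n"
    using that by (auto simp: epsilon_eq_wt[symmetric] \<epsilon>_def act_V_def vec_eq_iff cartan_def
        matrix_vector_mult_def axis_def if_distrib[of "\<lambda>c. _ * c"] cong: if_cong)
  then show ?thesis using assms by (auto simp: B_def intro: hom_weight)
qed

lemma act_S_cartan:
  assumes "h \<in> cartan"
  shows "act_S h (munit i j) = mscale (wt (unit_wt i + unit_wt j) h) (munit i j)"
proof -
  have "wt (unit_wt i + unit_wt j) h = h $ i $ i + h $ j $ j"
    using assms by (simp add: wt_add[symmetric] epsilon_eq_wt[symmetric] \<epsilon>_def)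
  then show ?thesis using assms
    by (auto simp: act_S_def vec_eq_iff cartan_def transpose_def algebra_simps)
qed

lemma C_weight:
  assumes "c \<in> C"
  shows "c (munit i j + munit j i) \<in> W (unit_wt i + unit_wt j)"
proof -
  have "act_S h (munit i j + munit j i) = mscale (wt (unit_wt i + unit_wt j) h) (munit i j + munit j i)"
    if "h \<in> cartan" for h :: "'f^'n^'n"
    using act_S_cartan[OF that, of i j] act_S_cartan[OF that, of j i]
    by (simp add: Sm.act_add_right mscale_add add.commute)
  then show ?thesis
    using assms by (auto simp: C_def sym_mats_def transpose_add add.commute intro: hom_weight)
qed

lemma C_weight_diag: "c \<in> C \<Longrightarrow> c (munit i i) \<in> W (unit_wt i + unit_wt i)"
  unfolding C_def
  by (rule hom_weight[where \<alpha> = "wt (unit_wt i + unit_wt i)"]) (rule act_S_cartan | simp)+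

lemma E_weight:
  assumes "e \<in> E"
  shows "e (munit i j - munit j i) \<in> W (unit_wt i + unit_wt j)"
proof -
  have "act_S h (munit i j - munit j i) = mscale (wt (unit_wt i + unit_wt j) h) (munit i j - munit j i)"
    if "h \<in> cartan" for h :: "'f^'n^'n"
    using act_S_cartan[OF that, of i j] act_S_cartan[OF that, of j i]
    by (simp add: act_S_def mult_diff_left mult_diff_right mscale_diff add.commute algebra_simps)
  then show ?thesis
    using assms by (auto simp: E_def skew_mats_def transpose_diff intro: hom_weight)
qed

end

context theta_graded5
begin

lemma A_exists:
  assumes "i \<noteq> j" "x \<in> W (unit_wt i - unit_wt j)"
  obtains a where "a \<in> A" "a (munit i j) = x"
proof -
  obtain X where X: "X i j = x"
    "\<And>p q i j. p \<noteq> q \<Longrightarrow> ad p q (X i j) = (if q = i then X p j else 0) - (if p = j then X i q else 0)"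
    using diff_family[OF assms] by blast
  let ?f = "lin_comb X"
  have "(\<lambda>m. if m \<in> sl then ?f m else 0) \<in> hom_space mscale comm_mat sl"
  proof (rule hom_spaceI[OF sl_module_sl])
    fix p q :: 'n and m :: "'f^'n^'n" assume pq: "p \<noteq> q"
    have "ad p q (?f m) = (\<Sum>k\<in>UNIV. \<Sum>l\<in>UNIV. if q = k then scale (m $ k $ l) (X p l) else 0)
      - (\<Sum>k\<in>UNIV. \<Sum>l\<in>UNIV. if p = l then scale (m $ k $ l) (X k q) else 0)"
      using X(2)[OF pq] by (simp add: lin_comb_def bracket_sum_right bracket_scale_right
          scale_right_diff_distrib sum_subtractf if_distrib[of "scale _"] cong: if_cong)
    also have "\<dots> = ?f (comm_mat (munit p q) m)"
      by (simp only: double_sum_row double_sum_col comm_mat_def lin_comb_diff lin_comb_munit_left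
          lin_comb_munit_right)
    finally show "ad p q (?f m) = ?f (comm_mat (munit p q) m)" .
  qed (simp_all add: lin_comb_add lin_comb_scale)
  then show ?thesis
    using that assms X(1) by (auto simp: A_def lin_comb_munit)
qed

text \<open>Half of the linear extension of the family is restricted once to symmetric and once to
  skew matrices. Since E_ij + E_ji and E_ij - E_ji add up to 2 E_ij, the two values add up to
  x.\<close>

lemma CE_exists:
  assumes "i \<noteq> j" "x \<in> W (unit_wt i + unit_wt j)"
  obtains c e where "c \<in> C" "e \<in> E" "x = c (munit i j + munit j i) + e (munit i j - munit j i)"
proof -
  obtain X where X: "X i j = x"
    "\<And>p q i j. p \<noteq> q \<Longrightarrow> ad p q (X i j) = (if q = i then X p j else 0) + (if q = j then X i p else 0)"
    using sum_family[OF assms] by blast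
  let ?f = "\<lambda>m. scale (1/2) (lin_comb X m)"
  have ad_f: "ad p q (?f m) = ?f (act_S (munit p q) m)" if pq: "p \<noteq> q" for p q m
  proof -
    have "ad p q (lin_comb X m) = (\<Sum>k\<in>UNIV. \<Sum>l\<in>UNIV. if q = k then scale (m $ k $ l) (X p l) else 0)
      + (\<Sum>k\<in>UNIV. \<Sum>l\<in>UNIV. if q = l then scale (m $ k $ l) (X k p) else 0)"
      using X(2)[OF pq] by (simp add: lin_comb_def bracket_sum_right bracket_scale_right
          scale_right_distrib sum.distrib if_distrib[of "scale _"] cong: if_cong)
    also have "\<dots> = lin_comb X (act_S (munit p q) m)"
      by (simp only: double_sum_row double_sum_col act_S_def lin_comb_add lin_comb_munit_left
          lin_comb_munit_right transpose_munit)
    finally show ?thesis by (simp add: bracket_scale_right)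
  qed
  let ?c = "\<lambda>m. if m \<in> sym_mats then ?f m else 0" and ?e = "\<lambda>m. if m \<in> skew_mats then ?f m else 0"
  have "?c \<in> C" unfolding C_def
    by (rule hom_spaceI[OF sl_module_S _ _ ad_f])
      (simp_all add: lin_comb_add lin_comb_scale scale_right_distrib scale_left_commute)
  moreover have "?e \<in> E" unfolding E_def
    by (rule hom_spaceI[OF sl_module_L _ _ ad_f])
      (simp_all add: lin_comb_add lin_comb_scale scale_right_distrib scale_left_commute)
  moreover have "x = ?c (munit i j + munit j i) + ?e (munit i j - munit j i)"
  proof -
    have "x = scale (1/2 + 1/2) x" by simp
    also have "\<dots> = scale (1/2) x + scale (1/2) x" by (rule scale_left_distrib)
    finally show ?thesis
      by (simp add: lin_comb_add lin_comb_diff lin_comb_munit X(1) scale_right_distrib scale_right_diff_distrib)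
  qed
  ultimately show ?thesis using that by blast
qed

text \<open>The vector is moved to weight \<epsilon>_j + \<epsilon>_i, split there, and moved back
  by E_ij. This doubles x, sends E_ji + E_ij to 2 E_ii and kills the skew part, so the symmetric
  part alone represents x.\<close>

lemma C_exists_diag:
  assumes x: "x \<in> W (unit_wt i + unit_wt i)"
  obtains c where "c \<in> C" "c (munit i i) = x"
proof -
  obtain j where j: "j \<noteq> i" using obtain_fresh[of i i i i] by metis
  have "ad j i x \<in> W (unit_wt j + unit_wt i)" using ad_W[OF x] j by simp
  then obtain c e where ce: "c \<in> C" "e \<in> E" "ad j i x = c (munit j i + munit i j) + e (munit j i - munit i j)"
    using CE_exists j by metis
  have "ad i j x = 0" by (rule ad_zero_sum[OF x]) (use j in auto)
  then have "ad i j (ad j i x) = scale 2 x"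
    using ad_ad_cartan[OF _ x, of i j] j by (simp add: unit_wt_def)
  moreover have "ad i j (c (munit j i + munit i j)) = c (act_S (munit i j) (munit j i + munit i j))"
    using hom_spaceD(2)[OF ce(1)[unfolded C_def], of "munit i j"] j by simp
  moreover have "act_S (munit i j) (munit j i + munit i j) = mscale 2 (munit i i :: 'f^'n^'n)"
    using j by (simp add: act_S_def matrix_ring vec_eq_iff)
  moreover have "ad i j (e (munit j i - munit i j)) = e (act_S (munit i j) (munit j i - munit i j))"
    using hom_spaceD(2)[OF ce(2)[unfolded E_def], of "munit i j"] j by simp
  moreover have "act_S (munit i j) (munit j i - munit i j) = (0 :: 'f^'n^'n)"
    using j by (simp add: act_S_def matrix_ring)
  moreover have "e 0 = 0" using hom_space_zero[OF sl_module_L] ce(2) by (simp add: E_def)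
  moreover have "c (mscale 2 (munit i i)) = scale 2 (c (munit i i))"
    using hom_spaceD(5)[OF ce(1)[unfolded C_def], of "munit i i" 2] by (simp add: sym_mats_def)
  ultimately have "scale 2 (c (munit i i)) = scale 2 x"
    using ce(3) by (simp add: bracket_add_right)
  then show ?thesis using that[OF ce(1)] by simp
qed

end

section \<open>Duality\<close>

text \<open>Composing the embedding of \<open>sl\<^sub>n\<close> with \<open>x \<mapsto> - x\<^sup>t\<close> gives another grading, which exchanges
  \<open>B, C, E\<close> with \<open>B', C', E'\<close>.\<close>

lemma sl_transpose [simp]: "transpose x \<in> sl \<longleftrightarrow> x \<in> sl" "- x \<in> sl \<longleftrightarrow> x \<in> sl"
  by (simp_all add: sl_def)

lemma cartan_transpose:
  assumes "x \<in> cartan"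
  shows "transpose x = x"
proof -
  have "x $ j $ i = x $ i $ j" for i j
    using assms by (cases "i = j") (simp_all add: cartan_def)
  then show ?thesis by (simp add: vec_eq_iff transpose_def)
qed

context lie_algebra_over_sl
begin

abbreviation dual_\<iota> :: "'f^'n^'n \<Rightarrow> 'l" where "dual_\<iota> \<equiv> \<lambda>x. \<iota> (- transpose x)"

lemma dual_lie_algebra: "lie_algebra_over_sl scale bracket dual_\<iota>"
proof
  show "linear_on mscale sl scale UNIV dual_\<iota>"
    by (auto simp: linear_on_def transpose_add transpose_mscale \<iota>_add \<iota>_diff \<iota>_scale \<iota>_minus
        mscale.subspace_add[OF sl_subspace] mscale.subspace_scale[OF sl_subspace])
  show "inj_on dual_\<iota> sl"
  proof (rule inj_onI)
    fix x y :: "'f^'n^'n" assume "x \<in> sl" "y \<in> sl" "dual_\<iota> x = dual_\<iota> y"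
    then have "- transpose x = - transpose y" by (intro inj_onD[OF \<iota>_inj]) simp_all
    then show "x = y" by (metis neg_equal_iff_equal transpose_transpose)
  qed
  fix x y :: "'f^'n^'n" assume "x \<in> sl" "y \<in> sl"
  moreover have "- transpose (comm_mat x y) = comm_mat (- transpose x) (- transpose y)"
    by (simp add: comm_mat_def matrix_ring transpose_ring)
  ultimately show "dual_\<iota> (comm_mat x y) = bracket (dual_\<iota> x) (dual_\<iota> y)"
    by (simp add: \<iota>_bracket)
qed

text \<open>A diagonal matrix is its own transpose, so the twist merely changes its sign.\<close>

lemma dual_weight_space: "lie_algebra_over_sl.weight_space scale bracket dual_\<iota> \<alpha> = weight_space (- \<alpha>)"
proof -
  interpret dual: lie_algebra_over_sl scale bracket dual_\<iota> by (rule dual_lie_algebra)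
  have "bracket (dual_\<iota> h) x = scale (\<alpha> h) x \<longleftrightarrow> bracket (\<iota> h) x = scale ((- \<alpha>) h) x"
    if "h \<in> cartan" for h x
  proof -
    have "bracket (dual_\<iota> h) x = - bracket (\<iota> h) x"
      using that by (simp add: cartan_transpose \<iota>_minus cartan_in_sl bracket_minus_left)
    then show ?thesis by (auto simp: minus_equation_iff[of _ "scale (\<alpha> h) x"])
  qed
  then show ?thesis
    unfolding dual.weight_space_def weight_space_def by blast
qed

lemma dual_hom_space:
  "lie_algebra_over_sl.hom_space scale bracket dual_\<iota> sM act M = hom_space sM (\<lambda>x. act (- transpose x)) (M :: 'm::ab_group_add set)"
proof -
  interpret dual: lie_algebra_over_sl scale bracket dual_\<iota> by (rule dual_lie_algebra)
  have "(\<forall>x\<in>sl. \<forall>m\<in>M. \<phi> (act x m) = bracket (dual_\<iota> x) (\<phi> m))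
    \<longleftrightarrow> (\<forall>x\<in>sl. \<forall>m\<in>M. \<phi> (act (- transpose x) m) = bracket (\<iota> x) (\<phi> m))" 
    (is "?P \<longleftrightarrow> ?Q") for \<phi> :: "'m \<Rightarrow> 'l"
  proof
    assume P: ?P
    show ?Q
    proof (intro ballI)
      fix x m assume "x \<in> (sl :: ('f^'n^'n) set)" "m \<in> M"
      then show "\<phi> (act (- transpose x) m) = bracket (\<iota> x) (\<phi> m)"
        using P[rule_format, of "- transpose x" m] by (simp add: transpose_uminus)
    qed
  next
    assume Q: ?Q
    show ?P
    proof (intro ballI)
      fix x m assume "x \<in> (sl :: ('f^'n^'n) set)" "m \<in> M"
      then show "\<phi> (act x m) = bracket (dual_\<iota> x) (\<phi> m)"
        using Q[rule_format, of "- transpose x" m] by (simp add: transpose_uminus)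
    qed
  qed
  then show ?thesis unfolding dual.hom_space_def hom_space_def by auto
qed

lemma dual_spaces:
  "lie_algebra_over_sl.B scale bracket dual_\<iota> = B'"
  "lie_algebra_over_sl.C scale bracket dual_\<iota> = C'"
  "lie_algebra_over_sl.E scale bracket dual_\<iota> = E'"
proof -
  interpret dual: lie_algebra_over_sl scale bracket dual_\<iota> by (rule dual_lie_algebra)
  show "dual.B = B'" "dual.C = C'" "dual.E = E'"
    unfolding dual.B_def dual.C_def dual.E_def B'_def C'_def E'_def dual_hom_space act_V'_eq act_S'_eq
    by (rule refl)+
qed

end

lemma Theta_iff:
  "\<alpha> \<in> Theta \<longleftrightarrow> \<alpha> = 0
    \<or> (\<exists>i j. i \<noteq> j \<and> \<alpha> \<in> {\<epsilon> i + \<epsilon> j, \<epsilon> i - \<epsilon> j, - \<epsilon> i + \<epsilon> j, - \<epsilon> i - \<epsilon> j})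
    \<or> (\<exists>i. \<alpha> \<in> {\<epsilon> i, - \<epsilon> i, \<epsilon> i + \<epsilon> i, - (\<epsilon> i + \<epsilon> i)})"
  unfolding Theta_def Un_iff mem_Collect_eq singleton_iff by (rule disj_assoc)

lemma Theta_uminus [simp]: "- \<alpha> \<in> Theta \<longleftrightarrow> \<alpha> \<in> Theta"
proof -
  have "- \<alpha> \<in> Theta" if "\<alpha> \<in> Theta" for \<alpha> :: "'f::field^'n^'n \<Rightarrow> 'f"
    using that[unfolded Theta_iff]
  proof (elim disjE exE conjE)
    fix i j :: 'n
    assume ij: "i \<noteq> j" and "\<alpha> \<in> {\<epsilon> i + \<epsilon> j, \<epsilon> i - \<epsilon> j, - \<epsilon> i + \<epsilon> j, - \<epsilon> i - \<epsilon> j}"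
    then have "- \<alpha> \<in> {\<epsilon> i + \<epsilon> j, \<epsilon> i - \<epsilon> j, - \<epsilon> i + \<epsilon> j, - \<epsilon> i - \<epsilon> j}"
      by (elim insertE emptyE) simp_all
    then show ?thesis
      unfolding Theta_iff by (intro disjI2 disjI1 exI conjI) (rule ij)
  next
    fix i :: 'n
    assume "\<alpha> \<in> {\<epsilon> i, - \<epsilon> i, \<epsilon> i + \<epsilon> i, - (\<epsilon> i + \<epsilon> i)}"
    then have "- \<alpha> \<in> {\<epsilon> i, - \<epsilon> i, \<epsilon> i + \<epsilon> i, - (\<epsilon> i + \<epsilon> i)}"
      by (elim insertE emptyE) simp_all
    then show ?thesis unfolding Theta_iff by (intro disjI2 exI)
  qed (simp add: Theta_iff)
  from this[of \<alpha>] this[of "- \<alpha>"] show ?thesis by auto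
qed

text \<open>All data are stable under negation of weights: \<open>Theta\<close> is symmetric, and
  both the decomposition and the generators of the zero weight space are reindexed by
  -\<alpha>.\<close>

lemma (in theta_graded5) dual_theta_graded5: "theta_graded5 scale bracket dual_\<iota>"
proof -
  interpret dual: lie_algebra_over_sl scale bracket dual_\<iota> by (rule dual_lie_algebra)
  let ?T = "Theta :: ('f^'n^'n \<Rightarrow> 'f) set"
  have sum_neg: "(\<Sum>\<alpha>\<in>?T. f (- \<alpha>)) = sum f ?T" for f :: "_ \<Rightarrow> 'l"
    by (rule sum.reindex_bij_witness[where i = uminus and j = uminus]) auto
  note wd = weight_decomposition[unfolded direct_sum_of_def]
  have fin: "finite ?T" using wd by (rule conjunct1)
  have span: "UNIV = {sum f ?T |f. \<forall>\<alpha>\<in>?T. f \<alpha> \<in> weight_space \<alpha>}"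
    using wd[THEN conjunct2, THEN conjunct2, THEN conjunct1] .
  have indep: "\<forall>\<alpha>\<in>?T. f \<alpha> = 0" if "\<forall>\<alpha>\<in>?T. f \<alpha> \<in> weight_space \<alpha>" "sum f ?T = 0" for f
    using wd[THEN conjunct2, THEN conjunct2, THEN conjunct2, THEN spec, of f] that by blast
  show ?thesis
  proof unfold_locales
    show "direct_sum_of scale ?T dual.weight_space UNIV"
      unfolding direct_sum_of_def dual_weight_space
    proof (intro conjI allI impI ballI)
      show "UNIV = {sum f ?T |f. \<forall>\<alpha>\<in>?T. f \<alpha> \<in> weight_space (- \<alpha>)}"
      proof (intro set_eqI iffI)
        fix x :: 'l
        obtain f where f: "x = sum f ?T" "\<forall>\<alpha>\<in>?T. f \<alpha> \<in> weight_space \<alpha>" using span by blast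
        then show "x \<in> {sum f ?T |f. \<forall>\<alpha>\<in>?T. f \<alpha> \<in> weight_space (- \<alpha>)}"
          using sum_neg[of f] by (intro CollectI exI[of _ "\<lambda>\<alpha>. f (- \<alpha>)"]) auto
      qed simp
    next
      fix f \<alpha> assume f: "(\<forall>\<alpha>\<in>?T. f \<alpha> \<in> weight_space (- \<alpha>)) \<and> sum f ?T = 0" and "\<alpha> \<in> ?T"
      have "\<forall>\<alpha>\<in>?T. f (- \<alpha>) = 0"
      proof (rule indep)
        show "\<forall>\<alpha>\<in>?T. f (- \<alpha>) \<in> weight_space \<alpha>"
        proof
          fix \<alpha> assume "\<alpha> \<in> ?T"
          then show "f (- \<alpha>) \<in> weight_space \<alpha>"
            using f[THEN conjunct1, rule_format, of "- \<alpha>"] by simp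
        qed
      qed (use f sum_neg[of f] in simp)
      from this[rule_format, of "- \<alpha>"] show "f \<alpha> = 0" using \<open>\<alpha> \<in> ?T\<close> by simp
    qed (use fin weight_space_subspace in auto)
  next
    have "{bracket x y |x y \<alpha>. \<alpha> \<in> ?T - {0} \<and> - \<alpha> \<in> ?T - {0} \<and> x \<in> weight_space (- \<alpha>) \<and> y \<in> weight_space \<alpha>}
      = {bracket x y |x y \<alpha>. \<alpha> \<in> ?T - {0} \<and> - \<alpha> \<in> ?T - {0} \<and> x \<in> weight_space \<alpha> \<and> y \<in> weight_space (- \<alpha>)}"
      (is "?X = ?Y")
    proof (intro set_eqI iffI)
      fix z assume "z \<in> ?X"
      then obtain x y \<alpha> where "z = bracket x y" "\<alpha> \<in> ?T - {0}" "x \<in> weight_space (- \<alpha>)" "y \<in> weight_space \<alpha>"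
        by blast
      then show "z \<in> ?Y" by (intro CollectI exI[of _ x] exI[of _ y] exI[of _ "- \<alpha>"]) simp
    next
      fix z assume "z \<in> ?Y"
      then obtain x y \<alpha> where "z = bracket x y" "\<alpha> \<in> ?T - {0}" "x \<in> weight_space \<alpha>" "y \<in> weight_space (- \<alpha>)"
        by blast
      then show "z \<in> ?X" by (intro CollectI exI[of _ x] exI[of _ y] exI[of _ "- \<alpha>"]) simp
    qed
    then show "dual.weight_space 0 = span {bracket x y |x y \<alpha>. \<alpha> \<in> ?T - {0} \<and> - \<alpha> \<in> ?T - {0} \<and>
        x \<in> dual.weight_space \<alpha> \<and> y \<in> dual.weight_space (- \<alpha>)}"
      unfolding dual_weight_space minus_zero minus_minus zero_weight_space by (rule arg_cong[OF sym])
  qed (rule card5)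
qed

context theta_graded5
begin

lemma dual_W: "lie_algebra_over_sl.weight_space scale bracket dual_\<iota> (wt c) = W (- c)"
  by (simp add: dual_weight_space wt_minus)

lemma B'_exists:
  assumes "x \<in> W (- unit_wt i)"
  obtains b where "b \<in> B'" "b (axis i 1) = x"
proof -
  interpret dual: theta_graded5 scale bracket dual_\<iota> by (rule dual_theta_graded5)
  show ?thesis using dual.B_exists[of x i] assms that by (auto simp: dual_W dual_spaces)
qed

lemma CE'_exists:
  assumes "i \<noteq> j" "x \<in> W (- unit_wt i - unit_wt j)"
  obtains c e where "c \<in> C'" "e \<in> E'" "x = c (munit i j + munit j i) + e (munit i j - munit j i)"
proof -
  interpret dual: theta_graded5 scale bracket dual_\<iota> by (rule dual_theta_graded5)
  show ?thesis using dual.CE_exists[of i j x] assms that by (auto simp: dual_W dual_spaces algebra_simps)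
qed

lemma C'_exists_diag:
  assumes "x \<in> W (- (unit_wt i + unit_wt i))"
  obtains c where "c \<in> C'" "c (munit i i) = x"
proof -
  interpret dual: theta_graded5 scale bracket dual_\<iota> by (rule dual_theta_graded5)
  show ?thesis using dual.C_exists_diag[of x i] assms that unfolding dual_W dual_spaces by blast
qed

lemma B'_weight: "b \<in> B' \<Longrightarrow> b (axis i 1) \<in> W (- unit_wt i)"
proof -
  interpret dual: theta_graded5 scale bracket dual_\<iota> by (rule dual_theta_graded5)
  show "b \<in> B' \<Longrightarrow> b (axis i 1) \<in> W (- unit_wt i)"
    using dual.B_weight[of b i] by (simp add: dual_W dual_spaces)
qed

lemma C'_weight_diag: "c \<in> C' \<Longrightarrow> c (munit i i) \<in> W (- (unit_wt i + unit_wt i))"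
proof -
  interpret dual: theta_graded5 scale bracket dual_\<iota> by (rule dual_theta_graded5)
  show "c \<in> C' \<Longrightarrow> c (munit i i) \<in> W (- (unit_wt i + unit_wt i))"
    using dual.C_weight_diag[of c i] unfolding dual_W dual_spaces .
qed

lemma E'_weight: "e \<in> E' \<Longrightarrow> e (munit i j - munit j i) \<in> W (- (unit_wt i + unit_wt j))"
proof -
  interpret dual: theta_graded5 scale bracket dual_\<iota> by (rule dual_theta_graded5)
  show "e \<in> E' \<Longrightarrow> e (munit i j - munit j i) \<in> W (- (unit_wt i + unit_wt j))"
    using dual.E_weight[of e i j] unfolding dual_W dual_spaces .
qed

end

section \<open>The isotypic decomposition\<close>

lemma sym_mats_nth: "x \<in> sym_mats \<Longrightarrow> x $ j $ i = x $ i $ j"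
  unfolding sym_mats_def by (drule CollectD, drule arg_cong[where f = "\<lambda>x. x $ i $ j"])
    (simp add: transpose_def)

lemma skew_mats_nth: "x \<in> skew_mats \<Longrightarrow> x $ j $ i = - x $ i $ j"
  unfolding skew_mats_def by (drule CollectD, drule arg_cong[where f = "\<lambda>x. x $ i $ j"])
    (simp add: transpose_def)

context lie_algebra_over_sl
begin

lemma module_hs: "module (hs :: 'f \<Rightarrow> ('m \<Rightarrow> 'l) \<Rightarrow> 'm \<Rightarrow> 'l)"
  using vector_space_hs by (simp add: module_iff_vector_space)

lemma sum_apply: "(sum \<phi> K) m = (\<Sum>k\<in>K. \<phi> k m)" for \<phi> :: "'k \<Rightarrow> 'm \<Rightarrow> 'l"
  by (induction K rule: infinite_finite_induct) simp_all

lemma hs_apply [simp]: "hs k \<phi> m = scale k (\<phi> m)"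
  by (simp add: fscale_def)

lemma hom_lin_comb:
  assumes "\<And>k. k \<in> K \<Longrightarrow> \<phi> k \<in> hom_space sM act M"
  shows "(\<Sum>k\<in>K. hs (x k) (\<phi> k)) \<in> hom_space sM act M"
  using assms by (intro module.subspace_sum[OF module_hs hom_space_subspace]
      module.subspace_scale[OF module_hs hom_space_subspace])

text \<open>The invariants form a single trivial submodule containing all the others, so the span in
  the definition adds nothing to them.\<close>

lemma D_iff: "z \<in> D \<longleftrightarrow> (\<forall>x\<in>sl. bracket (\<iota> x) z = 0)"
proof
  let ?U = "{z. \<forall>x\<in>sl. bracket (\<iota> x) z = 0}"
  have U: "subspace ?U"
    by (rule subspaceI) (simp_all add: bracket_add_right bracket_scale_right)
  show "z \<in> D" if "\<forall>x\<in>sl. bracket (\<iota> x) z = 0"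
    unfolding D_def using U that by (intro span_base) auto
  have "D \<subseteq> ?U" unfolding D_def by (rule span_minimal[OF _ U]) auto
  then show "z \<in> D \<Longrightarrow> \<forall>x\<in>sl. bracket (\<iota> x) z = 0" by auto
qed

lemma D_subspace: "subspace D"
  unfolding D_def by (rule subspace_span)

lemma D_weight: "D \<subseteq> weight_space 0"
  by (auto simp: D_iff weight_space_def cartan_in_sl)

lemma ad_hom: "\<phi> \<in> hom_space sM act M \<Longrightarrow> p \<noteq> q \<Longrightarrow> m \<in> M \<Longrightarrow> ad p q (\<phi> m) = \<phi> (act (munit p q) m)"
  by (simp add: hom_spaceD(2))

text \<open>Expanding every \<open>m k\<close> along a common finite family \<open>b\<close> turns
  the sum into values of the homomorphisms with coefficients \<kappa>, all of which vanish. This is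
  the converse to \<open>coords_sl\<close> and \<open>coords_S_L\<close>, which extract those
  coefficients from a relation.\<close>

lemma coords_zero_imp:
  assumes "sl_module sM act M" and \<phi>: "\<And>k. k \<in> K \<Longrightarrow> \<phi> k \<in> hom_space sM act M" "\<And>k. k \<in> K \<Longrightarrow> m k \<in> M"
    and b: "\<And>p. b p \<in> M" "\<And>x. x \<in> M \<Longrightarrow> x = (\<Sum>p\<in>P. sM (\<kappa> p x) (b p))"
    and zero: "\<And>p. (\<Sum>k\<in>K. hs (\<kappa> p (m k)) (\<phi> k)) = 0"
  shows "(\<Sum>k\<in>K. \<phi> k (m k)) = 0"
proof -
  interpret M: sl_module sM act M by fact
  have "\<phi> k (m k) = (\<Sum>p\<in>P. scale (\<kappa> p (m k)) (\<phi> k (b p)))" if "k \<in> K" for k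
  proof -
    have "\<phi> k (m k) = \<phi> k (\<Sum>p\<in>P. sM (\<kappa> p (m k)) (b p))"
      using b(2)[OF \<phi>(2)[OF that]] by simp
    also have "\<dots> = (\<Sum>p\<in>P. \<phi> k (sM (\<kappa> p (m k)) (b p)))"
      by (rule linear_on_sum[OF _ M.carrier_subspace _ hom_spaceD(1)[OF \<phi>(1)[OF that]]])
        (simp_all add: M.vector_space_axioms vector_space_axioms M.subspace_scale[OF M.carrier_subspace b(1)])
    finally show ?thesis using b(1) by (simp add: hom_spaceD(5)[OF \<phi>(1)[OF that]])
  qed
  then have "(\<Sum>k\<in>K. \<phi> k (m k)) = (\<Sum>k\<in>K. \<Sum>p\<in>P. scale (\<kappa> p (m k)) (\<phi> k (b p)))"
    by (intro sum.cong refl)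
  also have "\<dots> = (\<Sum>p\<in>P. (\<Sum>k\<in>K. hs (\<kappa> p (m k)) (\<phi> k)) (b p))"
    by (subst sum.swap) (simp add: sum_apply)
  finally show ?thesis by (simp add: zero)
qed

text \<open>Scalars are absorbed into the homomorphisms, so a sum without coefficients
  suffices.\<close>

lemma tensor_imageE:
  assumes "y \<in> tensor_image M H" "module.subspace hs H"
  obtains N m \<phi> where "\<And>k. k < (N::nat) \<Longrightarrow> m k \<in> M" "\<And>k. k < N \<Longrightarrow> \<phi> k \<in> H" "y = (\<Sum>k<N. \<phi> k (m k))"
proof -
  have "\<exists>N m \<phi>. (\<forall>k<(N::nat). m k \<in> M \<and> \<phi> k \<in> H) \<and> y = (\<Sum>k<N. \<phi> k (m k))"
    using assms(1) unfolding tensor_image_def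
  proof (induction rule: span_induct_alt)
    case base
    show ?case by (intro exI[of _ 0]) simp
  next
    case (step c x y)
    then obtain N m \<phi> m0 \<phi>0 where *: "\<forall>k<(N::nat). m k \<in> M \<and> \<phi> k \<in> H" "y = (\<Sum>k<N. \<phi> k (m k))"
      "x = \<phi>0 m0" "m0 \<in> M" "\<phi>0 \<in> H"
      unfolding tens_def by blast
    show ?case
    proof (intro exI[of _ "Suc N"] exI[of _ "m(N := m0)"] exI[of _ "\<phi>(N := hs c \<phi>0)"] conjI allI impI)
      fix k assume "k < Suc N"
      then show "(m(N := m0)) k \<in> M" "(\<phi>(N := hs c \<phi>0)) k \<in> H"
        using * module.subspace_scale[OF module_hs assms(2)] by (auto simp: less_Suc_eq)
    next
      have "(\<Sum>k<N. (\<phi>(N := hs c \<phi>0)) k ((m(N := m0)) k)) = (\<Sum>k<N. \<phi> k (m k))"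
        by (intro sum.cong refl) simp
      then show "scale c x + y = (\<Sum>k<Suc N. (\<phi>(N := hs c \<phi>0)) k ((m(N := m0)) k))"
        using * by (simp add: add.commute)
    qed
  qed
  then show ?thesis using that by blast
qed

lemma tensor_image_subspace: "subspace (tensor_image M H)"
  unfolding tensor_image_def by (rule subspace_span)

lemma tensor_imageI: "m \<in> M \<Longrightarrow> \<phi> \<in> H \<Longrightarrow> \<phi> m \<in> tensor_image M H"
  unfolding tensor_image_def tens_def by (intro span_base) auto

lemma tensor_image_minimal:
  assumes "subspace U" "\<And>m \<phi>. m \<in> M \<Longrightarrow> \<phi> \<in> H \<Longrightarrow> \<phi> m \<in> U"
  shows "tensor_image M H \<subseteq> U"
  unfolding tensor_image_def tens_def using assms by (intro span_minimal) auto

end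

context theta_graded5
begin

lemma D_ad: "(\<And>p q. p \<noteq> q \<Longrightarrow> ad p q z = 0) \<Longrightarrow> z \<in> D"
proof -
  assume ad0: "\<And>p q. p \<noteq> q \<Longrightarrow> ad p q z = 0"
  obtain i j :: 'n where "i \<noteq> j" by (rule obtain_distinct) auto
  let ?N = "{x \<in> sl. bracket (\<iota> x) z = 0}"
  have "?N = sl"
  proof (rule slm.generated_byD[OF sl_generated[OF \<open>i \<noteq> j\<close>]])
    show "mscale.subspace ?N"
      by (rule mscale.subspaceI) (auto simp: mscale.subspace_0[OF sl_subspace]
          mscale.subspace_add[OF sl_subspace] mscale.subspace_scale[OF sl_subspace] \<iota>_add \<iota>_scale
          bracket_add_left bracket_scale_left)
    show "munit i j \<in> ?N" using ad0 \<open>i \<noteq> j\<close> by simp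
  next
    fix p q :: 'n and x :: "'f^'n^'n" assume "p \<noteq> q" "x \<in> ?N"
    then show "comm_mat (munit p q) x \<in> ?N"
      using ad0[of p q] by (simp add: \<iota>_bracket bracket_bracket_left)
  qed blast
  then show "z \<in> D" by (auto simp: D_iff)
qed

text \<open>E_ji sends a vector to its i-th coordinate times the basis vector at j, so applying E_ji
  to the relation evaluates the wanted combination of homomorphisms at a generator.\<close>

lemma coords_V:
  assumes "\<And>k. k \<in> K \<Longrightarrow> \<phi> k \<in> B" "(\<Sum>k\<in>K. \<phi> k (m k)) = 0"
  shows "(\<Sum>k\<in>K. hs (m k $ i) (\<phi> k)) = 0"
proof -
  obtain j where j: "j \<noteq> i" using obtain_fresh[of i i i i] by blast
  let ?\<Phi> = "\<Sum>k\<in>K. hs (m k $ i) (\<phi> k)"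
  have \<Phi>: "?\<Phi> \<in> hom_space (*s) act_V UNIV"
    using assms(1) by (intro hom_lin_comb) (simp add: B_def)
  have "act_V (munit j i) x = x $ i *s axis j 1" for x :: "'f^'n"
    by (auto simp: act_V_def vec_eq_iff axis_def)
  then have "?\<Phi> (axis j 1) = (\<Sum>k\<in>K. ad j i (\<phi> k (m k)))"
    using assms(1) j by (simp add: sum_apply B_def ad_hom[of _ "(*s)" act_V UNIV] hom_spaceD(5)[of _ "(*s)" act_V UNIV])
  also have "\<dots> = 0" using assms(2) by (simp flip: bracket_sum_right)
  finally show ?thesis using hom_eq_zero[OF sl_module_V V_generated \<Phi>] by blast
qed

text \<open>S and \<Lambda> share weights and must be treated together. For fresh p and q, the
  operators E_qj and E_pi turn x into x_ij E_pq + x_ji E_qp, which is x_ij times a symmetric or a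
  skew unit. A further E_pq kills the skew unit and sends the symmetric one to 2 E_pp, which
  separates the two.\<close>

lemma coords_S_L:
  assumes \<phi>: "\<And>k. k \<in> K \<Longrightarrow> \<phi> k \<in> C" "\<And>k. k \<in> K \<Longrightarrow> m k \<in> sym_mats"
    and \<psi>: "\<And>k. k \<in> K' \<Longrightarrow> \<psi> k \<in> E" "\<And>k. k \<in> K' \<Longrightarrow> n k \<in> skew_mats"
    and zero: "(\<Sum>k\<in>K. \<phi> k (m k)) + (\<Sum>k\<in>K'. \<psi> k (n k)) = 0"
  shows "(\<Sum>k\<in>K. hs (m k $ i $ j) (\<phi> k)) = 0" "(\<Sum>k\<in>K'. hs (n k $ i $ j) (\<psi> k)) = 0"
proof -
  obtain p where p: "p \<noteq> i" "p \<noteq> j" using obtain_fresh[of i j i j] by blast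
  obtain q where q: "q \<noteq> i" "q \<noteq> j" "q \<noteq> p" using obtain_fresh[of i j p i] by blast
  define \<Phi> where "\<Phi> = (\<Sum>k\<in>K. hs (m k $ i $ j) (\<phi> k))"
  define \<Psi> where "\<Psi> = (\<Sum>k\<in>K'. hs (n k $ i $ j) (\<psi> k))"
  have hom\<Phi>: "\<Phi> \<in> hom_space mscale act_S sym_mats" and hom\<Psi>: "\<Psi> \<in> hom_space mscale act_S skew_mats"
    using \<phi>(1) \<psi>(1) unfolding \<Phi>_def \<Psi>_def by (intro hom_lin_comb; simp add: C_def E_def)+
  have act: "act_S (munit p i) (act_S (munit q j) x) = mscale (x $ i $ j) (munit p q) + mscale (x $ j $ i) (munit q p)"
    for x :: "'f^'n^'n"
    using p q by (simp add: act_S_def matrix_ring) (auto simp: vec_eq_iff)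
  have 1: "ad p i (ad q j (\<phi> k (m k))) = scale (m k $ i $ j) (\<phi> k (munit p q + munit q p))" if "k \<in> K" for k
  proof -
    have h: "\<phi> k \<in> hom_space mscale act_S sym_mats" using \<phi>(1)[OF that] by (simp add: C_def)
    have "m k $ j $ i = m k $ i $ j"
      using sym_mats_nth[OF \<phi>(2)[OF that]] .
    then have "act_S (munit p i) (act_S (munit q j) (m k)) = mscale (m k $ i $ j) (munit p q + munit q p)"
      by (simp add: act mscale_add)
    then show ?thesis
      using p q \<phi>(2)[OF that] by (simp add: ad_hom[OF h] Sm.act_closed hom_spaceD(5)[OF h])
  qed
  have 2: "ad p i (ad q j (\<psi> k (n k))) = scale (n k $ i $ j) (\<psi> k (munit p q - munit q p))" if "k \<in> K'" for k
  proof -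
    have h: "\<psi> k \<in> hom_space mscale act_S skew_mats" using \<psi>(1)[OF that] by (simp add: E_def)
    have "n k $ j $ i = - n k $ i $ j"
      using skew_mats_nth[OF \<psi>(2)[OF that]] .
    then have "act_S (munit p i) (act_S (munit q j) (n k)) = mscale (n k $ i $ j) (munit p q - munit q p)"
      by (simp add: act mscale_diff vec_eq_iff)
    then show ?thesis
      using p q \<psi>(2)[OF that] by (simp add: ad_hom[OF h] Lm.act_closed hom_spaceD(5)[OF h])
  qed
  have "ad p i (ad q j ((\<Sum>k\<in>K. \<phi> k (m k)) + (\<Sum>k\<in>K'. \<psi> k (n k)))) = 0" by (simp add: zero)
  then have sum0: "\<Phi> (munit p q + munit q p) + \<Psi> (munit p q - munit q p) = 0"
    by (simp add: bracket_add_right bracket_sum_right 1 2 sum_apply \<Phi>_def \<Psi>_def)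
  have "ad p q (\<Phi> (munit p q + munit q p)) + ad p q (\<Psi> (munit p q - munit q p)) = 0"
    unfolding bracket_add_right[symmetric] sum0 by simp
  moreover have "ad p q (\<Phi> (munit p q + munit q p)) = scale 2 (\<Phi> (munit p p))"
  proof -
    have "act_S (munit p q) (munit p q + munit q p) = mscale 2 (munit p p :: 'f^'n^'n)"
      using q by (simp add: act_S_def matrix_ring vec_eq_iff)
    then show ?thesis using q by (simp add: ad_hom[OF hom\<Phi>] hom_spaceD(5)[OF hom\<Phi>])
  qed
  moreover have "ad p q (\<Psi> (munit p q - munit q p)) = 0"
  proof -
    have "act_S (munit p q) (munit p q - munit q p) = (0 :: 'f^'n^'n)"
      using q by (simp add: act_S_def matrix_ring)
    then show ?thesis using q by (simp add: ad_hom[OF hom\<Psi>] hom_space_zero[OF sl_module_L hom\<Psi>])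
  qed
  ultimately have "\<Phi> (munit p p) = 0" by simp
  from hom_eq_zero[OF sl_module_S S_generated hom\<Phi> this] have "\<Phi> = 0" .
  then show "(\<Sum>k\<in>K. hs (m k $ i $ j) (\<phi> k)) = 0" by (simp add: \<Phi>_def)
  then have "\<Psi> (munit p q - munit q p) = 0" using sum0 \<open>\<Phi> = 0\<close> by simp
  from hom_eq_zero[OF sl_module_L L_generated hom\<Psi> this] q have "\<Psi> = 0" by blast
  then show "(\<Sum>k\<in>K'. hs (n k $ i $ j) (\<psi> k)) = 0" by (simp add: \<Psi>_def)
qed

text \<open>Off the diagonal, E_ji applied twice turns x into -2 x_ij E_ji, and it removes
  \<open>d\<close>. On the diagonal, the (p,q) entry of the commutator of E_pq with x is x_qq -
  x_pp, so all diagonal combinations agree; their sum has the coefficients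
  \<open>trace (m k)\<close> = 0, and n can be cancelled.\<close>

lemma coords_sl:
  assumes \<phi>: "\<And>k. k \<in> K \<Longrightarrow> \<phi> k \<in> A" "\<And>k. k \<in> K \<Longrightarrow> m k \<in> sl" and "d \<in> D"
    and zero: "(\<Sum>k\<in>K. \<phi> k (m k)) + d = 0"
  shows "(\<Sum>k\<in>K. hs (m k $ i $ j) (\<phi> k)) = 0"
proof -
  have hom: "\<phi> k \<in> hom_space mscale comm_mat sl" if "k \<in> K" for k using \<phi>(1)[OF that] by (simp add: A_def)
  have off: "(\<Sum>k\<in>K. hs (m k $ i $ j) (\<phi> k)) = 0"
    if "\<And>k. k \<in> K \<Longrightarrow> m k \<in> sl" "ad j i (\<Sum>k\<in>K. \<phi> k (m k)) = 0" "i \<noteq> j" for m and i j :: 'n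
  proof -
    define \<Phi> where "\<Phi> = (\<Sum>k\<in>K. hs (m k $ i $ j) (\<phi> k))"
    have hom\<Phi>: "\<Phi> \<in> hom_space mscale comm_mat sl"
      unfolding \<Phi>_def using hom by (intro hom_lin_comb)
    have act: "comm_mat (munit j i) (comm_mat (munit j i) x) = mscale (- 2 * x $ i $ j) (munit j i)"
      for x :: "'f^'n^'n"
      using that(3) by (auto simp: comm_mat_def vec_eq_iff matrix_ring)
    have "ad j i (ad j i (\<phi> k (m k))) = scale (- 2) (scale (m k $ i $ j) (\<phi> k (munit j i)))" if "k \<in> K" for k
    proof -
      have "ad j i (ad j i (\<phi> k (m k))) = \<phi> k (mscale (- 2 * m k $ i $ j) (munit j i))"
        unfolding act[symmetric] using that \<open>i \<noteq> j\<close> \<open>\<And>k. k \<in> K \<Longrightarrow> m k \<in> sl\<close> by (simp add: ad_hom[OF hom])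
      also have "\<dots> = scale (- 2 * m k $ i $ j) (\<phi> k (munit j i))"
        using \<open>i \<noteq> j\<close> by (intro hom_spaceD(5)[OF hom[OF that]]) simp
      finally show ?thesis by simp
    qed
    then have "(\<Sum>k\<in>K. ad j i (ad j i (\<phi> k (m k)))) = scale (- 2) (\<Phi> (munit j i))"
      by (simp only: sum_apply scale_sum_right hs_apply \<Phi>_def cong: sum.cong)
    moreover have "(\<Sum>k\<in>K. ad j i (ad j i (\<phi> k (m k)))) = 0"
      using that(2) by (simp flip: bracket_sum_right)
    ultimately have "\<Phi> (munit j i) = 0" by simp
    from hom_eq_zero[OF sl_module_sl sl_generated hom\<Phi> this] that(3) show ?thesis by (simp add: \<Phi>_def)
  qed
  have killed: "ad p q (\<Sum>k\<in>K. \<phi> k (m k)) = 0" if "p \<noteq> q" for p q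
  proof -
    have "ad p q ((\<Sum>k\<in>K. \<phi> k (m k)) + d) = 0" by (simp add: zero)
    moreover have "ad p q d = 0" using \<open>d \<in> D\<close> that by (simp add: D_iff)
    ultimately show ?thesis by (simp add: bracket_add_right)
  qed
  show ?thesis
  proof (cases "i = j")
    case False
    then show ?thesis using off[of m j i] \<phi>(2) killed by simp
  next
    case True
    let ?\<Phi> = "\<lambda>i. \<Sum>k\<in>K. hs (m k $ i $ i) (\<phi> k)"
    have diff: "?\<Phi> q = ?\<Phi> p" if "p \<noteq> q" for p q
    proof -
      have "(\<Sum>k\<in>K. \<phi> k (comm_mat (munit p q) (m k))) = ad p q (\<Sum>k\<in>K. \<phi> k (m k))"
        using that \<phi>(2) by (simp add: bracket_sum_right ad_hom[OF hom])
      then have "(\<Sum>k\<in>K. hs (comm_mat (munit p q) (m k) $ p $ q) (\<phi> k)) = 0"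
        using off[of "\<lambda>k. comm_mat (munit p q) (m k)" q p] killed[OF that] that by simp
      moreover have "comm_mat (munit p q) x $ p $ q = x $ q $ q - x $ p $ p" for x :: "'f^'n^'n"
        by (simp add: comm_mat_def)
      ultimately show ?thesis
        by (simp add: module.scale_left_diff_distrib[OF module_hs] sum_subtractf)
    qed
    have eq: "?\<Phi> p = ?\<Phi> i" for p
      using diff[of i p] by (cases "i = p") (simp, blast)
    have "(\<Sum>p\<in>UNIV. ?\<Phi> p) = (\<Sum>p\<in>(UNIV :: 'n set). ?\<Phi> i)"
      by (rule sum.cong[OF refl]) (rule eq)
    then have "hs (of_nat CARD('n)) (?\<Phi> i) = (\<Sum>p\<in>UNIV. ?\<Phi> p)"
      by (simp only: module.sum_constant_scale[OF module_hs])
    also have "\<dots> = (\<Sum>k\<in>K. hs (trace (m k)) (\<phi> k))"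
      by (subst sum.swap) (simp add: trace_def module.scale_sum_left[OF module_hs])
    also have "\<dots> = 0" using \<phi>(2) by (simp add: sl_def module.scale_zero_left[OF module_hs])
    finally have "?\<Phi> i = 0" by (simp add: vector_space.scale_eq_0_iff[OF vector_space_hs])
    then show ?thesis using True by simp
  qed
qed

end

text \<open>The traceless part of E_pp. Root vectors commute with the scalar that is subtracted, so
  brackets treat it like E_pp.\<close>

definition cmunit :: "'n \<Rightarrow> 'f::field_char_0^'n^'n" where
  "cmunit p = munit p p - mat (1 / of_nat CARD('n))"

lemma cmunit_in_sl [simp]: "cmunit p \<in> sl"
  by (simp add: cmunit_def sl_def trace_mat)

lemma comm_mat_cmunit: "comm_mat (munit p q) (cmunit r) = comm_mat (munit p q) (munit r r)"
  by (simp add: comm_mat_def cmunit_def matrix_ring mult_mat_left mult_mat_right)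

context lie_algebra_over_sl
begin

text \<open>A functional that picks \<open>m0\<close> out of the independent set \<open>T\<close> is
  a combination of the coordinate functionals \<kappa>. Applied to the vanishing coordinates of the
  tensor, it isolates \<open>\<phi> m0\<close>.\<close>

lemma tensor_injectiveI:
  assumes "sl_module sM act M" "module.subspace hs H"
    and expansion: "\<And>x. x = (\<Sum>p\<in>P. sM (\<kappa> p x) (b p))"
    and coords: "\<And>T \<phi> p. (\<And>m. m \<in> T \<Longrightarrow> m \<in> M) \<Longrightarrow> (\<And>m. m \<in> T \<Longrightarrow> \<phi> m \<in> H) \<Longrightarrow> (\<Sum>m\<in>T. \<phi> m m) = 0 \<Longrightarrow>
      (\<Sum>m\<in>T. hs (\<kappa> p m) (\<phi> m)) = 0"
  shows "tensor_injective sM M H"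
  unfolding tensor_injective_def tens_def
proof (intro allI impI ballI, elim conjE)
  fix T \<phi> m0
  assume m0: "m0 \<in> T" and T: "finite T" "T \<subseteq> M" "\<forall>m\<in>T. \<phi> m \<in> H" "(\<Sum>m\<in>T. \<phi> m m) = 0"
    and indep: "\<not> module.dependent sM T"
  interpret M: sl_module sM act M by fact
  interpret P: vector_space_pair sM "(*) :: 'f \<Rightarrow> 'f \<Rightarrow> 'f"
    by (intro vector_space_pair.intro M.vector_space_axioms) (unfold_locales, simp_all add: algebra_simps)
  interpret hs: vector_space hs by (rule vector_space_hs)
  obtain f where f: "Vector_Spaces.linear sM (*) f" "\<And>x. x \<in> T \<Longrightarrow> f x = (if x = m0 then 1 else 0)"
    using P.linear_independent_extend[OF indep, of "\<lambda>x. if x = m0 then 1 else 0"] by blast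
  have f_exp: "f x = (\<Sum>p\<in>P. \<kappa> p x * f (b p))" for x
  proof -
    have "f x = f (\<Sum>p\<in>P. sM (\<kappa> p x) (b p))" using expansion[of x] by simp
    then show ?thesis by (simp add: P.linear_sum[OF f(1)] P.linear_scale[OF f(1)])
  qed
  have "\<phi> m0 = (\<Sum>m\<in>T. if m = m0 then \<phi> m else 0)" using T(1) m0 by simp
  also have "\<dots> = (\<Sum>m\<in>T. hs (f m) (\<phi> m))"
    by (intro sum.cong refl) (simp add: f(2))
  also have "\<dots> = (\<Sum>m\<in>T. \<Sum>p\<in>P. hs (f (b p)) (hs (\<kappa> p m) (\<phi> m)))"
    by (intro sum.cong refl) (subst f_exp, simp add: hs.scale_sum_left mult.commute)
  also have "\<dots> = (\<Sum>p\<in>P. hs (f (b p)) (\<Sum>m\<in>T. hs (\<kappa> p m) (\<phi> m)))"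
    by (subst sum.swap) (simp add: hs.scale_sum_right)
  also have "\<dots> = 0"
    using coords[of T \<phi>] T by (intro sum.neutral ballI) (simp add: subset_iff)
  finally show "\<phi> m0 = 0" .
qed

lemma hom_subspaces:
  "module.subspace hs A" "module.subspace hs B" "module.subspace hs B'" "module.subspace hs C"
  "module.subspace hs C'" "module.subspace hs E" "module.subspace hs E'"
  unfolding A_def B_def B'_def C_def C'_def E_def E'_def by (rule hom_space_subspace)+

definition sums_of :: "'i set \<Rightarrow> ('i \<Rightarrow> 'l set) \<Rightarrow> 'l set" where
  "sums_of I U = {sum g I | g. \<forall>i\<in>I. g i \<in> U i}"

lemma sums_of_subspace:
  assumes "\<And>i. i \<in> I \<Longrightarrow> subspace (U i)"
  shows "subspace (sums_of I U)"
proof (rule subspaceI)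
  show "0 \<in> sums_of I U"
    unfolding sums_of_def by (intro CollectI exI[of _ "\<lambda>_. 0"]) (simp add: subspace_0[OF assms])
next
  fix x y assume "x \<in> sums_of I U" "y \<in> sums_of I U"
  then obtain g h where "x = sum g I" "\<forall>i\<in>I. g i \<in> U i" "y = sum h I" "\<forall>i\<in>I. h i \<in> U i"
    unfolding sums_of_def by blast
  then show "x + y \<in> sums_of I U"
    unfolding sums_of_def by (intro CollectI exI[of _ "\<lambda>i. g i + h i"])
      (simp add: sum.distrib subspace_add[OF assms])
next
  fix c x assume "x \<in> sums_of I U"
  then obtain g where "x = sum g I" "\<forall>i\<in>I. g i \<in> U i"
    unfolding sums_of_def by blast
  then show "scale c x \<in> sums_of I U"
    unfolding sums_of_def by (intro CollectI exI[of _ "\<lambda>i. scale c (g i)"])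
      (simp add: scale_sum_right subspace_scale[OF assms])
qed

lemma sums_of_upper:
  assumes "finite I" "i \<in> I" "\<And>i. i \<in> I \<Longrightarrow> subspace (U i)"
  shows "U i \<subseteq> sums_of I U"
proof
  fix x assume "x \<in> U i"
  moreover have "(\<Sum>j\<in>I. if j = i then x else 0) = x" using assms(1,2) by simp
  ultimately show "x \<in> sums_of I U"
    unfolding sums_of_def by (intro CollectI exI[of _ "\<lambda>j. if j = i then x else 0"])
      (simp add: subspace_0[OF assms(3)])
qed

abbreviation WS :: "('f^'n^'n \<Rightarrow> 'f) set \<Rightarrow> 'l set" where
  "WS F \<equiv> sums_of F weight_space"

lemma WS_subspace: "subspace (WS F)"
  by (rule sums_of_subspace) (rule weight_space_subspace)

lemma weight_space_WS: "finite F \<Longrightarrow> \<alpha> \<in> F \<Longrightarrow> weight_space \<alpha> \<subseteq> WS F"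
  by (rule sums_of_upper) (simp_all add: weight_space_subspace)

lemma WS_mono:
  assumes "F \<subseteq> F'" "finite F'"
  shows "WS F \<subseteq> WS F'"
proof
  fix x assume "x \<in> WS F"
  then obtain g where g: "x = sum g F" "\<forall>\<alpha>\<in>F. g \<alpha> \<in> weight_space \<alpha>" unfolding sums_of_def by blast
  have "sum g F \<in> WS F'"
    using assms g(2) weight_space_WS[OF assms(2)] by (intro subspace_sum[OF WS_subspace]) blast
  then show "x \<in> WS F'" using g(1) by simp
qed

lemma WS_disjoint:
  assumes "finite F" "finite F'" "F \<inter> F' = {}" "\<And>\<alpha> h. \<alpha> \<in> F \<union> F' \<Longrightarrow> h \<notin> cartan \<Longrightarrow> \<alpha> h = 0"
    and "y \<in> WS F" "y' \<in> WS F'" "y + y' = 0"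
  shows "y = 0"
proof -
  obtain g where g: "y = sum g F" "\<forall>\<alpha>\<in>F. g \<alpha> \<in> weight_space \<alpha>" using assms unfolding sums_of_def by blast
  obtain g' where g': "y' = sum g' F'" "\<forall>\<alpha>\<in>F'. g' \<alpha> \<in> weight_space \<alpha>" using assms unfolding sums_of_def by blast
  define k where "k \<alpha> = (if \<alpha> \<in> F then g \<alpha> else g' \<alpha>)" for \<alpha>
  have "sum k F = y" unfolding g(1) k_def by (intro sum.cong) auto
  moreover have "sum k F' = y'" unfolding g'(1) k_def using assms(3) by (intro sum.cong) auto
  ultimately have "sum k (F \<union> F') = 0"
    using sum.union_disjoint[OF assms(1,2,3), of k] assms(7) by simp
  then have "k \<alpha> = 0" if "\<alpha> \<in> F" for \<alpha>
    using that g(2) g'(2) assms(1,2,4) by (intro weight_spaces_independent[of "F \<union> F'" k \<alpha>]) (auto simp: k_def)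
  then have "sum k F = 0" by simp
  then show ?thesis using \<open>sum k F = y\<close> by simp
qed

lemma hom_preimage_subspace:
  assumes "sl_module sM act M" "\<phi> \<in> hom_space sM act M" "subspace U"
  shows "module.subspace sM {m \<in> M. \<phi> m \<in> U}"
proof -
  interpret M: sl_module sM act M by fact
  show ?thesis
    using hom_space_zero[OF assms(1,2)] subspace_0[OF assms(3)] subspace_add[OF assms(3)] subspace_scale[OF assms(3)]
    by (intro M.subspaceI) (auto simp: hom_spaceD(4,5)[OF assms(2)] M.subspace_0[OF M.carrier_subspace]
        M.subspace_add[OF M.carrier_subspace] M.subspace_scale[OF M.carrier_subspace])
qed

end

context theta_graded5
begin

lemma tensor_injective_unprimed:
  "tensor_injective mscale sl A" "tensor_injective (*s) UNIV B"
  "tensor_injective mscale sym_mats C" "tensor_injective mscale skew_mats E"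
proof -
  have exp: "x = (\<Sum>p\<in>UNIV. mscale (x $ fst p $ snd p) (munit (fst p) (snd p)))" for x :: "'f^'n^'n"
    using matrix_expansion[of x] by (simp add: sum.cartesian_product split_def flip: UNIV_Times_UNIV)
  show "tensor_injective mscale sl A"
    by (rule tensor_injectiveI[OF sl_module_sl hom_subspaces(1) exp])
      (use coords_sl[of _ _ "\<lambda>m. m" 0] subspace_0[OF D_subspace] in simp)
  show "tensor_injective (*s) UNIV B"
    by (rule tensor_injectiveI[OF sl_module_V hom_subspaces(2) vector_expansion])
      (use coords_V[of _ _ "\<lambda>m. m"] in simp)
  show "tensor_injective mscale sym_mats C"
    by (rule tensor_injectiveI[OF sl_module_S hom_subspaces(4) exp])
      (use coords_S_L(1)[of _ _ "\<lambda>m. m" "{}"] in simp)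
  show "tensor_injective mscale skew_mats E"
    by (rule tensor_injectiveI[OF sl_module_L hom_subspaces(6) exp])
      (use coords_S_L(2)[of "{}" _ _ _ _ "\<lambda>m. m"] in simp)
qed

lemma tensor_injective_primed:
  "tensor_injective (*s) UNIV B'" "tensor_injective mscale sym_mats C'" "tensor_injective mscale skew_mats E'"
proof -
  interpret dual: theta_graded5 scale bracket dual_\<iota> by (rule dual_theta_graded5)
  show "tensor_injective (*s) UNIV B'" "tensor_injective mscale sym_mats C'" "tensor_injective mscale skew_mats E'"
    using dual.tensor_injective_unprimed by (simp_all add: dual_spaces)
qed

text \<open>The vector \<open>ad q p z\<close> is a value a(E_qp) with a in \<open>A\<close>. At
  weight zero E_pq and E_qp commute on z, so E_pq kills this value too, whereas E_qp E_pq multiplies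
  it by 2.\<close>

lemma ad_zero_sym:
  assumes z: "z \<in> W 0" and "p \<noteq> q" "ad p q z = 0"
  shows "ad q p z = 0"
proof -
  have "ad q p z \<in> W (unit_wt q - unit_wt p)" using ad_W[OF z] assms(2) by simp
  then obtain a where a: "a \<in> A" "a (munit q p) = ad q p z" using A_exists assms(2) by metis
  have h: "a \<in> hom_space mscale comm_mat sl" using a(1) by (simp add: A_def)
  have "ad p q (ad q p z) = 0" using ad_ad_cartan[OF assms(2) z] assms(3) by simp
  then have "ad q p (ad p q (a (munit q p))) = 0" using a(2) by simp
  moreover have "ad q p (ad p q (a (munit q p))) = a (mscale 2 (munit q p))"
  proof -
    have "comm_mat (munit q p) (comm_mat (munit p q) (munit q p)) = mscale 2 (munit q p :: 'f^'n^'n)"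
      using assms(2) by (simp add: comm_mat_def matrix_ring vec_eq_iff)
    then show ?thesis using assms(2) by (simp add: ad_hom[OF h])
  qed
  ultimately show ?thesis using hom_spaceD(5)[OF h, of "munit q p" 2] assms(2) a(2) by simp
qed

lemma ad_zero_trans:
  assumes "p \<noteq> q" "q \<noteq> r" "p \<noteq> r" "ad p q z = 0" "ad q r z = 0"
  shows "ad p r z = 0"
  using ad_ad_left[OF assms(1,2,3), of z] assms(4,5) by simp

text \<open>The root vectors E_rq of one star suffice: weight zero gives the opposite ones E_qr by
  \<open>ad_zero_sym\<close>, and E_pq is the commutator of E_pr and E_rq.\<close>

lemma D_of_star:
  assumes z: "z \<in> W 0" and star: "\<And>q. q \<noteq> r \<Longrightarrow> ad r q z = 0"
  shows "z \<in> D"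
proof (rule D_ad)
  fix p q :: 'n assume "p \<noteq> q"
  then show "ad p q z = 0"
    using star ad_zero_sym[OF z _ star[of p]] ad_zero_trans[of p r q z] by (cases "p = r"; cases "q = r") auto
qed

text \<open>For j \<noteq> r, the root vector E_rq sends the centred unit at j to E_rq if j = q and
  to zero otherwise. So the values of the E_rq on z are matched independently by elements
  \<open>t q\<close> of \<open>A\<close>, and what remains is killed by the star at r.\<close>

lemma zero_weight_decomposition:
  assumes z: "z \<in> W 0"
  shows "\<exists>y\<in>tensor_image sl A. z - y \<in> D"
proof -
  obtain r :: 'n where True by blast
  have "\<exists>a. a \<in> A \<and> a (munit r j) = ad r j z" if "j \<noteq> r" for j
    using A_exists[of r j "ad r j z"] ad_W[OF z, of r j "unit_wt r - unit_wt j"] that by (metis add_0)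
  then obtain t where t: "\<And>j. j \<noteq> r \<Longrightarrow> t j \<in> A" "\<And>j. j \<noteq> r \<Longrightarrow> t j (munit r j) = ad r j z" by metis
  define y where "y = (\<Sum>j\<in>UNIV - {r}. t j (cmunit j))"
  have hom: "t j \<in> hom_space mscale comm_mat sl" if "j \<noteq> r" for j using t(1)[OF that] by (simp add: A_def)
  have "y \<in> tensor_image sl A"
    unfolding y_def using t(1) by (intro subspace_sum[OF tensor_image_subspace] tensor_imageI) auto
  moreover have "z - y \<in> D"
  proof (rule D_of_star)
    have c: "t j (cmunit j) \<in> W 0" if "j \<noteq> r" for j
    proof -
      have "comm_mat h (cmunit j) = 0" if "h \<in> cartan" for h :: "'f^'n^'n"
        using comm_mat_cartan[OF that, of j j]
        by (simp add: cmunit_def comm_mat_def matrix_ring mult_mat_left mult_mat_right)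
      then show ?thesis
        using hom_weight[OF hom[OF that], of "cmunit j" "wt 0"] by (simp add: wt_zero[symmetric] zero_fun_def wt_def)
    qed
    then have "y \<in> W 0" unfolding y_def by (intro subspace_sum[OF weight_space_subspace]) auto
    then show "z - y \<in> W 0" using z by (rule subspace_diff[OF weight_space_subspace, rotated])
  next
    fix q assume q: "q \<noteq> r"
    have "ad r q y = (\<Sum>j\<in>UNIV - {r}. if j = q then t q (munit r q) else 0)"
      unfolding y_def bracket_sum_right
    proof (intro sum.cong refl)
      fix j assume "j \<in> UNIV - {r}"
      then have j: "j \<noteq> r" by simp
      have "ad r q (t j (cmunit j)) = t j (comm_mat (munit r q) (munit j j))"
        using q by (simp add: ad_hom[OF hom[OF j]] comm_mat_cmunit)
      also have "comm_mat (munit r q) (munit j j) = (if j = q then munit r q else 0 :: 'f^'n^'n)"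
        using j by (auto simp: comm_mat_def)
      finally show "ad r q (t j (cmunit j)) = (if j = q then t q (munit r q) else 0)"
        using hom_space_zero[OF sl_module_sl hom[OF j]] by simp
    qed
    also have "\<dots> = ad r q z" using q t(2) by simp
    finally show "ad r q (z - y) = 0" by (simp add: bracket_diff_right)
  qed
  ultimately show ?thesis by blast
qed

text \<open>Weights sorted by total degree, which is 0 for \<open>A\<close> and \<open>D\<close>, 1
  and 2 for the unprimed spaces, -1 and -2 for the primed ones. The degree refers to some
  representative, because a weight determines \<open>tot\<close> only modulo n.\<close>

definition level :: "int \<Rightarrow> ('f^'n^'n \<Rightarrow> 'f) set" where
  "level s = {\<alpha> \<in> Theta. \<exists>c. \<alpha> = wt c \<and> tot c = s}"

lemma finite_level: "finite (level s)"
  using weight_decomposition by (simp add: level_def direct_sum_of_def)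

text \<open>Representatives of one weight have totals that differ by a multiple of n, while s - t is
  at most 4 in absolute value.\<close>

lemma level_disjoint:
  assumes "\<bar>s\<bar> \<le> 2" "\<bar>t\<bar> \<le> 2" "s \<noteq> t"
  shows "level s \<inter> level t = {}"
proof (rule ccontr)
  assume "level s \<inter> level t \<noteq> {}"
  then obtain c d :: "'n \<Rightarrow> int" where cd: "(wt c :: 'f^'n^'n \<Rightarrow> 'f) = wt d" "tot c = s" "tot d = t"
    unfolding level_def by auto
  obtain r :: 'n where True by blast
  have eq: "int CARD('n) * (c r - d r) = s - t" using wt_inj[OF cd(1), of r] cd(2,3) by simp
  then have "\<bar>int CARD('n) * (c r - d r)\<bar> \<le> 4" using assms(1,2) by linarith
  then have "int CARD('n) * \<bar>c r - d r\<bar> \<le> 4" by (simp add: abs_mult)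
  moreover have "5 * \<bar>c r - d r\<bar> \<le> int CARD('n) * \<bar>c r - d r\<bar>" using card5 by (intro mult_right_mono) auto
  ultimately have "5 * \<bar>c r - d r\<bar> \<le> 4" by (rule order_trans[rotated])
  then have "c r - d r = 0" by presburger
  then show False using eq assms(3) by simp
qed

lemma level_off_cartan: "\<alpha> \<in> level s \<Longrightarrow> h \<notin> cartan \<Longrightarrow> \<alpha> h = 0"
  by (auto simp: level_def wt_def)

lemma levels_independent:
  assumes y: "\<And>s. s \<in> {-2..2} \<Longrightarrow> y s \<in> WS (level s)" and sum0: "(\<Sum>s\<in>{-2..2}. y s) = 0"
    and s: "s \<in> {-2..2}"
  shows "y s = 0"
proof -
  let ?F = "\<Union>t\<in>{-2..2} - {s}. level t"
  have fin: "finite ?F" using finite_level by simp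
  have rest: "(\<Sum>t\<in>{-2..2} - {s}. y t) \<in> WS ?F"
  proof (rule subspace_sum[OF WS_subspace])
    fix t assume t: "t \<in> {-2..2} - {s}"
    have "level t \<subseteq> ?F" by (rule UN_upper[OF t])
    then show "y t \<in> WS ?F" using subsetD[OF WS_mono[OF _ fin]] y[of t] t by simp
  qed
  have zero: "y s + (\<Sum>t\<in>{-2..2} - {s}. y t) = 0"
    using sum0 s sum.remove[of "{-2..2}" s y] by simp
  have disj: "level s \<inter> level t = {}" if "t \<in> {-2..2} - {s}" for t
    using s that by (intro level_disjoint) (auto simp: abs_le_iff)
  have disjoint: "level s \<inter> ?F = {}"
  proof (rule equals0I)
    fix \<alpha> assume "\<alpha> \<in> level s \<inter> ?F"
    then obtain t where "t \<in> {-2..2} - {s}" "\<alpha> \<in> level t" "\<alpha> \<in> level s" by (elim IntE UN_E)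
    then show False using disj[of t] by blast
  qed
  have off: "\<alpha> h = 0" if "\<alpha> \<in> level s \<union> ?F" "h \<notin> cartan" for \<alpha> h
    using that by (elim UnE UN_E) (simp_all add: level_off_cartan)
  show ?thesis
    by (rule WS_disjoint[where F = "level s" and F' = ?F and y' = "\<Sum>t\<in>{-2..2} - {s}. y t"])
      (fact finite_level fin disjoint off y[OF s] rest zero)+
qed

lemma Theta_members:
  "wt 0 \<in> Theta" "wt (unit_wt i) \<in> Theta" "wt (unit_wt i + unit_wt j) \<in> Theta" "wt (unit_wt i - unit_wt j) \<in> Theta"
proof -
  show "wt 0 \<in> Theta" unfolding Theta_iff wt_zero by (intro disjI1 refl)
  show "wt (unit_wt i) \<in> Theta" unfolding Theta_iff epsilon_eq_wt[symmetric] by (rule disjI2, rule disjI2, rule exI[of _ i]) simp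
  show "wt (unit_wt i + unit_wt j) \<in> Theta"
    unfolding Theta_iff wt_add[symmetric] epsilon_eq_wt[symmetric]
    by (cases "i = j") (rule disjI2, rule disjI2, rule exI[of _ i], simp,
        rule disjI2, rule disjI1, rule exI[of _ i], rule exI[of _ j], simp)
  show "wt (unit_wt i - unit_wt j) \<in> Theta"
    unfolding Theta_iff wt_diff[symmetric] epsilon_eq_wt[symmetric]
    by (cases "i = j") (rule disjI1, simp,
        rule disjI2, rule disjI1, rule exI[of _ i], rule exI[of _ j], simp)
qed

lemma W_level:
  assumes "wt c \<in> (Theta :: ('f^'n^'n \<Rightarrow> 'f) set)" "tot c = s"
  shows "W c \<subseteq> WS (level s)"
  by (rule weight_space_WS[OF finite_level]) (use assms in \<open>auto simp: level_def\<close>)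

lemma tensor_levels_unprimed:
  "tensor_image sl A \<subseteq> WS (level 0)" "D \<subseteq> WS (level 0)" "tensor_image UNIV B \<subseteq> WS (level 1)"
  "tensor_image sym_mats C \<subseteq> WS (level 2)" "tensor_image skew_mats E \<subseteq> WS (level 2)"
proof -
  note L = W_level[OF Theta_members(1), of 0] W_level[OF Theta_members(2), of _ 1]
    W_level[OF Theta_members(3), of _ _ 2] W_level[OF Theta_members(4), of _ _ 0]
  show "D \<subseteq> WS (level 0)" using D_weight L(1) by (simp add: wt_zero)
  show "tensor_image UNIV B \<subseteq> WS (level 1)"
  proof (rule tensor_image_minimal[OF WS_subspace])
    fix m and b assume b: "b \<in> B"
    let ?N = "{m \<in> UNIV. b m \<in> WS (level 1)}"
    have N: "vec.subspace ?N"
      using b by (intro hom_preimage_subspace[OF sl_module_V] WS_subspace) (simp add: B_def)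
    have "axis p 1 \<in> ?N" for p using B_weight[OF b, of p] L(2) by auto
    then have "m \<in> ?N"
      by (subst vector_expansion) (intro vec.subspace_sum[OF N] vec.subspace_scale[OF N])
    then show "b m \<in> WS (level 1)" by simp
  qed
  show "tensor_image sl A \<subseteq> WS (level 0)"
  proof (rule tensor_image_minimal[OF WS_subspace])
    fix m :: "'f^'n^'n" and a assume m: "m \<in> sl" and a: "a \<in> A"
    have h: "a \<in> hom_space mscale comm_mat sl" using a by (simp add: A_def)
    let ?N = "{m \<in> sl. a m \<in> WS (level 0)}"
    have N: "mscale.subspace ?N" by (rule hom_preimage_subspace[OF sl_module_sl h WS_subspace])
    obtain r :: 'n where True by blast
    have "munit p q - (if p = q then munit r r else 0) \<in> ?N" for p q
    proof (cases "p = q")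
      case False
      then show ?thesis using subsetD[OF L(4) A_weight[OF a False]] by simp
    next
      case True
      show ?thesis
      proof (cases "p = r")
        case False
        \<comment> \<open>Diagonal values have weight zero since E_pp - E_rr is the commutator of
          E_pr and E_rp.\<close>
        have "ad p r (a (munit r p)) \<in> W 0"
          using ad_W[OF A_weight[OF a, of r p], of p r 0] False by simp
        moreover have "ad p r (a (munit r p)) = a (munit p p - munit r r)"
          using False by (simp add: ad_hom[OF h] comm_mat_def)
        ultimately show ?thesis using True L(1) cartan_in_sl[OF cartan_munit] by auto
      qed (use True mscale.subspace_0[OF N] in simp)
    qed
    from matrix_span[OF N this sl_expansion[OF m]] show "a m \<in> WS (level 0)" by simp
  qed
  show "tensor_image sym_mats C \<subseteq> WS (level 2)"
  proof (rule tensor_image_minimal[OF WS_subspace])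
    fix m :: "'f^'n^'n" and c assume m: "m \<in> sym_mats" and c: "c \<in> C"
    let ?N = "{m \<in> sym_mats. c m \<in> WS (level 2)}"
    have N: "mscale.subspace ?N"
      using c by (intro hom_preimage_subspace[OF sl_module_S _ WS_subspace]) (simp add: C_def)
    have "munit p q + munit q p \<in> ?N" for p q
      using C_weight[OF c, of p q] L(3)[of p q] by auto
    from matrix_span[OF N this sym_expansion] m show "c m \<in> WS (level 2)" by (simp add: sym_mats_def)
  qed
  show "tensor_image skew_mats E \<subseteq> WS (level 2)"
  proof (rule tensor_image_minimal[OF WS_subspace])
    fix m :: "'f^'n^'n" and e assume m: "m \<in> skew_mats" and e: "e \<in> E"
    let ?N = "{m \<in> skew_mats. e m \<in> WS (level 2)}"
    have N: "mscale.subspace ?N"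
      using e by (intro hom_preimage_subspace[OF sl_module_L _ WS_subspace]) (simp add: E_def)
    have "munit p q - munit q p \<in> ?N" for p q
      using E_weight[OF e, of p q] L(3)[of p q] by auto
    from matrix_span[OF N this skew_expansion] m show "e m \<in> WS (level 2)" by (simp add: skew_mats_def)
  qed
qed

lemma dual_WS_level:
  "sums_of (level s) (lie_algebra_over_sl.weight_space scale bracket dual_\<iota>) = WS (level (- s))"
proof -
  interpret dual: lie_algebra_over_sl scale bracket dual_\<iota> by (rule dual_lie_algebra)
  have inv: "- \<alpha> \<in> level (- s)" if "\<alpha> \<in> level s" for s and \<alpha> :: "'f^'n^'n \<Rightarrow> 'f"
  proof -
    from that obtain c where c: "\<alpha> = wt c" "tot c = s" "\<alpha> \<in> Theta" unfolding level_def by blast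
    then show ?thesis unfolding level_def by (intro CollectI conjI exI[of _ "- c"]) (simp_all add: wt_minus[symmetric])
  qed
  have sum_neg: "(\<Sum>\<alpha>\<in>level (- s). f (- \<alpha>)) = sum f (level s)" for f :: "_ \<Rightarrow> 'l" and s
    by (rule sum.reindex_bij_witness[where i = uminus and j = uminus]) (auto dest: inv)
  have "dual.WS (level s) \<subseteq> WS (level (- s))" for s
    unfolding dual.sums_of_def sums_of_def dual_weight_space
  proof clarify
    fix g assume "\<forall>\<alpha>\<in>level s. g \<alpha> \<in> weight_space (- \<alpha>)"
    then show "\<exists>g'. sum g (level s) = sum g' (level (- s)) \<and> (\<forall>\<alpha>\<in>level (- s). g' \<alpha> \<in> weight_space \<alpha>)"
      using inv[of _ "- s"] sum_neg[of g s] by (intro exI[of _ "\<lambda>\<alpha>. g (- \<alpha>)"]) force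
  qed
  moreover have "WS (level (- s)) \<subseteq> dual.WS (level s)"
    unfolding dual.sums_of_def sums_of_def dual_weight_space
  proof clarify
    fix g assume "\<forall>\<alpha>\<in>level (- s). g \<alpha> \<in> weight_space \<alpha>"
    then show "\<exists>g'. sum g (level (- s)) = sum g' (level s) \<and> (\<forall>\<alpha>\<in>level s. g' \<alpha> \<in> weight_space (- \<alpha>))"
      using inv[of _ s] sum_neg[of g "- s"] by (intro exI[of _ "\<lambda>\<alpha>. g (- \<alpha>)"]) force
  qed
  ultimately show ?thesis by blast
qed

lemma tensor_levels_primed:
  "tensor_image UNIV B' \<subseteq> WS (level (-1))"
  "tensor_image sym_mats C' \<subseteq> WS (level (-2))" "tensor_image skew_mats E' \<subseteq> WS (level (-2))"
proof -
  interpret dual: theta_graded5 scale bracket dual_\<iota> by (rule dual_theta_graded5)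
  show "tensor_image UNIV B' \<subseteq> WS (level (-1))"
    "tensor_image sym_mats C' \<subseteq> WS (level (-2))" "tensor_image skew_mats E' \<subseteq> WS (level (-2))"
    using dual.tensor_levels_unprimed(3-5) by (simp_all add: dual_spaces dual_WS_level)
qed

lemma coords_zero_sl:
  assumes "\<And>k. k < (N::nat) \<Longrightarrow> m k \<in> sl" "\<And>k. k < N \<Longrightarrow> \<phi> k \<in> A"
    and "\<And>i j. (\<Sum>k<N. hs (m k $ i $ j) (\<phi> k)) = 0"
  shows "(\<Sum>k<N. \<phi> k (m k)) = 0"
proof -
  obtain r :: 'n where True by blast
  let ?b = "\<lambda>p. munit (fst p) (snd p) - (if fst p = snd p then munit r r else 0)"
  have exp: "x = (\<Sum>p\<in>UNIV. mscale (x $ fst p $ snd p) (?b p))" if "x \<in> sl" for x :: "'f^'n^'n"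
    using sl_expansion[OF that, of r] by (simp add: sum.cartesian_product split_def flip: UNIV_Times_UNIV)
  show ?thesis
  proof (rule coords_zero_imp[OF sl_module_sl _ _ _ exp])
    show "\<phi> k \<in> hom_space mscale comm_mat sl" if "k \<in> {..<N}" for k using assms(2) that by (simp add: A_def)
    show "?b p \<in> sl" for p :: "'n \<times> 'n" by (simp add: sl_def)
  qed (use assms(1,3) in auto)
qed

lemma tensor_sl_D:
  assumes "y \<in> tensor_image sl A" "d \<in> D" "y + d = 0"
  shows "y = 0"
proof -
  obtain N m \<phi> where y: "\<And>k. k < (N::nat) \<Longrightarrow> m k \<in> sl" "\<And>k. k < N \<Longrightarrow> \<phi> k \<in> A" "y = (\<Sum>k<N. \<phi> k (m k))"
    using tensor_imageE[OF assms(1) hom_subspaces(1)] by blast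
  have coords: "(\<Sum>k<N. hs (m k $ i $ j) (\<phi> k)) = 0" for i j
    using coords_sl[of "{..<N}" \<phi> m d i j] y assms by simp
  show ?thesis unfolding y(3) by (rule coords_zero_sl[OF y(1,2) coords])
qed

lemma tensor_S_L:
  assumes "y \<in> tensor_image sym_mats C" "z \<in> tensor_image skew_mats E" "y + z = 0"
  shows "y = 0"
proof -
  obtain N m \<phi> where y: "\<And>k. k < (N::nat) \<Longrightarrow> m k \<in> sym_mats" "\<And>k. k < N \<Longrightarrow> \<phi> k \<in> C" "y = (\<Sum>k<N. \<phi> k (m k))"
    using tensor_imageE[OF assms(1) hom_subspaces(4)] by blast
  obtain N' m' \<psi> where z: "\<And>k. k < (N'::nat) \<Longrightarrow> m' k \<in> skew_mats" "\<And>k. k < N' \<Longrightarrow> \<psi> k \<in> E" "z = (\<Sum>k<N'. \<psi> k (m' k))"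
    using tensor_imageE[OF assms(2) hom_subspaces(6)] by blast
  have coords: "(\<Sum>k<N. hs (m k $ i $ j) (\<phi> k)) = 0" for i j
    using coords_S_L(1)[of "{..<N}" \<phi> m "{..<N'}" \<psi> m' i j] y z assms(3) by simp
  have coords2: "(\<Sum>k<N. hs (m k $ i $ j / 2) (\<phi> k)) = 0" for i j
  proof -
    have "(\<Sum>k<N. hs (m k $ i $ j / 2) (\<phi> k)) = hs (1/2) (\<Sum>k<N. hs (m k $ i $ j) (\<phi> k))"
      by (simp add: module.scale_sum_right[OF module_hs] module.scale_scale[OF module_hs])
    then show ?thesis using coords by (simp add: module.scale_zero_right[OF module_hs])
  qed
  let ?b = "\<lambda>p. munit (fst p) (snd p) + munit (snd p) (fst p)"
  have exp: "x = (\<Sum>p\<in>UNIV. mscale (x $ fst p $ snd p / 2) (?b p))" if "x \<in> sym_mats" for x :: "'f^'n^'n"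
    using sym_expansion[of x] that
    by (simp add: sum.cartesian_product split_def sym_mats_def flip: UNIV_Times_UNIV)
  have "(\<Sum>k<N. \<phi> k (m k)) = 0"
  proof (rule coords_zero_imp[OF sl_module_S _ _ _ exp])
    show "\<phi> k \<in> hom_space mscale act_S sym_mats" if "k \<in> {..<N}" for k using y(2) that by (simp add: C_def)
  qed (use y(1) coords2 in auto)
  then show ?thesis using y(3) by simp
qed

lemma tensor_S'_L':
  assumes "y \<in> tensor_image sym_mats C'" "z \<in> tensor_image skew_mats E'" "y + z = 0"
  shows "y = 0"
proof -
  interpret dual: theta_graded5 scale bracket dual_\<iota> by (rule dual_theta_graded5)
  show ?thesis using dual.tensor_S_L assms by (simp add: dual_spaces)
qed

text \<open>Spanning is checked weight space by weight space. For independence the eight components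
  are grouped by level, which leaves three pairs with a common level: \<open>A\<close> and
  \<open>D\<close>, \<open>C\<close> and \<open>E\<close>, \<open>C'\<close> and \<open>E'\<close>.
  Each pair is separated by coefficients.\<close>

lemma isotypic: isotypic_decomposition
proof -
  let ?l = "[tensor_image sl A, tensor_image UNIV B, tensor_image UNIV B',
             tensor_image sym_mats C, tensor_image sym_mats C',
             tensor_image skew_mats E, tensor_image skew_mats E', D]"
  let ?W = "(!) ?l" and ?I = "{..<8::nat}"
  have I: "?I = {0, 1, 2, 3, 4, 5, 6, 7}" by auto
  have sub: "subspace (?W i)" if "i \<in> ?I" for i
    using that unfolding I by (auto simp: tensor_image_subspace D_subspace)
  let ?U = "sums_of ?I ?W"
  have U: "subspace ?U" by (rule sums_of_subspace[OF sub])
  have up: "?W i \<subseteq> ?U" if "i \<in> ?I" for i by (rule sums_of_upper[OF _ that sub]) auto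
  have incl: "tensor_image sl A \<subseteq> ?U" "tensor_image UNIV B \<subseteq> ?U" "tensor_image UNIV B' \<subseteq> ?U"
    "tensor_image sym_mats C \<subseteq> ?U" "tensor_image sym_mats C' \<subseteq> ?U" "tensor_image skew_mats E \<subseteq> ?U"
    "tensor_image skew_mats E' \<subseteq> ?U" "D \<subseteq> ?U"
    using up[of 0] up[of 1] up[of 2] up[of 3] up[of 4] up[of 5] up[of 6] up[of 7] by simp_all
  have in_U: "\<phi> m \<in> ?U" if "m \<in> M" "\<phi> \<in> H" "tensor_image M H \<subseteq> ?U" for \<phi> :: "'m \<Rightarrow> 'l" and m M H
    using tensor_imageI[OF that(1,2)] that(3) by blast
  have W_A: "W (unit_wt i - unit_wt j) \<subseteq> ?U" if ij: "i \<noteq> j" for i j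
  proof
    fix x assume "x \<in> W (unit_wt i - unit_wt j)"
    then obtain a where "a \<in> A" "a (munit i j) = x" by (rule A_exists[OF ij])
    then show "x \<in> ?U" using in_U[of "munit i j" sl a A] ij incl by auto
  qed
  have W_B: "W (unit_wt i) \<subseteq> ?U" "W (- unit_wt i) \<subseteq> ?U" for i
  proof (safe)
    fix x assume "x \<in> W (unit_wt i)"
    then obtain b where "b \<in> B" "b (axis i 1) = x" by (rule B_exists)
    then show "x \<in> ?U" using in_U[of "axis i 1" UNIV b B] incl by auto
  next
    fix x assume "x \<in> W (- unit_wt i)"
    then obtain b where "b \<in> B'" "b (axis i 1) = x" by (rule B'_exists)
    then show "x \<in> ?U" using in_U[of "axis i 1" UNIV b B'] incl by auto
  qed
  have W_C: "W (unit_wt i + unit_wt j) \<subseteq> ?U" for i j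
  proof
    fix x assume x: "x \<in> W (unit_wt i + unit_wt j)"
    show "x \<in> ?U"
    proof (cases "i = j")
      case True
      from x[folded True] obtain c where "c \<in> C" "c (munit i i) = x" by (rule C_exists_diag)
      then show ?thesis using in_U[of "munit i i" sym_mats c C] incl by auto
    next
      case False
      obtain c e where "c \<in> C" "e \<in> E" "x = c (munit i j + munit j i) + e (munit i j - munit j i)"
        by (rule CE_exists[OF False x])
      then show ?thesis
        using in_U[of "munit i j + munit j i" sym_mats c C] in_U[of "munit i j - munit j i" skew_mats e E] incl
        by (auto intro: subspace_add[OF U])
    qed
  qed
  have W_C': "W (- (unit_wt i + unit_wt j)) \<subseteq> ?U" for i j
  proof
    fix x assume x: "x \<in> W (- (unit_wt i + unit_wt j))"
    show "x \<in> ?U"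
    proof (cases "i = j")
      case True
      from x[folded True] obtain c where "c \<in> C'" "c (munit i i) = x" by (rule C'_exists_diag)
      then show ?thesis using in_U[of "munit i i" sym_mats c C'] incl by auto
    next
      case False
      have "x \<in> W (- unit_wt i - unit_wt j)" using x by simp
      then obtain c e where "c \<in> C'" "e \<in> E'" "x = c (munit i j + munit j i) + e (munit i j - munit j i)"
        by (rule CE'_exists[OF False])
      then show ?thesis
        using in_U[of "munit i j + munit j i" sym_mats c C'] in_U[of "munit i j - munit j i" skew_mats e E'] incl
        by (auto intro: subspace_add[OF U])
    qed
  qed
  have W_0: "W 0 \<subseteq> ?U"
  proof
    fix z assume "z \<in> W 0"
    then obtain y where "y \<in> tensor_image sl A" "z - y \<in> D" using zero_weight_decomposition by blast
    then have "y + (z - y) \<in> ?U" using incl by (intro subspace_add[OF U]) blast+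
    then show "z \<in> ?U" by simp
  qed
  have W_U: "weight_space \<alpha> \<subseteq> ?U" if "\<alpha> \<in> Theta" for \<alpha> :: "'f^'n^'n \<Rightarrow> 'f"
    using that unfolding Theta_iff
  proof (elim disjE exE conjE)
    fix i j :: 'n
    assume "i \<noteq> j" and \<alpha>: "\<alpha> \<in> {\<epsilon> i + \<epsilon> j, \<epsilon> i - \<epsilon> j, - \<epsilon> i + \<epsilon> j, - \<epsilon> i - \<epsilon> j}"
    have e: "- \<epsilon> i + \<epsilon> j = (\<epsilon> j - \<epsilon> i :: 'f^'n^'n \<Rightarrow> 'f)" "- \<epsilon> i - \<epsilon> j = (- (\<epsilon> i + \<epsilon> j) :: 'f^'n^'n \<Rightarrow> 'f)"
      by simp_all
    have "\<alpha> \<in> {wt (unit_wt i + unit_wt j), wt (unit_wt i - unit_wt j), wt (unit_wt j - unit_wt i),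
        wt (- (unit_wt i + unit_wt j))}"
      using \<alpha> unfolding e unfolding epsilon_eq_wt wt_add wt_diff wt_minus .
    then show ?thesis
      using W_C[of i j] W_C'[of i j] W_A[of i j] W_A[of j i] \<open>i \<noteq> j\<close> \<open>i \<noteq> j\<close>[symmetric]
      by (elim insertE emptyE) (simp_all only: simp_thms)
  next
    fix i :: 'n
    assume "\<alpha> \<in> {\<epsilon> i, - \<epsilon> i, \<epsilon> i + \<epsilon> i, - (\<epsilon> i + \<epsilon> i)}"
    then have "\<alpha> \<in> {wt (unit_wt i), wt (- unit_wt i), wt (unit_wt i + unit_wt i), wt (- (unit_wt i + unit_wt i))}"
      unfolding epsilon_eq_wt wt_add wt_diff wt_minus .
    then show ?thesis
      using W_C[of i i] W_C'[of i i] W_B[of i] by (elim insertE emptyE) (simp_all only:)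
  next
    assume "\<alpha> = 0"
    then show ?thesis using W_0 by (simp only: wt_zero)
  qed
  have span: "UNIV = {sum f Theta |f. \<forall>\<alpha>\<in>Theta. f \<alpha> \<in> weight_space \<alpha>}"
    using weight_decomposition unfolding direct_sum_of_def by (elim conjE)
  have UNIV_U: "UNIV = ?U"
  proof (intro set_eqI iffI UNIV_I)
    fix x :: 'l
    have "x \<in> {sum f Theta |f. \<forall>\<alpha>\<in>Theta. f \<alpha> \<in> weight_space \<alpha>}"
      unfolding span[symmetric] by simp
    then obtain f where f: "x = sum f Theta" "\<forall>\<alpha>\<in>Theta. f \<alpha> \<in> weight_space \<alpha>" by blast
    show "x \<in> ?U" unfolding f(1)
    proof (rule subspace_sum[OF U])
      fix \<alpha> :: "'f^'n^'n \<Rightarrow> 'f" assume "\<alpha> \<in> Theta"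
      then show "f \<alpha> \<in> ?U" using subsetD[OF W_U] f(2) by simp
    qed
  qed
  have indep: "\<forall>i\<in>?I. f i = 0" if f: "\<forall>i\<in>?I. f i \<in> ?W i" and f0: "sum f ?I = 0" for f
  proof -
    have f': "f 0 \<in> tensor_image sl A" "f 1 \<in> tensor_image UNIV B" "f 2 \<in> tensor_image UNIV B'"
      "f 3 \<in> tensor_image sym_mats C" "f 4 \<in> tensor_image sym_mats C'" "f 5 \<in> tensor_image skew_mats E"
      "f 6 \<in> tensor_image skew_mats E'" "f 7 \<in> D"
      using f[unfolded I] by simp_all
    have sum8: "f 0 + f 1 + f 2 + f 3 + f 4 + f 5 + f 6 + f 7 = 0"
      using f0 unfolding I by (simp add: algebra_simps)
    \<comment> \<open>The components collected by level; the last branch is meant for level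
      -2.\<close>
    define y where "y s = (if s = 0 then f 0 + f 7 else if s = 1 then f 1 else if s = -1 then f 2
      else if s = 2 then f 3 + f 5 else f 4 + f 6)" for s :: int
    have J: "{-2..2} = {-2, -1, 0, 1, 2::int}" by auto
    have "y 0 \<in> WS (level 0)" "y 1 \<in> WS (level 1)" "y (-1) \<in> WS (level (-1))" "y 2 \<in> WS (level 2)"
      "y (-2) \<in> WS (level (-2))"
      using subsetD[OF tensor_levels_unprimed(1) f'(1)] subsetD[OF tensor_levels_unprimed(2) f'(8)]
        subsetD[OF tensor_levels_unprimed(3) f'(2)] subsetD[OF tensor_levels_unprimed(4) f'(4)]
        subsetD[OF tensor_levels_unprimed(5) f'(6)] subsetD[OF tensor_levels_primed(1) f'(3)]
        subsetD[OF tensor_levels_primed(2) f'(5)] subsetD[OF tensor_levels_primed(3) f'(7)]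
      by (simp_all add: y_def subspace_add[OF WS_subspace])
    then have y_WS: "y s \<in> WS (level s)" if "s \<in> {-2..2}" for s
      using that unfolding J by (elim insertE emptyE) (simp_all only:)
    have "(\<Sum>s\<in>{-2..2}. y s) = 0"
      using sum8 unfolding J by (simp add: y_def algebra_simps)
    note y0 = levels_independent[of y, OF y_WS this]
    have eqs: "f 0 + f 7 = 0" "f 1 = 0" "f 2 = 0" "f 3 + f 5 = 0" "f 4 + f 6 = 0"
      using y0[of 0] y0[of 1] y0[of "-1"] y0[of 2] y0[of "-2"] by (simp_all add: y_def)
    have "f 0 = 0" using tensor_sl_D[OF f'(1,8)] eqs by simp
    moreover have "f 3 = 0" using tensor_S_L[OF f'(4,6)] eqs by simp
    moreover have "f 4 = 0" using tensor_S'_L'[OF f'(5,7)] eqs by simp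
    ultimately show ?thesis using eqs unfolding I by simp
  qed
  have "direct_sum_of scale ?I ?W UNIV"
    unfolding direct_sum_of_def
  proof (intro conjI allI impI)
    show "UNIV = {sum f ?I |f. \<forall>i\<in>?I. f i \<in> ?W i}" using UNIV_U unfolding sums_of_def .
  next
    fix f assume "(\<forall>i\<in>?I. f i \<in> ?W i) \<and> sum f ?I = 0"
    then show "\<forall>i\<in>?I. f i = 0" by (intro indep) blast+
  qed (use sub in auto)
  then show ?thesis
    unfolding isotypic_decomposition_def
    using tensor_injective_unprimed tensor_injective_primed by blast
qed

text \<open>Independence compares coefficients in \<open>A\<close>: those of one part are symmetric
  in (i,j), those of the other skew, and they add up to zero, so twice the symmetric ones
  vanish.\<close>

lemma sym_skew: sym_skew_decomposition
proof -
  let ?W = "(!) [tensor_image (sl \<inter> sym_mats) A, tensor_image (sl \<inter> skew_mats) A]" and ?I = "{..<2::nat}"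
  have I: "?I = {0, 1}" by auto
  have sub: "subspace (?W i)" if "i \<in> ?I" for i
    using that unfolding I by (auto simp: tensor_image_subspace)
  have U: "subspace (sums_of ?I ?W)" by (rule sums_of_subspace[OF sub])
  have up: "?W i \<subseteq> sums_of ?I ?W" if "i \<in> ?I" for i by (rule sums_of_upper[OF _ that sub]) auto
  have mono: "tensor_image (sl \<inter> M) A \<subseteq> tensor_image sl A" for M :: "('f^'n^'n) set"
    by (rule tensor_image_minimal[OF tensor_image_subspace]) (auto intro: tensor_imageI)
  have sums: "tensor_image sl A = sums_of ?I ?W"
  proof
    show "sums_of ?I ?W \<subseteq> tensor_image sl A"
      unfolding sums_of_def I using mono by (auto intro!: subspace_add[OF tensor_image_subspace])
    show "tensor_image sl A \<subseteq> sums_of ?I ?W"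
    proof (rule tensor_image_minimal[OF U])
      fix m :: "'f^'n^'n" and a assume m: "m \<in> sl" and a: "a \<in> A"
      let ?s = "mscale (1/2) (m + transpose m)" and ?t = "mscale (1/2) (m - transpose m)"
      have s: "?s \<in> sl \<inter> sym_mats" and t: "?t \<in> sl \<inter> skew_mats"
        using m by (auto simp: sl_def sym_mats_def skew_mats_def transpose_mscale transpose_add transpose_diff
            add.commute mscale_diff)
      have "a ?s \<in> sums_of ?I ?W" "a ?t \<in> sums_of ?I ?W"
        using tensor_imageI[OF s a] tensor_imageI[OF t a] up[of 0] up[of 1] by auto
      moreover have "m = ?s + ?t" by (simp add: vec_eq_iff field_simps)
      then have "a m = a ?s + a ?t" using s t hom_spaceD(4)[OF a[unfolded A_def], of ?s ?t] by simp
      ultimately show "a m \<in> sums_of ?I ?W" using subspace_add[OF U] by simp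
    qed
  qed
  have indep: "y = 0" if y: "y \<in> tensor_image (sl \<inter> sym_mats) A" and z: "z \<in> tensor_image (sl \<inter> skew_mats) A"
    and "y + z = 0" for y z
  proof -
    obtain N m \<phi> where y: "\<And>k. k < (N::nat) \<Longrightarrow> m k \<in> sl \<inter> sym_mats" "\<And>k. k < N \<Longrightarrow> \<phi> k \<in> A" "y = (\<Sum>k<N. \<phi> k (m k))"
      using tensor_imageE[OF y hom_subspaces(1)] by blast
    obtain N' m' \<psi> where z: "\<And>k. k < (N'::nat) \<Longrightarrow> m' k \<in> sl \<inter> skew_mats" "\<And>k. k < N' \<Longrightarrow> \<psi> k \<in> A" "z = (\<Sum>k<N'. \<psi> k (m' k))"
      using tensor_imageE[OF z hom_subspaces(1)] by blast
    define \<Phi> \<Psi> where "\<Phi> i j = (\<Sum>k<N. hs (m k $ i $ j) (\<phi> k))"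
      and "\<Psi> i j = (\<Sum>k<N'. hs (m' k $ i $ j) (\<psi> k))" for i j
    have sum0: "\<Phi> i j + \<Psi> i j = 0" for i j
      using coords_sl[of "{..<N} <+> {..<N'}" "case_sum \<phi> \<psi>" "case_sum m m'" 0 i j] y z \<open>y + z = 0\<close>
        subspace_0[OF D_subspace]
      by (force simp: \<Phi>_def \<Psi>_def sum.Plus)
    have "\<Phi> i j = 0" for i j
    proof -
      have 1: "\<Phi> j i = \<Phi> i j" unfolding \<Phi>_def
        by (rule sum.cong[OF refl]) (use sym_mats_nth[of "m _" j i] y(1) in auto)
      have 2: "\<Psi> j i = - \<Psi> i j" unfolding \<Psi>_def sum_negf[symmetric]
        by (rule sum.cong[OF refl])
          (use skew_mats_nth[of "m' _" j i] z(1) in \<open>auto simp: module.scale_minus_left[OF module_hs]\<close>)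
      have "\<Psi> i j = \<Phi> i j" using sum0[of j i] unfolding 1 2 by simp
      then have "\<Phi> i j + \<Phi> i j = 0" using sum0[of i j] by simp
      then have "hs 2 (\<Phi> i j) = 0"
        using module.scale_left_distrib[OF module_hs, of 1 1 "\<Phi> i j"]
        by (simp add: module.scale_one[OF module_hs])
      then show ?thesis by (simp add: vector_space.scale_eq_0_iff[OF vector_space_hs])
    qed
    then show ?thesis unfolding y(3) using y(1,2) by (intro coords_zero_sl) (auto simp: \<Phi>_def)
  qed
  show ?thesis
    unfolding sym_skew_decomposition_def direct_sum_of_def
  proof (intro conjI allI impI)
    show "tensor_image sl A = {sum f ?I |f. \<forall>i\<in>?I. f i \<in> ?W i}" using sums unfolding sums_of_def .
  next
    fix f assume f: "(\<forall>i\<in>?I. f i \<in> ?W i) \<and> sum f ?I = 0"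
    then have "f 0 = 0" by (intro indep[of "f 0" "f 1"]) (auto simp: I)
    then show "\<forall>i\<in>?I. f i = 0" using f by (simp add: I)
  qed (use sub in auto)
qed

end

section \<open>Equivariant bilinear maps\<close>

lemma bilinear_onD:
  assumes "bilinear_on sX X sY Y sZ Z f"
  shows "x \<in> X \<Longrightarrow> y \<in> Y \<Longrightarrow> f x y \<in> Z"
    "x \<in> X \<Longrightarrow> y \<in> Y \<Longrightarrow> y' \<in> Y \<Longrightarrow> f x (y + y') = f x y + f x y'"
    "x \<in> X \<Longrightarrow> y \<in> Y \<Longrightarrow> f x (sY k y) = sZ k (f x y)"
    "x \<in> X \<Longrightarrow> x' \<in> X \<Longrightarrow> y \<in> Y \<Longrightarrow> f (x + x') y = f x y + f x' y"
    "x \<in> X \<Longrightarrow> y \<in> Y \<Longrightarrow> f (sX k x) y = sZ k (f x y)"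
  using assms unfolding bilinear_on_def linear_on_def by blast+

lemma bilinear_onI:
  assumes "\<And>x y. x \<in> X \<Longrightarrow> y \<in> Y \<Longrightarrow> f x y \<in> Z"
    "\<And>x y y'. x \<in> X \<Longrightarrow> y \<in> Y \<Longrightarrow> y' \<in> Y \<Longrightarrow> f x (y + y') = f x y + f x y'"
    "\<And>x y k. x \<in> X \<Longrightarrow> y \<in> Y \<Longrightarrow> f x (sY k y) = sZ k (f x y)"
    "\<And>x x' y. x \<in> X \<Longrightarrow> x' \<in> X \<Longrightarrow> y \<in> Y \<Longrightarrow> f (x + x') y = f x y + f x' y"
    "\<And>x y k. x \<in> X \<Longrightarrow> y \<in> Y \<Longrightarrow> f (sX k x) y = sZ k (f x y)"
  shows "bilinear_on sX X sY Y sZ Z f"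
  using assms unfolding bilinear_on_def linear_on_def by blast

text \<open>Product spaces let a single use of \<open>bilinear_rule\<close> deliver several
  coordinate maps at once, as when a bracket has a \<open>C\<close> part and an \<open>E\<close>
  part.\<close>

definition scale_pair :: "('f \<Rightarrow> 'x \<Rightarrow> 'x) \<Rightarrow> ('f \<Rightarrow> 'y \<Rightarrow> 'y) \<Rightarrow> 'f \<Rightarrow> 'x \<times> 'y \<Rightarrow> 'x \<times> 'y" where
  "scale_pair sX sY k p = (sX k (fst p), sY k (snd p))"

lemma vector_space_pair_scale:
  assumes "vector_space sX" "vector_space sY"
  shows "vector_space (scale_pair sX sY)"
proof -
  interpret X: vector_space sX by fact
  interpret Y: vector_space sY by fact
  show ?thesis
    by standard (simp_all add: scale_pair_def prod_eq_iff X.scale_right_distrib Y.scale_right_distrib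
        X.scale_left_distrib Y.scale_left_distrib)
qed

lemma subspace_Times:
  assumes "vector_space sX" "vector_space sY" "module.subspace sX X" "module.subspace sY Y"
  shows "module.subspace (scale_pair sX sY) (X \<times> Y)"
proof -
  interpret X: vector_space sX by fact
  interpret Y: vector_space sY by fact
  interpret XY: vector_space "scale_pair sX sY" by (rule vector_space_pair_scale[OF assms(1,2)])
  show ?thesis
    by (rule XY.subspaceI) (auto simp: scale_pair_def zero_prod_def X.subspace_0[OF assms(3)] Y.subspace_0[OF assms(4)]
        X.subspace_add[OF assms(3)] Y.subspace_add[OF assms(4)]
        X.subspace_scale[OF assms(3)] Y.subspace_scale[OF assms(4)])
qed

lemma bilinear_on_fst_snd:
  assumes "bilinear_on sX X sY Y (scale_pair sZ sZ') (Z \<times> Z') f"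
  shows "bilinear_on sX X sY Y sZ Z (\<lambda>x y. fst (f x y))" "bilinear_on sX X sY Y sZ' Z' (\<lambda>x y. snd (f x y))"
proof -
  have "f x y \<in> Z \<times> Z'" if "x \<in> X" "y \<in> Y" for x y using bilinear_onD(1)[OF assms that] .
  then have mem: "fst (f x y) \<in> Z" "snd (f x y) \<in> Z'" if "x \<in> X" "y \<in> Y" for x y
    using that by (simp_all add: mem_Times_iff)
  show "bilinear_on sX X sY Y sZ Z (\<lambda>x y. fst (f x y))" "bilinear_on sX X sY Y sZ' Z' (\<lambda>x y. snd (f x y))"
    by (rule bilinear_onI; simp add: mem bilinear_onD(2-5)[OF assms] scale_pair_def)+
qed

definition sl_bilinear where
  "sl_bilinear sM act M sN act' N sK act'' K opn \<longleftrightarrow> bilinear_on sM M sN N sK K opn \<and>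
     (\<forall>x\<in>sl. \<forall>m\<in>M. \<forall>n\<in>N. act'' x (opn m n) = opn (act x m) n + opn m (act' x n))"

definition sl_invariant_form where
  "sl_invariant_form sM act M sN act' N form \<longleftrightarrow> bilinear_on sM M sN N (*) UNIV form \<and>
     (\<forall>x\<in>sl. \<forall>m\<in>M. \<forall>n\<in>N. form (act x m) n + form m (act' x n) = 0)"

context lie_algebra_over_sl
begin

definition equivariant where
  "equivariant sM act M sN act' N f \<longleftrightarrow> bilinear_on sM M sN N scale UNIV f \<and>
     (\<forall>p q. p \<noteq> q \<longrightarrow> (\<forall>m\<in>M. \<forall>n\<in>N. ad p q (f m n) = f (act (munit p q) m) n + f m (act' (munit p q) n)))"

lemma equivariant_add:
  assumes "equivariant sM act M sN act' N f" "equivariant sM act M sN act' N g"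
  shows "equivariant sM act M sN act' N (\<lambda>m n. f m n + g m n)"
  using assms unfolding equivariant_def
  by (auto intro!: bilinear_onI simp: bilinear_onD(2-5) scale_right_distrib bracket_add_right)

lemma equivariant_diff:
  assumes "equivariant sM act M sN act' N f" "equivariant sM act M sN act' N g"
  shows "equivariant sM act M sN act' N (\<lambda>m n. f m n - g m n)"
  using assms unfolding equivariant_def
  by (auto intro!: bilinear_onI simp: bilinear_onD(2-5) scale_right_diff_distrib bracket_diff_right)

lemma bracket_equivariant:
  assumes "\<phi> \<in> hom_space sM act M" "\<psi> \<in> hom_space sN act' N"
  shows "equivariant sM act M sN act' N (\<lambda>m n. bracket (\<phi> m) (\<psi> n))"
  unfolding equivariant_def
  by (auto intro!: bilinear_onI simp: hom_spaceD(4,5)[OF assms(1)] hom_spaceD(4,5)[OF assms(2)]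
      bracket_add_left bracket_add_right bracket_scale_left bracket_scale_right ad_bracket
      ad_hom[OF assms(1)] ad_hom[OF assms(2)])

lemma hom_equivariant:
  assumes \<xi>: "\<xi> \<in> hom_space sK act'' K" and opn: "sl_bilinear sM act M sN act' N sK act'' K opn"
    and M: "sl_module sM act M" and N: "sl_module sN act' N"
  shows "equivariant sM act M sN act' N (\<lambda>m n. \<xi> (opn m n))"
proof -
  have bil: "bilinear_on sM M sN N sK K opn" using opn by (simp add: sl_bilinear_def)
  note D = bilinear_onD[OF bil]
  have "ad p q (\<xi> (opn m n)) = \<xi> (opn (act (munit p q) m) n) + \<xi> (opn m (act' (munit p q) n))"
    if "p \<noteq> q" "m \<in> M" "n \<in> N" for p q m n
  proof -
    have "ad p q (\<xi> (opn m n)) = \<xi> (opn (act (munit p q) m) n + opn m (act' (munit p q) n))"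
      using that opn by (simp add: ad_hom[OF \<xi>] D(1) sl_bilinear_def)
    also have "\<dots> = \<xi> (opn (act (munit p q) m) n) + \<xi> (opn m (act' (munit p q) n))"
      using that by (intro hom_spaceD(4)[OF \<xi>] D(1)) (simp_all add: sl_module.act_closed[OF M] sl_module.act_closed[OF N])
    finally show ?thesis .
  qed
  then show ?thesis
    unfolding equivariant_def by (auto intro!: bilinear_onI simp: D hom_spaceD(4,5)[OF \<xi>])
qed

lemma form_equivariant:
  assumes d: "d \<in> D" and form: "sl_invariant_form sM act M sN act' N form"
  shows "equivariant sM act M sN act' N (\<lambda>m n. scale (form m n) d)"
proof -
  have bil: "bilinear_on sM M sN N (*) UNIV form" using form by (simp add: sl_invariant_form_def)
  have "ad p q (scale (form m n) d) = scale (form (act (munit p q) m) n) d + scale (form m (act' (munit p q) n)) d"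
    if "p \<noteq> q" "m \<in> M" "n \<in> N" for p q m n
  proof -
    have "scale (form (act (munit p q) m) n) d + scale (form m (act' (munit p q) n)) d = 0"
      using form that unfolding sl_invariant_form_def by (simp flip: scale_left_distrib)
    then show ?thesis using d that by (simp add: bracket_scale_right D_iff)
  qed
  then show ?thesis
    unfolding equivariant_def
    by (auto intro!: bilinear_onI simp: bilinear_onD(2-5)[OF bil] scale_left_distrib)
qed

text \<open>With \<open>w\<close> fixed, the m with \<open>f m w = 0\<close> are stable under
  \<open>R\<close>, because the second term of the Leibniz rule dies on \<open>w\<close>. Then the n
  on which f vanishes for every m are stable under all root vectors, and \<open>w\<close> is among
  them.\<close>

lemma equivariant_eq_zero:
  assumes M: "sl_module sM act M" "sl_module.generated_by sM act M R v"
    and N: "sl_module sN act' N" "sl_module.generated_by sN act' N R' w"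
    and kill: "\<And>p q. (p, q) \<in> R \<Longrightarrow> p \<noteq> q \<Longrightarrow> act' (munit p q) w = 0"
    and f: "equivariant sM act M sN act' N f" "f v w = 0"
    and "m \<in> M" "n \<in> N"
  shows "f m n = 0"
proof -
  interpret M: sl_module sM act M by fact
  interpret N: sl_module sN act' N by fact
  have bil: "bilinear_on sM M sN N scale UNIV f" using f by (simp add: equivariant_def)
  note D = bilinear_onD[OF bil]
  have w: "w \<in> N" and v: "v \<in> M" using M(2) N(2) by (simp_all add: M.generated_by_def N.generated_by_def)
  have zero: "f 0 n = 0" if "n \<in> N" for n using D(5)[OF v that, of 0] by simp
  have zero': "f m 0 = 0" if "m \<in> M" for m using D(3)[OF that w, of 0] by simp
  have ad: "ad p q (f m n) = f (act (munit p q) m) n + f m (act' (munit p q) n)"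
    if "p \<noteq> q" "m \<in> M" "n \<in> N" for p q m n using f(1) that by (simp add: equivariant_def)
  have "{m \<in> M. f m w = 0} = M"
  proof (rule M.generated_byD[OF M(2)])
    show "M.subspace {m \<in> M. f m w = 0}"
      using w by (intro M.subspaceI) (simp_all add: D zero M.subspace_0[OF M.carrier_subspace]
          M.subspace_add[OF M.carrier_subspace] M.subspace_scale[OF M.carrier_subspace])
    show "v \<in> {m \<in> M. f m w = 0}" using v f(2) by simp
  next
    fix p q :: 'n and m assume pq: "(p, q) \<in> R" "p \<noteq> q" and m: "m \<in> {m \<in> M. f m w = 0}"
    then show "act (munit p q) m \<in> {m \<in> M. f m w = 0}"
      using ad[of p q m w] kill[OF pq] w zero'[of m] by (simp add: M.act_closed)
  qed blast
  then have 1: "f m w = 0" if "m \<in> M" for m using that by blast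
  have "{n \<in> N. \<forall>m\<in>M. f m n = 0} = N"
  proof (rule N.generated_byD[OF N(2)])
    show "N.subspace {n \<in> N. \<forall>m\<in>M. f m n = 0}"
      by (intro N.subspaceI) (simp_all add: D zero' N.subspace_0[OF N.carrier_subspace]
          N.subspace_add[OF N.carrier_subspace] N.subspace_scale[OF N.carrier_subspace])
    show "w \<in> {n \<in> N. \<forall>m\<in>M. f m n = 0}" using w 1 by simp
  next
    fix p q :: 'n and n assume pq: "p \<noteq> q" and n: "n \<in> {n \<in> N. \<forall>m\<in>M. f m n = 0}"
    then show "act' (munit p q) n \<in> {n \<in> N. \<forall>m\<in>M. f m n = 0}"
      using ad[OF pq, of _ n] by (simp add: M.act_closed N.act_closed)
  qed blast
  then show ?thesis using assms(8,9) by blast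
qed

text \<open>\<open>T\<close> is the space of admissible coordinates and \<open>ev t\<close> the
  equivariant map with coordinates \<open>t\<close>. At (v, w) coordinates exist by
  \<open>surj\<close> and are unique by \<open>inj\<close>; uniqueness makes the chosen
  \<open>f\<close> bilinear, and \<open>equivariant_eq_zero\<close> spreads the equality from (v, w)
  to all pairs.\<close>

lemma bilinear_rule:
  assumes M: "sl_module sM act M" "sl_module.generated_by sM act M R v"
    and N: "sl_module sN act' N" "sl_module.generated_by sN act' N R' w"
    and kill: "\<And>p q. (p, q) \<in> R \<Longrightarrow> p \<noteq> q \<Longrightarrow> act' (munit p q) w = 0"
    and T: "vector_space sT" "module.subspace sT T"
    and equi: "\<And>t. t \<in> T \<Longrightarrow> equivariant sM act M sN act' N (ev t)"
    and ev_add: "\<And>t t'. t \<in> T \<Longrightarrow> t' \<in> T \<Longrightarrow> ev (t + t') v w = ev t v w + ev t' v w"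
    and ev_scale: "\<And>k t. t \<in> T \<Longrightarrow> ev (sT k t) v w = scale k (ev t v w)"
    and inj: "\<And>t. t \<in> T \<Longrightarrow> ev t v w = 0 \<Longrightarrow> t = 0"
    and surj: "\<And>\<phi> \<psi>. \<phi> \<in> hom_space sM act M \<Longrightarrow> \<psi> \<in> hom_space sN act' N \<Longrightarrow>
      \<exists>t\<in>T. bracket (\<phi> v) (\<psi> w) = ev t v w"
  obtains f where "bilinear_on hs (hom_space sM act M) hs (hom_space sN act' N) sT T f"
    "\<And>\<phi> \<psi> m n. \<phi> \<in> hom_space sM act M \<Longrightarrow> \<psi> \<in> hom_space sN act' N \<Longrightarrow> m \<in> M \<Longrightarrow> n \<in> N \<Longrightarrow>
      bracket (\<phi> m) (\<psi> n) = ev (f \<phi> \<psi>) m n"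
proof -
  interpret T: vector_space sT by fact
  let ?H = "hom_space sM act M" and ?H' = "hom_space sN act' N"
  define f where "f \<phi> \<psi> = (SOME t. t \<in> T \<and> bracket (\<phi> v) (\<psi> w) = ev t v w)" for \<phi> \<psi>
  have f: "f \<phi> \<psi> \<in> T" "bracket (\<phi> v) (\<psi> w) = ev (f \<phi> \<psi>) v w" if "\<phi> \<in> ?H" "\<psi> \<in> ?H'" for \<phi> \<psi>
    using someI_ex[of "\<lambda>t. t \<in> T \<and> bracket (\<phi> v) (\<psi> w) = ev t v w"] surj[OF that] unfolding f_def by blast+
  have uniq: "t = t'" if "t \<in> T" "t' \<in> T" "ev t v w = ev t' v w" for t t'
  proof -
    have "ev (t + sT (-1) t') v w = 0"
      using that by (simp only: ev_add ev_scale T.subspace_scale[OF T(2)]) simp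
    then have "t + sT (-1) t' = 0"
      using that by (intro inj T.subspace_add[OF T(2)] T.subspace_scale[OF T(2)])
    then show ?thesis by simp
  qed
  show ?thesis
  proof (rule that[of f])
    show "bilinear_on hs ?H hs ?H' sT T f"
    proof (rule bilinear_onI)
      fix \<phi> \<psi> assume "\<phi> \<in> ?H" "\<psi> \<in> ?H'"
      then show "f \<phi> \<psi> \<in> T" by (rule f)
    next
      fix \<phi> \<psi> \<psi>' assume h: "\<phi> \<in> ?H" "\<psi> \<in> ?H'" "\<psi>' \<in> ?H'"
      have "ev (f \<phi> (\<psi> + \<psi>')) v w = bracket (\<phi> v) ((\<psi> + \<psi>') w)"
        using f(2)[OF h(1), of "\<psi> + \<psi>'"] module.subspace_add[OF module_hs hom_space_subspace h(2,3)] by simp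
      also have "\<dots> = ev (f \<phi> \<psi> + f \<phi> \<psi>') v w"
        using f h by (simp add: bracket_add_right ev_add)
      finally show "f \<phi> (\<psi> + \<psi>') = f \<phi> \<psi> + f \<phi> \<psi>'"
        using f(1) h module.subspace_add[OF module_hs hom_space_subspace h(2,3)] by (intro uniq T.subspace_add[OF T(2)]) simp_all
    next
      fix \<phi> \<psi> k assume h: "\<phi> \<in> ?H" "\<psi> \<in> ?H'"
      note s = module.subspace_scale[OF module_hs hom_space_subspace h(2), of k]
      have "ev (f \<phi> (hs k \<psi>)) v w = bracket (\<phi> v) ((hs k \<psi>) w)"
        using f(2)[OF h(1) s] by simp
      also have "\<dots> = ev (sT k (f \<phi> \<psi>)) v w"
        using f h by (simp add: bracket_scale_right ev_scale)
      finally show "f \<phi> (hs k \<psi>) = sT k (f \<phi> \<psi>)"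
        using f(1) h s by (intro uniq T.subspace_scale[OF T(2)]) simp_all
    next
      fix \<phi> \<phi>' \<psi> assume h: "\<phi> \<in> ?H" "\<phi>' \<in> ?H" "\<psi> \<in> ?H'"
      note s = module.subspace_add[OF module_hs hom_space_subspace h(1,2)]
      have "ev (f (\<phi> + \<phi>') \<psi>) v w = bracket ((\<phi> + \<phi>') v) (\<psi> w)"
        using f(2)[OF s h(3)] by simp
      also have "\<dots> = ev (f \<phi> \<psi> + f \<phi>' \<psi>) v w"
        using f h by (simp add: bracket_add_left ev_add)
      finally show "f (\<phi> + \<phi>') \<psi> = f \<phi> \<psi> + f \<phi>' \<psi>"
        using f(1) h s by (intro uniq T.subspace_add[OF T(2)]) simp_all
    next
      fix \<phi> \<psi> k assume h: "\<phi> \<in> ?H" "\<psi> \<in> ?H'"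
      note s = module.subspace_scale[OF module_hs hom_space_subspace h(1), of k]
      have "ev (f (hs k \<phi>) \<psi>) v w = bracket ((hs k \<phi>) v) (\<psi> w)"
        using f(2)[OF s h(2)] by simp
      also have "\<dots> = ev (sT k (f \<phi> \<psi>)) v w"
        using f h by (simp add: bracket_scale_left ev_scale)
      finally show "f (hs k \<phi>) \<psi> = sT k (f \<phi> \<psi>)"
        using f(1) h s by (intro uniq T.subspace_scale[OF T(2)]) simp_all
    qed
  next
    fix \<phi> \<psi> m n assume h: "\<phi> \<in> ?H" "\<psi> \<in> ?H'" "m \<in> M" "n \<in> N"
    have "equivariant sM act M sN act' N (\<lambda>m n. bracket (\<phi> m) (\<psi> n) - ev (f \<phi> \<psi>) m n)"
      by (intro equivariant_diff bracket_equivariant equi h f)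
    moreover have "bracket (\<phi> v) (\<psi> w) - ev (f \<phi> \<psi>) v w = 0" using f(2) h by simp
    ultimately have "bracket (\<phi> m) (\<psi> n) - ev (f \<phi> \<psi>) m n = 0"
      using equivariant_eq_zero[OF M N kill] h(3,4) by blast
    then show "bracket (\<phi> m) (\<psi> n) = ev (f \<phi> \<psi>) m n" by simp
  qed
qed

end

section \<open>Products of matrices\<close>

lemma sl_bilinearI:
  assumes "\<And>m n. m \<in> M \<Longrightarrow> n \<in> N \<Longrightarrow> opn m n \<in> K"
    "\<And>m n n'. opn m (n + n') = opn m n + opn m n'" "\<And>m n k. opn m (sN k n) = sK k (opn m n)"
    "\<And>m m' n. opn (m + m') n = opn m n + opn m' n" "\<And>m n k. opn (sM k m) n = sK k (opn m n)"
    "\<And>x m n. x \<in> sl \<Longrightarrow> m \<in> M \<Longrightarrow> n \<in> N \<Longrightarrow> act'' x (opn m n) = opn (act x m) n + opn m (act' x n)"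
  shows "sl_bilinear sM act M sN act' N sK act'' K opn"
  using assms unfolding sl_bilinear_def by (auto intro!: bilinear_onI)

lemma sl_invariant_formI:
  assumes "\<And>m n n'. form m (n + n') = form m n + form m n'" "\<And>m n k. form m (sN k n) = k * form m n"
    "\<And>m m' n. form (m + m') n = form m n + form m' n" "\<And>m n k. form (sM k m) n = k * form m n"
    "\<And>x m n. x \<in> sl \<Longrightarrow> m \<in> M \<Longrightarrow> n \<in> N \<Longrightarrow> form (act x m) n + form m (act' x n) = 0"
  shows "sl_invariant_form sM act M sN act' N form"
  using assms unfolding sl_invariant_form_def by (auto intro!: bilinear_onI)

lemma outer_add: "outer (u + u') v = outer u v + outer u' v" "outer u (v + v') = outer u v + outer u v'"
  by (simp_all add: outer_def vec_eq_iff algebra_simps)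

lemma outer_scale: "outer (k *s u) v = mscale k (outer u v)" "outer u (k *s v) = mscale k (outer u v)"
  by (simp_all add: outer_def vec_eq_iff algebra_simps)

lemma outer_uminus: "outer (- u) v = - outer u v" "outer u (- v) = - outer u v"
  by (simp_all add: outer_def vec_eq_iff)

lemma outer_mult: "outer (x *v u) v = x ** outer u v" "outer u (x *v v) = outer u v ** transpose x"
  by (simp_all add: outer_def vec_eq_iff matrix_vector_mult_def matrix_matrix_mult_def transpose_def
      sum_distrib_left sum_distrib_right mult_ac)

lemma transpose_outer: "transpose (outer u v) = outer v u"
  by (simp add: outer_def transpose_def vec_eq_iff mult.commute)

lemma mat_add: "mat (a + b) = mat a + (mat b :: 'f::field^'n^'n)"
  by (simp add: mat_def vec_eq_iff)

lemma mat_mscale: "mat (k * a) = mscale k (mat a :: 'f::field^'n^'n)"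
  by (simp add: mat_def vec_eq_iff)

lemma trace_skew_sym:
  assumes "s \<in> sym_mats" "w \<in> skew_mats"
  shows "trace (s ** w :: 'f::field_char_0^'n^'n) = 0"
proof -
  have "trace (s ** w) = trace (transpose (s ** w))" by simp
  also have "transpose (s ** w) = - (w ** s)"
    using assms by (simp add: transpose_mult sym_mats_def skew_mats_def mult_uminus_left)
  also have "trace \<dots> = - trace (s ** w)" by (simp add: trace_mult_commute[of w s])
  finally show ?thesis by simp
qed

lemma comm_mat_mat [simp]: "comm_mat x (mat k) = 0"
  by (simp add: comm_mat_def mult_mat_left mult_mat_right)

lemma comm_mat_diff: "comm_mat x (y - z) = comm_mat x y - comm_mat x z"
  by (simp add: comm_mat_def matrix_ring)

lemma comm_op_bilinear:
  "sl_bilinear mscale comm_mat sl mscale comm_mat sl mscale comm_mat (sl :: ('f::field_char_0^'n^'n) set) comm_mat"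
  by (rule sl_bilinearI, simp)
    (simp_all add: comm_mat_def matrix_ring mult_mscale_left mult_mscale_right mscale_diff)

lemma form_mat_sl_invariant:
  "sl_invariant_form mscale comm_mat sl mscale comm_mat (sl :: ('f::field_char_0^'n^'n) set) form_mat"
proof (rule sl_invariant_formI)
  fix x m n :: "'f^'n^'n"
  have "trace (m ** n ** x) = trace (x ** m ** n)" by (simp add: trace_mult_commute[of "m ** n"] matrix_ring)
  then show "form_mat (comm_mat x m) n + form_mat m (comm_mat x n) = 0"
    by (simp add: form_mat_def comm_mat_def matrix_ring algebra_simps add_divide_distrib[symmetric] diff_divide_distrib[symmetric])
qed (simp_all add: form_mat_def matrix_ring mult_mscale_left mult_mscale_right algebra_simps add_divide_distrib)

text \<open>The subtracted scalar matrix brings the product into \<open>sl\<close>. It leaves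
  equivariance intact because the trace form is invariant.\<close>

lemma jord_op_bilinear:
  "sl_bilinear mscale comm_mat sl mscale comm_mat sl mscale comm_mat (sl :: ('f::field_char_0^'n^'n) set) jord_mat"
proof (rule sl_bilinearI)
  fix x m n :: "'f^'n^'n"
  show "jord_mat m n \<in> sl"
    by (simp add: jord_mat_def sl_def trace_mat trace_mult_commute[of n m])
  have inv: "trace (comm_mat x m ** n) + trace (m ** comm_mat x n) = 0"
    using trace_mult_commute[of "m ** n" x] by (simp add: comm_mat_def matrix_ring)
  have "comm_mat x (jord_mat m n) = comm_mat x (m ** n + n ** m)"
    by (simp add: jord_mat_def comm_mat_diff)
  also have "\<dots> = comm_mat x m ** n + n ** comm_mat x m + (m ** comm_mat x n + comm_mat x n ** m)
      - mat (2 / of_nat CARD('n) * (trace (comm_mat x m ** n) + trace (m ** comm_mat x n)))"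
    unfolding inv by (simp add: comm_mat_def matrix_ring)
  also have "\<dots> = jord_mat (comm_mat x m) n + jord_mat m (comm_mat x n)"
    unfolding jord_mat_def distrib_left mat_add by simp
  finally show "comm_mat x (jord_mat m n) = jord_mat (comm_mat x m) n + jord_mat m (comm_mat x n)" .
qed (simp_all add: jord_mat_def matrix_ring mult_mscale_left mult_mscale_right mscale_diff mscale_add
      distrib_left mat_add mult.left_commute mat_mscale[symmetric] add_divide_distrib)

lemma V_V'_form_invariant:
  "sl_invariant_form (*s) act_V UNIV (*s) act_V' (UNIV :: ('f::field_char_0^'n) set)
    (\<lambda>u v. c * trace (outer u v))"
proof (rule sl_invariant_formI)
  fix x :: "'f^'n^'n" and u v :: "'f^'n"
  have "trace (outer u v ** x) = trace (x ** outer u v)" by (rule trace_mult_commute)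
  then show "c * trace (outer (act_V x u) v) + c * trace (outer u (act_V' x v)) = 0"
    by (simp add: act_V_def act_V'_def outer_mult outer_uminus transpose_transpose del: transpose_matrix_vector)
qed (simp_all add: outer_add outer_scale algebra_simps)

lemma V_V'_op_bilinear:
  "sl_bilinear (*s) act_V UNIV (*s) act_V' UNIV mscale comm_mat (sl :: ('f::field_char_0^'n^'n) set)
    (\<lambda>u v. outer u v - mat (trace (outer u v) / of_nat CARD('n)))"
proof (rule sl_bilinearI)
  fix x :: "'f^'n^'n" and u v :: "'f^'n"
  show "outer u v - mat (trace (outer u v) / of_nat CARD('n)) \<in> sl" by (simp add: sl_def trace_mat)
  have "trace (outer u v ** x) = trace (x ** outer u v)" by (rule trace_mult_commute)
  then have "trace (outer (act_V x u) v) = - trace (outer u (act_V' x v))"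
    by (simp add: act_V_def act_V'_def outer_mult outer_uminus transpose_transpose del: transpose_matrix_vector)
  then have "mat (trace (outer (act_V x u) v) / of_nat CARD('n)) + mat (trace (outer u (act_V' x v)) / of_nat CARD('n))
    = (0 :: 'f^'n^'n)" by (simp flip: mat_add add_divide_distrib)
  moreover have "comm_mat x (outer u v) = outer (act_V x u) v + outer u (act_V' x v)"
    by (simp add: comm_mat_def act_V_def act_V'_def outer_mult outer_uminus transpose_transpose del: transpose_matrix_vector)
  ultimately show "comm_mat x (outer u v - mat (trace (outer u v) / of_nat CARD('n)))
    = outer (act_V x u) v - mat (trace (outer (act_V x u) v) / of_nat CARD('n))
      + (outer u (act_V' x v) - mat (trace (outer u (act_V' x v)) / of_nat CARD('n)))"
    by (simp add: comm_mat_diff algebra_simps)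
qed (simp_all add: outer_add outer_scale mat_add add_divide_distrib mscale_diff mat_mscale[symmetric])

lemma form_mat_S_S':
  fixes x m n :: "'f::field_char_0^'n^'n"
  shows "form_mat (act_S x m) n + form_mat m (act_S' x n) = 0"
proof -
  have "trace (m ** n ** x) = trace (x ** m ** n)"
    by (simp add: trace_mult_commute[of "m ** n"] matrix_ring)
  then show ?thesis
    by (simp add: form_mat_def act_S_def act_S'_def matrix_ring algebra_simps add_divide_distrib[symmetric] diff_divide_distrib[symmetric])
qed

lemma S_S'_form_invariant:
  "sl_invariant_form mscale act_S M mscale act_S' (M :: ('f::field_char_0^'n^'n) set) form_mat"
  by (rule sl_invariant_formI) (simp_all add: form_mat_S_S',
      simp_all add: form_mat_def matrix_ring mult_mscale_left mult_mscale_right add_divide_distrib)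

lemma S_S'_op_bilinear:
  "sl_bilinear mscale act_S M mscale act_S' M mscale comm_mat (sl :: ('f::field_char_0^'n^'n) set)
    (\<lambda>s s'. s ** s' - mat (form_mat s s'))"
proof (rule sl_bilinearI)
  fix x m n :: "'f^'n^'n"
  show "m ** n - mat (form_mat m n) \<in> sl" by (simp add: sl_def trace_mat form_mat_def)
  have "mat (form_mat (act_S x m) n) + mat (form_mat m (act_S' x n)) = (0 :: 'f^'n^'n)"
    by (simp add: form_mat_S_S' flip: mat_add)
  moreover have "comm_mat x (m ** n) = act_S x m ** n + m ** act_S' x n"
    by (simp add: comm_mat_def act_S_def act_S'_def matrix_ring)
  ultimately show "comm_mat x (m ** n - mat (form_mat m n))
    = act_S x m ** n - mat (form_mat (act_S x m) n) + (m ** act_S' x n - mat (form_mat m (act_S' x n)))"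
    by (simp add: comm_mat_diff algebra_simps)
qed (simp_all add: form_mat_def matrix_ring mult_mscale_left mult_mscale_right mat_add add_divide_distrib mscale_diff
      mat_mscale[symmetric])

lemma V_V_op_bilinear:
  "sl_bilinear (*s) act_V UNIV (*s) act_V UNIV mscale act_S (sym_mats :: ('f::field_char_0^'n^'n) set)
    (\<lambda>u v. outer u v + outer v u)"
  "sl_bilinear (*s) act_V UNIV (*s) act_V UNIV mscale act_S (skew_mats :: ('f::field_char_0^'n^'n) set)
    (\<lambda>u v. outer u v - outer v u)"
  by (rule sl_bilinearI; simp add: outer_add outer_scale sym_mats_def skew_mats_def transpose_add transpose_diff
      transpose_outer act_S_def act_V_def outer_mult matrix_ring mscale_add mscale_diff add.commute)+

lemma sl_S_op_bilinear:
  "sl_bilinear mscale comm_mat sl mscale act_S sym_mats mscale act_S (sym_mats :: ('f::field_char_0^'n^'n) set)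
    (\<lambda>x s. x ** s + s ** transpose x)"
  "sl_bilinear mscale comm_mat sl mscale act_S sym_mats mscale act_S (skew_mats :: ('f::field_char_0^'n^'n) set)
    (\<lambda>x s. x ** s - s ** transpose x)"
  by (rule sl_bilinearI; simp add: sym_mats_def skew_mats_def transpose_ring transpose_mscale act_S_def comm_mat_def
      matrix_ring mult_mscale_left mult_mscale_right mscale_add mscale_diff add.commute)+

lemma sl_L_op_bilinear:
  "sl_bilinear mscale comm_mat sl mscale act_S skew_mats mscale act_S (skew_mats :: ('f::field_char_0^'n^'n) set)
    (\<lambda>x s. x ** s + s ** transpose x)"
  "sl_bilinear mscale comm_mat sl mscale act_S skew_mats mscale act_S (sym_mats :: ('f::field_char_0^'n^'n) set)
    (\<lambda>x s. x ** s - s ** transpose x)"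
  by (rule sl_bilinearI; simp add: sym_mats_def skew_mats_def transpose_ring transpose_mscale act_S_def comm_mat_def
      matrix_ring mult_mscale_left mult_mscale_right mscale_add mscale_diff add.commute)+

text \<open>A symmetric times a skew matrix is traceless, so neither a correction term nor a
  \<open>D\<close>-valued map arises for this pair.\<close>

lemma S_L'_op_bilinear:
  "sl_bilinear mscale act_S sym_mats mscale act_S' skew_mats mscale comm_mat (sl :: ('f::field_char_0^'n^'n) set)
    (\<lambda>s w. s ** w)"
  by (rule sl_bilinearI) (simp_all add: sl_def trace_skew_sym[unfolded sl_def] act_S_def act_S'_def comm_mat_def
      matrix_ring mult_mscale_left mult_mscale_right)

lemma S'_L_op_bilinear:
  "sl_bilinear mscale act_S' sym_mats mscale act_S skew_mats mscale comm_mat (sl :: ('f::field_char_0^'n^'n) set)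
    (\<lambda>s w. transpose (s ** w))"
proof (rule sl_bilinearI)
  fix s w :: "'f^'n^'n" assume "s \<in> sym_mats" "w \<in> skew_mats"
  then show "transpose (s ** w) \<in> sl" using trace_skew_sym[of s w] by (simp add: sl_def)
qed (simp_all add: act_S_def act_S'_def comm_mat_def transpose_ring transpose_mscale
      matrix_ring mult_mscale_left mult_mscale_right sym_mats_def skew_mats_def)

lemma vec_op_bilinear:
  "sl_bilinear mscale comm_mat sl (*s) act_V UNIV (*s) act_V (UNIV :: ('f::field_char_0^'n) set) (*v)"
  "sl_bilinear mscale act_S' sym_mats (*s) act_V UNIV (*s) act_V' (UNIV :: ('f::field_char_0^'n) set) (*v)"
  "sl_bilinear mscale act_S' skew_mats (*s) act_V UNIV (*s) act_V' (UNIV :: ('f::field_char_0^'n) set) (*v)"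
  by (rule sl_bilinearI; simp add: matrix_vec_ring mult_vec_mscale_left mult_vec_scale_right act_V_def act_V'_def
      act_S'_def comm_mat_def matrix_ring del: transpose_matrix_vector)+

section \<open>The bilinear maps of the bracket\<close>

context theta_graded5
begin

lemmas hom_defs = A_def B_def B'_def C_def C'_def E_def E'_def

lemma A_inj: "a \<in> A \<Longrightarrow> i \<noteq> j \<Longrightarrow> a (munit i j) = 0 \<Longrightarrow> a = 0"
  using hom_eq_zero[OF sl_module_sl sl_generated] by (simp add: A_def)

lemma B_inj: "b \<in> B \<Longrightarrow> b (axis i 1) = 0 \<Longrightarrow> b = 0"
  using hom_eq_zero[OF sl_module_V V_generated] by (simp add: B_def)

lemma B'_inj: "b \<in> B' \<Longrightarrow> b (axis i 1) = 0 \<Longrightarrow> b = 0"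
  using hom_eq_zero[OF sl_module_V' V'_generated] by (simp add: B'_def)

lemma CE_inj:
  assumes "c \<in> C" "e \<in> E" "i \<noteq> j" "c (munit i j + munit j i) + e (munit i j - munit j i) = 0"
  shows "c = 0" "e = 0"
proof -
  have "hs 1 c = 0" "hs 1 e = 0"
    using coords_S_L[of "{()}" "\<lambda>_. c" "\<lambda>_. munit i j + munit j i" "{()}" "\<lambda>_. e" "\<lambda>_. munit i j - munit j i" i j]
      assms by simp_all
  then show "c = 0" "e = 0" by (simp_all add: module.scale_one[OF module_hs])
qed

lemma A_D_inj:
  assumes "a \<in> A" "d \<in> D" "m \<in> sl" "m $ i $ j \<noteq> 0" "a m + d = 0"
  shows "a = 0" "d = 0"
proof -
  have "hs (m $ i $ j) a = 0"
    using coords_sl[of "{()}" "\<lambda>_. a" "\<lambda>_. m" d i j] assms by simp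
  then show "a = 0" using assms(4) by (simp add: vector_space.scale_eq_0_iff[OF vector_space_hs])
  then show "d = 0" using assms(5) by simp
qed

lemma A_ex:
  assumes "i \<noteq> j" "x \<in> W (unit_wt i - unit_wt j)"
  shows "\<exists>a\<in>A. x = a (munit i j)"
proof -
  obtain a where "a \<in> A" "a (munit i j) = x" by (rule A_exists[OF assms])
  then show ?thesis by (intro bexI[of _ a]) simp_all
qed

lemma B_ex:
  assumes "x \<in> W (unit_wt i)"
  shows "\<exists>b\<in>B. x = b (axis i 1)"
proof -
  obtain b where "b \<in> B" "b (axis i 1) = x" by (rule B_exists[OF assms])
  then show ?thesis by (intro bexI[of _ b]) simp_all
qed

lemma B'_ex:
  assumes "x \<in> W (- unit_wt i)"
  shows "\<exists>b\<in>B'. x = b (axis i 1)"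
proof -
  obtain b where "b \<in> B'" "b (axis i 1) = x" by (rule B'_exists[OF assms])
  then show ?thesis by (intro bexI[of _ b]) simp_all
qed

lemma ad_cmunit:
  assumes "a \<in> A" "p \<noteq> q"
  shows "ad p q (a (cmunit r)) = (if q = r then a (munit p r) else 0) - (if p = r then a (munit r q) else 0)"
proof -
  have h: "a \<in> hom_space mscale comm_mat sl" using assms(1) by (simp add: A_def)
  have "ad p q (a (cmunit r)) = a (comm_mat (munit p q) (munit r r))"
    using assms(2) by (simp add: ad_hom[OF h] comm_mat_cmunit)
  also have "\<dots> = (if q = r then a (munit p r) else 0) - (if p = r then a (munit r q) else 0)"
    using assms(2) hom_space_zero[OF sl_module_sl h] hom_space_minus[OF sl_module_sl h, of "munit r q"]
    by (auto simp: comm_mat_def)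
  finally show ?thesis .
qed

lemma cmunit_W:
  assumes "a \<in> A"
  shows "a (cmunit r) \<in> W 0"
proof -
  have h: "a \<in> hom_space mscale comm_mat sl" using assms by (simp add: A_def)
  have "comm_mat x (cmunit r) = mscale (wt 0 x) (cmunit r)" if "x \<in> cartan" for x :: "'f^'n^'n"
    using comm_mat_cartan[OF that, of r r] by (simp add: cmunit_def comm_mat_diff wt_zero)
  then show ?thesis by (intro hom_weight[OF h]) simp_all
qed

text \<open>From a third index k, the values of z under E_kr and E_ks are matched by two elements of
  \<open>A\<close>. The other E_kq annihilate z and both diagonal terms, so the difference is killed
  by the star at k.\<close>

lemma zero_weight_two:
  assumes z: "z \<in> W 0" and kill: "\<And>p q. p \<noteq> q \<Longrightarrow> p \<notin> {r, s} \<Longrightarrow> q \<notin> {r, s} \<Longrightarrow> ad p q z = 0"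
    and "r \<noteq> s"
  obtains a b where "a \<in> A" "b \<in> A" "z - a (cmunit r) - b (cmunit s) \<in> D"
proof -
  obtain k where k: "k \<noteq> r" "k \<noteq> s" using obtain_fresh[of r s r s] by blast
  obtain a where a: "a \<in> A" "a (munit k r) = ad k r z"
    by (rule A_exists[OF k(1) ad_W[OF z k(1)]]) simp
  obtain b where b: "b \<in> A" "b (munit k s) = ad k s z"
    by (rule A_exists[OF k(2) ad_W[OF z k(2)]]) simp
  have "z - a (cmunit r) - b (cmunit s) \<in> D"
  proof (rule D_of_star[where r = k])
    show "z - a (cmunit r) - b (cmunit s) \<in> W 0"
      by (intro subspace_diff[OF weight_space_subspace] z cmunit_W a b)
    fix q assume q: "q \<noteq> k"
    then show "ad k q (z - a (cmunit r) - b (cmunit s)) = 0"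
      using k a b kill[of k q] \<open>r \<noteq> s\<close> by (auto simp: bracket_diff_right ad_cmunit)
  qed
  then show ?thesis using that a(1) b(1) by blast
qed

lemma zero_weight_one:
  assumes z: "z \<in> W 0" and kill: "\<And>p q. p \<noteq> q \<Longrightarrow> p \<noteq> r \<Longrightarrow> q \<noteq> r \<Longrightarrow> ad p q z = 0"
  obtains a where "a \<in> A" "z - a (cmunit r) \<in> D"
proof -
  obtain k where k: "k \<noteq> r" using obtain_fresh[of r r r r] by blast
  obtain a where a: "a \<in> A" "a (munit k r) = ad k r z"
    by (rule A_exists[OF k ad_W[OF z k]]) simp
  have "z - a (cmunit r) \<in> D"
  proof (rule D_of_star[where r = k])
    show "z - a (cmunit r) \<in> W 0"
      by (intro subspace_diff[OF weight_space_subspace] z cmunit_W a)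
    fix q assume q: "q \<noteq> k"
    then show "ad k q (z - a (cmunit r)) = 0"
      using k a kill[of k q] by (auto simp: bracket_diff_right ad_cmunit)
  qed
  then show ?thesis using that a(1) by blast
qed

lemma ad_bracket_hom:
  assumes "\<phi> \<in> hom_space sM act M" "\<psi> \<in> hom_space sN act' N" "m \<in> M" "n \<in> N" "p \<noteq> q"
  shows "ad p q (bracket (\<phi> m) (\<psi> n)) = bracket (\<phi> (act (munit p q) m)) (\<psi> n) + bracket (\<phi> m) (\<psi> (act' (munit p q) n))"
  using assms by (simp add: ad_bracket ad_hom[OF assms(1)] ad_hom[OF assms(2)])

text \<open>The pattern of the product lemmas. Generators are chosen such that the root vectors in
  \<open>R\<close> annihilate the second one, here E_ij and the basis vector at j. The weight of
  their bracket, here \<epsilon>_i, tells which spaces the value can come from, and the matrix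
  formula does not vanish at this pair.\<close>

lemma product_sl_V:
  obtains f where "bilinear_on hs A hs B hs B f"
    "\<And>a b x u. a \<in> A \<Longrightarrow> b \<in> B \<Longrightarrow> x \<in> sl \<Longrightarrow> bracket (a x) (b u) = f a b (x *v u)"
proof -
  obtain i j :: 'n where ij: "i \<noteq> j" by (rule obtain_distinct) auto
  obtain f where f: "bilinear_on hs (hom_space mscale comm_mat sl) hs (hom_space (*s) act_V UNIV) hs B f"
    "\<And>\<phi> \<psi> m n. \<phi> \<in> hom_space mscale comm_mat sl \<Longrightarrow> \<psi> \<in> hom_space (*s) act_V UNIV \<Longrightarrow> m \<in> sl \<Longrightarrow> n \<in> UNIV \<Longrightarrow>
      bracket (\<phi> m) (\<psi> n) = f \<phi> \<psi> (m *v n)"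
  proof (rule bilinear_rule[OF sl_module_sl sl_generated[OF ij] sl_module_V V_generated[of j] _ vector_space_hs hom_subspaces(2),
        where ev = "\<lambda>t x u. t (x *v u)"])
    fix \<phi> \<psi> assume "\<phi> \<in> hom_space mscale comm_mat sl" "\<psi> \<in> hom_space (*s) act_V UNIV"
    then have "bracket (\<phi> (munit i j)) (\<psi> (axis j 1)) \<in> W (unit_wt i - unit_wt j + unit_wt j)"
      by (intro bracket_W A_weight ij B_weight) (simp_all only: A_def B_def)
    then have "bracket (\<phi> (munit i j)) (\<psi> (axis j 1)) \<in> W (unit_wt i)"
      by (simp only: diff_add_cancel)
    then show "\<exists>t\<in>B. bracket (\<phi> (munit i j)) (\<psi> (axis j 1)) = t (munit i j *v axis j 1)"
      using ij by (simp add: B_ex)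
  next
    fix t assume "t \<in> B" "t (munit i j *v axis j 1) = 0"
    then show "t = 0" using B_inj by simp
  qed (use ij in \<open>auto simp: munit_act_V B_def intro: hom_equivariant[OF _ vec_op_bilinear(1) sl_module_sl sl_module_V]\<close>)
  then show ?thesis using that by (simp add: A_def B_def)
qed

text \<open>Here both generators carry the same index: S' is generated by means of the E_iq, and
  these annihilate the basis vector at i.\<close>

lemma product_S'_V:
  obtains f where "bilinear_on hs C' hs B hs B' f"
    "\<And>c b s u. c \<in> C' \<Longrightarrow> b \<in> B \<Longrightarrow> s \<in> sym_mats \<Longrightarrow> bracket (c s) (b u) = f c b (s *v u)"
proof -
  obtain i :: 'n where True by blast
  obtain f where f: "bilinear_on hs (hom_space mscale act_S' sym_mats) hs (hom_space (*s) act_V UNIV) hs B' f"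
    "\<And>\<phi> \<psi> m n. \<phi> \<in> hom_space mscale act_S' sym_mats \<Longrightarrow> \<psi> \<in> hom_space (*s) act_V UNIV \<Longrightarrow> m \<in> sym_mats \<Longrightarrow> n \<in> UNIV \<Longrightarrow>
      bracket (\<phi> m) (\<psi> n) = f \<phi> \<psi> (m *v n)"
  proof (rule bilinear_rule[OF sl_module_S' S'_generated[of i] sl_module_V V_generated[of i] _ vector_space_hs hom_subspaces(3),
        where ev = "\<lambda>t x u. t (x *v u)"])
    fix \<phi> \<psi> assume "\<phi> \<in> hom_space mscale act_S' sym_mats" "\<psi> \<in> hom_space (*s) act_V UNIV"
    then have "bracket (\<phi> (munit i i)) (\<psi> (axis i 1)) \<in> W (- (unit_wt i + unit_wt i) + unit_wt i)"
      by (intro bracket_W C'_weight_diag B_weight) (simp_all only: C'_def B_def)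
    then have "bracket (\<phi> (munit i i)) (\<psi> (axis i 1)) \<in> W (- unit_wt i)"
      by (simp only: minus_add_distrib add.assoc add.left_inverse add_0_right)
    then show "\<exists>t\<in>B'. bracket (\<phi> (munit i i)) (\<psi> (axis i 1)) = t (munit i i *v axis i 1)"
      by (simp add: B'_ex)
  next
    fix t assume "t \<in> B'" "t (munit i i *v axis i 1) = 0"
    then show "t = 0" using B'_inj by simp
  qed (auto simp: munit_act_V B'_def intro: hom_equivariant[OF _ vec_op_bilinear(2) sl_module_S' sl_module_V])
  then show ?thesis using that by (simp add: C'_def B_def)
qed

text \<open>The matrix E_ij - E_ji sends the basis vector at i to minus the one at j, so the
  coordinate is found for the negative of the bracket.\<close>

lemma product_L'_V:
  obtains f where "bilinear_on hs E' hs B hs B' f"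
    "\<And>e b s u. e \<in> E' \<Longrightarrow> b \<in> B \<Longrightarrow> s \<in> skew_mats \<Longrightarrow> bracket (e s) (b u) = f e b (s *v u)"
proof -
  obtain i j :: 'n where ij: "i \<noteq> j" by (rule obtain_distinct) auto
  have op: "(munit i j - munit j i) *v axis i 1 = (- axis j 1 :: 'f^'n)"
    using ij by (simp add: mult_vec_diff_left)
  obtain f where f: "bilinear_on hs (hom_space mscale act_S' skew_mats) hs (hom_space (*s) act_V UNIV) hs B' f"
    "\<And>\<phi> \<psi> m n. \<phi> \<in> hom_space mscale act_S' skew_mats \<Longrightarrow> \<psi> \<in> hom_space (*s) act_V UNIV \<Longrightarrow> m \<in> skew_mats \<Longrightarrow> n \<in> UNIV \<Longrightarrow>
      bracket (\<phi> m) (\<psi> n) = f \<phi> \<psi> (m *v n)"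
  proof (rule bilinear_rule[OF sl_module_L' L'_generated[OF ij] sl_module_V V_generated[of i] _ vector_space_hs hom_subspaces(3),
        where ev = "\<lambda>t x u. t (x *v u)"])
    fix \<phi> \<psi> assume "\<phi> \<in> hom_space mscale act_S' skew_mats" "\<psi> \<in> hom_space (*s) act_V UNIV"
    then have "bracket (\<phi> (munit i j - munit j i)) (\<psi> (axis i 1)) \<in> W (- (unit_wt i + unit_wt j) + unit_wt i)"
      by (intro bracket_W E'_weight B_weight) (simp_all only: E'_def B_def)
    then have "- bracket (\<phi> (munit i j - munit j i)) (\<psi> (axis i 1)) \<in> W (- unit_wt j)"
      by (simp add: subspace_neg[OF weight_space_subspace])
    then obtain t where t: "t \<in> B'" "t (axis j 1) = - bracket (\<phi> (munit i j - munit j i)) (\<psi> (axis i 1))"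
      by (rule B'_exists)
    then show "\<exists>t\<in>B'. bracket (\<phi> (munit i j - munit j i)) (\<psi> (axis i 1)) = t ((munit i j - munit j i) *v axis i 1)"
      using hom_space_minus[OF sl_module_V', of t "axis j 1"] by (intro bexI[of _ t]) (simp_all add: op B'_def)
  next
    fix t assume "t \<in> B'" "t ((munit i j - munit j i) *v axis i 1) = 0"
    then show "t = 0" using B'_inj[of t j] hom_space_minus[OF sl_module_V', of t "axis j 1"] by (simp add: op B'_def)
  qed (auto simp: munit_act_V B'_def intro: hom_equivariant[OF _ vec_op_bilinear(3) sl_module_L' sl_module_V])
  then show ?thesis using that by (simp add: E'_def B_def)
qed

lemma product_S_L':
  obtains f where "bilinear_on hs C hs E' hs A f"
    "\<And>c e s w. c \<in> C \<Longrightarrow> e \<in> E' \<Longrightarrow> s \<in> sym_mats \<Longrightarrow> w \<in> skew_mats \<Longrightarrow> bracket (c s) (e w) = f c e (s ** w)"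
proof -
  obtain i j :: 'n where ij: "i \<noteq> j" by (rule obtain_distinct) auto
  have op: "munit i i ** (munit i j - munit j i) = (munit i j :: 'f^'n^'n)"
    using ij by (simp add: matrix_ring)
  obtain f where f: "bilinear_on hs (hom_space mscale act_S sym_mats) hs (hom_space mscale act_S' skew_mats) hs A f"
    "\<And>\<phi> \<psi> m n. \<phi> \<in> hom_space mscale act_S sym_mats \<Longrightarrow> \<psi> \<in> hom_space mscale act_S' skew_mats \<Longrightarrow> m \<in> sym_mats \<Longrightarrow> n \<in> skew_mats \<Longrightarrow>
      bracket (\<phi> m) (\<psi> n) = f \<phi> \<psi> (m ** n)"
  proof (rule bilinear_rule[OF sl_module_S S_generated[of i] sl_module_L' L'_generated[OF ij] _ vector_space_hs hom_subspaces(1),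
        where ev = "\<lambda>t x u. t (x ** u)"])
    fix p q :: 'n assume "(p, q) \<in> {(p, q). q = i}" "p \<noteq> q"
    then show "act_S' (munit p q) (munit i j - munit j i) = (0 :: 'f^'n^'n)"
      using ij by (auto simp: act_S'_def matrix_ring)
  next
    fix \<phi> \<psi> assume "\<phi> \<in> hom_space mscale act_S sym_mats" "\<psi> \<in> hom_space mscale act_S' skew_mats"
    then have "bracket (\<phi> (munit i i)) (\<psi> (munit i j - munit j i)) \<in> W ((unit_wt i + unit_wt i) + - (unit_wt i + unit_wt j))"
      by (intro bracket_W E'_weight C_weight_diag) (simp_all only: E'_def C_def)
    then have "bracket (\<phi> (munit i i)) (\<psi> (munit i j - munit j i)) \<in> W (unit_wt i - unit_wt j)"
      by (simp add: algebra_simps)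
    then show "\<exists>t\<in>A. bracket (\<phi> (munit i i)) (\<psi> (munit i j - munit j i)) = t (munit i i ** (munit i j - munit j i))"
      unfolding op by (rule A_ex[OF ij])
  next
    fix t assume "t \<in> A" "t (munit i i ** (munit i j - munit j i)) = 0"
    then show "t = 0" using A_inj[OF _ ij] by (simp add: op)
  qed (auto simp: A_def intro: hom_equivariant[OF _ S_L'_op_bilinear sl_module_S sl_module_L'])
  then show ?thesis using that by (simp add: E'_def C_def)
qed

lemma product_S'_L:
  obtains f where "bilinear_on hs C' hs E hs A f"
    "\<And>c e s w. c \<in> C' \<Longrightarrow> e \<in> E \<Longrightarrow> s \<in> sym_mats \<Longrightarrow> w \<in> skew_mats \<Longrightarrow> bracket (c s) (e w) = f c e (transpose (s ** w))"
proof -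
  obtain i j :: 'n where ij: "i \<noteq> j" by (rule obtain_distinct) auto
  have op: "transpose (munit i i ** (munit i j - munit j i)) = (munit j i :: 'f^'n^'n)"
    using ij by (simp add: matrix_ring)
  obtain f where f: "bilinear_on hs (hom_space mscale act_S' sym_mats) hs (hom_space mscale act_S skew_mats) hs A f"
    "\<And>\<phi> \<psi> m n. \<phi> \<in> hom_space mscale act_S' sym_mats \<Longrightarrow> \<psi> \<in> hom_space mscale act_S skew_mats \<Longrightarrow> m \<in> sym_mats \<Longrightarrow> n \<in> skew_mats \<Longrightarrow>
      bracket (\<phi> m) (\<psi> n) = f \<phi> \<psi> (transpose (m ** n))"
  proof (rule bilinear_rule[OF sl_module_S' S'_generated[of i] sl_module_L L_generated[OF ij] _ vector_space_hs hom_subspaces(1),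
        where ev = "\<lambda>t x u. t (transpose (x ** u))"])
    fix p q :: 'n assume "(p, q) \<in> {(p, q). p = i}" "p \<noteq> q"
    then show "act_S (munit p q) (munit i j - munit j i) = (0 :: 'f^'n^'n)"
      using ij by (auto simp: act_S_def matrix_ring)
  next
    fix \<phi> \<psi> assume "\<phi> \<in> hom_space mscale act_S' sym_mats" "\<psi> \<in> hom_space mscale act_S skew_mats"
    then have "bracket (\<phi> (munit i i)) (\<psi> (munit i j - munit j i)) \<in> W (- (unit_wt i + unit_wt i) + (unit_wt i + unit_wt j))"
      by (intro bracket_W E_weight C'_weight_diag) (simp_all only: E_def C'_def)
    then have "bracket (\<phi> (munit i i)) (\<psi> (munit i j - munit j i)) \<in> W (unit_wt j - unit_wt i)"
      by (simp add: algebra_simps)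
    then show "\<exists>t\<in>A. bracket (\<phi> (munit i i)) (\<psi> (munit i j - munit j i)) = t (transpose (munit i i ** (munit i j - munit j i)))"
      unfolding op by (rule A_ex[OF ij[symmetric]])
  next
    fix t assume "t \<in> A" "t (transpose (munit i i ** (munit i j - munit j i))) = 0"
    then show "t = 0" using A_inj[OF _ ij[symmetric]] by (simp add: op)
  qed (auto simp: A_def intro: hom_equivariant[OF _ S'_L_op_bilinear sl_module_S' sl_module_L])
  then show ?thesis using that by (simp add: E_def C'_def)
qed

text \<open>A weight \<epsilon>_i + \<epsilon>_j with i \<noteq> j occurs in S and in \<Lambda>, so
  the value at the generators has two coordinates, which \<open>CE_exists\<close> supplies
  together.\<close>

lemma product_into_S_L:
  assumes M: "sl_module sM act M" "sl_module.generated_by sM act M R v"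
    and N: "sl_module sN act' N" "sl_module.generated_by sN act' N R' w"
    and kill: "\<And>p q. (p, q) \<in> R \<Longrightarrow> p \<noteq> q \<Longrightarrow> act' (munit p q) w = 0"
    and opS: "sl_bilinear sM act M sN act' N mscale act_S sym_mats opS"
    and opL: "sl_bilinear sM act M sN act' N mscale act_S skew_mats opL"
    and ij: "i \<noteq> j" "opS v w = munit i j + munit j i" "opL v w = munit i j - munit j i"
    and wt: "\<And>\<phi> \<psi>. \<phi> \<in> hom_space sM act M \<Longrightarrow> \<psi> \<in> hom_space sN act' N \<Longrightarrow>
      bracket (\<phi> v) (\<psi> w) \<in> W (unit_wt i + unit_wt j)"
  obtains f g where "bilinear_on hs (hom_space sM act M) hs (hom_space sN act' N) hs C f"
    "bilinear_on hs (hom_space sM act M) hs (hom_space sN act' N) hs E g"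
    "\<And>\<phi> \<psi> m n. \<phi> \<in> hom_space sM act M \<Longrightarrow> \<psi> \<in> hom_space sN act' N \<Longrightarrow> m \<in> M \<Longrightarrow> n \<in> N \<Longrightarrow>
      bracket (\<phi> m) (\<psi> n) = hs (1/2) (f \<phi> \<psi>) (opS m n) + hs (1/2) (g \<phi> \<psi>) (opL m n)"
proof -
  note sc = module.subspace_scale[OF module_hs hom_subspaces(4)] module.subspace_scale[OF module_hs hom_subspaces(6)]
  obtain f where f: "bilinear_on hs (hom_space sM act M) hs (hom_space sN act' N) (scale_pair hs hs) (C \<times> E) f"
    "\<And>\<phi> \<psi> m n. \<phi> \<in> hom_space sM act M \<Longrightarrow> \<psi> \<in> hom_space sN act' N \<Longrightarrow> m \<in> M \<Longrightarrow> n \<in> N \<Longrightarrow>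
      bracket (\<phi> m) (\<psi> n) = hs (1/2) (fst (f \<phi> \<psi>)) (opS m n) + hs (1/2) (snd (f \<phi> \<psi>)) (opL m n)"
  proof (rule bilinear_rule[OF M N kill vector_space_pair_scale[OF vector_space_hs vector_space_hs]
        subspace_Times[OF vector_space_hs vector_space_hs hom_subspaces(4,6)],
        where ev = "\<lambda>t m n. hs (1/2) (fst t) (opS m n) + hs (1/2) (snd t) (opL m n)"])
    fix t assume "t \<in> C \<times> E"
    then have "hs (1/2) (fst t) \<in> hom_space mscale act_S sym_mats" "hs (1/2) (snd t) \<in> hom_space mscale act_S skew_mats"
      using sc by (auto simp: C_def E_def)
    then show "equivariant sM act M sN act' N (\<lambda>m n. hs (1/2) (fst t) (opS m n) + hs (1/2) (snd t) (opL m n))"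
      by (intro equivariant_add hom_equivariant[OF _ opS M(1) N(1)] hom_equivariant[OF _ opL M(1) N(1)])
  next
    fix t assume t: "t \<in> C \<times> E" "hs (1/2) (fst t) (opS v w) + hs (1/2) (snd t) (opL v w) = 0"
    then have "scale (1/2) (fst t (munit i j + munit j i) + snd t (munit i j - munit j i)) = 0"
      by (simp add: ij scale_right_distrib)
    then have "fst t (munit i j + munit j i) + snd t (munit i j - munit j i) = 0" by simp
    then show "t = 0" using CE_inj[of "fst t" "snd t", OF _ _ ij(1)] t(1) by (auto simp: prod_eq_iff)
  next
    fix \<phi> \<psi> assume "\<phi> \<in> hom_space sM act M" "\<psi> \<in> hom_space sN act' N"
    then obtain c e where ce: "c \<in> C" "e \<in> E" "bracket (\<phi> v) (\<psi> w) = c (munit i j + munit j i) + e (munit i j - munit j i)"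
      using CE_exists[OF ij(1) wt] by blast
    \<comment> \<open>Doubling both coordinates cancels the factor 1/2 of the rule.\<close>
    then show "\<exists>t\<in>C \<times> E. bracket (\<phi> v) (\<psi> w) = hs (1/2) (fst t) (opS v w) + hs (1/2) (snd t) (opL v w)"
      using sc by (intro bexI[of _ "(hs 2 c, hs 2 e)"]) (simp_all add: ij)
  qed (simp_all add: scale_pair_def scale_right_distrib scale_left_commute algebra_simps)
  show ?thesis by (rule that[OF bilinear_on_fst_snd[OF f(1)] f(2)])
qed

text \<open>At the generators the bracket is a value of \<open>A\<close> up to \<open>D\<close>. A
  nonzero entry of \<open>opA v w\<close> separates the two parts, and division by
  \<open>form v w\<close> produces the coordinate in \<open>D\<close>.\<close>

lemma product_into_sl_D:
  assumes M: "sl_module sM act M" "sl_module.generated_by sM act M R v"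
    and N: "sl_module sN act' N" "sl_module.generated_by sN act' N R' w"
    and kill: "\<And>p q. (p, q) \<in> R \<Longrightarrow> p \<noteq> q \<Longrightarrow> act' (munit p q) w = 0"
    and opA: "sl_bilinear sM act M sN act' N mscale comm_mat sl opA"
    and form: "sl_invariant_form sM act M sN act' N form"
    and ij: "opA v w \<in> sl" "opA v w $ i $ j \<noteq> 0" "form v w \<noteq> 0"
    and surj: "\<And>\<phi> \<psi>. \<phi> \<in> hom_space sM act M \<Longrightarrow> \<psi> \<in> hom_space sN act' N \<Longrightarrow>
      \<exists>a\<in>A. bracket (\<phi> v) (\<psi> w) - a (opA v w) \<in> D"
  obtains f g where "bilinear_on hs (hom_space sM act M) hs (hom_space sN act' N) hs A f"
    "bilinear_on hs (hom_space sM act M) hs (hom_space sN act' N) scale D g"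
    "\<And>\<phi> \<psi> m n. \<phi> \<in> hom_space sM act M \<Longrightarrow> \<psi> \<in> hom_space sN act' N \<Longrightarrow> m \<in> M \<Longrightarrow> n \<in> N \<Longrightarrow>
      bracket (\<phi> m) (\<psi> n) = f \<phi> \<psi> (opA m n) + scale (form m n) (g \<phi> \<psi>)"
proof -
  obtain f where f: "bilinear_on hs (hom_space sM act M) hs (hom_space sN act' N) (scale_pair hs scale) (A \<times> D) f"
    "\<And>\<phi> \<psi> m n. \<phi> \<in> hom_space sM act M \<Longrightarrow> \<psi> \<in> hom_space sN act' N \<Longrightarrow> m \<in> M \<Longrightarrow> n \<in> N \<Longrightarrow>
      bracket (\<phi> m) (\<psi> n) = fst (f \<phi> \<psi>) (opA m n) + scale (form m n) (snd (f \<phi> \<psi>))"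
  proof (rule bilinear_rule[OF M N kill vector_space_pair_scale[OF vector_space_hs vector_space_axioms]
        subspace_Times[OF vector_space_hs vector_space_axioms hom_subspaces(1) D_subspace],
        where ev = "\<lambda>t m n. fst t (opA m n) + scale (form m n) (snd t)"])
    fix t assume "t \<in> A \<times> D"
    then have "fst t \<in> hom_space mscale comm_mat sl" "snd t \<in> D" by (auto simp: A_def)
    then show "equivariant sM act M sN act' N (\<lambda>m n. fst t (opA m n) + scale (form m n) (snd t))"
      by (intro equivariant_add hom_equivariant[OF _ opA M(1) N(1)] form_equivariant[OF _ form])
  next
    fix t assume t: "t \<in> A \<times> D" "fst t (opA v w) + scale (form v w) (snd t) = 0"
    then have "fst t = 0" "scale (form v w) (snd t) = 0"
      using A_D_inj[of "fst t" "scale (form v w) (snd t)", OF _ _ ij(1,2)] by (auto simp: subspace_scale[OF D_subspace])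
    then show "t = 0" using ij(3) by (simp add: prod_eq_iff)
  next
    fix \<phi> \<psi> assume "\<phi> \<in> hom_space sM act M" "\<psi> \<in> hom_space sN act' N"
    then obtain a where a: "a \<in> A" "bracket (\<phi> v) (\<psi> w) - a (opA v w) \<in> D" using surj by blast
    then have "(a, scale (1 / form v w) (bracket (\<phi> v) (\<psi> w) - a (opA v w))) \<in> A \<times> D"
      by (simp add: subspace_scale[OF D_subspace])
    then show "\<exists>t\<in>A \<times> D. bracket (\<phi> v) (\<psi> w) = fst t (opA v w) + scale (form v w) (snd t)"
      by (rule bexI[rotated]) (simp add: ij(3))
  qed (simp_all add: scale_pair_def scale_right_distrib scale_left_commute algebra_simps)
  show ?thesis by (rule that[OF bilinear_on_fst_snd[OF f(1)] f(2)])
qed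

lemma product_V_V:
  obtains f g where "bilinear_on hs B hs B hs C f" "bilinear_on hs B hs B hs E g"
    "\<And>b1 b2 u v. b1 \<in> B \<Longrightarrow> b2 \<in> B \<Longrightarrow> bracket (b1 u) (b2 v)
      = hs (1/2) (f b1 b2) (outer u v + outer v u) + hs (1/2) (g b1 b2) (outer u v - outer v u)"
proof -
  obtain i j :: 'n where ij: "i \<noteq> j" by (rule obtain_distinct) auto
  show ?thesis
  proof (rule product_into_S_L[OF sl_module_V V_generated[of i] sl_module_V V_generated[of j] _ V_V_op_bilinear ij])
    fix \<phi> \<psi> assume "\<phi> \<in> hom_space (*s) act_V UNIV" "\<psi> \<in> hom_space (*s) act_V UNIV"
    then show "bracket (\<phi> (axis i 1)) (\<psi> (axis j 1)) \<in> W (unit_wt i + unit_wt j)"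
      by (intro bracket_W B_weight) (simp_all only: B_def)
  next
    fix f g
    assume "bilinear_on hs (hom_space (*s) act_V UNIV) hs (hom_space (*s) act_V UNIV) hs C f"
      "bilinear_on hs (hom_space (*s) act_V UNIV) hs (hom_space (*s) act_V UNIV) hs E g"
      "\<And>\<phi> \<psi> m n. \<phi> \<in> hom_space (*s) act_V UNIV \<Longrightarrow> \<psi> \<in> hom_space (*s) act_V UNIV \<Longrightarrow> m \<in> UNIV \<Longrightarrow> n \<in> UNIV \<Longrightarrow>
        bracket (\<phi> m) (\<psi> n) = hs (1/2) (f \<phi> \<psi>) (outer m n + outer n m) + hs (1/2) (g \<phi> \<psi>) (outer m n - outer n m)"
    then show thesis by (intro that[of f g]) (simp_all only: B_def UNIV_I)
  qed (use ij in \<open>auto simp: munit_act_V\<close>)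
qed

lemma product_sl_S:
  obtains f g where "bilinear_on hs A hs C hs C f" "bilinear_on hs A hs C hs E g"
    "\<And>a c x s. a \<in> A \<Longrightarrow> c \<in> C \<Longrightarrow> x \<in> sl \<Longrightarrow> s \<in> sym_mats \<Longrightarrow> bracket (a x) (c s)
      = hs (1/2) (f a c) (x ** s + s ** transpose x) + hs (1/2) (g a c) (x ** s - s ** transpose x)"
proof -
  obtain i j :: 'n where ij: "i \<noteq> j" by (rule obtain_distinct) auto
  show ?thesis
  proof (rule product_into_S_L[OF sl_module_sl sl_generated[OF ij] sl_module_S S_generated[of j] _ sl_S_op_bilinear ij])
    fix p q :: 'n assume "(p, q) \<in> {(p, q). q = i \<or> p = j}" "p \<noteq> q"
    then show "act_S (munit p q) (munit j j) = (0 :: 'f^'n^'n)" using ij by (auto simp: act_S_def)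
  next
    fix \<phi> \<psi> assume "\<phi> \<in> hom_space mscale comm_mat sl" "\<psi> \<in> hom_space mscale act_S sym_mats"
    then have "bracket (\<phi> (munit i j)) (\<psi> (munit j j)) \<in> W ((unit_wt i - unit_wt j) + (unit_wt j + unit_wt j))"
      by (intro bracket_W A_weight C_weight_diag ij) (simp_all only: A_def C_def)
    then show "bracket (\<phi> (munit i j)) (\<psi> (munit j j)) \<in> W (unit_wt i + unit_wt j)"
      by (simp only: add.assoc[symmetric] diff_add_cancel)
  next
    fix f g
    assume "bilinear_on hs (hom_space mscale comm_mat sl) hs (hom_space mscale act_S sym_mats) hs C f"
      "bilinear_on hs (hom_space mscale comm_mat sl) hs (hom_space mscale act_S sym_mats) hs E g"
      "\<And>\<phi> \<psi> m n. \<phi> \<in> hom_space mscale comm_mat sl \<Longrightarrow> \<psi> \<in> hom_space mscale act_S sym_mats \<Longrightarrow> m \<in> sl \<Longrightarrow> n \<in> sym_mats \<Longrightarrow>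
        bracket (\<phi> m) (\<psi> n) = hs (1/2) (f \<phi> \<psi>) (m ** n + n ** transpose m) + hs (1/2) (g \<phi> \<psi>) (m ** n - n ** transpose m)"
    then show thesis by (intro that[of f g]) (simp_all only: A_def C_def)
  qed simp_all
qed

text \<open>The generators E_ij and E_jk - E_kj meet in j only. On skew matrices the plus sign
  yields a skew and the minus sign a symmetric matrix, so the two maps come in the opposite
  order.\<close>

lemma product_sl_L:
  obtains f g where "bilinear_on hs A hs E hs E f" "bilinear_on hs A hs E hs C g"
    "\<And>a e x w. a \<in> A \<Longrightarrow> e \<in> E \<Longrightarrow> x \<in> sl \<Longrightarrow> w \<in> skew_mats \<Longrightarrow> bracket (a x) (e w)
      = hs (1/2) (f a e) (x ** w + w ** transpose x) + hs (1/2) (g a e) (x ** w - w ** transpose x)"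
proof -
  obtain i j k l m :: 'n where d: "distinct [i, j, k, l, m]" by (rule obtain_distinct)
  then have ij: "i \<noteq> j" and ik: "i \<noteq> k" and jk: "j \<noteq> k" by auto
  show ?thesis
  proof (rule product_into_S_L[OF sl_module_sl sl_generated[OF ij] sl_module_L L_generated[OF jk] _ sl_L_op_bilinear(2,1) ik])
    fix p q :: 'n assume "(p, q) \<in> {(p, q). q = i \<or> p = j}" "p \<noteq> q"
    then show "act_S (munit p q) (munit j k - munit k j) = (0 :: 'f^'n^'n)"
      using ij ik jk by (auto simp: act_S_def matrix_ring)
  next
    fix \<phi> \<psi> assume "\<phi> \<in> hom_space mscale comm_mat sl" "\<psi> \<in> hom_space mscale act_S skew_mats"
    then have "bracket (\<phi> (munit i j)) (\<psi> (munit j k - munit k j)) \<in> W ((unit_wt i - unit_wt j) + (unit_wt j + unit_wt k))"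
      by (intro bracket_W A_weight E_weight ij) (simp_all only: A_def E_def)
    then show "bracket (\<phi> (munit i j)) (\<psi> (munit j k - munit k j)) \<in> W (unit_wt i + unit_wt k)"
      by (simp only: add.assoc[symmetric] diff_add_cancel)
  next
    fix f g
    assume "bilinear_on hs (hom_space mscale comm_mat sl) hs (hom_space mscale act_S skew_mats) hs C f"
      "bilinear_on hs (hom_space mscale comm_mat sl) hs (hom_space mscale act_S skew_mats) hs E g"
      "\<And>\<phi> \<psi> m n. \<phi> \<in> hom_space mscale comm_mat sl \<Longrightarrow> \<psi> \<in> hom_space mscale act_S skew_mats \<Longrightarrow> m \<in> sl \<Longrightarrow> n \<in> skew_mats \<Longrightarrow>
        bracket (\<phi> m) (\<psi> n) = hs (1/2) (f \<phi> \<psi>) (m ** n - n ** transpose m) + hs (1/2) (g \<phi> \<psi>) (m ** n + n ** transpose m)"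
    then show thesis by (intro that[of g f]) (simp_all only: A_def E_def add.commute)
  qed (use ij ik jk in \<open>simp_all add: matrix_ring add.commute\<close>)
qed

section \<open>Brackets of dual pairs, with values of weight zero\<close>

lemma zero_weight_one':
  assumes "z \<in> W 0" "\<And>p q. p \<noteq> q \<Longrightarrow> p \<noteq> r \<Longrightarrow> q \<noteq> r \<Longrightarrow> ad p q z = 0"
  shows "\<exists>a\<in>A. z - a (cmunit r) \<in> D"
  using zero_weight_one[OF assms] by blast

lemma cmunit_entry: "j \<noteq> i \<Longrightarrow> (cmunit i :: 'f^'n^'n) $ j $ j \<noteq> 0"
  by (simp add: cmunit_def mat_def)

text \<open>With both generators at index i, the bracket is killed by all root vectors avoiding i,
  hence is a value at \<open>cmunit i\<close> up to \<open>D\<close>; this matrix is the traceless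
  part of the outer product. A second index j provides the nonzero diagonal entry -1/n.\<close>

lemma product_V_V':
  obtains f g where "bilinear_on hs B hs B' hs A f" "bilinear_on hs B hs B' scale D g"
    "\<And>b b' u v. b \<in> B \<Longrightarrow> b' \<in> B' \<Longrightarrow> bracket (b u) (b' v)
      = f b b' (outer u v - mat (trace (outer u v) / of_nat CARD('n)))
        + scale (2 / of_nat CARD('n) * trace (outer u v)) (g b b')"
proof -
  obtain i j :: 'n where ij: "i \<noteq> j" by (rule obtain_distinct) auto
  have op: "outer (axis i 1) (axis i 1) - mat (trace (outer (axis i 1) (axis i 1)) / of_nat CARD('n)) = (cmunit i :: 'f^'n^'n)"
    by (simp add: cmunit_def)
  show ?thesis
  proof (rule product_into_sl_D[OF sl_module_V V_generated[of i] sl_module_V' V'_generated[of i] _ V_V'_op_bilinear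
        V_V'_form_invariant[where c = "2 / of_nat CARD('n)"], of j j, unfolded op])
    fix p q :: 'n assume "(p, q) \<in> {(p, q). q = i}" "p \<noteq> q"
    then show "act_V' (munit p q) (axis i 1) = (0 :: 'f^'n)"
      by (simp add: act_V'_def del: transpose_matrix_vector)
  next
    fix \<phi> \<psi> assume h: "\<phi> \<in> hom_space (*s) act_V UNIV" "\<psi> \<in> hom_space (*s) act_V' UNIV"
    have "bracket (\<phi> (axis i 1)) (\<psi> (axis i 1)) \<in> W (unit_wt i + - unit_wt i)"
      using h by (intro bracket_W B_weight B'_weight) (simp_all only: B_def B'_def)
    then have "bracket (\<phi> (axis i 1)) (\<psi> (axis i 1)) \<in> W 0" by (simp only: add.right_inverse)
    then show "\<exists>a\<in>A. bracket (\<phi> (axis i 1)) (\<psi> (axis i 1)) - a (cmunit i) \<in> D"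
      by (rule zero_weight_one')
        (simp add: ad_bracket_hom[OF h] munit_act_V act_V'_def hom_space_zero[OF sl_module_V h(1)]
          hom_space_zero[OF sl_module_V' h(2)] del: transpose_matrix_vector)
  next
    fix f g
    assume "bilinear_on hs (hom_space (*s) act_V UNIV) hs (hom_space (*s) act_V' UNIV) hs A f"
      "bilinear_on hs (hom_space (*s) act_V UNIV) hs (hom_space (*s) act_V' UNIV) scale D g"
      "\<And>\<phi> \<psi> m n. \<phi> \<in> hom_space (*s) act_V UNIV \<Longrightarrow> \<psi> \<in> hom_space (*s) act_V' UNIV \<Longrightarrow> m \<in> UNIV \<Longrightarrow> n \<in> UNIV \<Longrightarrow>
        bracket (\<phi> m) (\<psi> n) = f \<phi> \<psi> (outer m n - mat (trace (outer m n) / of_nat CARD('n)))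
          + scale (2 / of_nat CARD('n) * trace (outer m n)) (g \<phi> \<psi>)"
    then show thesis by (intro that[of f g]) (simp_all only: B_def B'_def UNIV_I)
  qed (use ij cmunit_entry in simp_all)
qed

lemma product_S_S':
  obtains f g where "bilinear_on hs C hs C' hs A f" "bilinear_on hs C hs C' scale D g"
    "\<And>c c' s s'. c \<in> C \<Longrightarrow> c' \<in> C' \<Longrightarrow> s \<in> sym_mats \<Longrightarrow> s' \<in> sym_mats \<Longrightarrow> bracket (c s) (c' s')
      = f c c' (s ** s' - mat (form_mat s s')) + scale (form_mat s s') (g c c')"
proof -
  obtain i j :: 'n where ij: "i \<noteq> j" by (rule obtain_distinct) auto
  have op: "munit i i ** munit i i - mat (form_mat (munit i i) (munit i i)) = (cmunit i :: 'f^'n^'n)"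
    by (simp add: cmunit_def form_mat_def)
  show ?thesis
  proof (rule product_into_sl_D[OF sl_module_S S_generated[of i] sl_module_S' S'_generated[of i] _ S_S'_op_bilinear
        S_S'_form_invariant, of j j, unfolded op])
    fix p q :: 'n assume "(p, q) \<in> {(p, q). q = i}" "p \<noteq> q"
    then show "act_S' (munit p q) (munit i i) = (0 :: 'f^'n^'n)"
      by (auto simp add: act_S'_def)
  next
    fix \<phi> \<psi> assume h: "\<phi> \<in> hom_space mscale act_S sym_mats" "\<psi> \<in> hom_space mscale act_S' sym_mats"
    have "bracket (\<phi> (munit i i)) (\<psi> (munit i i)) \<in> W ((unit_wt i + unit_wt i) + - (unit_wt i + unit_wt i))"
      using h by (intro bracket_W C_weight_diag C'_weight_diag) (simp_all only: C_def C'_def)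
    then have "bracket (\<phi> (munit i i)) (\<psi> (munit i i)) \<in> W 0" by (simp only: add.right_inverse)
    then show "\<exists>a\<in>A. bracket (\<phi> (munit i i)) (\<psi> (munit i i)) - a (cmunit i) \<in> D"
      by (rule zero_weight_one')
        (simp add: ad_bracket_hom[OF h] act_S_def act_S'_def hom_space_zero[OF sl_module_S h(1)]
          hom_space_zero[OF sl_module_S' h(2)])
  next
    fix f g
    assume "bilinear_on hs (hom_space mscale act_S sym_mats) hs (hom_space mscale act_S' sym_mats) hs A f"
      "bilinear_on hs (hom_space mscale act_S sym_mats) hs (hom_space mscale act_S' sym_mats) scale D g"
      "\<And>\<phi> \<psi> m n. \<phi> \<in> hom_space mscale act_S sym_mats \<Longrightarrow> \<psi> \<in> hom_space mscale act_S' sym_mats \<Longrightarrow> m \<in> sym_mats \<Longrightarrow> n \<in> sym_mats \<Longrightarrow>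
        bracket (\<phi> m) (\<psi> n) = f \<phi> \<psi> (m ** n - mat (form_mat m n)) + scale (form_mat m n) (g \<phi> \<psi>)"
    then show thesis by (intro that[of f g]) (simp_all only: C_def C'_def)
  qed (use ij cmunit_entry in \<open>simp_all add: form_mat_def\<close>)
qed

text \<open>The square of w = E_ij - E_ji is -(E_ii + E_jj), so the bracket at (w, w) is first
  described by two elements a and b of \<open>A\<close>, one for each centred unit. Since E_ij
  annihilates w in both modules, a = b, as a formula with one coordinate demands.\<close>

lemma product_L_L':
  obtains f g where "bilinear_on hs E hs E' hs A f" "bilinear_on hs E hs E' scale D g"
    "\<And>c c' s s'. c \<in> E \<Longrightarrow> c' \<in> E' \<Longrightarrow> s \<in> skew_mats \<Longrightarrow> s' \<in> skew_mats \<Longrightarrow> bracket (c s) (c' s')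
      = f c c' (s ** s' - mat (form_mat s s')) + scale (form_mat s s') (g c c')"
proof -
  obtain i j k l m :: 'n where d: "distinct [i, j, k, l, m]" by (rule obtain_distinct)
  then have ij: "i \<noteq> j" and ik: "i \<noteq> k" and jk: "j \<noteq> k" by auto
  let ?w = "munit i j - munit j i :: 'f^'n^'n"
  have ww: "?w ** ?w = - (munit i i + munit j j)"
    using ij by (simp add: matrix_ring)
  have form: "form_mat ?w ?w = - 2 / of_nat CARD('n)" by (simp add: form_mat_def ww)
  have op: "?w ** ?w - mat (form_mat ?w ?w) = - (cmunit i + cmunit j :: 'f^'n^'n)"
    unfolding ww form by (simp add: cmunit_def vec_eq_iff mat_def)
  have opsl: "- (cmunit i + cmunit j :: 'f^'n^'n) \<in> sl"
    by (intro mscale.subspace_neg[OF sl_subspace] mscale.subspace_add[OF sl_subspace]) simp_all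
  show ?thesis
  proof (rule product_into_sl_D[OF sl_module_L L_generated[OF ij] sl_module_L' L'_generated[OF ij] _ S_S'_op_bilinear
        S_S'_form_invariant, of k k, unfolded op])
    fix p q :: 'n assume "(p, q) \<in> {(p, q). p \<noteq> i \<and> p \<noteq> j \<and> (q = i \<or> q = j)}" "p \<noteq> q"
    then show "act_S' (munit p q) ?w = (0 :: 'f^'n^'n)"
      by (auto simp add: act_S'_def matrix_ring)
  next
    fix \<phi> \<psi> assume h: "\<phi> \<in> hom_space mscale act_S skew_mats" "\<psi> \<in> hom_space mscale act_S' skew_mats"
    let ?z = "bracket (\<phi> ?w) (\<psi> ?w)"
    have "?z \<in> W ((unit_wt i + unit_wt j) + - (unit_wt i + unit_wt j))"
      using h by (intro bracket_W E_weight E'_weight) (simp_all only: E_def E'_def)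
    then have z: "?z \<in> W 0" by (simp only: add.right_inverse)
    have ad_z: "ad p q ?z = bracket (\<phi> (act_S (munit p q) ?w)) (\<psi> ?w) + bracket (\<phi> ?w) (\<psi> (act_S' (munit p q) ?w))"
      if "p \<noteq> q" for p q
      by (rule ad_bracket_hom[OF h _ _ that]) simp_all
    have kill: "ad p q ?z = 0" if "p \<noteq> q" "p \<notin> {i, j}" "q \<notin> {i, j}" for p q
    proof -
      have "i \<noteq> p" "i \<noteq> q" "j \<noteq> p" "j \<noteq> q" using that by auto
      then show ?thesis
        using that by (simp add: ad_z act_S_def act_S'_def matrix_ring hom_space_zero[OF sl_module_L h(1)]
          hom_space_zero[OF sl_module_L' h(2)])
    qed
    obtain a b where ab: "a \<in> A" "b \<in> A" "?z - a (cmunit i) - b (cmunit j) \<in> D"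
      by (rule zero_weight_two[OF z kill ij])
    have "ad i j ?z = 0"
      using ij by (simp add: ad_z act_S_def act_S'_def matrix_ring hom_space_zero[OF sl_module_L h(1)]
          hom_space_zero[OF sl_module_L' h(2)])
    moreover have "ad i j (?z - a (cmunit i) - b (cmunit j)) = 0"
      using ab(3) ij by (simp add: D_iff)
    ultimately have "a (munit i j) = b (munit i j)"
      using ij ab(1,2) by (simp add: bracket_diff_right ad_cmunit)
    then have "a = b"
      using hom_eqI[OF sl_module_sl sl_generated[OF ij]] ab(1,2) by (simp add: A_def)
    \<comment> \<open>The sign in -(E_ii + E_jj) is moved into the homomorphism.\<close>
    let ?a = "hs (- 1) a"
    have a': "?a \<in> A" using module.subspace_scale[OF module_hs hom_subspaces(1) ab(1)] .
    have h': "a \<in> hom_space mscale comm_mat sl" using ab(1) by (simp add: A_def)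
    have "a (- (cmunit i + cmunit j)) = - (a (cmunit i) + a (cmunit j))"
      using hom_space_minus[OF sl_module_sl h', of "cmunit i + cmunit j"] hom_spaceD(4)[OF h', of "cmunit i" "cmunit j"]
        mscale.subspace_add[OF sl_subspace, of "cmunit i" "cmunit j"] by simp
    then have "?z - ?a (- (cmunit i + cmunit j)) = ?z - a (cmunit i) - b (cmunit j)"
      using \<open>a = b\<close> by (simp add: algebra_simps)
    then have "?z - ?a (- (cmunit i + cmunit j)) \<in> D" by (simp only: ab(3))
    then show "\<exists>a\<in>A. ?z - a (- (cmunit i + cmunit j)) \<in> D" by (rule bexI[OF _ a'])
  next
    fix f g
    assume "bilinear_on hs (hom_space mscale act_S skew_mats) hs (hom_space mscale act_S' skew_mats) hs A f"
      "bilinear_on hs (hom_space mscale act_S skew_mats) hs (hom_space mscale act_S' skew_mats) scale D g"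
      "\<And>\<phi> \<psi> m n. \<phi> \<in> hom_space mscale act_S skew_mats \<Longrightarrow> \<psi> \<in> hom_space mscale act_S' skew_mats \<Longrightarrow> m \<in> skew_mats \<Longrightarrow> n \<in> skew_mats \<Longrightarrow>
        bracket (\<phi> m) (\<psi> n) = f \<phi> \<psi> (m ** n - mat (form_mat m n)) + scale (form_mat m n) (g \<phi> \<psi>)"
    then show thesis by (intro that[of f g]) (simp_all only: E_def E'_def)
  next
    show "(- (cmunit i + cmunit j :: 'f^'n^'n)) $ k $ k \<noteq> 0"
      using ik jk by (simp add: cmunit_def mat_def)
    show "form_mat ?w ?w \<noteq> 0" unfolding form by simp
  qed (rule opsl)
qed

end

lemma bilinear_on_flip: "bilinear_on sX X sY Y sZ Z f \<Longrightarrow> bilinear_on sY Y sX X sZ Z (\<lambda>y x. f x y)"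
  by (simp add: bilinear_on_def)

lemma bilinear_on_uminus:
  assumes "bilinear_on sX X sY Y sZ Z f" "vector_space sZ" "module.subspace sZ Z"
  shows "bilinear_on sX X sY Y sZ Z (\<lambda>x y. - f x y)"
proof -
  interpret Z: vector_space sZ by fact
  show ?thesis
    by (rule bilinear_onI) (simp_all add: bilinear_onD[OF assms(1)] Z.subspace_neg[OF assms(3)])
qed

context theta_graded5
begin

text \<open>At the pair E_ij, E_ji the three terms are independent: the Jordan product gives the sum
  and the commutator the difference of the centred units at i and j, and the form is 1/n. At E_ij,
  E_jk both matrix products equal E_ik and the form vanishes, so that pair would not separate the
  terms.\<close>

lemma product_sl_sl:
  obtains p q g where "bilinear_on hs A hs A hs A p" "bilinear_on hs A hs A hs A q" "bilinear_on hs A hs A scale D g"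
    "\<And>a1 a2 x y. a1 \<in> A \<Longrightarrow> a2 \<in> A \<Longrightarrow> x \<in> sl \<Longrightarrow> y \<in> sl \<Longrightarrow> bracket (a1 x) (a2 y)
      = hs (1/2) (p a1 a2) (jord_mat x y) + hs (1/2) (q a1 a2) (comm_mat x y) + scale (form_mat x y) (g a1 a2)"
proof -
  obtain i j k l m :: 'n where d: "distinct [i, j, k, l, m]" by (rule obtain_distinct)
  then have ij: "i \<noteq> j" and ik: "i \<noteq> k" and jk: "j \<noteq> k" by auto
  have jord: "jord_mat (munit i j) (munit j i) = (cmunit i + cmunit j :: 'f^'n^'n)"
  proof -
    have "2 / of_nat CARD('n) = (1 / of_nat CARD('n) + 1 / of_nat CARD('n) :: 'f)" by (simp add: add_divide_distrib[symmetric])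
    then have "mat (2 / of_nat CARD('n)) = (mat (1 / of_nat CARD('n)) + mat (1 / of_nat CARD('n)) :: 'f^'n^'n)"
      by (simp only: mat_add)
    then show ?thesis using ij by (simp add: jord_mat_def cmunit_def)
  qed
  have comm: "comm_mat (munit i j) (munit j i) = (cmunit i - cmunit j :: 'f^'n^'n)"
    by (simp add: comm_mat_def cmunit_def)
  have form: "form_mat (munit i j) (munit j i) = (1 / of_nat CARD('n) :: 'f)" by (simp add: form_mat_def)
  have csl: "cmunit i + cmunit j \<in> (sl :: ('f^'n^'n) set)" "cmunit i - cmunit j \<in> (sl :: ('f^'n^'n) set)"
    by (simp_all add: mscale.subspace_add[OF sl_subspace] mscale.subspace_diff[OF sl_subspace])
  note half = module.subspace_scale[OF module_hs hom_subspaces(1)]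
  let ?T = "A \<times> A \<times> D" and ?s = "scale_pair hs (scale_pair hs scale)"
  let ?ev = "\<lambda>t m n. hs (1/2) (fst t) (jord_mat m n) + hs (1/2) (fst (snd t)) (comm_mat m n) + scale (form_mat m n) (snd (snd t))"
  obtain f where f: "bilinear_on hs (hom_space mscale comm_mat sl) hs (hom_space mscale comm_mat sl) ?s ?T f"
    "\<And>\<phi> \<psi> m n. \<phi> \<in> hom_space mscale comm_mat sl \<Longrightarrow> \<psi> \<in> hom_space mscale comm_mat sl \<Longrightarrow> m \<in> sl \<Longrightarrow> n \<in> sl \<Longrightarrow>
      bracket (\<phi> m) (\<psi> n) = ?ev (f \<phi> \<psi>) m n"
  proof (rule bilinear_rule[OF sl_module_sl sl_generated[OF ij] sl_module_sl sl_generated[OF ij[symmetric]]  _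
        vector_space_pair_scale[OF vector_space_hs vector_space_pair_scale[OF vector_space_hs vector_space_axioms]]
        subspace_Times[OF vector_space_hs vector_space_pair_scale[OF vector_space_hs vector_space_axioms] hom_subspaces(1)
          subspace_Times[OF vector_space_hs vector_space_axioms hom_subspaces(1) D_subspace]],
        where ev = ?ev])
    fix p q :: 'n assume "(p, q) \<in> {(p, q). q = i \<or> p = j}" "p \<noteq> q"
    then show "comm_mat (munit p q) (munit j i) = (0 :: 'f^'n^'n)" using ij by (auto simp: comm_mat_def)
  next
    fix t assume "t \<in> ?T"
    then have "hs (1/2) (fst t) \<in> hom_space mscale comm_mat sl" "hs (1/2) (fst (snd t)) \<in> hom_space mscale comm_mat sl" "snd (snd t) \<in> D"
      using half by (auto simp: A_def)
    then show "equivariant mscale comm_mat sl mscale comm_mat sl (?ev t)"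
      by (intro equivariant_add hom_equivariant[OF _ jord_op_bilinear sl_module_sl sl_module_sl]
          hom_equivariant[OF _ comm_op_bilinear sl_module_sl sl_module_sl] form_equivariant[OF _ form_mat_sl_invariant])
  next
    fix t assume t: "t \<in> ?T" "?ev t (munit i j) (munit j i) = 0"
    define p q d where "p = hs (1/2) (fst t)" "q = hs (1/2) (fst (snd t))" "d = scale (1 / of_nat CARD('n)) (snd (snd t))"
    have pA: "p \<in> A" "q \<in> A" "d \<in> D" using t(1) half by (auto simp: p_q_d_def subspace_scale[OF D_subspace])
    have sum0: "p (cmunit i + cmunit j) + q (cmunit i - cmunit j) + d = 0"
      using t(2) unfolding jord comm form p_q_d_def .
    have coords: "hs ((cmunit i + cmunit j :: 'f^'n^'n) $ r $ r) p + hs ((cmunit i - cmunit j :: 'f^'n^'n) $ r $ r) q = 0" for r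
      using coords_sl[of UNIV "\<lambda>b. if b then p else q" "\<lambda>b. if b then cmunit i + cmunit j else cmunit i - cmunit j" d r r]
        pA csl sum0 by (simp add: UNIV_bool add.commute)
    \<comment> \<open>At the diagonal position k, outside {i, j}, the difference of the centred
      units vanishes and their sum is -2/n, which isolates p.\<close>
    have "hs (- (1 / of_nat CARD('n)) - 1 / of_nat CARD('n)) p = 0"
      using coords[of k] ik jk by (simp add: cmunit_def mat_def module.scale_zero_left[OF module_hs])
    then have p0: "p = 0"
      by (subst (asm) vector_space.scale_eq_0_iff[OF vector_space_hs]) (simp add: add_divide_distrib[symmetric])
    then have "hs 1 q = 0"
      using coords[of i] ij by (simp add: cmunit_def mat_def module.scale_zero_right[OF module_hs])
    then have q0: "q = 0" by (simp add: module.scale_one[OF module_hs])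
    have "d = 0" using sum0 p0 q0 by simp
    then show "t = 0"
      using p0 q0 unfolding p_q_d_def by (simp add: vector_space.scale_eq_0_iff[OF vector_space_hs] prod_eq_iff)
  next
    fix \<phi> \<psi> assume h: "\<phi> \<in> hom_space mscale comm_mat sl" "\<psi> \<in> hom_space mscale comm_mat sl"
    let ?z = "bracket (\<phi> (munit i j)) (\<psi> (munit j i))"
    have "?z \<in> W ((unit_wt i - unit_wt j) + (unit_wt j - unit_wt i))"
      using h by (intro bracket_W A_weight ij ij[symmetric]) (simp_all only: A_def)
    then have z: "?z \<in> W 0" by simp
    have kill: "ad p q ?z = 0" if "p \<noteq> q" "p \<notin> {i, j}" "q \<notin> {i, j}" for p q
    proof -
      have "i \<noteq> p" "i \<noteq> q" "j \<noteq> p" "j \<noteq> q" using that by auto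
      then have "comm_mat (munit p q) (munit i j) = (0 :: 'f^'n^'n)" "comm_mat (munit p q) (munit j i) = (0 :: 'f^'n^'n)"
        using that by (auto simp: comm_mat_def)
      then show ?thesis
        using that ij by (simp add: ad_bracket_hom[OF h] hom_space_zero[OF sl_module_sl h(1)] hom_space_zero[OF sl_module_sl h(2)])
    qed
    obtain a b where ab: "a \<in> A" "b \<in> A" "?z - a (cmunit i) - b (cmunit j) \<in> D"
      by (rule zero_weight_two[OF z kill ij])
    have ha: "a \<in> hom_space mscale comm_mat sl" and hb: "b \<in> hom_space mscale comm_mat sl"
      using ab by (simp_all add: A_def)
    define d where "d = ?z - a (cmunit i) - b (cmunit j)"
    \<comment> \<open>These coordinates solve (p + q)/2 = a and (p - q)/2 = b; the factor n cancels
      the value 1/n of the form.\<close>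
    have "(a + b, a - b, scale (of_nat CARD('n)) d) \<in> ?T"
      using ab module.subspace_add[OF module_hs hom_subspaces(1)] module.subspace_diff[OF module_hs hom_subspaces(1)]
      by (simp add: subspace_scale[OF D_subspace] d_def)
    moreover have "?z = ?ev (a + b, a - b, scale (of_nat CARD('n)) d) (munit i j) (munit j i)"
    proof -
      have "hs (1/2) (a + b) (cmunit i + cmunit j) + hs (1/2) (a - b) (cmunit i - cmunit j) = a (cmunit i) + b (cmunit j)"
      proof -
        have "a (cmunit i + cmunit j) = a (cmunit i) + a (cmunit j)" "b (cmunit i + cmunit j) = b (cmunit i) + b (cmunit j)"
          "a (cmunit i - cmunit j) = a (cmunit i) - a (cmunit j)" "b (cmunit i - cmunit j) = b (cmunit i) - b (cmunit j)"
          by (simp_all add: hom_spaceD(4)[OF ha] hom_spaceD(4)[OF hb] hom_space_diff[OF sl_module_sl ha] hom_space_diff[OF sl_module_sl hb])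
        then have "hs (1/2) (a + b) (cmunit i + cmunit j) + hs (1/2) (a - b) (cmunit i - cmunit j)
          = scale (1/2) (a (cmunit i) + a (cmunit i) + (b (cmunit j) + b (cmunit j)))"
          by (simp add: algebra_simps flip: scale_right_distrib)
        also have "a (cmunit i) + a (cmunit i) + (b (cmunit j) + b (cmunit j)) = scale 2 (a (cmunit i) + b (cmunit j))"
          using scale_left_distrib[of 1 1 "a (cmunit i) + b (cmunit j)"] by (simp add: algebra_simps)
        finally show ?thesis by simp
      qed
      then show ?thesis unfolding jord comm form by (simp add: d_def)
    qed
    ultimately show "\<exists>t\<in>?T. ?z = ?ev t (munit i j) (munit j i)" by (rule bexI[rotated])
  qed (simp_all add: scale_pair_def scale_right_distrib scale_left_commute algebra_simps)
  note b = bilinear_on_fst_snd[OF f(1)[folded A_def]]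
  note b' = bilinear_on_fst_snd[OF b(2)]
  show ?thesis
    by (rule that[OF b(1) b']) (simp only: f(2)[folded A_def])
qed

text \<open>Duality does not exchange \<open>A\<close> with another space: precomposition with x
  \<mapsto> - x^t carries it to the space \<open>A\<close> of the dual grading.\<close>

definition twist :: "('f^'n^'n \<Rightarrow> 'l) \<Rightarrow> 'f^'n^'n \<Rightarrow> 'l" where
  "twist a x = a (- transpose x)"

lemma twist_apply: "a x = twist a (- transpose x)"
  by (simp add: twist_def transpose_uminus)

lemma twist_in_dual: "a \<in> A \<Longrightarrow> twist a \<in> lie_algebra_over_sl.A scale bracket dual_\<iota>"
proof -
  assume "a \<in> A"
  then have h: "a \<in> hom_space mscale comm_mat sl" by (simp add: A_def)
  interpret dual: lie_algebra_over_sl scale bracket dual_\<iota> by (rule dual_lie_algebra)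
  have "- transpose (comm_mat x y) = comm_mat (- transpose x) (- transpose y)" for x y :: "'f^'n^'n"
    by (simp add: comm_mat_def matrix_ring transpose_ring)
  then show "twist a \<in> dual.A"
    unfolding dual.A_def dual.hom_space_def twist_def
    using hom_spaceD(4)[OF h, of "- transpose _" "- transpose _"] hom_spaceD(5)[OF h, of "- transpose _"]
    by (auto simp: linear_on_def transpose_add transpose_mscale hom_spaceD(2)[OF h] hom_spaceD(3)[OF h])
qed

lemma bilinear_on_twist:
  assumes "bilinear_on hs (lie_algebra_over_sl.A scale bracket dual_\<iota>) sY Y sZ Z F"
  shows "bilinear_on sY Y hs A sZ Z (\<lambda>y a. F (twist a) y)"
proof -
  have tw: "twist (a + a') = twist a + twist a'" "twist (hs k a) = hs k (twist a)" for a a' k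
    by (simp_all add: twist_def fun_eq_iff)
  show ?thesis
    by (rule bilinear_onI) (simp_all add: tw twist_in_dual bilinear_onD[OF assms])
qed

section \<open>Brackets with primed spaces, obtained by duality\<close>

lemma dual_spaces':
  "lie_algebra_over_sl.B' scale bracket dual_\<iota> = B"
  "lie_algebra_over_sl.C' scale bracket dual_\<iota> = C"
  "lie_algebra_over_sl.E' scale bracket dual_\<iota> = E"
proof -
  interpret dual: lie_algebra_over_sl scale bracket dual_\<iota> by (rule dual_lie_algebra)
  have "act_V' (- transpose x) = (act_V x :: 'f^'n \<Rightarrow> _)" "act_S' (- transpose x) = act_S x" for x :: "'f^'n^'n"
    by (simp_all add: act_V'_eq act_S'_eq transpose_uminus)
  then show "dual.B' = B" "dual.C' = C" "dual.E' = E"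
    unfolding dual.B'_def dual.C'_def dual.E'_def B_def C_def E_def dual_hom_space by simp_all
qed

lemma product_V'_V':
  obtains f g where "bilinear_on hs B' hs B' hs C' f" "bilinear_on hs B' hs B' hs E' g"
    "\<And>b1 b2 u v. b1 \<in> B' \<Longrightarrow> b2 \<in> B' \<Longrightarrow> bracket (b1 u) (b2 v)
      = hs (1/2) (f b1 b2) (outer u v + outer v u) + hs (1/2) (g b1 b2) (outer u v - outer v u)"
proof -
  interpret dual: theta_graded5 scale bracket dual_\<iota> by (rule dual_theta_graded5)
  show ?thesis by (rule dual.product_V_V[unfolded dual_spaces]) (rule that)
qed

lemma product_V'_sl:
  obtains f where "bilinear_on hs B' hs A hs B' f"
    "\<And>a b x u. a \<in> A \<Longrightarrow> b \<in> B' \<Longrightarrow> x \<in> sl \<Longrightarrow> bracket (b u) (a x) = f b a (transpose x *v u)"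
proof -
  interpret dual: theta_graded5 scale bracket dual_\<iota> by (rule dual_theta_graded5)
  obtain F where F: "bilinear_on hs dual.A hs B' hs B' F"
    "\<And>a b x u. a \<in> dual.A \<Longrightarrow> b \<in> B' \<Longrightarrow> x \<in> sl \<Longrightarrow> bracket (a x) (b u) = F a b (x *v u)"
    by (rule dual.product_sl_V[unfolded dual_spaces]) (rule that)
  show ?thesis
  proof (rule that[OF bilinear_on_twist[OF F(1)]])
    fix a b x and u :: "'f^'n" assume a: "a \<in> A" "b \<in> B'" "x \<in> (sl :: ('f^'n^'n) set)"
    have Fh: "F (twist a) b \<in> hom_space (*s) act_V' UNIV"
      using bilinear_onD(1)[OF F(1) twist_in_dual[OF a(1)] a(2)] by (simp add: B'_def)
    have "bracket (b u) (a x) = - bracket (twist a (- transpose x)) (b u)"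
      by (simp only: twist_apply[of a x] bracket_anticomm[of "b u"])
    also have "\<dots> = - F (twist a) b (- transpose x *v u)" using F(2)[OF twist_in_dual[OF a(1)] a(2)] a(3) by simp
    also have "\<dots> = F (twist a) b (transpose x *v u)"
      using hom_space_minus[OF sl_module_V' Fh] by (simp add: mult_vec_uminus_left del: transpose_matrix_vector)
    finally show "bracket (b u) (a x) = F (twist a) b (transpose x *v u)" .
  qed
qed

lemma product_V'_S:
  obtains f where "bilinear_on hs B' hs C hs B f"
    "\<And>c b s u. c \<in> C \<Longrightarrow> b \<in> B' \<Longrightarrow> s \<in> sym_mats \<Longrightarrow> bracket (b u) (c s) = f b c (s *v u)"
proof -
  interpret dual: theta_graded5 scale bracket dual_\<iota> by (rule dual_theta_graded5)
  obtain F where F: "bilinear_on hs C hs B' hs B F"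
    "\<And>c b s u. c \<in> C \<Longrightarrow> b \<in> B' \<Longrightarrow> s \<in> sym_mats \<Longrightarrow> bracket (c s) (b u) = F c b (s *v u)"
    by (rule dual.product_S'_V[unfolded dual_spaces dual_spaces']) (rule that)
  show ?thesis
    by (rule that[OF bilinear_on_uminus[OF bilinear_on_flip[OF F(1)] vector_space_hs hom_subspaces(2)]])
      (simp add: bracket_anticomm[of "_ _ :: 'l" "(_ :: 'f^'n^'n \<Rightarrow> 'l) _"] F(2))
qed

lemma product_V'_L:
  obtains f where "bilinear_on hs B' hs E hs B f"
    "\<And>e b s u. e \<in> E \<Longrightarrow> b \<in> B' \<Longrightarrow> s \<in> skew_mats \<Longrightarrow> bracket (b u) (e s) = f b e (- (s *v u))"
proof -
  interpret dual: theta_graded5 scale bracket dual_\<iota> by (rule dual_theta_graded5)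
  obtain F where F: "bilinear_on hs E hs B' hs B F"
    "\<And>c b s u. c \<in> E \<Longrightarrow> b \<in> B' \<Longrightarrow> s \<in> skew_mats \<Longrightarrow> bracket (c s) (b u) = F c b (s *v u)"
    by (rule dual.product_L'_V[unfolded dual_spaces dual_spaces']) (rule that)
  show ?thesis
  proof (rule that[OF bilinear_on_flip[OF F(1)]])
    fix e b s and u :: "'f^'n" assume h: "e \<in> E" "b \<in> B'" "s \<in> (skew_mats :: ('f^'n^'n) set)"
    have Fh: "F e b \<in> hom_space (*s) act_V UNIV" using bilinear_onD(1)[OF F(1) h(1,2)] by (simp add: B_def)
    show "bracket (b u) (e s) = F e b (- (s *v u))"
      using F(2)[OF h] hom_space_minus[OF sl_module_V Fh] by (simp add: bracket_anticomm[of "b u"])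
  qed
qed

text \<open>Reversing the bracket and replacing x by - x^t each bring a sign. They cancel on
  \<open>s ** x + transpose x ** s\<close>, but not on the difference, where the sign is absorbed
  into the second map.\<close>

lemma product_S'_sl:
  obtains f g where "bilinear_on hs C' hs A hs C' f" "bilinear_on hs C' hs A hs E' g"
    "\<And>a c x s. a \<in> A \<Longrightarrow> c \<in> C' \<Longrightarrow> x \<in> sl \<Longrightarrow> s \<in> sym_mats \<Longrightarrow> bracket (c s) (a x)
      = hs (1/2) (f c a) (s ** x + transpose x ** s) + hs (1/2) (g c a) (s ** x - transpose x ** s)"
proof -
  interpret dual: theta_graded5 scale bracket dual_\<iota> by (rule dual_theta_graded5)
  obtain F G where F: "bilinear_on hs dual.A hs C' hs C' F" "bilinear_on hs dual.A hs C' hs E' G"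
    "\<And>a c x s. a \<in> dual.A \<Longrightarrow> c \<in> C' \<Longrightarrow> x \<in> sl \<Longrightarrow> s \<in> sym_mats \<Longrightarrow> bracket (a x) (c s)
      = hs (1/2) (F a c) (x ** s + s ** transpose x) + hs (1/2) (G a c) (x ** s - s ** transpose x)"
    by (rule dual.product_sl_S[unfolded dual_spaces]) (rule that)
  show ?thesis
  proof (rule that[OF bilinear_on_twist[OF F(1)] bilinear_on_uminus[OF bilinear_on_twist[OF F(2)] vector_space_hs hom_subspaces(7)]])
    fix a c and x s :: "'f^'n^'n" assume h: "a \<in> A" "c \<in> C'" "x \<in> sl" "s \<in> sym_mats"
    let ?F = "F (twist a) c" and ?G = "G (twist a) c"
    have Fh: "?F \<in> hom_space mscale act_S' sym_mats" and Gh: "?G \<in> hom_space mscale act_S' skew_mats"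
      using bilinear_onD(1)[OF F(1) twist_in_dual[OF h(1)] h(2)] bilinear_onD(1)[OF F(2) twist_in_dual[OF h(1)] h(2)]
      by (simp_all add: C'_def E'_def)
    have s: "transpose s = s" using h(4) by (simp add: sym_mats_def)
    have "bracket (c s) (a x) = - bracket (twist a (- transpose x)) (c s)"
      by (simp only: twist_apply[of a x] bracket_anticomm[of "c s"])
    also have "\<dots> = - (hs (1/2) ?F (- (s ** x + transpose x ** s)) + hs (1/2) ?G (s ** x - transpose x ** s))"
      using F(3)[OF twist_in_dual[OF h(1)] h(2), of "- transpose x" s] h(3,4)
      by (simp add: matrix_ring transpose_uminus algebra_simps)
    finally have *: "bracket (c s) (a x)
      = - (hs (1/2) ?F (- (s ** x + transpose x ** s)) + hs (1/2) ?G (s ** x - transpose x ** s))" .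
    have "?F (- (s ** x + transpose x ** s)) = - ?F (s ** x + transpose x ** s)"
      by (rule hom_space_minus[OF sl_module_S' Fh]) (simp add: sym_mats_def transpose_ring s add.commute)
    then show "bracket (c s) (a x)
      = hs (1/2) ?F (s ** x + transpose x ** s) + hs (1/2) (- ?G) (s ** x - transpose x ** s)"
      unfolding * hs_apply by (simp only:) simp
  qed
qed

lemma product_L'_sl:
  obtains f g where "bilinear_on hs E' hs A hs E' f" "bilinear_on hs E' hs A hs C' g"
    "\<And>a c x s. a \<in> A \<Longrightarrow> c \<in> E' \<Longrightarrow> x \<in> sl \<Longrightarrow> s \<in> skew_mats \<Longrightarrow> bracket (c s) (a x)
      = hs (1/2) (f c a) (s ** x + transpose x ** s) + hs (1/2) (g c a) (s ** x - transpose x ** s)"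
proof -
  interpret dual: theta_graded5 scale bracket dual_\<iota> by (rule dual_theta_graded5)
  obtain F G where F: "bilinear_on hs dual.A hs E' hs E' F" "bilinear_on hs dual.A hs E' hs C' G"
    "\<And>a c x s. a \<in> dual.A \<Longrightarrow> c \<in> E' \<Longrightarrow> x \<in> sl \<Longrightarrow> s \<in> skew_mats \<Longrightarrow> bracket (a x) (c s)
      = hs (1/2) (F a c) (x ** s + s ** transpose x) + hs (1/2) (G a c) (x ** s - s ** transpose x)"
    by (rule dual.product_sl_L[unfolded dual_spaces]) (rule that)
  show ?thesis
  proof (rule that[OF bilinear_on_twist[OF F(1)] bilinear_on_uminus[OF bilinear_on_twist[OF F(2)] vector_space_hs hom_subspaces(5)]])
    fix a c and x s :: "'f^'n^'n" assume h: "a \<in> A" "c \<in> E'" "x \<in> sl" "s \<in> skew_mats"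
    let ?F = "F (twist a) c" and ?G = "G (twist a) c"
    have Fh: "?F \<in> hom_space mscale act_S' skew_mats" and Gh: "?G \<in> hom_space mscale act_S' sym_mats"
      using bilinear_onD(1)[OF F(1) twist_in_dual[OF h(1)] h(2)] bilinear_onD(1)[OF F(2) twist_in_dual[OF h(1)] h(2)]
      by (simp_all add: C'_def E'_def)
    have s: "transpose s = - s" using h(4) by (simp add: skew_mats_def)
    have "bracket (c s) (a x) = - bracket (twist a (- transpose x)) (c s)"
      by (simp only: twist_apply[of a x] bracket_anticomm[of "c s"])
    also have "\<dots> = - (hs (1/2) ?F (- (s ** x + transpose x ** s)) + hs (1/2) ?G (s ** x - transpose x ** s))"
      using F(3)[OF twist_in_dual[OF h(1)] h(2), of "- transpose x" s] h(3,4)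
      by (simp add: matrix_ring transpose_uminus algebra_simps)
    finally have *: "bracket (c s) (a x)
      = - (hs (1/2) ?F (- (s ** x + transpose x ** s)) + hs (1/2) ?G (s ** x - transpose x ** s))" .
    have "?F (- (s ** x + transpose x ** s)) = - ?F (s ** x + transpose x ** s)"
      by (rule hom_space_minus[OF sl_module_L' Fh]) (simp add: skew_mats_def transpose_ring s matrix_ring)
    then show "bracket (c s) (a x)
      = hs (1/2) ?F (s ** x + transpose x ** s) + hs (1/2) (- ?G) (s ** x - transpose x ** s)"
      unfolding * hs_apply by (simp only:) simp
  qed
qed

text \<open>Elements of \<open>D\<close> commute with the image of \<open>sl\<close>, so bracketing
  with d preserves equivariance. The coordinate action of \<open>D\<close> is therefore composition
  with \<open>ad d\<close> on all seven spaces.\<close>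

lemma D_action:
  assumes d: "d \<in> D" and \<phi>: "\<phi> \<in> hom_space sM act M"
  shows "(\<lambda>m. bracket d (\<phi> m)) \<in> hom_space sM act M"
proof -
  have "bracket d (\<iota> x) = 0" if "x \<in> sl" for x
    using d that bracket_anticomm[of d "\<iota> x"] by (simp add: D_iff)
  then have "bracket d (bracket (\<iota> x) z) = bracket (\<iota> x) (bracket d z)" if "x \<in> sl" for x z
    using that by (simp add: bracket_bracket_right[of d])
  then show ?thesis
    using \<phi> by (auto simp: hom_space_def linear_on_def bracket_add_right bracket_scale_right)
qed

definition act_D :: "'l \<Rightarrow> ('m \<Rightarrow> 'l) \<Rightarrow> 'm \<Rightarrow> 'l" where
  "act_D d \<phi> = (\<lambda>m. bracket d (\<phi> m))"

lemma act_D_bilinear: "bilinear_on scale D hs (hom_space sM act M) hs (hom_space sM act M) act_D"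
  by (rule bilinear_onI) (simp_all add: act_D_def D_action fun_eq_iff bracket_ring bracket_scale_left bracket_scale_right)

lemma D_bracket: "d1 \<in> D \<Longrightarrow> d2 \<in> D \<Longrightarrow> bracket d1 d2 \<in> D"
  by (simp add: D_iff bracket_bracket_right[of "\<iota> _"])

end

section \<open>Vanishing brackets\<close>

text \<open>Off \<open>P\<close> every coefficient becomes -1, which contributes n - |P| to the
  norm; the shifted coefficients on \<open>P\<close> add up to \<open>tot c\<close> - |P|.\<close>

lemma nrm_ge_support:
  assumes "finite P" "\<And>k. k \<notin> P \<Longrightarrow> c k = 0"
  shows "int CARD('n::finite) + tot c - 2 * int (card P) \<le> nrm (\<lambda>k::'n. c k - 1)"
proof -
  have compl: "int (card (- P)) = int CARD('n) - int (card P)"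
    using card_Diff_subset[of P UNIV] card_mono[of UNIV P] by (simp add: Compl_eq_Diff_UNIV of_nat_diff)
  have "(\<Sum>k\<in>- P. c k - 1) = (\<Sum>k\<in>- P. - 1)"
    by (rule sum.cong) (use assms in auto)
  then have sumZ: "(\<Sum>k\<in>- P. c k - 1) = - (int CARD('n) - int (card P))" using compl by simp
  have tot: "tot (\<lambda>k. c k - 1) = tot c - int CARD('n)" by (simp add: tot_def sum_subtractf)
  show ?thesis using nrm_ge_split[of "\<lambda>k. c k - 1" "- P"] unfolding sumZ tot by linarith
qed

context theta_graded5
begin

lemma tot_double: "tot (2 * c) = 2 * tot c"
  by (simp only: mult_2 tot_simps)

text \<open>Weights of total degree 3 or 4 can only be congruent to weights in \<open>\<Theta>\<^sub>n\<close> after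
  subtracting \<open>\<epsilon>\<^sub>1 + \<dots> + \<epsilon>\<^sub>n\<close> once, which is excluded by the size of \<open>n\<close>.\<close>

lemma W_zero_high:
  assumes "x \<in> W c" "3 \<le> tot c" "tot c \<le> 4" "finite P" "\<And>k. k \<notin> P \<Longrightarrow> c k = 0"
    and "int CARD('n) > tot c + 2 \<or> int CARD('n) + tot c - 2 * int (card P) > 2"
  shows "x = 0"
proof (rule ccontr)
  assume "x \<noteq> 0"
  then obtain c' k where c': "nrm c' \<le> 2" "c = (\<lambda>r. c' r + k)" "tot c = tot c' + int CARD('n) * k"
    by (rule W_nonzero[OF assms(1)])
  have tot': "\<bar>tot c'\<bar> \<le> 2" using abs_tot_le_nrm[of c'] c'(1) by linarith
  have n5: "int CARD('n) \<ge> 5" using card5 by simp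
  have "k \<ge> 1"
  proof (rule ccontr)
    assume "\<not> k \<ge> 1"
    then have "int CARD('n) * k \<le> 0" by (simp add: mult_le_0_iff)
    then show False using c'(3) tot' assms(2) by linarith
  qed
  moreover have "k \<le> 1"
  proof (rule ccontr)
    \<comment> \<open>Then n k would be at least 10, whereas it is the difference of two totals, at
      most 4 + 2.\<close>
    assume "\<not> k \<le> 1"
    then have "5 * 2 \<le> int CARD('n) * k" using n5 by (intro mult_mono) auto
    then show False using c'(3) tot' assms(3) by linarith
  qed
  ultimately have k: "k = 1" by simp
  then have "int CARD('n) \<le> tot c + 2" using c'(3) tot' by simp
  moreover have "c' = (\<lambda>r. c r - 1)" using c'(2) k by auto
  then have "int CARD('n) + tot c - 2 * int (card P) \<le> 2"
    using nrm_ge_support[of P c] assms(4,5) c'(1) by auto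
  ultimately show False using assms(6) by linarith
qed

lemma bracket_tensor_zero:
  assumes "\<And>\<phi> \<psi> m n. \<phi> \<in> H \<Longrightarrow> \<psi> \<in> H' \<Longrightarrow> m \<in> M \<Longrightarrow> n \<in> N \<Longrightarrow> bracket (\<phi> m) (\<psi> n) = 0"
    and "y \<in> tensor_image M H" "z \<in> tensor_image N H'"
  shows "bracket y z = 0"
proof -
  have "tensor_image N H' \<subseteq> {z. \<forall>\<phi>\<in>H. \<forall>m\<in>M. bracket (\<phi> m) z = 0}"
    by (rule tensor_image_minimal) (auto intro!: subspaceI simp: assms(1) bracket_add_right bracket_scale_right)
  then have "tensor_image M H \<subseteq> {y. bracket y z = 0}"
    using assms(3) by (intro tensor_image_minimal) (auto intro!: subspaceI simp: bracket_add_left bracket_scale_left)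
  then show ?thesis using assms(2) by auto
qed

lemma bracket_zero_rule:
  assumes M: "sl_module sM act M" "sl_module.generated_by sM act M R v"
    and N: "sl_module sN act' N" "sl_module.generated_by sN act' N R' w"
    and kill: "\<And>p q. (p, q) \<in> R \<Longrightarrow> p \<noteq> q \<Longrightarrow> act' (munit p q) w = 0"
    and zero: "\<And>\<phi> \<psi>. \<phi> \<in> hom_space sM act M \<Longrightarrow> \<psi> \<in> hom_space sN act' N \<Longrightarrow> bracket (\<phi> v) (\<psi> w) = 0"
    and y: "y \<in> tensor_image M (hom_space sM act M)" and z: "z \<in> tensor_image N (hom_space sN act' N)"
  shows "bracket y z = 0"
  by (rule bracket_tensor_zero[OF _ y z])
    (rule equivariant_eq_zero[OF M N kill bracket_equivariant zero])

text \<open>A weight with a doubled unit has a support of at most three indices, and with that n +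
  \<open>tot c\<close> - 2 |P| exceeds 2 already for n = 5. The same count settles the next two
  brackets.\<close>

lemma zero_S_S:
  assumes "y \<in> tensor_image sym_mats C" "z \<in> tensor_image sym_mats C"
  shows "bracket y z = 0"
proof -
  obtain i j :: 'n where ij: "i \<noteq> j" by (rule obtain_distinct) auto
  show ?thesis
  proof (rule bracket_zero_rule[OF sl_module_S S_generated[of i] sl_module_S S_generated[of j] _ _ assms[unfolded C_def]])
    fix p q :: 'n assume "(p, q) \<in> {(p, q). q = i}" "p \<noteq> q"
    then show "act_S (munit p q) (munit j j) = (0 :: 'f^'n^'n)" using ij by (auto simp: act_S_def)
  next
    fix \<phi> \<psi> assume "\<phi> \<in> hom_space mscale act_S sym_mats" "\<psi> \<in> hom_space mscale act_S sym_mats"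
    then have "bracket (\<phi> (munit i i)) (\<psi> (munit j j)) \<in> W ((unit_wt i + unit_wt i) + (unit_wt j + unit_wt j))"
      by (intro bracket_W C_weight_diag) (simp_all only: C_def)
    then show "bracket (\<phi> (munit i i)) (\<psi> (munit j j)) = 0"
      by (rule W_zero_high[where P = "{i, j}"]) (use ij card5 in \<open>auto simp: unit_wt_def tot_double\<close>)
  qed
qed

lemma zero_S_L:
  assumes "y \<in> tensor_image sym_mats C" "z \<in> tensor_image skew_mats E"
  shows "bracket y z = 0"
proof -
  obtain i j k l m :: 'n where d: "distinct [i, j, k, l, m]" by (rule obtain_distinct)
  then have ij: "i \<noteq> j" and ik: "i \<noteq> k" and jk: "j \<noteq> k" by auto
  show ?thesis
  proof (rule bracket_zero_rule[OF sl_module_S S_generated[of i] sl_module_L L_generated[OF jk] _ _ assms[unfolded C_def E_def]])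
    fix p q :: 'n assume "(p, q) \<in> {(p, q). q = i}" "p \<noteq> q"
    then show "act_S (munit p q) (munit j k - munit k j) = (0 :: 'f^'n^'n)" using ij ik by (auto simp: act_S_def matrix_ring)
  next
    fix \<phi> \<psi> assume "\<phi> \<in> hom_space mscale act_S sym_mats" "\<psi> \<in> hom_space mscale act_S skew_mats"
    then have "bracket (\<phi> (munit i i)) (\<psi> (munit j k - munit k j)) \<in> W ((unit_wt i + unit_wt i) + (unit_wt j + unit_wt k))"
      by (intro bracket_W C_weight_diag E_weight) (simp_all only: C_def E_def)
    then show "bracket (\<phi> (munit i i)) (\<psi> (munit j k - munit k j)) = 0"
      by (rule W_zero_high[where P = "{i, j, k}"]) (use ij ik jk card5 in \<open>auto simp: unit_wt_def tot_double\<close>)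
  qed
qed

lemma zero_S_V:
  assumes "y \<in> tensor_image sym_mats C" "z \<in> tensor_image UNIV B"
  shows "bracket y z = 0"
proof -
  obtain i j :: 'n where ij: "i \<noteq> j" by (rule obtain_distinct) auto
  show ?thesis
  proof (rule bracket_zero_rule[OF sl_module_S S_generated[of i] sl_module_V V_generated[of j] _ _ assms[unfolded C_def B_def]])
    fix \<phi> \<psi> assume "\<phi> \<in> hom_space mscale act_S sym_mats" "\<psi> \<in> hom_space (*s) act_V UNIV"
    then have "bracket (\<phi> (munit i i)) (\<psi> (axis j 1)) \<in> W ((unit_wt i + unit_wt i) + unit_wt j)"
      by (intro bracket_W C_weight_diag B_weight) (simp_all only: C_def B_def)
    then show "bracket (\<phi> (munit i i)) (\<psi> (axis j 1)) = 0"
      by (rule W_zero_high[where P = "{i, j}"]) (use ij card5 in \<open>auto simp: unit_wt_def tot_double\<close>)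
  qed (use ij in \<open>auto simp: munit_act_V\<close>)
qed

text \<open>Four distinct units have the largest support, and weights exclude the bracket only for n
  \<ge> 7. For n = 6 their sum is congruent to minus the sum of the other two units, for n = 5 to
  minus the remaining one; both weights lie in \<open>Theta\<close>, and there the vanishing is an
  assumption.\<close>

lemma zero_L_L:
  assumes "CARD('n) \<ge> 7" "y \<in> tensor_image skew_mats E" "z \<in> tensor_image skew_mats E"
  shows "bracket y z = 0"
proof -
  obtain i j k l m :: 'n where d: "distinct [i, j, k, l, m]" by (rule obtain_distinct)
  then have ij: "i \<noteq> j" and kl: "k \<noteq> l" by auto
  show ?thesis
  proof (rule bracket_zero_rule[OF sl_module_L L_generated[OF ij] sl_module_L L_generated[OF kl] _ _ assms(2,3)[unfolded E_def]])
    fix p q :: 'n assume "(p, q) \<in> {(p, q). p \<noteq> i \<and> p \<noteq> j \<and> (q = i \<or> q = j)}" "p \<noteq> q"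
    then show "act_S (munit p q) (munit k l - munit l k) = (0 :: 'f^'n^'n)" using d by (auto simp: act_S_def matrix_ring)
  next
    fix \<phi> \<psi> assume "\<phi> \<in> hom_space mscale act_S skew_mats" "\<psi> \<in> hom_space mscale act_S skew_mats"
    then have "bracket (\<phi> (munit i j - munit j i)) (\<psi> (munit k l - munit l k)) \<in> W ((unit_wt i + unit_wt j) + (unit_wt k + unit_wt l))"
      by (intro bracket_W E_weight) (simp_all only: E_def)
    then show "bracket (\<phi> (munit i j - munit j i)) (\<psi> (munit k l - munit l k)) = 0"
      by (rule W_zero_high[where P = "{i, j, k, l}"]) (use d assms(1) in \<open>auto simp: unit_wt_def\<close>)
  qed
qed

text \<open>For n = 5 the sum of three distinct units is congruent to minus the sum of the other
  two, a weight in \<open>Theta\<close>; from n = 6 on the support bound excludes it.\<close>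

lemma zero_L_V:
  assumes "CARD('n) \<ge> 6" "y \<in> tensor_image skew_mats E" "z \<in> tensor_image UNIV B"
  shows "bracket y z = 0"
proof -
  obtain i j k l m :: 'n where d: "distinct [i, j, k, l, m]" by (rule obtain_distinct)
  then have ij: "i \<noteq> j" and ik: "i \<noteq> k" and jk: "j \<noteq> k" by auto
  show ?thesis
  proof (rule bracket_zero_rule[OF sl_module_L L_generated[OF ij] sl_module_V V_generated[of k] _ _ assms(2,3)[unfolded E_def B_def]])
    fix \<phi> \<psi> assume "\<phi> \<in> hom_space mscale act_S skew_mats" "\<psi> \<in> hom_space (*s) act_V UNIV"
    then have "bracket (\<phi> (munit i j - munit j i)) (\<psi> (axis k 1)) \<in> W ((unit_wt i + unit_wt j) + unit_wt k)"
      by (intro bracket_W E_weight B_weight) (simp_all only: E_def B_def)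
    then show "bracket (\<phi> (munit i j - munit j i)) (\<psi> (axis k 1)) = 0"
      by (rule W_zero_high[where P = "{i, j, k}"]) (use ij ik jk assms(1) in \<open>auto simp: unit_wt_def\<close>)
  qed (use d in \<open>auto simp: munit_act_V\<close>)
qed

definition rank_condition :: bool where
  "rank_condition \<longleftrightarrow> CARD('n) \<ge> 7 \<or> CARD('n) = 6 \<and> condition_6 \<or> CARD('n) = 5 \<and> condition_5"

lemma zero_unprimed:
  assumes rank_condition and y: "y \<in> tensor_image sym_mats C \<union> tensor_image skew_mats E"
    and z: "z \<in> tensor_image sym_mats C \<union> tensor_image skew_mats E \<union> tensor_image UNIV B"
  shows "bracket y z = 0"
proof -
  have LL: "bracket y z = 0" if "y \<in> tensor_image skew_mats E" "z \<in> tensor_image skew_mats E" for y z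
    using assms(1) unfolding rank_condition_def
  proof (elim disjE conjE)
    assume condition_5
    \<comment> \<open>The condition for n = 5 speaks of sums z + w; one summand is taken to be
      zero.\<close>
    then have "bracket y (z + 0) = 0"
      using that subspace_0[OF tensor_image_subspace] unfolding condition_5_def by blast
    then show ?thesis by simp
  next
    assume condition_6
    then show ?thesis using that unfolding condition_6_def by blast
  qed (rule zero_L_L[OF _ that])
  have LV: "bracket y z = 0" if "y \<in> tensor_image skew_mats E" "z \<in> tensor_image UNIV B" for y z
    using assms(1) unfolding rank_condition_def
  proof (elim disjE conjE)
    assume condition_5
    then have "bracket y (0 + z) = 0"
      using that subspace_0[OF tensor_image_subspace] unfolding condition_5_def by blast
    then show ?thesis by simp
  qed (rule zero_L_V[OF _ that], simp)+
  have LS: "bracket y z = 0" if "y \<in> tensor_image skew_mats E" "z \<in> tensor_image sym_mats C" for y z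
    using zero_S_L[OF that(2,1)] bracket_anticomm[of y z] by simp
  show ?thesis
    using y z by (elim UnE) (simp_all only: zero_S_S zero_S_L zero_S_V LL LV LS)
qed

text \<open>Duality exchanges the primed and the unprimed half of each condition.\<close>

lemma dual_rank_condition:
  assumes rank_condition
  shows "theta_graded5.rank_condition scale bracket dual_\<iota>"
proof -
  interpret dual: theta_graded5 scale bracket dual_\<iota> by (rule dual_theta_graded5)
  show ?thesis
    using assms unfolding rank_condition_def dual.rank_condition_def condition_5_def condition_6_def
      dual.condition_5_def dual.condition_6_def dual_spaces dual_spaces' by (elim disjE) simp_all
qed

lemma zero_primed:
  assumes rank_condition and y: "y \<in> tensor_image sym_mats C' \<union> tensor_image skew_mats E'"
    and z: "z \<in> tensor_image sym_mats C' \<union> tensor_image skew_mats E' \<union> tensor_image UNIV B'"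
  shows "bracket y z = 0"
proof -
  interpret dual: theta_graded5 scale bracket dual_\<iota> by (rule dual_theta_graded5)
  show ?thesis
    by (rule dual.zero_unprimed[OF dual_rank_condition[OF assms(1)], unfolded dual_spaces]) (fact y z)+
qed

text \<open>At E_ij, E_jk both matrix products are E_ik, and exchanging the factors fixes the Jordan
  product and reverses the commutator. Anticommutativity for (a1, a2) and for (a2, a1) makes
  \<open>p a1 a2 + p a2 a1\<close> equal both to a difference of values of \<open>q\<close> and to
  its negative, hence zero.\<close>

lemma sl_sl_symmetries:
  assumes p: "bilinear_on hs A hs A hs A p" and q: "bilinear_on hs A hs A hs A q"
    and rule: "\<And>a1 a2 x y. a1 \<in> A \<Longrightarrow> a2 \<in> A \<Longrightarrow> x \<in> sl \<Longrightarrow> y \<in> sl \<Longrightarrow> bracket (a1 x) (a2 y)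
      = hs (1/2) (p a1 a2) (jord_mat x y) + hs (1/2) (q a1 a2) (comm_mat x y) + scale (form_mat x y) (g a1 a2)"
    and a: "a1 \<in> A" "a2 \<in> A"
  shows "p a1 a2 = - p a2 a1" "q a1 a2 = q a2 a1"
proof -
  obtain i j k l m :: 'n where d: "distinct [i, j, k, l, m]" by (rule obtain_distinct)
  then have ij: "i \<noteq> j" and ik: "i \<noteq> k" and jk: "j \<noteq> k" by auto
  have mem: "p b1 b2 \<in> A" "q b1 b2 \<in> A" if "b1 \<in> A" "b2 \<in> A" for b1 b2
    using bilinear_onD(1)[OF p that] bilinear_onD(1)[OF q that] by simp_all
  have h: "x \<in> hom_space mscale comm_mat sl" if "x \<in> A" for x using that by (simp add: A_def)
  have mats: "jord_mat (munit i j) (munit j k) = (munit i k :: 'f^'n^'n)" "jord_mat (munit j k) (munit i j) = (munit i k :: 'f^'n^'n)"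
    "comm_mat (munit i j) (munit j k) = (munit i k :: 'f^'n^'n)" "comm_mat (munit j k) (munit i j) = (- munit i k :: 'f^'n^'n)"
    "form_mat (munit i j) (munit j k) = (0 :: 'f)" "form_mat (munit j k) (munit i j) = (0 :: 'f)"
    using ij ik jk by (simp_all add: jord_mat_def comm_mat_def form_mat_def)
  have eq: "p a1 a2 + q a1 a2 = q a2 a1 - p a2 a1" if a: "a1 \<in> A" "a2 \<in> A" for a1 a2
  proof -
    have "bracket (a1 (munit i j)) (a2 (munit j k)) = scale (1/2) (p a1 a2 (munit i k) + q a1 a2 (munit i k))"
      using rule[OF a, of "munit i j" "munit j k"] ij jk by (simp add: mats scale_right_distrib)
    moreover have "bracket (a2 (munit j k)) (a1 (munit i j)) = scale (1/2) (p a2 a1 (munit i k) - q a2 a1 (munit i k))"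
      using rule[OF a(2,1), of "munit j k" "munit i j"] ij jk ik hom_space_minus[OF sl_module_sl h[OF mem(2)[OF a(2,1)]], of "munit i k"]
      by (simp add: mats scale_right_diff_distrib)
    ultimately have "scale (1/2) (p a1 a2 (munit i k) + q a1 a2 (munit i k)) = scale (1/2) (q a2 a1 (munit i k) - p a2 a1 (munit i k))"
      using bracket_anticomm[of "a1 (munit i j)" "a2 (munit j k)"] by (simp flip: scale_minus_right)
    then have "(p a1 a2 + q a1 a2) (munit i k) = (q a2 a1 - p a2 a1) (munit i k)" by simp
    moreover have "p a1 a2 + q a1 a2 \<in> A" "q a2 a1 - p a2 a1 \<in> A"
      using mem a module.subspace_add[OF module_hs hom_subspaces(1)] module.subspace_diff[OF module_hs hom_subspaces(1)] by simp_all
    ultimately show ?thesis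
      using hom_eqI[OF sl_module_sl sl_generated[OF ik]] by (simp add: A_def)
  qed
  have e1: "p a1 a2 + q a1 a2 = q a2 a1 - p a2 a1" and e2: "p a2 a1 + q a2 a1 = q a1 a2 - p a1 a2"
    using eq a by simp_all
  have "hs 2 (p a1 a2 + p a2 a1) = (p a1 a2 + p a2 a1) + (p a1 a2 + p a2 a1)"
    using module.scale_left_distrib[OF module_hs, of 1 1 "p a1 a2 + p a2 a1"] by (simp add: module.scale_one[OF module_hs])
  also have "\<dots> = 0"
  proof -
    have "p a1 a2 + p a2 a1 = q a2 a1 - q a1 a2" "p a1 a2 + p a2 a1 = q a1 a2 - q a2 a1"
      using arg_cong[OF e1, of "\<lambda>x. x + p a2 a1 - q a1 a2"] arg_cong[OF e2, of "\<lambda>x. x + p a1 a2 - q a2 a1"]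
      by (simp_all add: algebra_simps)
    then have "(p a1 a2 + p a2 a1) + (p a1 a2 + p a2 a1) = (q a2 a1 - q a1 a2) + (q a1 a2 - q a2 a1)"
      by (rule arg_cong2)
    then show ?thesis by simp
  qed
  finally have "p a1 a2 + p a2 a1 = 0" by (simp add: vector_space.scale_eq_0_iff[OF vector_space_hs])
  then show "p a1 a2 = - p a2 a1" by (simp add: eq_neg_iff_add_eq_0)
  then show "q a1 a2 = q a2 a1" using e1 by simp
qed

end

section \<open>The coordinate algebra\<close>

text \<open>The conditions of \<open>bilinear_products\<close> and \<open>bracket_rules\<close>, with \<open>\<phi> m\<close> for \<open>m \<otimes> \<phi>\<close>.\<close>

locale coordinatized = theta_graded5 scale bracket \<iota>
  for scale :: "'f::field_char_0 \<Rightarrow> 'l::ab_group_add \<Rightarrow> 'l" and bracket :: "'l \<Rightarrow> 'l \<Rightarrow> 'l"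
    and \<iota> :: "'f^'n^'n \<Rightarrow> 'l" +
  fixes P :: "('f^'n^'n \<Rightarrow> 'l, 'f^'n \<Rightarrow> 'l, 'l) products"
  assumes bilinear [simp]:
      "bilinear_on hs A hs A hs A (comm P)"
      "bilinear_on hs A hs A hs A (jord P)"
      "bilinear_on hs B hs B' hs A (bb'_A P)"
      "bilinear_on hs C hs C' hs A (cc'_A P)"
      "bilinear_on hs E hs E' hs A (ee'_A P)"
      "bilinear_on hs B hs B hs C (bb_C P)"
      "bilinear_on hs B hs B hs E (bb_E P)"
      "bilinear_on hs B' hs B' hs C' (b'b'_C' P)"
      "bilinear_on hs B' hs B' hs E' (b'b'_E' P)"
      "bilinear_on hs A hs C hs C (ac_C P)"
      "bilinear_on hs A hs C hs E (ac_E P)"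
      "bilinear_on hs A hs E hs E (ae_E P)"
      "bilinear_on hs A hs E hs C (ae_C P)"
      "bilinear_on hs C' hs A hs C' (c'a_C' P)"
      "bilinear_on hs C' hs A hs E' (c'a_E' P)"
      "bilinear_on hs E' hs A hs E' (e'a_E' P)"
      "bilinear_on hs E' hs A hs C' (e'a_C' P)"
      "bilinear_on hs C hs E' hs A (ce'_A P)"
      "bilinear_on hs C' hs E hs A (c'e_A P)"
      "bilinear_on hs A hs B hs B (ab_B P)"
      "bilinear_on hs C' hs B hs B' (c'b_B' P)"
      "bilinear_on hs E' hs B hs B' (e'b_B' P)"
      "bilinear_on hs B' hs A hs B' (b'a_B' P)"
      "bilinear_on hs B' hs C hs B (b'c_B P)"
      "bilinear_on hs B' hs E hs B (b'e_B P)"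
      "bilinear_on scale D hs A hs A (da P)"
      "bilinear_on scale D hs B hs B (db P)"
      "bilinear_on scale D hs B' hs B' (db' P)"
      "bilinear_on scale D hs C hs C (dc P)"
      "bilinear_on scale D hs C' hs C' (dc' P)"
      "bilinear_on scale D hs E hs E (de P)"
      "bilinear_on scale D hs E' hs E' (de' P)"
    and bilinear_ang:
      "bilinear_on hs A hs A scale D (ang_aa P)"
      "bilinear_on hs B hs B' scale D (ang_bb' P)"
      "bilinear_on hs C hs C' scale D (ang_cc' P)"
      "bilinear_on hs E hs E' scale D (ang_ee' P)"
    and symmetries: "a1 \<in> A \<Longrightarrow> a2 \<in> A \<Longrightarrow> comm P a1 a2 = - comm P a2 a1"
      "a1 \<in> A \<Longrightarrow> a2 \<in> A \<Longrightarrow> jord P a1 a2 = jord P a2 a1"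
    and rule_aa: "x \<in> sl \<Longrightarrow> y \<in> sl \<Longrightarrow> a1 \<in> A \<Longrightarrow> a2 \<in> A \<Longrightarrow>
      bracket (a1 x) (a2 y)
        = hs (1/2) (comm P a1 a2) (jord_mat x y) + hs (1/2) (jord P a1 a2) (comm_mat x y) + scale (form_mat x y) (ang_aa P a1 a2)"
    and rule_bb': "b \<in> B \<Longrightarrow> b' \<in> B' \<Longrightarrow>
      bracket (b u) (b' v')
        = bb'_A P b b' (outer u v' - mat (trace (outer u v') / of_nat CARD('n))) + scale (2 / of_nat CARD('n) * trace (outer u v')) (ang_bb' P b b')"
    and rule_cc': "s \<in> sym_mats \<Longrightarrow> s' \<in> sym_mats \<Longrightarrow> c \<in> C \<Longrightarrow> c' \<in> C' \<Longrightarrow>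
      bracket (c s) (c' s') = cc'_A P c c' (s ** s' - mat (form_mat s s')) + scale (form_mat s s') (ang_cc' P c c')"
    and rule_ee': "w \<in> skew_mats \<Longrightarrow> w' \<in> skew_mats \<Longrightarrow> e \<in> E \<Longrightarrow> e' \<in> E' \<Longrightarrow>
      bracket (e w) (e' w') = ee'_A P e e' (w ** w' - mat (form_mat w w')) + scale (form_mat w w') (ang_ee' P e e')"
    and rule_bb: "b1 \<in> B \<Longrightarrow> b2 \<in> B \<Longrightarrow>
      bracket (b1 u) (b2 v)
        = hs (1/2) (bb_C P b1 b2) (outer u v + outer v u) + hs (1/2) (bb_E P b1 b2) (outer u v - outer v u)"
    and rule_b'b': "b1' \<in> B' \<Longrightarrow> b2' \<in> B' \<Longrightarrow>
      bracket (b1' u') (b2' v')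
        = hs (1/2) (b'b'_C' P b1' b2') (outer u' v' + outer v' u') + hs (1/2) (b'b'_E' P b1' b2') (outer u' v' - outer v' u')"
    and rule_ac: "x \<in> sl \<Longrightarrow> s \<in> sym_mats \<Longrightarrow> a \<in> A \<Longrightarrow> c \<in> C \<Longrightarrow>
      bracket (a x) (c s)
        = hs (1/2) (ac_C P a c) (x ** s + s ** transpose x) + hs (1/2) (ac_E P a c) (x ** s - s ** transpose x)"
    and rule_ae: "x \<in> sl \<Longrightarrow> w \<in> skew_mats \<Longrightarrow> a \<in> A \<Longrightarrow> e \<in> E \<Longrightarrow>
      bracket (a x) (e w)
        = hs (1/2) (ae_E P a e) (x ** w + w ** transpose x) + hs (1/2) (ae_C P a e) (x ** w - w ** transpose x)"
    and rule_c'a: "x \<in> sl \<Longrightarrow> s' \<in> sym_mats \<Longrightarrow> a \<in> A \<Longrightarrow> c' \<in> C' \<Longrightarrow>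
      bracket (c' s') (a x)
        = hs (1/2) (c'a_C' P c' a) (s' ** x + transpose x ** s') + hs (1/2) (c'a_E' P c' a) (s' ** x - transpose x ** s')"
    and rule_e'a: "x \<in> sl \<Longrightarrow> w' \<in> skew_mats \<Longrightarrow> a \<in> A \<Longrightarrow> e' \<in> E' \<Longrightarrow>
      bracket (e' w') (a x)
        = hs (1/2) (e'a_E' P e' a) (w' ** x + transpose x ** w') + hs (1/2) (e'a_C' P e' a) (w' ** x - transpose x ** w')"
    and rule_ce': "s \<in> sym_mats \<Longrightarrow> w' \<in> skew_mats \<Longrightarrow> c \<in> C \<Longrightarrow> e' \<in> E' \<Longrightarrow>
      bracket (c s) (e' w') = ce'_A P c e' (s ** w')"
    and rule_c'e: "s' \<in> sym_mats \<Longrightarrow> w \<in> skew_mats \<Longrightarrow> c' \<in> C' \<Longrightarrow> e \<in> E \<Longrightarrow>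
      bracket (c' s') (e w) = c'e_A P c' e (transpose (s' ** w))"
    and rule_ab: "x \<in> sl \<Longrightarrow> a \<in> A \<Longrightarrow> b \<in> B \<Longrightarrow>
      bracket (a x) (b u) = ab_B P a b (x *v u)"
    and rule_c'b: "s' \<in> sym_mats \<Longrightarrow> b \<in> B \<Longrightarrow> c' \<in> C' \<Longrightarrow>
      bracket (c' s') (b u) = c'b_B' P c' b (s' *v u)"
    and rule_e'b: "w' \<in> skew_mats \<Longrightarrow> b \<in> B \<Longrightarrow> e' \<in> E' \<Longrightarrow>
      bracket (e' w') (b u) = e'b_B' P e' b (w' *v u)"
    and rule_b'a: "x \<in> sl \<Longrightarrow> a \<in> A \<Longrightarrow> b' \<in> B' \<Longrightarrow>
      bracket (b' u') (a x) = b'a_B' P b' a (transpose x *v u')"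
    and rule_b'c: "s \<in> sym_mats \<Longrightarrow> b' \<in> B' \<Longrightarrow> c \<in> C \<Longrightarrow>
      bracket (b' u') (c s) = b'c_B P b' c (s *v u')"
    and rule_b'e: "w \<in> skew_mats \<Longrightarrow> b' \<in> B' \<Longrightarrow> e \<in> E \<Longrightarrow>
      bracket (b' u') (e w) = b'e_B P b' e (- (w *v u'))"
    and rule_da: "x \<in> sl \<Longrightarrow> a \<in> A \<Longrightarrow> d \<in> D \<Longrightarrow>
      bracket d (a x) = da P d a x"
    and rule_db: "b \<in> B \<Longrightarrow> d \<in> D \<Longrightarrow> bracket d (b u) = db P d b u"
    and rule_db': "b' \<in> B' \<Longrightarrow> d \<in> D \<Longrightarrow> bracket d (b' u') = db' P d b' u'"
    and rule_dc: "s \<in> sym_mats \<Longrightarrow> c \<in> C \<Longrightarrow> d \<in> D \<Longrightarrow>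
      bracket d (c s) = dc P d c s"
    and rule_dc': "s' \<in> sym_mats \<Longrightarrow> c' \<in> C' \<Longrightarrow> d \<in> D \<Longrightarrow>
      bracket d (c' s') = dc' P d c' s'"
    and rule_de: "w \<in> skew_mats \<Longrightarrow> e \<in> E \<Longrightarrow> d \<in> D \<Longrightarrow>
      bracket d (e w) = de P d e w"
    and rule_de': "w' \<in> skew_mats \<Longrightarrow> e' \<in> E' \<Longrightarrow> d \<in> D \<Longrightarrow>
      bracket d (e' w') = de' P d e' w'"
    and rule_zero: "z1 \<in> tensor_image sym_mats C \<union> tensor_image skew_mats E \<Longrightarrow>
      z2 \<in> tensor_image sym_mats C \<union> tensor_image skew_mats E \<union> tensor_image UNIV B \<Longrightarrow> bracket z1 z2 = 0"
    and rule_zero': "z1 \<in> tensor_image sym_mats C' \<union> tensor_image skew_mats E' \<Longrightarrow>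
      z2 \<in> tensor_image sym_mats C' \<union> tensor_image skew_mats E' \<union> tensor_image UNIV B' \<Longrightarrow> bracket z1 z2 = 0"

lemma (in theta_graded5) coordinatized_exists:
  assumes rank_condition
  obtains P where "coordinatized scale bracket \<iota> P"
proof -
  obtain cm jd ang where aa: "bilinear_on hs A hs A hs A cm" "bilinear_on hs A hs A hs A jd" "bilinear_on hs A hs A scale D ang"
    "\<And>a1 a2 x y. a1 \<in> A \<Longrightarrow> a2 \<in> A \<Longrightarrow> x \<in> sl \<Longrightarrow> y \<in> sl \<Longrightarrow> bracket (a1 x) (a2 y)
      = hs (1/2) (cm a1 a2) (jord_mat x y) + hs (1/2) (jd a1 a2) (comm_mat x y) + scale (form_mat x y) (ang a1 a2)"
    by (rule product_sl_sl) (rule that)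
  note symm = sl_sl_symmetries[OF aa(1,2,4)]
  obtain bb'A bb'D where bb': "bilinear_on hs B hs B' hs A bb'A" "bilinear_on hs B hs B' scale D bb'D"
    "\<And>b b' u v. b \<in> B \<Longrightarrow> b' \<in> B' \<Longrightarrow> bracket (b u) (b' v)
      = bb'A b b' (outer u v - mat (trace (outer u v) / of_nat CARD('n)))
        + scale (2 / of_nat CARD('n) * trace (outer u v)) (bb'D b b')"
    by (rule product_V_V') (rule that)
  obtain cc'A cc'D where cc': "bilinear_on hs C hs C' hs A cc'A" "bilinear_on hs C hs C' scale D cc'D"
    "\<And>c c' s s'. c \<in> C \<Longrightarrow> c' \<in> C' \<Longrightarrow> s \<in> sym_mats \<Longrightarrow> s' \<in> sym_mats \<Longrightarrow> bracket (c s) (c' s')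
      = cc'A c c' (s ** s' - mat (form_mat s s')) + scale (form_mat s s') (cc'D c c')"
    by (rule product_S_S') (rule that)
  obtain ee'A ee'D where ee': "bilinear_on hs E hs E' hs A ee'A" "bilinear_on hs E hs E' scale D ee'D"
    "\<And>c c' s s'. c \<in> E \<Longrightarrow> c' \<in> E' \<Longrightarrow> s \<in> skew_mats \<Longrightarrow> s' \<in> skew_mats \<Longrightarrow> bracket (c s) (c' s')
      = ee'A c c' (s ** s' - mat (form_mat s s')) + scale (form_mat s s') (ee'D c c')"
    by (rule product_L_L') (rule that)
  obtain bbC bbE where bb: "bilinear_on hs B hs B hs C bbC" "bilinear_on hs B hs B hs E bbE"
    "\<And>b1 b2 u v. b1 \<in> B \<Longrightarrow> b2 \<in> B \<Longrightarrow> bracket (b1 u) (b2 v)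
      = hs (1/2) (bbC b1 b2) (outer u v + outer v u) + hs (1/2) (bbE b1 b2) (outer u v - outer v u)"
    by (rule product_V_V) (rule that)
  obtain b'b'C b'b'E where b'b': "bilinear_on hs B' hs B' hs C' b'b'C" "bilinear_on hs B' hs B' hs E' b'b'E"
    "\<And>b1 b2 u v. b1 \<in> B' \<Longrightarrow> b2 \<in> B' \<Longrightarrow> bracket (b1 u) (b2 v)
      = hs (1/2) (b'b'C b1 b2) (outer u v + outer v u) + hs (1/2) (b'b'E b1 b2) (outer u v - outer v u)"
    by (rule product_V'_V') (rule that)
  obtain acC acE where ac: "bilinear_on hs A hs C hs C acC" "bilinear_on hs A hs C hs E acE"
    "\<And>a c x s. a \<in> A \<Longrightarrow> c \<in> C \<Longrightarrow> x \<in> sl \<Longrightarrow> s \<in> sym_mats \<Longrightarrow> bracket (a x) (c s)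
      = hs (1/2) (acC a c) (x ** s + s ** transpose x) + hs (1/2) (acE a c) (x ** s - s ** transpose x)"
    by (rule product_sl_S) (rule that)
  obtain aeE aeC where ae: "bilinear_on hs A hs E hs E aeE" "bilinear_on hs A hs E hs C aeC"
    "\<And>a e x w. a \<in> A \<Longrightarrow> e \<in> E \<Longrightarrow> x \<in> sl \<Longrightarrow> w \<in> skew_mats \<Longrightarrow> bracket (a x) (e w)
      = hs (1/2) (aeE a e) (x ** w + w ** transpose x) + hs (1/2) (aeC a e) (x ** w - w ** transpose x)"
    by (rule product_sl_L) (rule that)
  obtain caC caE where ca: "bilinear_on hs C' hs A hs C' caC" "bilinear_on hs C' hs A hs E' caE"
    "\<And>a c x s. a \<in> A \<Longrightarrow> c \<in> C' \<Longrightarrow> x \<in> sl \<Longrightarrow> s \<in> sym_mats \<Longrightarrow> bracket (c s) (a x)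
      = hs (1/2) (caC c a) (s ** x + transpose x ** s) + hs (1/2) (caE c a) (s ** x - transpose x ** s)"
    by (rule product_S'_sl) (rule that)
  obtain eaE eaC where ea: "bilinear_on hs E' hs A hs E' eaE" "bilinear_on hs E' hs A hs C' eaC"
    "\<And>a c x s. a \<in> A \<Longrightarrow> c \<in> E' \<Longrightarrow> x \<in> sl \<Longrightarrow> s \<in> skew_mats \<Longrightarrow> bracket (c s) (a x)
      = hs (1/2) (eaE c a) (s ** x + transpose x ** s) + hs (1/2) (eaC c a) (s ** x - transpose x ** s)"
    by (rule product_L'_sl) (rule that)
  obtain ce' where ce': "bilinear_on hs C hs E' hs A ce'"
    "\<And>c e s w. c \<in> C \<Longrightarrow> e \<in> E' \<Longrightarrow> s \<in> sym_mats \<Longrightarrow> w \<in> skew_mats \<Longrightarrow> bracket (c s) (e w) = ce' c e (s ** w)"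
    by (rule product_S_L') (rule that)
  obtain c'e where c'e: "bilinear_on hs C' hs E hs A c'e"
    "\<And>c e s w. c \<in> C' \<Longrightarrow> e \<in> E \<Longrightarrow> s \<in> sym_mats \<Longrightarrow> w \<in> skew_mats \<Longrightarrow> bracket (c s) (e w) = c'e c e (transpose (s ** w))"
    by (rule product_S'_L) (rule that)
  obtain ab where ab: "bilinear_on hs A hs B hs B ab"
    "\<And>a b x u. a \<in> A \<Longrightarrow> b \<in> B \<Longrightarrow> x \<in> sl \<Longrightarrow> bracket (a x) (b u) = ab a b (x *v u)"
    by (rule product_sl_V) (rule that)
  obtain c'b where c'b: "bilinear_on hs C' hs B hs B' c'b"
    "\<And>c b s u. c \<in> C' \<Longrightarrow> b \<in> B \<Longrightarrow> s \<in> sym_mats \<Longrightarrow> bracket (c s) (b u) = c'b c b (s *v u)"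
    by (rule product_S'_V) (rule that)
  obtain e'b where e'b: "bilinear_on hs E' hs B hs B' e'b"
    "\<And>e b s u. e \<in> E' \<Longrightarrow> b \<in> B \<Longrightarrow> s \<in> skew_mats \<Longrightarrow> bracket (e s) (b u) = e'b e b (s *v u)"
    by (rule product_L'_V) (rule that)
  obtain b'a where b'a: "bilinear_on hs B' hs A hs B' b'a"
    "\<And>a b x u. a \<in> A \<Longrightarrow> b \<in> B' \<Longrightarrow> x \<in> sl \<Longrightarrow> bracket (b u) (a x) = b'a b a (transpose x *v u)"
    by (rule product_V'_sl) (rule that)
  obtain b'c where b'c: "bilinear_on hs B' hs C hs B b'c"
    "\<And>c b s u. c \<in> C \<Longrightarrow> b \<in> B' \<Longrightarrow> s \<in> sym_mats \<Longrightarrow> bracket (b u) (c s) = b'c b c (s *v u)"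
    by (rule product_V'_S) (rule that)
  obtain b'e where b'e: "bilinear_on hs B' hs E hs B b'e"
    "\<And>e b s u. e \<in> E \<Longrightarrow> b \<in> B' \<Longrightarrow> s \<in> skew_mats \<Longrightarrow> bracket (b u) (e s) = b'e b e (- (s *v u))"
    by (rule product_V'_L) (rule that)
  define P :: "('f^'n^'n \<Rightarrow> 'l, 'f^'n \<Rightarrow> 'l, 'l) products" where "P = \<lparr>
    comm = cm, jord = jd, ang_aa = ang, bb'_A = bb'A, ang_bb' = bb'D, cc'_A = cc'A, ang_cc' = cc'D,
    ee'_A = ee'A, ang_ee' = ee'D, bb_C = bbC, bb_E = bbE, b'b'_C' = b'b'C, b'b'_E' = b'b'E,
    ac_C = acC, ac_E = acE, ae_E = aeE, ae_C = aeC, c'a_C' = caC, c'a_E' = caE, e'a_E' = eaE, e'a_C' = eaC,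
    ce'_A = ce', c'e_A = c'e, ab_B = ab, c'b_B' = c'b, e'b_B' = e'b, b'a_B' = b'a, b'c_B = b'c, b'e_B = b'e,
    da = act_D, db = act_D, db' = act_D, dc = act_D, dc' = act_D, de = act_D, de' = act_D\<rparr>"
  have D: "bilinear_on scale D hs A hs A act_D" "bilinear_on scale D hs B hs B act_D" "bilinear_on scale D hs B' hs B' act_D"
    "bilinear_on scale D hs C hs C act_D" "bilinear_on scale D hs C' hs C' act_D" "bilinear_on scale D hs E hs E act_D"
    "bilinear_on scale D hs E' hs E' act_D"
    unfolding hom_defs by (rule act_D_bilinear)+
  have "coordinatized scale bracket \<iota> P"
  proof (unfold_locales, unfold P_def products.simps)
  qed ((rule aa bb' cc' ee' bb b'b' ac ae ca ea ce' c'e ab c'b e'b b'a b'c b'e D symm zero_unprimed[OF assms]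
      zero_primed[OF assms]; assumption) | (simp only: act_D_def))+
  then show ?thesis by (rule that)
qed

context coordinatized
begin

lemma bilinear_products: "bilinear_products P"
  unfolding bilinear_products_def by (intro conjI ballI bilinear bilinear_ang symmetries)

lemma bracket_rules: "bracket_rules P"
  unfolding bracket_rules_def tens_def
proof (intro conjI ballI allI)
qed ((rule rule_aa rule_bb' rule_cc' rule_ee' rule_bb rule_b'b' rule_ac rule_ae rule_c'a rule_e'a rule_ce' rule_c'e rule_ab rule_c'b rule_e'b rule_b'a rule_b'c rule_b'e rule_da rule_db rule_db' rule_dc rule_dc' rule_de rule_de'
      D_bracket rule_zero rule_zero'; assumption)+)

lemma hom_closed [simp]:
  "0 \<in> A" "0 \<in> B" "0 \<in> B'" "0 \<in> C" "0 \<in> C'" "0 \<in> E" "0 \<in> E'" "0 \<in> D"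
  "x \<in> A \<Longrightarrow> y \<in> A \<Longrightarrow> x + y \<in> A" "x \<in> A \<Longrightarrow> y \<in> A \<Longrightarrow> x - y \<in> A" "x \<in> A \<Longrightarrow> - x \<in> A" "x \<in> A \<Longrightarrow> hs k x \<in> A"
  "u \<in> B \<Longrightarrow> v \<in> B \<Longrightarrow> u + v \<in> B" "u \<in> B \<Longrightarrow> v \<in> B \<Longrightarrow> u - v \<in> B" "u \<in> B \<Longrightarrow> - u \<in> B" "u \<in> B \<Longrightarrow> hs k u \<in> B"
  "u \<in> B' \<Longrightarrow> v \<in> B' \<Longrightarrow> u + v \<in> B'" "u \<in> B' \<Longrightarrow> v \<in> B' \<Longrightarrow> u - v \<in> B'" "u \<in> B' \<Longrightarrow> - u \<in> B'" "u \<in> B' \<Longrightarrow> hs k u \<in> B'"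
  "x \<in> C \<Longrightarrow> y \<in> C \<Longrightarrow> x + y \<in> C" "x \<in> C \<Longrightarrow> y \<in> C \<Longrightarrow> x - y \<in> C" "x \<in> C \<Longrightarrow> - x \<in> C" "x \<in> C \<Longrightarrow> hs k x \<in> C"
  "x \<in> C' \<Longrightarrow> y \<in> C' \<Longrightarrow> x + y \<in> C'" "x \<in> C' \<Longrightarrow> y \<in> C' \<Longrightarrow> x - y \<in> C'" "x \<in> C' \<Longrightarrow> - x \<in> C'" "x \<in> C' \<Longrightarrow> hs k x \<in> C'"
  "x \<in> E \<Longrightarrow> y \<in> E \<Longrightarrow> x + y \<in> E" "x \<in> E \<Longrightarrow> y \<in> E \<Longrightarrow> x - y \<in> E" "x \<in> E \<Longrightarrow> - x \<in> E" "x \<in> E \<Longrightarrow> hs k x \<in> E"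
  "x \<in> E' \<Longrightarrow> y \<in> E' \<Longrightarrow> x + y \<in> E'" "x \<in> E' \<Longrightarrow> y \<in> E' \<Longrightarrow> x - y \<in> E'" "x \<in> E' \<Longrightarrow> - x \<in> E'" "x \<in> E' \<Longrightarrow> hs k x \<in> E'"
  by ((rule module.subspace_add[OF module_hs] module.subspace_diff[OF module_hs] module.subspace_neg[OF module_hs]
      module.subspace_scale[OF module_hs] module.subspace_0[OF module_hs] subspace_0 D_subspace hom_subspaces; assumption?)+)

lemmas products_closed [simp] = bilinear[THEN bilinear_onD(1)]

lemma bilinear_zero:
  assumes "bilinear_on sX X hs H hs H' f" "module.subspace hs H" "vector_space sX" "module.subspace sX X"
  shows "x \<in> X \<Longrightarrow> f x 0 = 0" "y \<in> H \<Longrightarrow> f 0 y = 0"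
proof -
  have "linear_on hs H hs H' (f x)" if "x \<in> X" for x using assms(1) that by (simp add: bilinear_on_def)
  from linear_on_zero[OF vector_space_hs assms(2) vector_space_hs this] show "x \<in> X \<Longrightarrow> f x 0 = 0" .
  have "linear_on sX X hs H' (\<lambda>x. f x y)" if "y \<in> H" for y using assms(1) that by (simp add: bilinear_on_def)
  from linear_on_zero[OF assms(3,4) vector_space_hs this] show "y \<in> H \<Longrightarrow> f 0 y = 0" .
qed

declare hom_subspaces [simp] D_subspace [simp] vector_space_hs [simp] vector_space_axioms [simp]

lemmas products_zero [simp] = bilinear[THEN bilinear_zero(1)] bilinear[THEN bilinear_zero(2)]

lemma zero_mats: "0 \<in> (sl :: ('f^'n^'n) set)" "0 \<in> (sym_mats :: ('f^'n^'n) set)" "0 \<in> (skew_mats :: ('f^'n^'n) set)"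
  by (rule mscale.subspace_0 sl_subspace sym_subspace skew_subspace)+

end

section \<open>Entries and columns of coordinate vectors\<close>

definition symunit :: "'n \<Rightarrow> 'n \<Rightarrow> 'f::field^'n^'n" where "symunit i j = munit i j + munit j i"
definition skewunit :: "'n \<Rightarrow> 'n \<Rightarrow> 'f::field^'n^'n" where "skewunit i j = munit i j - munit j i"

context coordinatized
begin

text \<open>The signs are such that multiplication in \<open>\<aa>\<close> becomes matrix multiplication with brackets as
  products, and that \<open>gamma\<close> becomes transposition along both diagonals up to sign.\<close>

fun entry :: "bool \<Rightarrow> bool \<Rightarrow> 'n \<Rightarrow> 'n \<Rightarrow> ('f^'n^'n \<Rightarrow> 'l) coord_a \<Rightarrow> 'l" where
  "entry True True i j (p, m, c, e, c', e') = p (munit i j) + m (munit i j)"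
| "entry True False i j (p, m, c, e, c', e') = c (symunit i j) + e (skewunit i j)"
| "entry False True i j (p, m, c, e, c', e') = c' (symunit i j) + e' (skewunit i j)"
| "entry False False i j (p, m, c, e, c', e') = m (munit j i) - p (munit j i)"

fun column :: "bool \<Rightarrow> 'n \<Rightarrow> ('f^'n \<Rightarrow> 'l) \<times> ('f^'n \<Rightarrow> 'l) \<Rightarrow> 'l" where
  "column True i (b, b') = b (axis i 1)"
| "column False i (b, b') = b' (axis i 1)"

definition coords_a :: "('f^'n^'n \<Rightarrow> 'l) coord_a set" where
  "coords_a = A \<times> A \<times> C \<times> E \<times> C' \<times> E'"

text \<open>The left action of \<open>\<aa>\<close> on B \<oplus> B'. On B' it is by definition a
  right product with \<open>gamma\<close> inserted, and the right action on the whole space is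
  recovered from it in the same manner.\<close>

fun mult_x :: "('f^'n^'n \<Rightarrow> 'l) coord_a \<Rightarrow> ('f^'n \<Rightarrow> 'l) \<times> ('f^'n \<Rightarrow> 'l) \<Rightarrow> ('f^'n \<Rightarrow> 'l) \<times> ('f^'n \<Rightarrow> 'l)" where
  "mult_x \<alpha> (b, b') = mult_a_B P \<alpha> b + mult_B'_a P b' (gamma \<alpha>)"

lemma unit_mems [simp]: "symunit i j \<in> sym_mats" "skewunit i j \<in> skew_mats"
  by (simp_all add: symunit_def skewunit_def)

lemma symunit_commute: "symunit j i = symunit i j"
  by (simp add: symunit_def add.commute)

lemma hom_zero_at [simp]:
  "a \<in> A \<Longrightarrow> a 0 = 0" "c \<in> C \<Longrightarrow> c 0 = 0" "c' \<in> C' \<Longrightarrow> c' 0 = 0" "e \<in> E \<Longrightarrow> e 0 = 0" "e' \<in> E' \<Longrightarrow> e' 0 = 0"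
  "b \<in> B \<Longrightarrow> b 0 = 0" "b' \<in> B' \<Longrightarrow> b' 0 = 0"
  unfolding hom_defs by (rule hom_space_zero[OF sl_module_sl] hom_space_zero[OF sl_module_S] hom_space_zero[OF sl_module_S']
      hom_space_zero[OF sl_module_L] hom_space_zero[OF sl_module_L'] hom_space_zero[OF sl_module_V] hom_space_zero[OF sl_module_V'], assumption)+

lemma hom_minus_munit:
  "a \<in> A \<Longrightarrow> i \<noteq> j \<Longrightarrow> a (- munit i j) = - a (munit i j)"
  "c \<in> C \<Longrightarrow> c (- symunit i j) = - c (symunit i j)" "c' \<in> C' \<Longrightarrow> c' (- symunit i j) = - c' (symunit i j)"
  "e \<in> E \<Longrightarrow> e (- skewunit i j) = - e (skewunit i j)" "e' \<in> E' \<Longrightarrow> e' (- skewunit i j) = - e' (skewunit i j)"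
  "b \<in> B \<Longrightarrow> b (- v) = - b v" "b' \<in> B' \<Longrightarrow> b' (- v) = - b' v"
  unfolding hom_defs by (rule hom_space_minus[OF sl_module_sl] hom_space_minus[OF sl_module_S] hom_space_minus[OF sl_module_S']
      hom_space_minus[OF sl_module_L] hom_space_minus[OF sl_module_L'] hom_space_minus[OF sl_module_V] hom_space_minus[OF sl_module_V']; simp)+

lemma half_add_half [simp]:
  "scale (1/2) x + scale (1/2) x = x" "- scale (1/2) x - scale (1/2) x = - x"
proof -
  have "scale (1/2) x + scale (1/2) x = scale (1/2 + 1/2) x" by (simp only: scale_left_distrib)
  then show "scale (1/2) x + scale (1/2) x = x" by simp
  then have "- (scale (1/2) x + scale (1/2) x) = - x" by (rule arg_cong)
  then show "- scale (1/2) x - scale (1/2) x = - x" by (simp only: minus_add_distrib diff_conv_add_uminus)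
qed

context
  fixes i j k :: 'n
  assumes d: "i \<noteq> j" "j \<noteq> k" "i \<noteq> k"
begin

lemma mat_prods:
  "jord_mat (munit i j) (munit j k) = (munit i k :: 'f^'n^'n)" "comm_mat (munit i j) (munit j k) = (munit i k :: 'f^'n^'n)"
  "jord_mat (munit j i) (munit k j) = (munit k i :: 'f^'n^'n)" "comm_mat (munit j i) (munit k j) = (- munit k i :: 'f^'n^'n)"
  "form_mat (munit i j) (munit j k) = (0 :: 'f)" "form_mat (munit j i) (munit k j) = (0 :: 'f)"
  using d d[symmetric] by (simp_all add: jord_mat_def comm_mat_def form_mat_def)

lemma sym_prods:
  "munit i j ** symunit j k + symunit j k ** munit j i = (symunit i k :: 'f^'n^'n)"
  "munit i j ** symunit j k - symunit j k ** munit j i = (skewunit i k :: 'f^'n^'n)"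
  "munit i j ** skewunit j k + skewunit j k ** munit j i = (skewunit i k :: 'f^'n^'n)"
  "munit i j ** skewunit j k - skewunit j k ** munit j i = (symunit i k :: 'f^'n^'n)"
  "munit k j ** symunit i j + symunit i j ** munit j k = (symunit i k :: 'f^'n^'n)"
  "munit k j ** symunit i j - symunit i j ** munit j k = (- skewunit i k :: 'f^'n^'n)"
  "munit k j ** skewunit i j + skewunit i j ** munit j k = (skewunit i k :: 'f^'n^'n)"
  "munit k j ** skewunit i j - skewunit i j ** munit j k = (- symunit i k :: 'f^'n^'n)"
  "symunit i j ** munit j k + munit k j ** symunit i j = (symunit i k :: 'f^'n^'n)"
  "symunit i j ** munit j k - munit k j ** symunit i j = (skewunit i k :: 'f^'n^'n)"
  "skewunit i j ** munit j k + munit k j ** skewunit i j = (skewunit i k :: 'f^'n^'n)"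
  "skewunit i j ** munit j k - munit k j ** skewunit i j = (symunit i k :: 'f^'n^'n)"
  "symunit j k ** munit j i + munit i j ** symunit j k = (symunit i k :: 'f^'n^'n)"
  "symunit j k ** munit j i - munit i j ** symunit j k = (- skewunit i k :: 'f^'n^'n)"
  "skewunit j k ** munit j i + munit i j ** skewunit j k = (skewunit i k :: 'f^'n^'n)"
  "skewunit j k ** munit j i - munit i j ** skewunit j k = (- symunit i k :: 'f^'n^'n)"
  using d d[symmetric] by (simp_all add: symunit_def skewunit_def matrix_ring)

lemma sym_sym_prods:
  "symunit i j ** symunit j k = (munit i k :: 'f^'n^'n)" "symunit i j ** skewunit j k = (munit i k :: 'f^'n^'n)"
  "skewunit i j ** skewunit j k = (munit i k :: 'f^'n^'n)" "skewunit i j ** symunit j k = (munit i k :: 'f^'n^'n)"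
  "symunit j k ** symunit i j = (munit k i :: 'f^'n^'n)" "symunit j k ** skewunit i j = (- munit k i :: 'f^'n^'n)"
  "skewunit j k ** skewunit i j = (munit k i :: 'f^'n^'n)" "skewunit j k ** symunit i j = (- munit k i :: 'f^'n^'n)"
  "transpose (symunit j k ** skewunit i j) = (- munit i k :: 'f^'n^'n)"
  "transpose (symunit i j ** skewunit j k) = (munit k i :: 'f^'n^'n)"
  using d d[symmetric] by (simp_all add: symunit_def skewunit_def matrix_ring transpose_ring)

lemma form_prods:
  "form_mat (symunit i j) (symunit j k) = (0::'f)" "form_mat (skewunit i j) (skewunit j k) = (0::'f)"
  "form_mat (symunit j k) (symunit i j) = (0::'f)" "form_mat (skewunit j k) (skewunit i j) = (0::'f)"
  using d d[symmetric] by (simp_all add: form_mat_def sym_sym_prods)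

text \<open>At distinct indices the \<open>D\<close>-valued terms vanish. Equal summands stay apart
  under the common factor 1/2 to match \<open>mult_a\<close>, where such a product has parts in both
  A^+ and A^- that an entry combines.\<close>

lemma brackets_unit:
  "a \<in> A \<Longrightarrow> a2 \<in> A \<Longrightarrow> bracket (a (munit i j)) (a2 (munit j k)) = scale (1/2) (comm P a a2 (munit i k) + jord P a a2 (munit i k))"
  "a \<in> A \<Longrightarrow> a2 \<in> A \<Longrightarrow> bracket (a (munit j i)) (a2 (munit k j)) = scale (1/2) (comm P a a2 (munit k i) - jord P a a2 (munit k i))"
  "a \<in> A \<Longrightarrow> c \<in> C \<Longrightarrow> bracket (a (munit i j)) (c (symunit j k)) = scale (1/2) (ac_C P a c (symunit i k) + ac_E P a c (skewunit i k))"
  "a \<in> A \<Longrightarrow> e \<in> E \<Longrightarrow> bracket (a (munit i j)) (e (skewunit j k)) = scale (1/2) (ae_E P a e (skewunit i k) + ae_C P a e (symunit i k))"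
  "a \<in> A \<Longrightarrow> c' \<in> C' \<Longrightarrow> bracket (c' (symunit i j)) (a (munit j k)) = scale (1/2) (c'a_C' P c' a (symunit i k) + c'a_E' P c' a (skewunit i k))"
  "a \<in> A \<Longrightarrow> e' \<in> E' \<Longrightarrow> bracket (e' (skewunit i j)) (a (munit j k)) = scale (1/2) (e'a_E' P e' a (skewunit i k) + e'a_C' P e' a (symunit i k))"
  "c \<in> C \<Longrightarrow> c' \<in> C' \<Longrightarrow> bracket (c (symunit i j)) (c' (symunit j k)) = scale (1/2) (cc'_A P c c' (munit i k) + cc'_A P c c' (munit i k))"
  "e \<in> E \<Longrightarrow> e' \<in> E' \<Longrightarrow> bracket (e (skewunit i j)) (e' (skewunit j k)) = scale (1/2) (ee'_A P e e' (munit i k) + ee'_A P e e' (munit i k))"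
  "c \<in> C \<Longrightarrow> e' \<in> E' \<Longrightarrow> bracket (c (symunit i j)) (e' (skewunit j k)) = scale (1/2) (ce'_A P c e' (munit i k) + ce'_A P c e' (munit i k))"
  "e \<in> E \<Longrightarrow> c' \<in> C' \<Longrightarrow> bracket (c' (symunit i j)) (e (skewunit j k)) = scale (1/2) (c'e_A P c' e (munit k i) + c'e_A P c' e (munit k i))"
  using d d[symmetric] by (simp_all add: rule_aa rule_ac rule_ae rule_c'a rule_e'a rule_cc' rule_ee' rule_ce' rule_c'e mat_prods sym_prods
      sym_sym_prods form_prods hom_minus_munit transpose_uminus scale_right_distrib scale_right_diff_distrib)

lemma brackets_unit':
  "a \<in> A \<Longrightarrow> c \<in> C \<Longrightarrow> bracket (c (symunit i j)) (a (munit k j)) = scale (1/2) (ac_E P a c (skewunit i k) - ac_C P a c (symunit i k))"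
  "a \<in> A \<Longrightarrow> e \<in> E \<Longrightarrow> bracket (e (skewunit i j)) (a (munit k j)) = scale (1/2) (ae_C P a e (symunit i k) - ae_E P a e (skewunit i k))"
  "a \<in> A \<Longrightarrow> c' \<in> C' \<Longrightarrow> bracket (a (munit j i)) (c' (symunit j k)) = scale (1/2) (c'a_E' P c' a (skewunit i k) - c'a_C' P c' a (symunit i k))"
  "a \<in> A \<Longrightarrow> e' \<in> E' \<Longrightarrow> bracket (a (munit j i)) (e' (skewunit j k)) = scale (1/2) (e'a_C' P e' a (symunit i k) - e'a_E' P e' a (skewunit i k))"
  "e \<in> E \<Longrightarrow> c' \<in> C' \<Longrightarrow> bracket (e (skewunit i j)) (c' (symunit j k)) = scale (1/2) (c'e_A P c' e (munit i k) + c'e_A P c' e (munit i k))"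
  "c \<in> C \<Longrightarrow> c' \<in> C' \<Longrightarrow> bracket (c' (symunit i j)) (c (symunit j k)) = - scale (1/2) (cc'_A P c c' (munit k i) + cc'_A P c c' (munit k i))"
  "e \<in> E \<Longrightarrow> e' \<in> E' \<Longrightarrow> bracket (e' (skewunit i j)) (e (skewunit j k)) = - scale (1/2) (ee'_A P e e' (munit k i) + ee'_A P e e' (munit k i))"
  "c \<in> C \<Longrightarrow> e' \<in> E' \<Longrightarrow> bracket (e' (skewunit i j)) (c (symunit j k)) = scale (1/2) (ce'_A P c e' (munit k i) + ce'_A P c e' (munit k i))"
  using d d[symmetric] by (subst bracket_anticomm, simp add: rule_aa rule_ac rule_ae rule_c'a rule_e'a rule_cc' rule_ee' rule_ce' rule_c'e mat_prods sym_prods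
      sym_sym_prods form_prods hom_minus_munit transpose_uminus scale_right_distrib scale_right_diff_distrib)+

end

text \<open>The middle sign runs over both values because, for instance, the (+,+) entry collects
  the product of two elements of A^+ \<oplus> A^- and that of an element of C \<oplus> E with one of
  C' \<oplus> E'. Since entries determine an element, this identity forces the product
  formulas.\<close>

lemma entry_bracket:
  assumes "\<alpha> \<in> coords_a" "\<beta> \<in> coords_a" "i \<noteq> j" "j \<noteq> k" "i \<noteq> k"
  shows "bracket (entry s True i j \<alpha>) (entry True t j k \<beta>) + bracket (entry s False i j \<alpha>) (entry False t j k \<beta>)
    = entry s t i k (mult_a hs P \<alpha> \<beta>)"
proof -
  obtain p1 m1 c1 e1 c1' e1' where \<alpha>: "\<alpha> = (p1, m1, c1, e1, c1', e1')" by (rule prod_cases6)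
  obtain p2 m2 c2 e2 c2' e2' where \<beta>: "\<beta> = (p2, m2, c2, e2, c2', e2')" by (rule prod_cases6)
  note mems = assms(1,2)[unfolded \<alpha> \<beta> coords_a_def mem_Times_iff prod.sel]
  note defs = in_Ap_def in_Am_def in_C_def in_E_def in_C'_def in_E'_def
  show ?thesis
    unfolding \<alpha> \<beta> using mems assms(3-5)
    by (cases s; cases t) (simp_all add: defs bracket_ring brackets_unit brackets_unit' scale_right_distrib scale_right_diff_distrib
        del: half_add_half)
qed

lemma zero_rules:
  "c \<in> C \<Longrightarrow> c2 \<in> C \<Longrightarrow> s1 \<in> sym_mats \<Longrightarrow> s2 \<in> sym_mats \<Longrightarrow> bracket (c s1) (c2 s2) = 0"
  "c \<in> C \<Longrightarrow> e \<in> E \<Longrightarrow> s1 \<in> sym_mats \<Longrightarrow> w1 \<in> skew_mats \<Longrightarrow> bracket (c s1) (e w1) = 0"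
  "e \<in> E \<Longrightarrow> c \<in> C \<Longrightarrow> w1 \<in> skew_mats \<Longrightarrow> s1 \<in> sym_mats \<Longrightarrow> bracket (e w1) (c s1) = 0"
  "e \<in> E \<Longrightarrow> e2 \<in> E \<Longrightarrow> w1 \<in> skew_mats \<Longrightarrow> w2 \<in> skew_mats \<Longrightarrow> bracket (e w1) (e2 w2) = 0"
  "c \<in> C \<Longrightarrow> b \<in> B \<Longrightarrow> s1 \<in> sym_mats \<Longrightarrow> bracket (c s1) (b v) = 0"
  "e \<in> E \<Longrightarrow> b \<in> B \<Longrightarrow> w1 \<in> skew_mats \<Longrightarrow> bracket (e w1) (b v) = 0"
  "c' \<in> C' \<Longrightarrow> c2' \<in> C' \<Longrightarrow> s1 \<in> sym_mats \<Longrightarrow> s2 \<in> sym_mats \<Longrightarrow> bracket (c' s1) (c2' s2) = 0"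
  "c' \<in> C' \<Longrightarrow> e' \<in> E' \<Longrightarrow> s1 \<in> sym_mats \<Longrightarrow> w1 \<in> skew_mats \<Longrightarrow> bracket (c' s1) (e' w1) = 0"
  "e' \<in> E' \<Longrightarrow> c' \<in> C' \<Longrightarrow> w1 \<in> skew_mats \<Longrightarrow> s1 \<in> sym_mats \<Longrightarrow> bracket (e' w1) (c' s1) = 0"
  "e' \<in> E' \<Longrightarrow> e2' \<in> E' \<Longrightarrow> w1 \<in> skew_mats \<Longrightarrow> w2 \<in> skew_mats \<Longrightarrow> bracket (e' w1) (e2' w2) = 0"
  "c' \<in> C' \<Longrightarrow> b' \<in> B' \<Longrightarrow> s1 \<in> sym_mats \<Longrightarrow> bracket (c' s1) (b' v) = 0"
  "e' \<in> E' \<Longrightarrow> b' \<in> B' \<Longrightarrow> w1 \<in> skew_mats \<Longrightarrow> bracket (e' w1) (b' v) = 0"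
  by (rule rule_zero rule_zero'; simp add: tensor_imageI)+

lemma disjoint_mats:
  assumes "distinct [i, j, k, l]"
  shows "jord_mat (munit i j) (munit k l) = (0 :: 'f^'n^'n)" "comm_mat (munit i j) (munit k l) = (0 :: 'f^'n^'n)"
    "form_mat (munit i j) (munit k l) = (0 :: 'f)" "form_mat (symunit i j) (symunit k l) = (0 :: 'f)"
    "form_mat (skewunit i j) (skewunit k l) = (0 :: 'f)"
    "munit i j ** symunit k l = (0 :: 'f^'n^'n)" "munit i j ** skewunit k l = (0 :: 'f^'n^'n)"
    "symunit k l ** munit i j = (0 :: 'f^'n^'n)" "skewunit k l ** munit i j = (0 :: 'f^'n^'n)"
    "symunit k l ** munit j i = (0 :: 'f^'n^'n)" "skewunit k l ** munit j i = (0 :: 'f^'n^'n)"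
    "munit j i ** symunit k l = (0 :: 'f^'n^'n)" "munit j i ** skewunit k l = (0 :: 'f^'n^'n)"
    "symunit i j ** symunit k l = (0 :: 'f^'n^'n)" "symunit i j ** skewunit k l = (0 :: 'f^'n^'n)"
    "skewunit i j ** skewunit k l = (0 :: 'f^'n^'n)" "skewunit i j ** symunit k l = (0 :: 'f^'n^'n)"
  using assms by (auto simp: jord_mat_def comm_mat_def form_mat_def symunit_def skewunit_def matrix_ring mat_0)

lemma distinct_swap:
  assumes "distinct [i, j, k, l]"
  shows "distinct [k, l, i, j]" "i \<noteq> j" "k \<noteq> l"
  using assms by auto

lemma transpose_zero: "transpose (0 :: 'f^'n^'n) = 0"
  by (simp add: vec_eq_iff transpose_def)

context
  fixes i j k l :: 'n
  assumes d: "distinct [i, j, k, l]"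
begin

lemma brackets_disjoint:
  "a \<in> A \<Longrightarrow> a2 \<in> A \<Longrightarrow> bracket (a (munit i j)) (a2 (munit k l)) = 0"
  "a \<in> A \<Longrightarrow> c \<in> C \<Longrightarrow> bracket (a (munit i j)) (c (symunit k l)) = 0"
  "a \<in> A \<Longrightarrow> e \<in> E \<Longrightarrow> bracket (a (munit i j)) (e (skewunit k l)) = 0"
  "c' \<in> C' \<Longrightarrow> a \<in> A \<Longrightarrow> bracket (c' (symunit i j)) (a (munit k l)) = 0"
  "e' \<in> E' \<Longrightarrow> a \<in> A \<Longrightarrow> bracket (e' (skewunit i j)) (a (munit k l)) = 0"
  "c \<in> C \<Longrightarrow> c' \<in> C' \<Longrightarrow> bracket (c (symunit i j)) (c' (symunit k l)) = 0"
  "e \<in> E \<Longrightarrow> e' \<in> E' \<Longrightarrow> bracket (e (skewunit i j)) (e' (skewunit k l)) = 0"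
  "c \<in> C \<Longrightarrow> e' \<in> E' \<Longrightarrow> bracket (c (symunit i j)) (e' (skewunit k l)) = 0"
  "c' \<in> C' \<Longrightarrow> e \<in> E \<Longrightarrow> bracket (c' (symunit i j)) (e (skewunit k l)) = 0"
  "a \<in> A \<Longrightarrow> a2 \<in> A \<Longrightarrow> bracket (a (munit k l)) (a2 (munit i j)) = 0"
  "a \<in> A \<Longrightarrow> c \<in> C \<Longrightarrow> bracket (a (munit k l)) (c (symunit i j)) = 0"
  "a \<in> A \<Longrightarrow> e \<in> E \<Longrightarrow> bracket (a (munit k l)) (e (skewunit i j)) = 0"
  "c' \<in> C' \<Longrightarrow> a \<in> A \<Longrightarrow> bracket (c' (symunit k l)) (a (munit i j)) = 0"
  "e' \<in> E' \<Longrightarrow> a \<in> A \<Longrightarrow> bracket (e' (skewunit k l)) (a (munit i j)) = 0"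
  "c \<in> C \<Longrightarrow> c' \<in> C' \<Longrightarrow> bracket (c (symunit k l)) (c' (symunit i j)) = 0"
  "e \<in> E \<Longrightarrow> e' \<in> E' \<Longrightarrow> bracket (e (skewunit k l)) (e' (skewunit i j)) = 0"
  "c \<in> C \<Longrightarrow> e' \<in> E' \<Longrightarrow> bracket (c (symunit k l)) (e' (skewunit i j)) = 0"
  "c' \<in> C' \<Longrightarrow> e \<in> E \<Longrightarrow> bracket (c' (symunit k l)) (e (skewunit i j)) = 0"
  using d distinct_swap[OF d] by (simp_all add: rule_aa rule_ac rule_ae rule_c'a rule_e'a rule_cc' rule_ee' rule_ce' rule_c'e transpose_zero disjoint_mats del: distinct.simps)

lemma brackets_disjoint':
  "c \<in> C \<Longrightarrow> a \<in> A \<Longrightarrow> bracket (c (symunit i j)) (a (munit k l)) = 0"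
  "e \<in> E \<Longrightarrow> a \<in> A \<Longrightarrow> bracket (e (skewunit i j)) (a (munit k l)) = 0"
  "a \<in> A \<Longrightarrow> c' \<in> C' \<Longrightarrow> bracket (a (munit i j)) (c' (symunit k l)) = 0"
  "a \<in> A \<Longrightarrow> e' \<in> E' \<Longrightarrow> bracket (a (munit i j)) (e' (skewunit k l)) = 0"
  "c' \<in> C' \<Longrightarrow> c \<in> C \<Longrightarrow> bracket (c' (symunit i j)) (c (symunit k l)) = 0"
  "e' \<in> E' \<Longrightarrow> e \<in> E \<Longrightarrow> bracket (e' (skewunit i j)) (e (skewunit k l)) = 0"
  "e' \<in> E' \<Longrightarrow> c \<in> C \<Longrightarrow> bracket (e' (skewunit i j)) (c (symunit k l)) = 0"
  "e \<in> E \<Longrightarrow> c' \<in> C' \<Longrightarrow> bracket (e (skewunit i j)) (c' (symunit k l)) = 0"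
  by (subst bracket_anticomm, simp add: brackets_disjoint)+

end

lemma entry_entry_zero:
  assumes "\<alpha> \<in> coords_a" "\<beta> \<in> coords_a" "distinct [i, j, k, l]"
  shows "bracket (entry s t i j \<alpha>) (entry s' t' k l \<beta>) = 0"
proof -
  obtain p1 m1 c1 e1 c1' e1' where \<alpha>: "\<alpha> = (p1, m1, c1, e1, c1', e1')" by (rule prod_cases6)
  obtain p2 m2 c2 e2 c2' e2' where \<beta>: "\<beta> = (p2, m2, c2, e2, c2', e2')" by (rule prod_cases6)
  note mems = assms(1,2)[unfolded \<alpha> \<beta> coords_a_def mem_Times_iff prod.sel]
  have "distinct [j, i, k, l]" "distinct [i, j, l, k]" "distinct [j, i, l, k]"
    using assms(3) by auto
  then show ?thesis
    unfolding \<alpha> \<beta> using mems assms(3)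
    by (cases s; cases t; cases s'; cases t')
      (simp_all add: bracket_ring zero_rules brackets_disjoint brackets_disjoint' del: distinct.simps)
qed

lemma unit_vec:
  "symunit i j *v axis k 1 = (if j = k then axis i 1 else 0) + (if i = k then axis j 1 else 0 :: 'f^'n)"
  "skewunit i j *v axis k 1 = (if j = k then axis i 1 else 0) - (if i = k then axis j 1 else 0 :: 'f^'n)"
  by (simp_all add: symunit_def skewunit_def matrix_vector_mult_add_rdistrib matrix_vector_mult_diff_rdistrib)

lemma bilinear_minus:
  assumes "bilinear_on hs H hs H' hs H'' f" "x \<in> H" "y \<in> H'"
  shows "f x (- y) = - f x y"
  using bilinear_onD(3)[OF assms, of "- 1"]
  by (simp add: module.scale_minus_left[OF module_hs] module.scale_one[OF module_hs])

lemmas products_minus = bilinear(1-25)[THEN bilinear_minus]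

lemma column_rules:
  assumes "i \<noteq> j"
  shows
  "a \<in> A \<Longrightarrow> b \<in> B \<Longrightarrow> bracket (a (munit i j)) (b (axis j 1)) = ab_B P a b (axis i 1)"
  "c' \<in> C' \<Longrightarrow> b \<in> B \<Longrightarrow> bracket (c' (symunit i j)) (b (axis j 1)) = c'b_B' P c' b (axis i 1)"
  "e' \<in> E' \<Longrightarrow> b \<in> B \<Longrightarrow> bracket (e' (skewunit i j)) (b (axis j 1)) = e'b_B' P e' b (axis i 1)"
  using assms by (simp_all add: rule_ab rule_c'b rule_e'b unit_vec hom_minus_munit)

lemma column_rules':
  assumes "i \<noteq> j"
  shows
  "a \<in> A \<Longrightarrow> b' \<in> B' \<Longrightarrow> bracket (a (munit j i)) (b' (axis j 1)) = - b'a_B' P b' a (axis i 1)"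
  "c \<in> C \<Longrightarrow> b' \<in> B' \<Longrightarrow> bracket (c (symunit i j)) (b' (axis j 1)) = - b'c_B P b' c (axis i 1)"
  "e \<in> E \<Longrightarrow> b' \<in> B' \<Longrightarrow> bracket (e (skewunit i j)) (b' (axis j 1)) = b'e_B P b' e (axis i 1)"
  using assms by (subst bracket_anticomm, simp add: rule_b'a rule_b'c rule_b'e unit_vec hom_minus_munit)+

lemma column_rules_zero:
  assumes "i \<noteq> j" "k \<noteq> i" "k \<noteq> j"
  shows
  "a \<in> A \<Longrightarrow> b \<in> B \<Longrightarrow> bracket (a (munit i j)) (b (axis k 1)) = 0"
  "c' \<in> C' \<Longrightarrow> b \<in> B \<Longrightarrow> bracket (c' (symunit i j)) (b (axis k 1)) = 0"
  "e' \<in> E' \<Longrightarrow> b \<in> B \<Longrightarrow> bracket (e' (skewunit i j)) (b (axis k 1)) = 0"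
  "c \<in> C \<Longrightarrow> b \<in> B \<Longrightarrow> bracket (c (symunit i j)) (b (axis k 1)) = 0"
  "e \<in> E \<Longrightarrow> b \<in> B \<Longrightarrow> bracket (e (skewunit i j)) (b (axis k 1)) = 0"
  "c' \<in> C' \<Longrightarrow> b' \<in> B' \<Longrightarrow> bracket (c' (symunit i j)) (b' (axis k 1)) = 0"
  "e' \<in> E' \<Longrightarrow> b' \<in> B' \<Longrightarrow> bracket (e' (skewunit i j)) (b' (axis k 1)) = 0"
  using assms by (simp_all add: rule_ab rule_c'b rule_e'b zero_rules unit_vec)

lemma column_rules_zero':
  assumes "i \<noteq> j" "k \<noteq> i" "k \<noteq> j"
  shows
  "a \<in> A \<Longrightarrow> b' \<in> B' \<Longrightarrow> bracket (a (munit i j)) (b' (axis k 1)) = 0"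
  "c \<in> C \<Longrightarrow> b' \<in> B' \<Longrightarrow> bracket (c (symunit i j)) (b' (axis k 1)) = 0"
  "e \<in> E \<Longrightarrow> b' \<in> B' \<Longrightarrow> bracket (e (skewunit i j)) (b' (axis k 1)) = 0"
  using assms by (subst bracket_anticomm, simp add: rule_b'a rule_b'c rule_b'e unit_vec)+

lemma column_column_rules:
  assumes "i \<noteq> j"
  shows "b \<in> B \<Longrightarrow> b' \<in> B' \<Longrightarrow> bracket (b (axis i 1)) (b' (axis j 1)) = bb'_A P b b' (munit i j)"
    "b \<in> B \<Longrightarrow> b' \<in> B' \<Longrightarrow> bracket (b' (axis i 1)) (b (axis j 1)) = - bb'_A P b b' (munit j i)"
    "b \<in> B \<Longrightarrow> b2 \<in> B \<Longrightarrow> bracket (b (axis i 1)) (b2 (axis j 1))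
      = scale (1/2) (bb_C P b b2 (symunit i j)) + scale (1/2) (bb_E P b b2 (skewunit i j))"
    "b' \<in> B' \<Longrightarrow> b2' \<in> B' \<Longrightarrow> bracket (b' (axis i 1)) (b2' (axis j 1))
      = scale (1/2) (b'b'_C' P b' b2' (symunit i j)) + scale (1/2) (b'b'_E' P b' b2' (skewunit i j))"
  using assms bracket_anticomm[of "b' (axis i 1)" "b (axis j 1)"]
  by (simp_all add: rule_bb' rule_bb rule_b'b' symunit_def skewunit_def mat_0)

definition coords_x :: "(('f^'n \<Rightarrow> 'l) \<times> ('f^'n \<Rightarrow> 'l)) set" where
  "coords_x = B \<times> B'"

lemma entry_column:
  assumes "\<alpha> \<in> coords_a" "x \<in> coords_x" "i \<noteq> j"
  shows "bracket (entry s True i j \<alpha>) (column True j x) + bracket (entry s False i j \<alpha>) (column False j x)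
    = column s i (mult_x \<alpha> x)"
proof -
  obtain p m c e c' e' where \<alpha>: "\<alpha> = (p, m, c, e, c', e')" by (rule prod_cases6)
  obtain b b' where x: "x = (b, b')" by (rule prod.exhaust)
  note mems = assms(1,2)[unfolded \<alpha> x coords_a_def coords_x_def mem_Times_iff prod.sel]
  show ?thesis
    unfolding \<alpha> x using mems assms(3)
    by (cases s) (simp_all add: bracket_ring column_rules column_rules' products_minus)
qed

lemma entry_column_zero:
  assumes "\<alpha> \<in> coords_a" "x \<in> coords_x" "i \<noteq> j" "k \<noteq> i" "k \<noteq> j"
  shows "bracket (entry s t i j \<alpha>) (column u k x) = 0"
proof -
  obtain p m c e c' e' where \<alpha>: "\<alpha> = (p, m, c, e, c', e')" by (rule prod_cases6)
  obtain b b' where x: "x = (b, b')" by (rule prod.exhaust)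
  note mems = assms(1,2)[unfolded \<alpha> x coords_a_def coords_x_def mem_Times_iff prod.sel]
  show ?thesis
    unfolding \<alpha> x using mems assms(3-5)
    by (cases s; cases t; cases u) (simp_all add: bracket_ring column_rules_zero column_rules_zero')
qed

text \<open>Read True as + and False as -. The entry (s,t) at (i,j) has weight s \<epsilon>_i - t
  \<epsilon>_j and the column of sign s at i has weight s \<epsilon>_i, so the second column must
  carry the sign opposite to t.\<close>

lemma column_column:
  assumes "x \<in> coords_x" "y \<in> coords_x" "i \<noteq> j"
  shows "bracket (column s i x) (column (\<not> t) j y) = entry s t i j (mult_BB' hs P x y)"
proof -
  obtain b b' where x: "x = (b, b')" by (rule prod.exhaust)
  obtain b2 b2' where y: "y = (b2, b2')" by (rule prod.exhaust)
  note mems = assms(1,2)[unfolded x y coords_x_def mem_Times_iff prod.sel]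
  note defs = in_Ap_def in_Am_def in_C_def in_E_def in_C'_def in_E'_def
  show ?thesis
    unfolding x y using mems assms(3)
    by (cases s; cases t) (simp_all add: defs column_column_rules scale_right_distrib scale_right_diff_distrib)
qed

section \<open>Algebraic laws deduced from the Jacobi identity\<close>

abbreviation mul_a where "mul_a \<equiv> mult_a hs P"
abbreviation form_x where "form_x \<equiv> mult_BB' hs P"
abbreviation scl_a where "scl_a \<equiv> scale_a hs"

fun scl_x :: "'f \<Rightarrow> ('f^'n \<Rightarrow> 'l) \<times> ('f^'n \<Rightarrow> 'l) \<Rightarrow> ('f^'n \<Rightarrow> 'l) \<times> ('f^'n \<Rightarrow> 'l)" where
  "scl_x k (b, b') = (hs k b, hs k b')"

fun deriv_a :: "'l \<Rightarrow> ('f^'n^'n \<Rightarrow> 'l) coord_a \<Rightarrow> ('f^'n^'n \<Rightarrow> 'l) coord_a" where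
  "deriv_a d (p, m, c, e, c', e') = (da P d p, da P d m, dc P d c, de P d e, dc' P d c', de' P d e')"

fun deriv_x :: "'l \<Rightarrow> ('f^'n \<Rightarrow> 'l) \<times> ('f^'n \<Rightarrow> 'l) \<Rightarrow> ('f^'n \<Rightarrow> 'l) \<times> ('f^'n \<Rightarrow> 'l)" where
  "deriv_x d (b, b') = (db P d b, db' P d b')"

definition one :: "('f^'n^'n \<Rightarrow> 'l) coord_a" where "one = in_Ap one_A"

lemma one_A_in [simp]: "one_A \<in> A"
  unfolding A_def
  by (auto simp: hom_space_def linear_on_def one_A_def \<iota>_add \<iota>_scale \<iota>_bracket mscale.subspace_add[OF sl_subspace]
      mscale.subspace_scale[OF sl_subspace])

lemma one_A_nonzero: "one_A \<noteq> 0"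
proof
  obtain i j :: 'n where ij: "i \<noteq> j" by (rule obtain_distinct) auto
  assume "one_A = 0"
  then have "one_A (munit i j) = 0" by simp
  then have "\<iota> (munit i j) = \<iota> 0" using ij by (simp add: one_A_def)
  then have "munit i j = (0 :: 'f^'n^'n)"
    using inj_onD[OF \<iota>_inj] ij zero_mats(1) by simp
  then have "(munit i j :: 'f^'n^'n) $ i $ j = 0" by simp
  then show False by simp
qed

lemma coords_a_closed [simp]:
  "0 \<in> coords_a" "one \<in> coords_a" "\<alpha> \<in> coords_a \<Longrightarrow> \<beta> \<in> coords_a \<Longrightarrow> \<alpha> + \<beta> \<in> coords_a"
  "\<alpha> \<in> coords_a \<Longrightarrow> \<beta> \<in> coords_a \<Longrightarrow> \<alpha> - \<beta> \<in> coords_a"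
  "\<alpha> \<in> coords_a \<Longrightarrow> scl_a k \<alpha> \<in> coords_a" "\<alpha> \<in> coords_a \<Longrightarrow> gamma \<alpha> \<in> coords_a"
  "d \<in> D \<Longrightarrow> \<alpha> \<in> coords_a \<Longrightarrow> deriv_a d \<alpha> \<in> coords_a"
  by (cases \<alpha> rule: prod_cases6; cases \<beta> rule: prod_cases6; simp add: coords_a_def zero_prod_def one_def in_Ap_def)+

lemma coords_x_closed [simp]:
  "0 \<in> coords_x" "x \<in> coords_x \<Longrightarrow> y \<in> coords_x \<Longrightarrow> x + y \<in> coords_x"
  "x \<in> coords_x \<Longrightarrow> y \<in> coords_x \<Longrightarrow> x - y \<in> coords_x"
  "x \<in> coords_x \<Longrightarrow> scl_x k x \<in> coords_x" "d \<in> D \<Longrightarrow> x \<in> coords_x \<Longrightarrow> deriv_x d x \<in> coords_x"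
  by (cases x; cases y; simp add: coords_x_def zero_prod_def)+

lemma mul_a_closed [simp]: "\<alpha> \<in> coords_a \<Longrightarrow> \<beta> \<in> coords_a \<Longrightarrow> mul_a \<alpha> \<beta> \<in> coords_a"
  by (cases \<alpha> rule: prod_cases6; cases \<beta> rule: prod_cases6)
    (simp add: coords_a_def in_Ap_def in_Am_def in_C_def in_E_def in_C'_def in_E'_def)

lemma form_x_closed [simp]: "x \<in> coords_x \<Longrightarrow> y \<in> coords_x \<Longrightarrow> form_x x y \<in> coords_a"
  by (cases x; cases y)
    (simp add: coords_a_def coords_x_def in_Ap_def in_Am_def in_C_def in_E_def in_C'_def in_E'_def)

lemma mult_x_closed [simp]: "\<alpha> \<in> coords_a \<Longrightarrow> x \<in> coords_x \<Longrightarrow> mult_x \<alpha> x \<in> coords_x"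
  by (cases \<alpha> rule: prod_cases6; cases x) (simp add: coords_a_def coords_x_def)

lemma entry_add: "entry s t i j (\<alpha> + \<beta>) = entry s t i j \<alpha> + entry s t i j \<beta>"
  by (cases \<alpha> rule: prod_cases6; cases \<beta> rule: prod_cases6; cases s; cases t) (simp_all add: algebra_simps)

lemma entry_diff: "entry s t i j (\<alpha> - \<beta>) = entry s t i j \<alpha> - entry s t i j \<beta>"
  by (cases \<alpha> rule: prod_cases6; cases \<beta> rule: prod_cases6; cases s; cases t) (simp_all add: algebra_simps)

lemma entry_scale: "entry s t i j (scl_a k \<alpha>) = scale k (entry s t i j \<alpha>)"
  by (cases \<alpha> rule: prod_cases6; cases s; cases t) (simp_all add: scale_right_distrib scale_right_diff_distrib)

lemma column_add: "column s i (x + y) = column s i x + column s i y"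
  by (cases x; cases y; cases s) simp_all

lemma column_diff: "column s i (x - y) = column s i x - column s i y"
  by (cases x; cases y; cases s) simp_all

lemma column_scale: "column s i (scl_x k x) = scale k (column s i x)"
  by (cases x; cases s) simp_all

lemma entry_gamma:
  assumes "\<alpha> \<in> coords_a"
  shows "entry s t i j (gamma \<alpha>) = - entry (\<not> t) (\<not> s) j i \<alpha>"
proof -
  have "skewunit j i = - (skewunit i j :: 'f^'n^'n)" by (simp add: skewunit_def)
  then show ?thesis using assms
    by (cases \<alpha> rule: prod_cases6; cases s; cases t)
      (simp_all add: coords_a_def symunit_commute[of j i] hom_minus_munit)
qed

text \<open>Taking entries merges the separate actions of d on the summands into the bracket with d,
  which reduces the derivation laws to the Jacobi identity.\<close>

lemma entry_deriv:
  assumes "\<alpha> \<in> coords_a" "d \<in> D" "i \<noteq> j"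
  shows "entry s t i j (deriv_a d \<alpha>) = bracket d (entry s t i j \<alpha>)"
  using assms by (cases \<alpha> rule: prod_cases6; cases s; cases t)
    (simp_all add: coords_a_def bracket_ring rule_da rule_dc rule_dc' rule_de rule_de')

lemma column_deriv:
  assumes "x \<in> coords_x" "d \<in> D"
  shows "column s i (deriv_x d x) = bracket d (column s i x)"
  using assms by (cases x; cases s) (simp_all add: coords_x_def rule_db rule_db')

lemma CE'_inj:
  assumes "c \<in> C'" "e \<in> E'" "i \<noteq> j" "c (munit i j + munit j i) + e (munit i j - munit j i) = 0"
  shows "c = 0" "e = 0"
proof -
  interpret dual: theta_graded5 scale bracket dual_\<iota> by (rule dual_theta_graded5)
  show "c = 0" "e = 0" using dual.CE_inj[unfolded dual_spaces, OF assms] by auto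
qed

lemma add_self_zero: "x + x = 0 \<Longrightarrow> x = (0 :: 'm \<Rightarrow> 'l)"
  using module.scale_left_distrib[OF module_hs, of 1 1 x]
  by (simp add: module.scale_one[OF module_hs] vector_space.scale_eq_0_iff[OF vector_space_hs])

text \<open>The entries (+,+) and (-,-) give p + m and m - p, so p and m vanish in characteristic
  zero; the other two split because symmetric and skew parts are independent. Hence an identity in
  \<open>\<aa>\<close> may be checked in L at one pair of indices.\<close>

lemma entry_kernel:
  assumes "\<alpha> \<in> coords_a" "i \<noteq> j" "\<And>s t. entry s t i j \<alpha> = 0"
  shows "\<alpha> = 0"
proof -
  obtain p m c e c' e' where \<alpha>: "\<alpha> = (p, m, c, e, c', e')" by (rule prod_cases6)
  have mem: "p \<in> A" "m \<in> A" "c \<in> C" "e \<in> E" "c' \<in> C'" "e' \<in> E'"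
    using assms(1) by (simp_all add: \<alpha> coords_a_def)
  have "p + m = 0" using A_inj[of "p + m" i j] assms(2) assms(3)[of True True] mem by (simp add: \<alpha>)
  moreover have "m - p = 0" using A_inj[of "m - p" j i] assms(2) assms(3)[of False False] mem by (simp add: \<alpha>)
  ultimately have "p = 0" "m = 0" using add_self_zero[of m] by simp_all
  moreover have "c = 0" "e = 0" using CE_inj[OF mem(3,4) assms(2)] assms(3)[of True False]
    by (simp_all add: \<alpha> symunit_def skewunit_def)
  moreover have "c' = 0" "e' = 0" using CE'_inj[OF mem(5,6) assms(2)] assms(3)[of False True]
    by (simp_all add: \<alpha> symunit_def skewunit_def)
  ultimately show ?thesis by (simp add: \<alpha> zero_prod_def)
qed

lemma coords_a_eqI:
  assumes "\<And>s t. entry s t i j \<alpha> = entry s t i j \<beta>" "i \<noteq> j" "\<alpha> \<in> coords_a" "\<beta> \<in> coords_a"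
  shows "\<alpha> = \<beta>"
  using entry_kernel[of "\<alpha> - \<beta>" i j] assms by (simp add: entry_diff)

lemma coords_x_eqI:
  assumes "\<And>s. column s i x = column s i y" "x \<in> coords_x" "y \<in> coords_x"
  shows "x = y"
proof -
  obtain b b' where xy: "x - y = (b, b')" by (rule prod.exhaust)
  have "b \<in> B" "b' \<in> B'" using coords_x_closed(3)[OF assms(2,3)] by (simp_all add: xy coords_x_def)
  moreover have "b (axis i 1) = 0" "b' (axis i 1) = 0"
    using column_diff[of True i x y] column_diff[of False i x y] assms(1) by (simp_all add: xy)
  ultimately have "x - y = 0" using B_inj[of b i] B'_inj[of b' i] by (simp add: xy zero_prod_def)
  then show ?thesis by simp
qed

text \<open>When the outer factors commute, the Jacobi identity becomes associativity.\<close>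

lemma bracket_assoc: "bracket x z = 0 \<Longrightarrow> bracket (bracket x y) z = bracket x (bracket y z)"
  by (simp add: bracket_bracket_right)

text \<open>Bilinearity is inherited from the bracket through the entries, which avoids expanding
  the product formula.\<close>

lemma mul_a_linear:
  shows "\<alpha> \<in> coords_a \<Longrightarrow> \<beta> \<in> coords_a \<Longrightarrow> \<gamma> \<in> coords_a \<Longrightarrow> mul_a (\<alpha> + \<beta>) \<gamma> = mul_a \<alpha> \<gamma> + mul_a \<beta> \<gamma>"
    "\<alpha> \<in> coords_a \<Longrightarrow> \<beta> \<in> coords_a \<Longrightarrow> \<gamma> \<in> coords_a \<Longrightarrow> mul_a \<alpha> (\<beta> + \<gamma>) = mul_a \<alpha> \<beta> + mul_a \<alpha> \<gamma>"
    "\<alpha> \<in> coords_a \<Longrightarrow> \<beta> \<in> coords_a \<Longrightarrow> mul_a (scl_a k \<alpha>) \<beta> = scl_a k (mul_a \<alpha> \<beta>)"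
    "\<alpha> \<in> coords_a \<Longrightarrow> \<beta> \<in> coords_a \<Longrightarrow> mul_a \<alpha> (scl_a k \<beta>) = scl_a k (mul_a \<alpha> \<beta>)"
proof -
  obtain i j k' l m :: 'n where "distinct [i, j, k', l, m]" by (rule obtain_distinct)
  then have d: "i \<noteq> j" "j \<noteq> k'" "i \<noteq> k'" by auto
  note eb = entry_bracket[OF _ _ d, symmetric]
  show "\<alpha> \<in> coords_a \<Longrightarrow> \<beta> \<in> coords_a \<Longrightarrow> \<gamma> \<in> coords_a \<Longrightarrow> mul_a (\<alpha> + \<beta>) \<gamma> = mul_a \<alpha> \<gamma> + mul_a \<beta> \<gamma>"
    "\<alpha> \<in> coords_a \<Longrightarrow> \<beta> \<in> coords_a \<Longrightarrow> \<gamma> \<in> coords_a \<Longrightarrow> mul_a \<alpha> (\<beta> + \<gamma>) = mul_a \<alpha> \<beta> + mul_a \<alpha> \<gamma>"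
    "\<alpha> \<in> coords_a \<Longrightarrow> \<beta> \<in> coords_a \<Longrightarrow> mul_a (scl_a k \<alpha>) \<beta> = scl_a k (mul_a \<alpha> \<beta>)"
    "\<alpha> \<in> coords_a \<Longrightarrow> \<beta> \<in> coords_a \<Longrightarrow> mul_a \<alpha> (scl_a k \<beta>) = scl_a k (mul_a \<alpha> \<beta>)"
    by (rule coords_a_eqI[OF _ d(3)];
        simp add: eb entry_add entry_scale bracket_ring bracket_scale_left bracket_scale_right scale_right_distrib algebra_simps)+
qed

lemma mult_x_linear:
  shows "\<alpha> \<in> coords_a \<Longrightarrow> \<beta> \<in> coords_a \<Longrightarrow> x \<in> coords_x \<Longrightarrow> mult_x (\<alpha> + \<beta>) x = mult_x \<alpha> x + mult_x \<beta> x"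
    "\<alpha> \<in> coords_a \<Longrightarrow> x \<in> coords_x \<Longrightarrow> y \<in> coords_x \<Longrightarrow> mult_x \<alpha> (x + y) = mult_x \<alpha> x + mult_x \<alpha> y"
    "\<alpha> \<in> coords_a \<Longrightarrow> x \<in> coords_x \<Longrightarrow> mult_x (scl_a k \<alpha>) x = scl_x k (mult_x \<alpha> x)"
    "\<alpha> \<in> coords_a \<Longrightarrow> x \<in> coords_x \<Longrightarrow> mult_x \<alpha> (scl_x k x) = scl_x k (mult_x \<alpha> x)"
proof -
  obtain i j :: 'n where ij: "i \<noteq> j" by (rule obtain_distinct) auto
  note ec = entry_column[OF _ _ ij, symmetric]
  show "\<alpha> \<in> coords_a \<Longrightarrow> \<beta> \<in> coords_a \<Longrightarrow> x \<in> coords_x \<Longrightarrow> mult_x (\<alpha> + \<beta>) x = mult_x \<alpha> x + mult_x \<beta> x"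
    "\<alpha> \<in> coords_a \<Longrightarrow> x \<in> coords_x \<Longrightarrow> y \<in> coords_x \<Longrightarrow> mult_x \<alpha> (x + y) = mult_x \<alpha> x + mult_x \<alpha> y"
    "\<alpha> \<in> coords_a \<Longrightarrow> x \<in> coords_x \<Longrightarrow> mult_x (scl_a k \<alpha>) x = scl_x k (mult_x \<alpha> x)"
    "\<alpha> \<in> coords_a \<Longrightarrow> x \<in> coords_x \<Longrightarrow> mult_x \<alpha> (scl_x k x) = scl_x k (mult_x \<alpha> x)"
    by (rule coords_x_eqI[of i];
        simp add: ec entry_add entry_scale column_add column_scale bracket_ring bracket_scale_left bracket_scale_right
          scale_right_distrib algebra_simps)+
qed

lemma form_x_linear:
  shows "x \<in> coords_x \<Longrightarrow> y \<in> coords_x \<Longrightarrow> z \<in> coords_x \<Longrightarrow> form_x (x + y) z = form_x x z + form_x y z"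
    "x \<in> coords_x \<Longrightarrow> y \<in> coords_x \<Longrightarrow> z \<in> coords_x \<Longrightarrow> form_x x (y + z) = form_x x y + form_x x z"
    "x \<in> coords_x \<Longrightarrow> y \<in> coords_x \<Longrightarrow> form_x (scl_x k x) y = scl_a k (form_x x y)"
    "x \<in> coords_x \<Longrightarrow> y \<in> coords_x \<Longrightarrow> form_x x (scl_x k y) = scl_a k (form_x x y)"
proof -
  obtain i j :: 'n where ij: "i \<noteq> j" by (rule obtain_distinct) auto
  note cc = column_column[OF _ _ ij, symmetric]
  show "x \<in> coords_x \<Longrightarrow> y \<in> coords_x \<Longrightarrow> z \<in> coords_x \<Longrightarrow> form_x (x + y) z = form_x x z + form_x y z"
    "x \<in> coords_x \<Longrightarrow> y \<in> coords_x \<Longrightarrow> z \<in> coords_x \<Longrightarrow> form_x x (y + z) = form_x x y + form_x x z"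
    "x \<in> coords_x \<Longrightarrow> y \<in> coords_x \<Longrightarrow> form_x (scl_x k x) y = scl_a k (form_x x y)"
    "x \<in> coords_x \<Longrightarrow> y \<in> coords_x \<Longrightarrow> form_x x (scl_x k y) = scl_a k (form_x x y)"
    by (rule coords_a_eqI[OF _ ij];
        simp add: cc entry_add entry_scale column_add column_scale bracket_ring bracket_scale_left bracket_scale_right)+
qed

text \<open>A triple product is a chain through four distinct indices, so that the entries of the
  outer factors commute and \<open>bracket_assoc\<close> applies to each choice of middle
  signs.\<close>

lemma mul_a_assoc:
  assumes "\<alpha> \<in> coords_a" "\<beta> \<in> coords_a" "\<gamma> \<in> coords_a"
  shows "mul_a (mul_a \<alpha> \<beta>) \<gamma> = mul_a \<alpha> (mul_a \<beta> \<gamma>)"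
proof -
  obtain i j k l m :: 'n where d: "distinct [i, j, k, l, m]" by (rule obtain_distinct)
  then have dist: "i \<noteq> j" "j \<noteq> k" "i \<noteq> k" "k \<noteq> l" "i \<noteq> l" "j \<noteq> l" and d4: "distinct [i, j, k, l]" by auto
  note [simp] = bracket_assoc[OF entry_entry_zero[OF assms(1,3) d4]]
  show ?thesis
  proof (rule coords_a_eqI[OF _ dist(5)])
    fix s t
    have "entry s t i l (mul_a (mul_a \<alpha> \<beta>) \<gamma>)
      = bracket (entry s True i k (mul_a \<alpha> \<beta>)) (entry True t k l \<gamma>) + bracket (entry s False i k (mul_a \<alpha> \<beta>)) (entry False t k l \<gamma>)"
      using entry_bracket[OF _ _ dist(3,4,5)] assms by simp
    also have "\<dots> = bracket (entry s True i j \<alpha>) (entry True t j l (mul_a \<beta> \<gamma>)) + bracket (entry s False i j \<alpha>) (entry False t j l (mul_a \<beta> \<gamma>))"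
      by (simp add: assms entry_bracket[OF _ _ dist(1,2,3), symmetric] entry_bracket[OF _ _ dist(2,4,6), symmetric] bracket_ring algebra_simps)
    also have "\<dots> = entry s t i l (mul_a \<alpha> (mul_a \<beta> \<gamma>))"
      using entry_bracket[OF _ _ dist(1,6,5)] assms by simp
    finally show "entry s t i l (mul_a (mul_a \<alpha> \<beta>) \<gamma>) = entry s t i l (mul_a \<alpha> (mul_a \<beta> \<gamma>))" .
  qed (simp_all add: assms)
qed

lemma mult_x_assoc:
  assumes "\<alpha> \<in> coords_a" "\<beta> \<in> coords_a" "x \<in> coords_x"
  shows "mult_x (mul_a \<alpha> \<beta>) x = mult_x \<alpha> (mult_x \<beta> x)"
proof -
  obtain i j k l m :: 'n where d: "distinct [i, j, k, l, m]" by (rule obtain_distinct)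
  then have dist: "i \<noteq> j" "j \<noteq> k" "i \<noteq> k" "k \<noteq> i" "k \<noteq> j" by auto
  note [simp] = bracket_assoc[OF entry_column_zero[OF assms(1,3) dist(1,4,5)]]
  show ?thesis
  proof (rule coords_x_eqI[of i])
    fix s
    have "column s i (mult_x (mul_a \<alpha> \<beta>) x)
      = bracket (entry s True i k (mul_a \<alpha> \<beta>)) (column True k x) + bracket (entry s False i k (mul_a \<alpha> \<beta>)) (column False k x)"
      using entry_column[OF _ _ dist(3)] assms by simp
    also have "\<dots> = bracket (entry s True i j \<alpha>) (column True j (mult_x \<beta> x)) + bracket (entry s False i j \<alpha>) (column False j (mult_x \<beta> x))"
      by (simp add: assms entry_bracket[OF _ _ dist(1,2,3), symmetric] entry_column[OF _ _ dist(2), symmetric] bracket_ring algebra_simps)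
    also have "\<dots> = column s i (mult_x \<alpha> (mult_x \<beta> x))"
      using entry_column[OF _ _ dist(1)] assms by simp
    finally show "column s i (mult_x (mul_a \<alpha> \<beta>) x) = column s i (mult_x \<alpha> (mult_x \<beta> x))" .
  qed (simp_all add: assms)
qed

text \<open>The chain i, j, k consists of an entry and two columns here: the entry of \<alpha> at
  (i,j) commutes with the column of y at k, so three indices are enough.\<close>

lemma form_x_left:
  assumes "\<alpha> \<in> coords_a" "x \<in> coords_x" "y \<in> coords_x"
  shows "form_x (mult_x \<alpha> x) y = mul_a \<alpha> (form_x x y)"
proof -
  obtain i j k l m :: 'n where d: "distinct [i, j, k, l, m]" by (rule obtain_distinct)
  then have dist: "i \<noteq> j" "j \<noteq> k" "i \<noteq> k" "k \<noteq> i" "k \<noteq> j" by auto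
  note [simp] = bracket_assoc[OF entry_column_zero[OF assms(1,3) dist(1,4,5)]]
  show ?thesis
  proof (rule coords_a_eqI[OF _ dist(3)])
    fix s t
    have "entry s t i k (form_x (mult_x \<alpha> x) y) = bracket (column s i (mult_x \<alpha> x)) (column (\<not> t) k y)"
      using column_column[OF _ _ dist(3)] assms by simp
    also have "\<dots> = bracket (entry s True i j \<alpha>) (entry True t j k (form_x x y)) + bracket (entry s False i j \<alpha>) (entry False t j k (form_x x y))"
      by (simp add: assms column_column[OF _ _ dist(2), symmetric] entry_column[OF _ _ dist(1), symmetric] bracket_ring)
    also have "\<dots> = entry s t i k (mul_a \<alpha> (form_x x y))"
      using entry_bracket[OF _ _ dist(1-3)] assms by simp
    finally show "entry s t i k (form_x (mult_x \<alpha> x) y) = entry s t i k (mul_a \<alpha> (form_x x y))" .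
  qed (simp_all add: assms)
qed

lemma gamma_gamma [simp]: "gamma (gamma \<alpha>) = (\<alpha> :: ('f^'n^'n \<Rightarrow> 'l) coord_a)"
  by (cases \<alpha> rule: prod_cases6) simp

lemma gamma_linear: "gamma (\<alpha> + \<beta>) = gamma \<alpha> + gamma \<beta>" "gamma (scl_a k \<alpha>) = scl_a k (gamma \<alpha>)"
  by (cases \<alpha> rule: prod_cases6; cases \<beta> rule: prod_cases6; simp add: module.scale_minus_right[OF module_hs])+

text \<open>By \<open>entry_gamma\<close>, \<open>gamma\<close> reverses the index pair and the sign
  pair at the cost of a sign. An entry of the left side is thus a chain from k to i, and
  anticommutativity of the bracket turns it into a chain from i to k with the factors
  exchanged.\<close>

lemma gamma_mul:
  assumes "\<alpha> \<in> coords_a" "\<beta> \<in> coords_a"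
  shows "gamma (mul_a \<alpha> \<beta>) = mul_a (gamma \<beta>) (gamma \<alpha>)"
proof -
  obtain i j k l m :: 'n where d: "distinct [i, j, k, l, m]" by (rule obtain_distinct)
  then have dist: "i \<noteq> j" "j \<noteq> k" "i \<noteq> k" "k \<noteq> j" "j \<noteq> i" "k \<noteq> i" by auto
  show ?thesis
  proof (rule coords_a_eqI[OF _ dist(3)])
    fix s t
    show "entry s t i k (gamma (mul_a \<alpha> \<beta>)) = entry s t i k (mul_a (gamma \<beta>) (gamma \<alpha>))"
      using bracket_anticomm[of "entry (\<not> t) True k j \<alpha>" "entry True (\<not> s) j i \<beta>"]
        bracket_anticomm[of "entry (\<not> t) False k j \<alpha>" "entry False (\<not> s) j i \<beta>"]
      by (simp add: assms entry_gamma entry_bracket[OF _ _ dist(1,2,3), symmetric] entry_bracket[OF _ _ dist(4-6), symmetric] bracket_ring)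
  qed (simp_all add: assms)
qed

lemma gamma_form:
  assumes "x \<in> coords_x" "y \<in> coords_x"
  shows "gamma (form_x x y) = form_x y x"
proof -
  obtain i j :: 'n where ij: "i \<noteq> j" by (rule obtain_distinct) auto
  show ?thesis
  proof (rule coords_a_eqI[OF _ ij])
    fix s t
    show "entry s t i j (gamma (form_x x y)) = entry s t i j (form_x y x)"
      using bracket_anticomm[of "column (\<not> t) j x" "column s i y"] ij
      by (simp add: assms entry_gamma flip: column_column)
  qed (simp_all add: assms)
qed

text \<open>The rule for the second argument is \<open>form_x_left\<close> conjugated by
  \<open>gamma\<close>, which exchanges the arguments of the form.\<close>

lemma form_x_right:
  assumes "\<alpha> \<in> coords_a" "x \<in> coords_x" "y \<in> coords_x"
  shows "form_x x (mult_x \<alpha> y) = mul_a (form_x x y) (gamma \<alpha>)"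
proof -
  have "form_x x (mult_x \<alpha> y) = gamma (mul_a \<alpha> (form_x y x))"
    by (simp add: assms gamma_form flip: form_x_left)
  then show ?thesis by (simp add: assms gamma_mul gamma_form)
qed

lemma one_act:
  assumes "a \<in> A" "c \<in> C" "e \<in> E" "c' \<in> C'" "e' \<in> E'" "b \<in> B" "b' \<in> B'" "i \<noteq> j" "j \<noteq> k" "i \<noteq> k"
  shows "bracket (\<iota> (munit i j)) (a (munit j k)) = a (munit i k)"
    "bracket (\<iota> (munit j i)) (a (munit k j)) = - a (munit k i)"
    "bracket (\<iota> (munit i j)) (c (symunit j k)) = c (symunit i k)"
    "bracket (\<iota> (munit i j)) (e (skewunit j k)) = e (skewunit i k)"
    "bracket (\<iota> (munit j i)) (c' (symunit j k)) = - c' (symunit i k)"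
    "bracket (\<iota> (munit j i)) (e' (skewunit j k)) = - e' (skewunit i k)"
    "bracket (\<iota> (munit i j)) (b (axis j 1)) = b (axis i 1)"
    "bracket (\<iota> (munit j i)) (b' (axis j 1)) = - b' (axis i 1)"
proof -
  note h = hom_spaceD(2)[OF assms(1)[unfolded A_def]] hom_spaceD(2)[OF assms(2)[unfolded C_def]]
    hom_spaceD(2)[OF assms(3)[unfolded E_def]] hom_spaceD(2)[OF assms(4)[unfolded C'_def]]
    hom_spaceD(2)[OF assms(5)[unfolded E'_def]] hom_spaceD(2)[OF assms(6)[unfolded B_def]]
    hom_spaceD(2)[OF assms(7)[unfolded B'_def]]
  have acts: "act_S (munit i j) (symunit j k) = (symunit i k :: 'f^'n^'n)" "act_S (munit i j) (skewunit j k) = (skewunit i k :: 'f^'n^'n)"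
    "act_S' (munit j i) (symunit j k) = (- symunit i k :: 'f^'n^'n)" "act_S' (munit j i) (skewunit j k) = (- skewunit i k :: 'f^'n^'n)"
    using assms(8-10) by (auto simp: act_S_def act_S'_def symunit_def skewunit_def matrix_ring)
  show "bracket (\<iota> (munit i j)) (a (munit j k)) = a (munit i k)"
    "bracket (\<iota> (munit j i)) (a (munit k j)) = - a (munit k i)"
    "bracket (\<iota> (munit i j)) (c (symunit j k)) = c (symunit i k)"
    "bracket (\<iota> (munit i j)) (e (skewunit j k)) = e (skewunit i k)"
    "bracket (\<iota> (munit j i)) (c' (symunit j k)) = - c' (symunit i k)"
    "bracket (\<iota> (munit j i)) (e' (skewunit j k)) = - e' (skewunit i k)"
    "bracket (\<iota> (munit i j)) (b (axis j 1)) = b (axis i 1)"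
    "bracket (\<iota> (munit j i)) (b' (axis j 1)) = - b' (axis i 1)"
    using assms by (simp_all add: h acts mat_prods act_V_def act_V'_def hom_minus_munit)
qed

text \<open>The entries of \<open>one\<close> are the images of E_ij at (+,+) and of -E_ji at (-,-),
  and zero elsewhere. So multiplying by it is the action of root vectors on values of homomorphisms,
  which only moves an index j to i.\<close>

lemma one_mul:
  assumes "\<alpha> \<in> coords_a"
  shows "mul_a one \<alpha> = \<alpha>"
proof -
  obtain i j k l m :: 'n where d: "distinct [i, j, k, l, m]" by (rule obtain_distinct)
  then have dist: "i \<noteq> j" "j \<noteq> k" "i \<noteq> k" "j \<noteq> i" by auto
  obtain p m c e c' e' where \<alpha>: "\<alpha> = (p, m, c, e, c', e')" by (rule prod_cases6)
  have mem: "p \<in> A" "m \<in> A" "c \<in> C" "e \<in> E" "c' \<in> C'" "e' \<in> E'"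
    using assms(1) by (simp_all add: \<alpha> coords_a_def)
  show ?thesis
  proof (rule coords_a_eqI[OF _ dist(3)])
    fix s t
    show "entry s t i k (mul_a one \<alpha>) = entry s t i k \<alpha>"
      unfolding entry_bracket[OF coords_a_closed(2) assms dist(1-3), symmetric]
      using dist by (cases s; cases t) (simp_all add: \<alpha> one_def in_Ap_def one_A_def bracket_ring
          one_act[OF mem(1,3-6) hom_closed(2,3) dist(1-3)] one_act[OF mem(2,3-6) hom_closed(2,3) dist(1-3)])
  qed (simp_all add: assms)
qed

lemma gamma_one: "gamma one = one"
  by (simp add: one_def in_Ap_def)

lemma mul_one: "\<alpha> \<in> coords_a \<Longrightarrow> mul_a \<alpha> one = \<alpha>"
  using gamma_mul[of one "gamma \<alpha>"] by (simp add: one_mul gamma_one)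

lemma one_mult_x:
  assumes "x \<in> coords_x"
  shows "mult_x one x = x"
proof -
  obtain i j k l m :: 'n where d: "distinct [i, j, k, l, m]" by (rule obtain_distinct)
  then have dist: "i \<noteq> j" "j \<noteq> k" "i \<noteq> k" "j \<noteq> i" by auto
  obtain b b' where x: "x = (b, b')" by (rule prod.exhaust)
  have mem: "b \<in> B" "b' \<in> B'" using assms by (simp_all add: x coords_x_def)
  show ?thesis
  proof (rule coords_x_eqI[of i])
    fix s
    show "column s i (mult_x one x) = column s i x"
      unfolding entry_column[OF coords_a_closed(2) assms dist(1), symmetric]
      using dist by (cases s) (simp_all add: x one_def in_Ap_def one_A_def bracket_ring
          one_act[OF hom_closed(1,4,6,5,7) mem dist(1-3)])
  qed (simp_all add: assms)
qed

section \<open>The action of D on coordinates\<close>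

lemma deriv_mul:
  assumes "d \<in> D" "\<alpha> \<in> coords_a" "\<beta> \<in> coords_a"
  shows "deriv_a d (mul_a \<alpha> \<beta>) = mul_a (deriv_a d \<alpha>) \<beta> + mul_a \<alpha> (deriv_a d \<beta>)"
proof -
  obtain i j k' l m :: 'n where "distinct [i, j, k', l, m]" by (rule obtain_distinct)
  then have d: "i \<noteq> j" "j \<noteq> k'" "i \<noteq> k'" by auto
  show ?thesis
    by (rule coords_a_eqI[OF _ d(3)]; simp add: assms d entry_add entry_deriv bracket_bracket_right[of d] bracket_ring
        flip: entry_bracket[OF _ _ d])
qed

lemma deriv_mult_x:
  assumes "d \<in> D" "\<alpha> \<in> coords_a" "x \<in> coords_x"
  shows "deriv_x d (mult_x \<alpha> x) = mult_x (deriv_a d \<alpha>) x + mult_x \<alpha> (deriv_x d x)"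
proof -
  obtain i j :: 'n where ij: "i \<noteq> j" by (rule obtain_distinct) auto
  show ?thesis
    by (rule coords_x_eqI[of i]; simp add: assms ij column_add entry_deriv column_deriv bracket_bracket_right[of d] bracket_ring
        flip: entry_column[OF _ _ ij])
qed

lemma deriv_form:
  assumes "d \<in> D" "x \<in> coords_x" "y \<in> coords_x"
  shows "deriv_a d (form_x x y) = form_x (deriv_x d x) y + form_x x (deriv_x d y)"
proof -
  obtain i j :: 'n where ij: "i \<noteq> j" by (rule obtain_distinct) auto
  show ?thesis
    by (rule coords_a_eqI[OF _ ij]; simp add: assms ij entry_add entry_deriv column_deriv bracket_bracket_right[of d]
        flip: column_column[OF _ _ ij])
qed

lemma deriv_gamma:
  assumes "d \<in> D" "\<alpha> \<in> coords_a"
  shows "deriv_a d (gamma \<alpha>) = gamma (deriv_a d \<alpha>)"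
proof -
  obtain i j :: 'n where ij: "i \<noteq> j" by (rule obtain_distinct) auto
  show ?thesis
    by (rule coords_a_eqI[OF _ ij]; simp add: assms ij ij[symmetric] entry_deriv entry_gamma bracket_ring)
qed

lemma D_closed [simp]: "d \<in> D \<Longrightarrow> d' \<in> D \<Longrightarrow> d + d' \<in> D" "d \<in> D \<Longrightarrow> scale k d \<in> D"
  "d \<in> D \<Longrightarrow> d' \<in> D \<Longrightarrow> bracket d d' \<in> D"
  by (simp_all add: subspace_add[OF D_subspace] subspace_scale[OF D_subspace] D_bracket)

lemma deriv_a_linear:
  shows "\<alpha> \<in> coords_a \<Longrightarrow> \<beta> \<in> coords_a \<Longrightarrow> d \<in> D \<Longrightarrow> deriv_a d (\<alpha> + \<beta>) = deriv_a d \<alpha> + deriv_a d \<beta>"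
    "\<alpha> \<in> coords_a \<Longrightarrow> d \<in> D \<Longrightarrow> deriv_a d (scl_a k \<alpha>) = scl_a k (deriv_a d \<alpha>)"
    "\<alpha> \<in> coords_a \<Longrightarrow> d \<in> D \<Longrightarrow> d' \<in> D \<Longrightarrow> deriv_a (d + d') \<alpha> = deriv_a d \<alpha> + deriv_a d' \<alpha>"
    "\<alpha> \<in> coords_a \<Longrightarrow> d \<in> D \<Longrightarrow> deriv_a (scale k d) \<alpha> = scl_a k (deriv_a d \<alpha>)"
    "\<alpha> \<in> coords_a \<Longrightarrow> d \<in> D \<Longrightarrow> d' \<in> D \<Longrightarrow> deriv_a (bracket d d') \<alpha> = deriv_a d (deriv_a d' \<alpha>) - deriv_a d' (deriv_a d \<alpha>)"
proof -
  obtain i j :: 'n where ij: "i \<noteq> j" by (rule obtain_distinct) auto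
  show "\<alpha> \<in> coords_a \<Longrightarrow> \<beta> \<in> coords_a \<Longrightarrow> d \<in> D \<Longrightarrow> deriv_a d (\<alpha> + \<beta>) = deriv_a d \<alpha> + deriv_a d \<beta>"
    "\<alpha> \<in> coords_a \<Longrightarrow> d \<in> D \<Longrightarrow> deriv_a d (scl_a k \<alpha>) = scl_a k (deriv_a d \<alpha>)"
    "\<alpha> \<in> coords_a \<Longrightarrow> d \<in> D \<Longrightarrow> d' \<in> D \<Longrightarrow> deriv_a (d + d') \<alpha> = deriv_a d \<alpha> + deriv_a d' \<alpha>"
    "\<alpha> \<in> coords_a \<Longrightarrow> d \<in> D \<Longrightarrow> deriv_a (scale k d) \<alpha> = scl_a k (deriv_a d \<alpha>)"
    "\<alpha> \<in> coords_a \<Longrightarrow> d \<in> D \<Longrightarrow> d' \<in> D \<Longrightarrow> deriv_a (bracket d d') \<alpha> = deriv_a d (deriv_a d' \<alpha>) - deriv_a d' (deriv_a d \<alpha>)"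
    by (rule coords_a_eqI[OF _ ij]; simp add: ij entry_deriv entry_add entry_diff entry_scale bracket_ring
        bracket_scale_left bracket_scale_right bracket_bracket_right[of d d'])+
qed

lemma deriv_x_linear:
  shows "x \<in> coords_x \<Longrightarrow> y \<in> coords_x \<Longrightarrow> d \<in> D \<Longrightarrow> deriv_x d (x + y) = deriv_x d x + deriv_x d y"
    "x \<in> coords_x \<Longrightarrow> d \<in> D \<Longrightarrow> deriv_x d (scl_x k x) = scl_x k (deriv_x d x)"
    "x \<in> coords_x \<Longrightarrow> d \<in> D \<Longrightarrow> d' \<in> D \<Longrightarrow> deriv_x (d + d') x = deriv_x d x + deriv_x d' x"
    "x \<in> coords_x \<Longrightarrow> d \<in> D \<Longrightarrow> deriv_x (scale k d) x = scl_x k (deriv_x d x)"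
    "x \<in> coords_x \<Longrightarrow> d \<in> D \<Longrightarrow> d' \<in> D \<Longrightarrow> deriv_x (bracket d d') x = deriv_x d (deriv_x d' x) - deriv_x d' (deriv_x d x)"
proof -
  show "x \<in> coords_x \<Longrightarrow> y \<in> coords_x \<Longrightarrow> d \<in> D \<Longrightarrow> deriv_x d (x + y) = deriv_x d x + deriv_x d y"
    "x \<in> coords_x \<Longrightarrow> d \<in> D \<Longrightarrow> deriv_x d (scl_x k x) = scl_x k (deriv_x d x)"
    "x \<in> coords_x \<Longrightarrow> d \<in> D \<Longrightarrow> d' \<in> D \<Longrightarrow> deriv_x (d + d') x = deriv_x d x + deriv_x d' x"
    "x \<in> coords_x \<Longrightarrow> d \<in> D \<Longrightarrow> deriv_x (scale k d) x = scl_x k (deriv_x d x)"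
    "x \<in> coords_x \<Longrightarrow> d \<in> D \<Longrightarrow> d' \<in> D \<Longrightarrow> deriv_x (bracket d d') x = deriv_x d (deriv_x d' x) - deriv_x d' (deriv_x d x)"
    by (rule coords_x_eqI[of undefined]; simp add: column_deriv column_add column_diff column_scale bracket_ring
        bracket_scale_left bracket_scale_right bracket_bracket_right[of d d'])+
qed

section \<open>The algebra on all coordinates\<close>

abbreviation mul :: "('f^'n^'n \<Rightarrow> 'l, 'f^'n \<Rightarrow> 'l) coord_b \<Rightarrow> ('f^'n^'n \<Rightarrow> 'l, 'f^'n \<Rightarrow> 'l) coord_b \<Rightarrow> ('f^'n^'n \<Rightarrow> 'l, 'f^'n \<Rightarrow> 'l) coord_b"
  where "mul \<equiv> mult_b hs P"
abbreviation sb :: "'f \<Rightarrow> ('f^'n^'n \<Rightarrow> 'l, 'f^'n \<Rightarrow> 'l) coord_b \<Rightarrow> ('f^'n^'n \<Rightarrow> 'l, 'f^'n \<Rightarrow> 'l) coord_b"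
  where "sb \<equiv> scale_b hs hs"

definition one_b :: "('f^'n^'n \<Rightarrow> 'l, 'f^'n \<Rightarrow> 'l) coord_b" where "one_b = (in_Ap one_A, 0, 0)"

definition coords_b :: "('f^'n^'n \<Rightarrow> 'l, 'f^'n \<Rightarrow> 'l) coord_b set" where
  "coords_b = (A \<times> A \<times> C \<times> E \<times> C' \<times> E') \<times> B \<times> B'"

definition sub_a :: "('f^'n^'n \<Rightarrow> 'l, 'f^'n \<Rightarrow> 'l) coord_b set" where
  "sub_a = (A \<times> A \<times> C \<times> E \<times> C' \<times> E') \<times> {0} \<times> {0}"

definition sub_x :: "('f^'n^'n \<Rightarrow> 'l, 'f^'n \<Rightarrow> 'l) coord_b set" where
  "sub_x = {0} \<times> B \<times> B'"

text \<open>In blocks, the product of \<open>\<bb>\<close> consists of the product of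
  \<open>\<aa>\<close>, the form, and the left action; the right action by \<beta> is the left
  action by \<open>gamma \<beta>\<close>. Laws for \<open>mul\<close> thus reduce to laws for these
  three maps and \<open>gamma\<close>.\<close>

lemma mul_eq: "mul (\<alpha>, x) (\<beta>, y) = (mul_a \<alpha> \<beta> + form_x x y, mult_x \<alpha> y + mult_x (gamma \<beta>) x)"
  by (cases x; cases y) (simp add: algebra_simps)

lemma sb_eq: "sb k (\<alpha>, x) = (scl_a k \<alpha>, scl_x k x)"
  by (cases x) simp

lemma eta_eq: "eta (\<alpha>, x) = (gamma \<alpha>, x)"
  by (cases x) simp

lemma deriv_b_eq: "deriv_b P d (\<alpha>, x) = (deriv_a d \<alpha>, deriv_x d x)"
  by (cases \<alpha> rule: prod_cases6; cases x) simp

lemma coords_eqs: "coords_b = coords_a \<times> coords_x" "sub_a = coords_a \<times> {0}" "sub_x = {0} \<times> coords_x" "one_b = (one, 0)"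
  by (simp_all add: coords_b_def sub_a_def sub_x_def coords_a_def coords_x_def one_b_def one_def zero_prod_def)

lemmas b_simps = mul_eq sb_eq eta_eq deriv_b_eq coords_eqs

lemma scl_x_zero [simp]: "scl_x k 0 = 0"
  by (simp add: zero_prod_def module.scale_zero_right[OF module_hs])

lemma scl_right_distrib: "scl_a k (\<alpha> + \<beta>) = scl_a k \<alpha> + scl_a k \<beta>" "scl_x k (x + y) = scl_x k x + scl_x k y"
  by (cases \<alpha> rule: prod_cases6; cases \<beta> rule: prod_cases6; cases x; cases y;
      simp add: module.scale_right_distrib[OF module_hs])+

lemma module_b: "module sb"
proof
  fix k l and x y :: "('f^'n^'n \<Rightarrow> 'l, 'f^'n \<Rightarrow> 'l) coord_b"
  obtain \<alpha> b b' where x: "x = (\<alpha>, b, b')" by (rule prod_cases3)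
  obtain \<beta> b2 b2' where y: "y = (\<beta>, b2, b2')" by (rule prod_cases3)
  obtain p m c e c' e' where \<alpha>: "\<alpha> = (p, m, c, e, c', e')" by (rule prod_cases6)
  obtain p2 m2 c2 e2 c2' e2' where \<beta>: "\<beta> = (p2, m2, c2, e2, c2', e2')" by (rule prod_cases6)
  show "sb k (x + y) = sb k x + sb k y" "sb (k + l) x = sb k x + sb l x" "sb k (sb l x) = sb (k * l) x" "sb 1 x = x"
    by (simp_all add: x y \<alpha> \<beta> module.scale_right_distrib[OF module_hs] module.scale_left_distrib[OF module_hs]
        module.scale_scale[OF module_hs] module.scale_one[OF module_hs])
qed

declare mult_a.simps [simp del] mult_b.simps [simp del] mult_BB'.simps [simp del] mult_x.simps [simp del]
  scale_a.simps [simp del] scale_b.simps [simp del] scl_x.simps [simp del] gamma.simps [simp del] eta.simps [simp del]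
  deriv_a.simps [simp del] deriv_x.simps [simp del] deriv_b.simps [simp del]

lemma mult_zero [simp]:
  "\<alpha> \<in> coords_a \<Longrightarrow> mul_a \<alpha> 0 = 0" "\<alpha> \<in> coords_a \<Longrightarrow> mul_a 0 \<alpha> = 0"
  "\<alpha> \<in> coords_a \<Longrightarrow> mult_x \<alpha> 0 = 0" "x \<in> coords_x \<Longrightarrow> mult_x 0 x = 0"
  "x \<in> coords_x \<Longrightarrow> form_x x 0 = 0" "x \<in> coords_x \<Longrightarrow> form_x 0 x = 0"
  using mul_a_linear(2)[of \<alpha> 0 0] mul_a_linear(1)[of 0 0 \<alpha>] mult_x_linear(2)[of \<alpha> 0 0]
    mult_x_linear(1)[of 0 0 x] form_x_linear(2)[of x 0 0] form_x_linear(1)[of 0 0 x] by simp_all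

lemma gamma_zero [simp]: "gamma (0 :: ('f^'n^'n \<Rightarrow> 'l) coord_a) = 0"
  by (simp add: zero_prod_def gamma.simps)

lemma subs: "sub_a \<subseteq> coords_b" "sub_x \<subseteq> coords_b" "one_b \<in> sub_a"
  by (auto simp: b_simps)

lemma mul_closed: "\<xi> \<in> coords_b \<Longrightarrow> \<zeta> \<in> coords_b \<Longrightarrow> mul \<xi> \<zeta> \<in> coords_b"
  by (cases \<xi> rule: prod.exhaust; cases \<zeta> rule: prod.exhaust) (simp add: b_simps)

lemma mul_closed_a: "\<xi> \<in> sub_a \<Longrightarrow> \<zeta> \<in> sub_a \<Longrightarrow> mul \<xi> \<zeta> \<in> sub_a"
  by (cases \<xi> rule: prod.exhaust; cases \<zeta> rule: prod.exhaust) (simp add: b_simps)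

lemma bilinear_mul:
  assumes "X \<subseteq> coords_b" "Y \<subseteq> coords_b" "\<And>\<xi> \<zeta>. \<xi> \<in> X \<Longrightarrow> \<zeta> \<in> Y \<Longrightarrow> mul \<xi> \<zeta> \<in> Z"
  shows "bilinear_on sb X sb Y sb Z mul"
proof (rule bilinear_onI)
  fix \<xi> \<zeta> k assume "\<xi> \<in> X" "\<zeta> \<in> Y"
  then have m: "\<xi> \<in> coords_b" "\<zeta> \<in> coords_b" using assms(1,2) by auto
  show "mul \<xi> (sb k \<zeta>) = sb k (mul \<xi> \<zeta>)" "mul (sb k \<xi>) \<zeta> = sb k (mul \<xi> \<zeta>)"
    using m by (cases \<xi> rule: prod.exhaust; cases \<zeta> rule: prod.exhaust; simp add: b_simps gamma_linear mul_a_linear mult_x_linear form_x_linear scl_right_distrib)+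
next
  fix \<xi> \<zeta> \<zeta>' assume "\<xi> \<in> X" "\<zeta> \<in> Y" "\<zeta>' \<in> Y"
  then have m: "\<xi> \<in> coords_b" "\<zeta> \<in> coords_b" "\<zeta>' \<in> coords_b" using assms(1,2) by auto
  show "mul \<xi> (\<zeta> + \<zeta>') = mul \<xi> \<zeta> + mul \<xi> \<zeta>'"
    using m by (cases \<xi> rule: prod.exhaust; cases \<zeta> rule: prod.exhaust; cases \<zeta>' rule: prod.exhaust) (simp add: b_simps gamma_linear mul_a_linear mult_x_linear form_x_linear algebra_simps)
next
  fix \<xi> \<zeta> \<xi>' assume "\<xi> \<in> X" "\<xi>' \<in> X" "\<zeta> \<in> Y"
  then have m: "\<xi> \<in> coords_b" "\<zeta> \<in> coords_b" "\<xi>' \<in> coords_b" using assms(1,2) by auto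
  show "mul (\<xi> + \<xi>') \<zeta> = mul \<xi> \<zeta> + mul \<xi>' \<zeta>"
    using m by (cases \<xi> rule: prod.exhaust; cases \<zeta> rule: prod.exhaust; cases \<xi>' rule: prod.exhaust) (simp add: b_simps gamma_linear mul_a_linear mult_x_linear form_x_linear algebra_simps)
qed (rule assms(3))

lemma subspaces:
  "module.subspace sb coords_b" "module.subspace sb sub_a" "module.subspace sb sub_x"
  by (auto simp: module.subspace_def[OF module_b] coords_b_def sub_a_def sub_x_def scale_a.simps scale_b.simps
      zero_prod_def module.scale_zero_right[OF module_hs])

lemma one_b_mul:
  assumes "\<xi> \<in> coords_b"
  shows "mul one_b \<xi> = \<xi>" "mul \<xi> one_b = \<xi>"
  using assms by (cases \<xi> rule: prod.exhaust; simp add: b_simps one_mul mul_one one_mult_x gamma_one)+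

lemma mul_assoc_a:
  assumes "\<xi> \<in> sub_a" "\<zeta> \<in> sub_a" "\<theta> \<in> sub_a"
  shows "mul (mul \<xi> \<zeta>) \<theta> = mul \<xi> (mul \<zeta> \<theta>)"
  using assms by (cases \<xi> rule: prod.exhaust; cases \<zeta> rule: prod.exhaust; cases \<theta> rule: prod.exhaust) (simp add: b_simps mul_a_assoc)

text \<open>The law on the right is the law on the left in disguise: right multiplication is left
  multiplication after \<open>gamma\<close>, and \<open>gamma\<close> reverses products.\<close>

lemma mul_assoc_x:
  assumes "\<xi> \<in> sub_a" "\<zeta> \<in> sub_a" "\<theta> \<in> sub_x"
  shows "mul (mul \<xi> \<zeta>) \<theta> = mul \<xi> (mul \<zeta> \<theta>)" "mul \<theta> (mul \<xi> \<zeta>) = mul (mul \<theta> \<xi>) \<zeta>"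
  using assms by (cases \<xi> rule: prod.exhaust; cases \<zeta> rule: prod.exhaust; cases \<theta> rule: prod.exhaust; simp add: b_simps mult_x_assoc gamma_mul)+

lemma eta_eta: "eta (eta \<xi>) = (\<xi> :: ('f^'n^'n \<Rightarrow> 'l, 'f^'n \<Rightarrow> 'l) coord_b)"
  by (cases \<xi> rule: prod.exhaust) (simp add: eta_eq)

lemma eta_mul:
  assumes "\<xi> \<in> coords_b" "\<zeta> \<in> coords_b"
  shows "eta (mul \<xi> \<zeta>) = mul (eta \<zeta>) (eta \<xi>)"
  using assms by (cases \<xi> rule: prod.exhaust; cases \<zeta> rule: prod.exhaust) (simp add: b_simps gamma_linear gamma_mul gamma_form add.commute)

text \<open>The copy 1^- of the unit is negated by \<open>eta\<close> and differs from its negative,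
  so \<open>eta\<close> has order exactly 2 on any \<open>X\<close> containing it.\<close>

lemma involution_eta:
  assumes "X \<subseteq> coords_b" "eta ` X \<subseteq> X" "(in_Am one_A, 0, 0) \<in> X"
  shows "involution_on sb X mul eta"
  unfolding involution_on_def antiautomorphism_on_def
proof (intro conjI ballI)
  show "linear_on sb X sb X eta"
    unfolding linear_on_def
  proof (intro conjI ballI allI)
    fix k \<xi> \<zeta>
    show "eta (\<xi> + \<zeta>) = eta \<xi> + eta \<zeta>" "eta (sb k \<xi>) = sb k (eta \<xi>)" for \<xi> \<zeta> k
      by (cases \<xi> rule: prod.exhaust; cases \<zeta> rule: prod.exhaust; simp add: b_simps gamma_linear)+
  qed (use assms(2) in auto)
  show "bij_betw eta X X"
    by (rule bij_betw_byWitness[where f' = eta]) (use assms(2) in \<open>auto simp: eta_eta\<close>)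
  have "- one_A \<noteq> one_A"
  proof
    assume "- one_A = one_A"
    then have "one_A + one_A = 0" by (metis add.left_inverse)
    then show False using add_self_zero one_A_nonzero by blast
  qed
  then have "eta (in_Am one_A, 0, 0) \<noteq> (in_Am one_A, 0 :: 'f^'n \<Rightarrow> 'l, 0 :: 'f^'n \<Rightarrow> 'l)" by (simp add: in_Am_def eta.simps gamma.simps)
  then show "\<exists>\<xi>\<in>X. eta \<xi> \<noteq> \<xi>" using assms(3) by blast
qed (use assms(1) in \<open>auto simp: eta_eta intro: eta_mul\<close>)

lemma eq_minus_iff: "x = - x \<longleftrightarrow> x = 0" "- x = x \<longleftrightarrow> x = 0" for x :: "'m \<Rightarrow> 'l"
proof -
  have "x = 0" if "x = - x"
  proof (rule add_self_zero)
    show "x + x = 0" using arg_cong[OF that, of "\<lambda>y. y + x"] by simp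
  qed
  then show "x = - x \<longleftrightarrow> x = 0" "- x = x \<longleftrightarrow> x = 0" by (auto simp: eq_commute[of "- x"])
qed

lemma symmetric_elements:
  "{\<alpha> \<in> sub_a. eta \<alpha> = \<alpha>} = (A \<times> {0} \<times> {0} \<times> E \<times> {0} \<times> E') \<times> {0} \<times> {0}"
  "{\<alpha> \<in> sub_a. eta \<alpha> = - \<alpha>} = ({0} \<times> A \<times> C \<times> {0} \<times> C' \<times> {0}) \<times> {0} \<times> {0}"
  "{\<beta> \<in> coords_b. eta \<beta> = \<beta>} = (A \<times> {0} \<times> {0} \<times> E \<times> {0} \<times> E') \<times> B \<times> B'"
  "{\<beta> \<in> coords_b. eta \<beta> = - \<beta>} = ({0} \<times> A \<times> C \<times> {0} \<times> C' \<times> {0}) \<times> {0} \<times> {0}"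
  by (auto simp: sub_a_def coords_b_def eq_minus_iff eta.simps gamma.simps)

text \<open>Inside \<open>\<aa>\<close> both laws are instances of associativity, whereas on B
  \<oplus> B' they come from \<open>mul_assoc_x\<close>; hence the two alternatives for
  \<open>M\<close>.\<close>

lemma left_right_module:
  assumes "X \<subseteq> sub_a" "M \<subseteq> sub_x \<or> M \<subseteq> sub_a" "module.subspace sb M"
    and "\<And>\<xi> \<theta>. \<xi> \<in> X \<Longrightarrow> \<theta> \<in> M \<Longrightarrow> mul \<xi> \<theta> \<in> M" "\<And>\<xi> \<theta>. \<xi> \<in> X \<Longrightarrow> \<theta> \<in> M \<Longrightarrow> mul \<theta> \<xi> \<in> M"
  shows "left_right_module_on sb X mul one_b sb M mul mul"
proof -
  have sub: "X \<subseteq> coords_b" "M \<subseteq> coords_b" using assms(1,2) subs by auto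
  have "mul (mul \<xi> \<zeta>) \<theta> = mul \<xi> (mul \<zeta> \<theta>) \<and> mul \<theta> (mul \<xi> \<zeta>) = mul (mul \<theta> \<xi>) \<zeta>"
    if "\<xi> \<in> X" "\<zeta> \<in> X" "\<theta> \<in> M" for \<xi> \<zeta> \<theta>
  proof -
    have m: "\<xi> \<in> sub_a" "\<zeta> \<in> sub_a" using that assms(1) by auto
    have "\<theta> \<in> sub_x \<or> \<theta> \<in> sub_a" using that assms(2) by auto
    then show ?thesis
      using mul_assoc_a[OF m] mul_assoc_a[OF _ m] mul_assoc_x[OF m] by (elim disjE) simp_all
  qed
  moreover have "mul one_b \<theta> = \<theta> \<and> mul \<theta> one_b = \<theta>" if "\<theta> \<in> M" for \<theta>
    using one_b_mul[OF subsetD[OF sub(2) that]] by simp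
  ultimately show ?thesis
    unfolding left_right_module_on_def using assms(3-5) bilinear_mul[OF sub] bilinear_mul[OF sub(2,1)] by auto
qed

lemma bimodule:
  assumes "X \<subseteq> sub_a" "M \<subseteq> sub_a" "module.subspace sb M"
    and "\<And>\<xi> \<theta>. \<xi> \<in> X \<Longrightarrow> \<theta> \<in> M \<Longrightarrow> mul \<xi> \<theta> \<in> M" "\<And>\<xi> \<theta>. \<xi> \<in> X \<Longrightarrow> \<theta> \<in> M \<Longrightarrow> mul \<theta> \<xi> \<in> M"
  shows "bimodule_on sb X mul one_b sb M mul mul"
  unfolding bimodule_on_def
proof (intro conjI ballI)
  show "left_right_module_on sb X mul one_b sb M mul mul" using assms by (intro left_right_module) auto
  show "mul (mul \<xi> \<theta>) \<zeta> = mul \<xi> (mul \<theta> \<zeta>)" if "\<xi> \<in> X" "\<zeta> \<in> X" "\<theta> \<in> M" for \<xi> \<zeta> \<theta>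
    using that assms(1,2) by (intro mul_assoc_a) auto
qed

lemma hermitian_form: "hermitian_form_on sb sub_a mul eta sb sub_x mul mul"
  unfolding hermitian_form_on_def
proof (intro conjI ballI)
  show "bilinear_on sb sub_x sb sub_x sb sub_a mul"
  proof (rule bilinear_mul[OF subs(2,2)])
    fix \<xi> \<theta> assume "\<xi> \<in> sub_x" "\<theta> \<in> sub_x"
    then show "mul \<xi> \<theta> \<in> sub_a"
      by (cases \<xi> rule: prod.exhaust; cases \<theta> rule: prod.exhaust; simp add: b_simps)
  qed
next
  fix \<beta>1 \<beta>2 \<alpha> assume "\<beta>1 \<in> sub_x" "\<beta>2 \<in> sub_x" "\<alpha> \<in> sub_a"
  then show "mul (mul \<alpha> \<beta>1) \<beta>2 = mul \<alpha> (mul \<beta>1 \<beta>2)" "eta (mul \<beta>1 \<beta>2) = mul \<beta>2 \<beta>1"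
    "mul \<beta>1 (mul \<alpha> \<beta>2) = mul (mul \<beta>1 \<beta>2) (eta \<alpha>)"
    by (cases \<beta>1 rule: prod.exhaust; cases \<beta>2 rule: prod.exhaust; cases \<alpha> rule: prod.exhaust; simp add: b_simps form_x_left form_x_right gamma_form)+
qed

section \<open>The subalgebra on A^+ and A^- and its modules\<close>

definition sub_AA :: "('f^'n^'n \<Rightarrow> 'l, 'f^'n \<Rightarrow> 'l) coord_b set" where
  "sub_AA = (A \<times> A \<times> {0} \<times> {0} \<times> {0} \<times> {0}) \<times> {0} \<times> {0}"
definition sub_CE :: "('f^'n^'n \<Rightarrow> 'l, 'f^'n \<Rightarrow> 'l) coord_b set" where
  "sub_CE = ({0} \<times> {0} \<times> C \<times> E \<times> {0} \<times> {0}) \<times> {0} \<times> {0}"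
definition sub_CE' :: "('f^'n^'n \<Rightarrow> 'l, 'f^'n \<Rightarrow> 'l) coord_b set" where
  "sub_CE' = ({0} \<times> {0} \<times> {0} \<times> {0} \<times> C' \<times> E') \<times> {0} \<times> {0}"
definition sub_B :: "('f^'n^'n \<Rightarrow> 'l, 'f^'n \<Rightarrow> 'l) coord_b set" where
  "sub_B = {0} \<times> B \<times> {0}"
definition sub_B' :: "('f^'n^'n \<Rightarrow> 'l, 'f^'n \<Rightarrow> 'l) coord_b set" where
  "sub_B' = {0} \<times> {0} \<times> B'"

lemmas sub_defs = sub_AA_def sub_CE_def sub_CE'_def sub_B_def sub_B'_def

lemma sub_subsets: "sub_AA \<subseteq> sub_a" "sub_CE \<subseteq> sub_a" "sub_CE' \<subseteq> sub_a" "sub_B \<subseteq> sub_x" "sub_B' \<subseteq> sub_x"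
  "one_b \<in> sub_AA"
  by (auto simp: sub_defs sub_a_def sub_x_def one_b_def in_Ap_def)

lemma sub_subspaces: "module.subspace sb sub_AA" "module.subspace sb sub_CE" "module.subspace sb sub_CE'"
  "module.subspace sb sub_B" "module.subspace sb sub_B'"
  by (auto simp: module.subspace_def[OF module_b] sub_defs zero_prod_def scale_a.simps scale_b.simps module.scale_zero_right[OF module_hs])

lemma sub_closed:
  assumes "\<xi> \<in> sub_AA"
  shows "\<zeta> \<in> sub_AA \<Longrightarrow> mul \<xi> \<zeta> \<in> sub_AA" "\<zeta> \<in> sub_CE \<Longrightarrow> mul \<xi> \<zeta> \<in> sub_CE" "\<zeta> \<in> sub_CE \<Longrightarrow> mul \<zeta> \<xi> \<in> sub_CE"
    "\<zeta> \<in> sub_CE' \<Longrightarrow> mul \<xi> \<zeta> \<in> sub_CE'" "\<zeta> \<in> sub_CE' \<Longrightarrow> mul \<zeta> \<xi> \<in> sub_CE'"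
    "\<zeta> \<in> sub_B \<Longrightarrow> mul \<xi> \<zeta> \<in> sub_B" "\<zeta> \<in> sub_B \<Longrightarrow> mul \<zeta> \<xi> \<in> sub_B"
    "\<zeta> \<in> sub_B' \<Longrightarrow> mul \<xi> \<zeta> \<in> sub_B'" "\<zeta> \<in> sub_B' \<Longrightarrow> mul \<zeta> \<xi> \<in> sub_B'"
  using assms by (auto simp: sub_defs in_Ap_def in_Am_def in_C_def in_E_def in_C'_def in_E'_def zero_prod_def
      mult_a.simps mult_b.simps mult_BB'.simps scale_a.simps gamma.simps module.scale_zero_right[OF module_hs])

lemma algebras:
  "algebra_on sb coords_b mul" "algebra_on sb sub_a mul" "algebra_on sb sub_AA mul"
  unfolding algebra_on_def using subspaces sub_subspaces subs sub_subsets
  by (auto intro!: bilinear_mul mul_closed mul_closed_a sub_closed)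

lemma bilinear_deriv: "bilinear_on scale D sb coords_b sb coords_b (deriv_b P)"
proof (rule bilinear_onI)
  fix d d' k and \<xi> \<zeta> :: "('f^'n^'n \<Rightarrow> 'l, 'f^'n \<Rightarrow> 'l) coord_b"
  assume d: "d \<in> D" and \<xi>: "\<xi> \<in> coords_b"
  obtain \<alpha> x where \<xi>': "\<xi> = (\<alpha>, x)" by (rule prod.exhaust)
  obtain \<beta> y where \<zeta>': "\<zeta> = (\<beta>, y)" by (rule prod.exhaust)
  note mem = d \<xi>[unfolded \<xi>' coords_eqs mem_Times_iff prod.sel]
  show "deriv_b P d \<xi> \<in> coords_b" "deriv_b P d (sb k \<xi>) = sb k (deriv_b P d \<xi>)"
    "deriv_b P (scale k d) \<xi> = sb k (deriv_b P d \<xi>)"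
    using mem by (simp_all add: \<xi>' b_simps deriv_a_linear deriv_x_linear)
  show "deriv_b P d (\<xi> + \<zeta>) = deriv_b P d \<xi> + deriv_b P d \<zeta>" if "\<zeta> \<in> coords_b"
    using mem that by (simp add: \<xi>' \<zeta>' b_simps deriv_a_linear deriv_x_linear)
  show "deriv_b P (d + d') \<xi> = deriv_b P d \<xi> + deriv_b P d' \<xi>" if "d' \<in> D"
    using mem that by (simp add: \<xi>' b_simps deriv_a_linear deriv_x_linear)
qed

lemma derivation_deriv:
  assumes "d \<in> D"
  shows "derivation_on sb coords_b mul (deriv_b P d)"
  unfolding derivation_on_def
proof (intro conjI ballI)
  show "linear_on sb coords_b sb coords_b (deriv_b P d)"
    using bilinear_deriv assms by (simp add: bilinear_on_def)
  show "deriv_b P d (mul \<xi> \<zeta>) = mul (deriv_b P d \<xi>) \<zeta> + mul \<xi> (deriv_b P d \<zeta>)"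
    if "\<xi> \<in> coords_b" "\<zeta> \<in> coords_b" for \<xi> \<zeta>
    using that assms by (cases \<xi> rule: prod.exhaust; cases \<zeta> rule: prod.exhaust) (simp add: b_simps deriv_a_linear deriv_x_linear deriv_mul deriv_form
        deriv_mult_x deriv_gamma algebra_simps)
qed

lemma deriv_bracket:
  assumes "d1 \<in> D" "d2 \<in> D" "\<beta> \<in> coords_b"
  shows "deriv_b P (bracket d1 d2) \<beta> = deriv_b P d1 (deriv_b P d2 \<beta>) - deriv_b P d2 (deriv_b P d1 \<beta>)"
  using assms by (cases \<beta> rule: prod.exhaust) (simp add: b_simps deriv_a_linear deriv_x_linear)

lemma coordinate_algebra:
  "(let mul = mult_b (fscale scale) P;
           sb = scale_b (fscale scale) (fscale scale);
           \<bb> = (A \<times> A \<times> C \<times> E \<times> C' \<times> E') \<times> B \<times> B';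
           \<aa> = (A \<times> A \<times> C \<times> E \<times> C' \<times> E') \<times> {0} \<times> {0};
           BB' = {0} \<times> B \<times> B';
           AA = (A \<times> A \<times> {0} \<times> {0} \<times> {0} \<times> {0}) \<times> {0} \<times> {0};
           CE = ({0} \<times> {0} \<times> C \<times> E \<times> {0} \<times> {0}) \<times> {0} \<times> {0};
           CE' = ({0} \<times> {0} \<times> {0} \<times> {0} \<times> C' \<times> E') \<times> {0} \<times> {0};
           one = (in_Ap one_A, 0, 0)
       in
        (\<aa> \<subseteq> \<bb> \<and> algebra_on sb \<aa> mul \<and> associative_on \<aa> mul \<and> identity_on \<aa> mul one \<and>
         involution_on sb \<aa> mul eta \<and>
         {\<alpha> \<in> \<aa>. eta \<alpha> = \<alpha>} = (A \<times> {0} \<times> {0} \<times> E \<times> {0} \<times> E') \<times> {0} \<times> {0} \<and>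
         {\<alpha> \<in> \<aa>. eta \<alpha> = - \<alpha>} = ({0} \<times> A \<times> C \<times> {0} \<times> C' \<times> {0}) \<times> {0} \<times> {0}) \<and>
        (algebra_on sb \<bb> mul \<and> identity_on \<bb> mul one \<and>
         involution_on sb \<bb> mul eta \<and>
         {\<beta> \<in> \<bb>. eta \<beta> = \<beta>} = (A \<times> {0} \<times> {0} \<times> E \<times> {0} \<times> E') \<times> B \<times> B' \<and>
         {\<beta> \<in> \<bb>. eta \<beta> = - \<beta>} = ({0} \<times> A \<times> C \<times> {0} \<times> C' \<times> {0}) \<times> {0} \<times> {0}) \<and>
        (left_right_module_on sb \<aa> mul one sb BB' mul mul \<and>
         (\<exists>chi. hermitian_form_on sb \<aa> mul eta sb BB' mul chi \<and>
              (\<forall>\<beta>1\<in>BB'. \<forall>\<beta>2\<in>BB'. chi \<beta>1 \<beta>2 = mul \<beta>1 \<beta>2))) \<and>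
        (AA \<subseteq> \<aa> \<and> algebra_on sb AA mul \<and> associative_on AA mul \<and> identity_on AA mul one \<and>
         bimodule_on sb AA mul one sb CE mul mul \<and>
         bimodule_on sb AA mul one sb CE' mul mul \<and>
         left_right_module_on sb AA mul one sb ({0} \<times> B \<times> {0}) mul mul \<and>
         left_right_module_on sb AA mul one sb ({0} \<times> {0} \<times> B') mul mul) \<and>
        (bilinear_on scale D sb \<bb> sb \<bb> (deriv_b P) \<and>
         (\<forall>d\<in>D. derivation_on sb \<bb> mul (deriv_b P d)) \<and>
         (\<forall>d1\<in>D. \<forall>d2\<in>D. \<forall>\<beta>\<in>\<bb>.
            deriv_b P (bracket d1 d2) \<beta> =
              deriv_b P d1 (deriv_b P d2 \<beta>) - deriv_b P d2 (deriv_b P d1 \<beta>))))"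
  unfolding Let_def coords_b_def[symmetric] sub_a_def[symmetric] sub_x_def[symmetric] one_b_def[symmetric]
    sub_AA_def[symmetric] sub_CE_def[symmetric] sub_CE'_def[symmetric] sub_B_def[symmetric] sub_B'_def[symmetric]
proof (intro conjI)
  show "associative_on sub_a mul" "associative_on sub_AA mul"
    unfolding associative_on_def using mul_assoc_a subsetD[OF sub_subsets(1)] by blast+
  show "identity_on sub_a mul one_b" "identity_on coords_b mul one_b" "identity_on sub_AA mul one_b"
    unfolding identity_on_def using one_b_mul subs sub_subsets(1,6) by blast+
  show "involution_on sb sub_a mul eta" "involution_on sb coords_b mul eta"
    by (rule involution_eta; auto simp: sub_a_def coords_b_def in_Am_def eta.simps gamma.simps)+
  show "left_right_module_on sb sub_a mul one_b sb sub_x mul mul"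
  proof (rule left_right_module)
    fix \<xi> \<theta> assume "\<xi> \<in> sub_a" "\<theta> \<in> sub_x"
    then show "mul \<xi> \<theta> \<in> sub_x" "mul \<theta> \<xi> \<in> sub_x"
      by (cases \<xi> rule: prod.exhaust; cases \<theta> rule: prod.exhaust; simp add: b_simps)+
  qed (simp_all add: subspaces)
  show "\<exists>chi. hermitian_form_on sb sub_a mul eta sb sub_x mul chi \<and> (\<forall>\<beta>1\<in>sub_x. \<forall>\<beta>2\<in>sub_x. chi \<beta>1 \<beta>2 = mul \<beta>1 \<beta>2)"
    using hermitian_form by blast
  show "bimodule_on sb sub_AA mul one_b sb sub_CE mul mul" "bimodule_on sb sub_AA mul one_b sb sub_CE' mul mul"
    by (rule bimodule; simp add: sub_subsets sub_subspaces sub_closed)+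
  show "left_right_module_on sb sub_AA mul one_b sb sub_B mul mul" "left_right_module_on sb sub_AA mul one_b sb sub_B' mul mul"
    by (rule left_right_module; simp add: sub_subsets sub_subspaces sub_closed)+
qed (simp_all add: subs sub_subsets algebras symmetric_elements bilinear_deriv derivation_deriv deriv_bracket)

end

theorem theorem4p14:
  fixes scale :: "'f::field_char_0 \<Rightarrow> 'l::ab_group_add \<Rightarrow> 'l"
    and bracket :: "'l \<Rightarrow> 'l \<Rightarrow> 'l"
    and \<iota> :: "'f^'n^'n \<Rightarrow> 'l"
  assumes "theta_graded scale bracket \<iota>"
    and "CARD('n) \<ge> 7 \<or>
         CARD('n) = 6 \<and> lie_algebra_over_sl.condition_6 scale bracket \<iota> \<or>
         CARD('n) = 5 \<and> lie_algebra_over_sl.condition_5 scale bracket \<iota>"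
  shows "lie_algebra_over_sl.isotypic_decomposition scale bracket \<iota> \<and>
    lie_algebra_over_sl.sym_skew_decomposition scale bracket \<iota> \<and>
    (\<exists>P.
      lie_algebra_over_sl.bilinear_products scale bracket \<iota> P \<and>
      lie_algebra_over_sl.bracket_rules scale bracket \<iota> P \<and>
      (let A = lie_algebra_over_sl.A scale bracket \<iota>;
           B = lie_algebra_over_sl.B scale bracket \<iota>;
           B' = lie_algebra_over_sl.B' scale bracket \<iota>;
           C = lie_algebra_over_sl.C scale bracket \<iota>;
           C' = lie_algebra_over_sl.C' scale bracket \<iota>;
           E = lie_algebra_over_sl.E scale bracket \<iota>;
           E' = lie_algebra_over_sl.E' scale bracket \<iota>;
           D = lie_algebra_over_sl.D scale bracket \<iota>;
           mul = mult_b (fscale scale) P;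
           sb = scale_b (fscale scale) (fscale scale);
           \<bb> = (A \<times> A \<times> C \<times> E \<times> C' \<times> E') \<times> B \<times> B';
           \<aa> = (A \<times> A \<times> C \<times> E \<times> C' \<times> E') \<times> {0} \<times> {0};
           BB' = {0} \<times> B \<times> B';
           AA = (A \<times> A \<times> {0} \<times> {0} \<times> {0} \<times> {0}) \<times> {0} \<times> {0};
           CE = ({0} \<times> {0} \<times> C \<times> E \<times> {0} \<times> {0}) \<times> {0} \<times> {0};
           CE' = ({0} \<times> {0} \<times> {0} \<times> {0} \<times> C' \<times> E') \<times> {0} \<times> {0};
           one = (in_Ap (lie_algebra_over_sl.one_A \<iota>), 0, 0)
       in
        \<comment> \<open>(i)\<close>
        (\<aa> \<subseteq> \<bb> \<and> algebra_on sb \<aa> mul \<and> associative_on \<aa> mul \<and> identity_on \<aa> mul one \<and>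
         involution_on sb \<aa> mul eta \<and>
         {\<alpha> \<in> \<aa>. eta \<alpha> = \<alpha>} = (A \<times> {0} \<times> {0} \<times> E \<times> {0} \<times> E') \<times> {0} \<times> {0} \<and>
         {\<alpha> \<in> \<aa>. eta \<alpha> = - \<alpha>} = ({0} \<times> A \<times> C \<times> {0} \<times> C' \<times> {0}) \<times> {0} \<times> {0}) \<and>
        \<comment> \<open>(ii)\<close>
        (algebra_on sb \<bb> mul \<and> identity_on \<bb> mul one \<and>
         involution_on sb \<bb> mul eta \<and>
         {\<beta> \<in> \<bb>. eta \<beta> = \<beta>} = (A \<times> {0} \<times> {0} \<times> E \<times> {0} \<times> E') \<times> B \<times> B' \<and>
         {\<beta> \<in> \<bb>. eta \<beta> = - \<beta>} = ({0} \<times> A \<times> C \<times> {0} \<times> C' \<times> {0}) \<times> {0} \<times> {0}) \<and>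
        \<comment> \<open>(iii)\<close>
        (left_right_module_on sb \<aa> mul one sb BB' mul mul \<and>
         (\<exists>chi. hermitian_form_on sb \<aa> mul eta sb BB' mul chi \<and>
              (\<forall>\<beta>1\<in>BB'. \<forall>\<beta>2\<in>BB'. chi \<beta>1 \<beta>2 = mul \<beta>1 \<beta>2))) \<and>
        \<comment> \<open>(iv)\<close>
        (AA \<subseteq> \<aa> \<and> algebra_on sb AA mul \<and> associative_on AA mul \<and> identity_on AA mul one \<and>
         bimodule_on sb AA mul one sb CE mul mul \<and>
         bimodule_on sb AA mul one sb CE' mul mul \<and>
         left_right_module_on sb AA mul one sb ({0} \<times> B \<times> {0}) mul mul \<and>
         left_right_module_on sb AA mul one sb ({0} \<times> {0} \<times> B') mul mul) \<and>
        \<comment> \<open>(v)\<close>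
        (bilinear_on scale D sb \<bb> sb \<bb> (deriv_b P) \<and>
         (\<forall>d\<in>D. derivation_on sb \<bb> mul (deriv_b P d)) \<and>
         (\<forall>d1\<in>D. \<forall>d2\<in>D. \<forall>\<beta>\<in>\<bb>.
            deriv_b P (bracket d1 d2) \<beta> =
              deriv_b P d1 (deriv_b P d2 \<beta>) - deriv_b P d2 (deriv_b P d1 \<beta>)))))"
proof -
  interpret theta_graded scale bracket \<iota> by fact
  interpret theta_graded5 scale bracket \<iota>
    by unfold_locales (use assms(2) in auto)
  have rank_condition using assms(2) by (simp add: rank_condition_def)
  then obtain P where "coordinatized scale bracket \<iota> P" by (rule coordinatized_exists)
  then interpret coordinatized scale bracket \<iota> P .
  show ?thesis
    unfolding Let_def
    by (rule conjI[OF isotypic], rule conjI[OF sym_skew], rule exI, rule conjI[OF bilinear_products],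
        rule conjI[OF bracket_rules], rule coordinate_algebra[unfolded Let_def])
qed

end
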